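(* There is a generically 6-to-1 piecewise isometric map $\phi:T\to\mathbb{R}^3$ from the hexagonal torus $T$ onto an equilateral triangle (a filled planar equilateral triangle in $\mathbb{R}^3$) which is approximated arbitrarily closely, in the uniform metric, by 8-vertex paper tori: for every $\epsilon>0$ there is an 8-vertex paper torus $\phi':T'\to\mathbb{R}^3$ whose uniform distance from $\phi$ is less than $\epsilon$.
   Context: A flat torus is a quotient $\mathbb{R}^2/\Lambda$ with $\Lambda$ a lattice of translations. The hexagonal torus is (up to scale) $\mathbb{C}/(\mathbb{Z}+\mathbb{Z}h)$ with $h=\tfrac12+\tfrac{\sqrt3}{2}i$. A paper torus is a piecewise linear isometric embedding $\phi':T'\to\mathbb{R}^3$ of a flat torus $T'$; it is an 8-vertex paper torus if it is isometric and affine on each triangle of some triangulation of $T'$ with 8 vertices. A piecewise isometric map from a flat torus is a continuous map that restricts to an isometric affine embedding on each triangle of some finite triangulation by Euclidean triangles. Generically $k$-to-1 means that every point of the image outside a finite union of line segments has exactly $k$ preimages. Uniform distance: given maps $\phi_j:T_j\to\mathbb{R}^3$ ($j=1,2$) on flat tori $T_j$, their uniform distance is the infimal $\epsilon$ such that there is a $(1+\epsilon)$-bilipschitz map $\alpha:T_1\to T_2$ for which the $L_\infty$ distance from $\phi_1$ to $\phi_2\circ\alpha$ is at most $\epsilon$. (The tori $T_1,T_2$ may be different flat tori.) *)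

theory Defs
  imports "HOL-Analysis.Analysis"
begin

section \<open>Flat tori\<close>

text \<open>The Euclidean plane is the type \<^typ>\<open>complex\<close>. A flat torus is given by its lattice
  \<open>\<Lambda>\<close>; its points are the cosets \<open>z + \<Lambda>\<close>.\<close>

definition lattice_span :: "complex \<Rightarrow> complex \<Rightarrow> complex set" where
  "lattice_span u v = {of_int m *\<^sub>R u + of_int n *\<^sub>R v | m n :: int. True}"

definition planar_lattice :: "complex set \<Rightarrow> bool" where
  "planar_lattice \<Lambda> \<longleftrightarrow> (\<exists>u v. u \<noteq> v \<and> independent {u, v} \<and> \<Lambda> = lattice_span u v)"

definition hex_lattice :: "complex set" where
  "hex_lattice = lattice_span 1 (Complex (1/2) (sqrt 3 / 2))"

definition torus_proj :: "complex set \<Rightarrow> complex \<Rightarrow> complex set" where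
  "torus_proj \<Lambda> z = (\<lambda>l. z + l) ` \<Lambda>"

definition flat_torus :: "complex set \<Rightarrow> complex set set" where
  "flat_torus \<Lambda> = range (torus_proj \<Lambda>)"

definition torus_topology :: "complex set \<Rightarrow> complex set topology" where
  "torus_topology \<Lambda> = topology (\<lambda>U. U \<subseteq> flat_torus \<Lambda> \<and> open (torus_proj \<Lambda> -` U))"

text \<open>The flat metric on the torus is \<^const>\<open>setdist\<close>, the infimal distance between
  representatives of the two cosets; see \<open>Metric_space_flat_torus\<close> below.\<close>

lemma openin_torus_topology:
  "openin (torus_topology \<Lambda>) U \<longleftrightarrow> U \<subseteq> flat_torus \<Lambda> \<and> open (torus_proj \<Lambda> -` U)"
proof -
  have "istopology (\<lambda>U. U \<subseteq> flat_torus \<Lambda> \<and> open (torus_proj \<Lambda> -` U))"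
    unfolding istopology_def by (auto simp: vimage_Union)
  then show ?thesis
    by (simp add: torus_topology_def topology_inverse')
qed

lemma topspace_torus_topology [simp]: "topspace (torus_topology \<Lambda>) = flat_torus \<Lambda>"
proof -
  have "openin (torus_topology \<Lambda>) (flat_torus \<Lambda>)"
    by (simp add: openin_torus_topology flat_torus_def vimage_def)
  then show ?thesis
    by (metis openin_subset openin_topspace openin_torus_topology subset_antisym)
qed

lemma quotient_map_torus_proj: "quotient_map euclidean (torus_topology \<Lambda>) (torus_proj \<Lambda>)"
  by (auto simp: quotient_map_def openin_torus_topology flat_torus_def vimage_def)

lemma closed_planar_lattice:
  assumes "planar_lattice \<Lambda>"
  shows "closed \<Lambda>"
proof -
  obtain u v where uv: "u \<noteq> v" "independent {u, v}" "\<Lambda> = lattice_span u v"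
    using assms by (auto simp: planar_lattice_def)
  define f :: "real \<times> real \<Rightarrow> complex" where "f = (\<lambda>(a, b). a *\<^sub>R u + b *\<^sub>R v)"
  have lin: "linear f"
    by (rule linearI) (auto simp: f_def algebra_simps)
  have "inj f"
  proof -
    have "a = 0 \<and> b = 0" if "a *\<^sub>R u + b *\<^sub>R v = 0" for a b
    proof -
      have "(\<Sum>x\<in>{u, v}. (if x = u then a else b) *\<^sub>R x) = 0"
        using that uv(1) by simp
      then have "\<forall>x\<in>{u, v}. (if x = u then a else b) = 0"
        using independentD[OF uv(2), of "{u, v}" "\<lambda>x. if x = u then a else b"] by blast
      then show ?thesis using uv(1) by auto
    qed
    then show ?thesis
      unfolding linear_injective_0[OF lin] by (auto simp: f_def zero_prod_def)
  qed
  have "closed (f ` (\<int> \<times> \<int>))"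
    by (intro closed_injective_linear_image closed_Times closed_Ints lin \<open>inj f\<close>)
  also have "f ` (\<int> \<times> \<int>) = \<Lambda>"
    unfolding uv(3) lattice_span_def by (force simp: f_def Ints_def image_iff)
  finally show ?thesis .
qed

lemma planar_lattice_zero_add_minus:
  assumes "planar_lattice \<Lambda>"
  shows "0 \<in> \<Lambda>" "l \<in> \<Lambda> \<Longrightarrow> l' \<in> \<Lambda> \<Longrightarrow> l + l' \<in> \<Lambda>" "l \<in> \<Lambda> \<Longrightarrow> - l \<in> \<Lambda>"
proof -
  obtain u v where L: "\<Lambda> = lattice_span u v"
    using assms by (auto simp: planar_lattice_def)
  have I: "of_int m *\<^sub>R u + of_int n *\<^sub>R v \<in> \<Lambda>" for m n :: int
    by (auto simp: L lattice_span_def)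
  have E: "\<exists>m n :: int. l = of_int m *\<^sub>R u + of_int n *\<^sub>R v" if "l \<in> \<Lambda>" for l
    using that by (auto simp: L lattice_span_def)
  show "0 \<in> \<Lambda>" using I[of 0 0] by simp
  show "l + l' \<in> \<Lambda>" if l: "l \<in> \<Lambda>" "l' \<in> \<Lambda>"
  proof -
    obtain m n m' n' :: int where
      "l = of_int m *\<^sub>R u + of_int n *\<^sub>R v" "l' = of_int m' *\<^sub>R u + of_int n' *\<^sub>R v"
      using E[OF l(1)] E[OF l(2)] by blast
    then show ?thesis using I[of "m + m'" "n + n'"] by (simp add: algebra_simps)
  qed
  show "- l \<in> \<Lambda>" if l: "l \<in> \<Lambda>"
  proof -
    obtain m n :: int where "l = of_int m *\<^sub>R u + of_int n *\<^sub>R v"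
      using E[OF l] by blast
    then show ?thesis using I[of "- m" "- n"] by (simp add: algebra_simps)
  qed
qed

lemma setdist_torus_proj:
  assumes "planar_lattice \<Lambda>"
  shows "setdist (torus_proj \<Lambda> x) (torus_proj \<Lambda> y) = setdist {x} (torus_proj \<Lambda> y)"
proof (rule antisym)
  note L = planar_lattice_zero_add_minus[OF assms]
  have x: "x \<in> torus_proj \<Lambda> x"
    using L(1) by (force simp: torus_proj_def)
  show "setdist (torus_proj \<Lambda> x) (torus_proj \<Lambda> y) \<le> setdist {x} (torus_proj \<Lambda> y)"
    by (rule setdist_le_sing[OF x])
  have ne: "torus_proj \<Lambda> z \<noteq> {}" for z
    using L(1) by (auto simp: torus_proj_def)
  show "setdist {x} (torus_proj \<Lambda> y) \<le> setdist (torus_proj \<Lambda> x) (torus_proj \<Lambda> y)"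
  proof (rule le_setdistI)
    fix a b assume "a \<in> torus_proj \<Lambda> x" "b \<in> torus_proj \<Lambda> y"
    then obtain l l' where *: "l \<in> \<Lambda>" "l' \<in> \<Lambda>" "a = x + l" "b = y + l'"
      by (auto simp: torus_proj_def)
    have "l' + - l \<in> \<Lambda>" using L * by blast
    then have "y + (l' + - l) \<in> torus_proj \<Lambda> y"
      unfolding torus_proj_def by blast
    then have "setdist {x} (torus_proj \<Lambda> y) \<le> dist x (y + (l' + - l))"
      by (intro setdist_le_dist) auto
    also have "\<dots> = dist a b"
      by (simp add: * dist_norm algebra_simps)
    finally show "setdist {x} (torus_proj \<Lambda> y) \<le> dist a b" .
  qed (use ne in auto)
qed

lemma Metric_space_flat_torus:
  assumes "planar_lattice \<Lambda>"
  shows "Metric_space (flat_torus \<Lambda>) setdist"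
proof
  note L = planar_lattice_zero_add_minus[OF assms]
  show "0 \<le> setdist A B" "setdist A B = setdist B A" for A B :: "complex set"
    by (simp_all add: setdist_sym)
  have ne: "torus_proj \<Lambda> z \<noteq> {}" for z
    using L(1) by (auto simp: torus_proj_def)
  have closed: "closed (torus_proj \<Lambda> z)" for z
    unfolding torus_proj_def by (rule closed_translation[OF closed_planar_lattice[OF assms]])
  have eq: "torus_proj \<Lambda> x = torus_proj \<Lambda> y" if x: "x \<in> torus_proj \<Lambda> y" for x y
  proof -
    obtain l where l: "l \<in> \<Lambda>" "x = y + l" using x by (auto simp: torus_proj_def)
    have "x + m = y + (l + m)" "y + m = x + (- l + m)" for m
      using l by (auto simp: algebra_simps)
    then show ?thesis
      unfolding torus_proj_def using l L by blast
  qed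
  show "setdist A B = 0 \<longleftrightarrow> A = B" if AB: "A \<in> flat_torus \<Lambda>" "B \<in> flat_torus \<Lambda>" for A B
  proof -
    obtain x y where xy: "A = torus_proj \<Lambda> x" "B = torus_proj \<Lambda> y"
      using AB by (auto simp: flat_torus_def)
    show ?thesis
    proof
      assume "setdist A B = 0"
      then have "x \<in> closure (torus_proj \<Lambda> y)"
        using ne[of y] by (simp add: xy setdist_torus_proj[OF assms] setdist_eq_0_sing_1)
      then show "A = B"
        using closed[of y] eq[of x y] by (simp add: xy)
    qed (simp add: setdist_refl)
  qed
  show "setdist A C \<le> setdist A B + setdist B C"
    if "A \<in> flat_torus \<Lambda>" "B \<in> flat_torus \<Lambda>" "C \<in> flat_torus \<Lambda>" for A B C
  proof -
    obtain x y z where xyz: "A = torus_proj \<Lambda> x" "B = torus_proj \<Lambda> y" "C = torus_proj \<Lambda> z"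
      using \<open>A \<in> _\<close> \<open>B \<in> _\<close> \<open>C \<in> _\<close> by (auto simp: flat_torus_def)
    have "setdist A C \<le> setdist A {y} + setdist {y} C"
      by (rule setdist_triangle)
    moreover have "setdist A {y} = setdist A B"
      using setdist_torus_proj[OF assms, of y x] by (simp add: xyz setdist_sym)
    moreover have "setdist {y} C = setdist B C"
      by (simp add: xyz setdist_torus_proj[OF assms])
    ultimately show ?thesis by simp
  qed
qed

section \<open>Triangulations and piecewise isometric maps\<close>

text \<open>A triangle of the torus is given by a Euclidean triangle \<open>K\<close> in the plane that the
  projection maps injectively to the torus. The set \<open>\<T>\<close> contains one such lift for each triangle
  of the triangulation. Two different triangles of the torus meet in a common proper face
  (possibly empty).\<close>

definition torus_triangulation :: "complex set \<Rightarrow> complex set set \<Rightarrow> bool" where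
  "torus_triangulation \<Lambda> \<T> \<longleftrightarrow>
     finite \<T> \<and>
     (\<forall>K\<in>\<T>. 2 simplex K \<and> inj_on (torus_proj \<Lambda>) K) \<and>
     (\<Union>K\<in>\<T>. torus_proj \<Lambda> ` K) = flat_torus \<Lambda> \<and>
     (\<forall>K\<in>\<T>. \<forall>L\<in>\<T>. K \<noteq> L \<longrightarrow>
        (\<exists>F G. F face_of K \<and> F \<noteq> K \<and> G face_of L \<and> G \<noteq> L \<and>
           torus_proj \<Lambda> ` K \<inter> torus_proj \<Lambda> ` L = torus_proj \<Lambda> ` F \<and>
           torus_proj \<Lambda> ` K \<inter> torus_proj \<Lambda> ` L = torus_proj \<Lambda> ` G))"

definition torus_vertices :: "complex set \<Rightarrow> complex set set \<Rightarrow> complex set set" where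
  "torus_vertices \<Lambda> \<T> = torus_proj \<Lambda> ` {v. \<exists>K\<in>\<T>. v extreme_point_of K}"

definition affine_isometry_on :: "complex set \<Rightarrow> (complex \<Rightarrow> real^3) \<Rightarrow> bool" where
  "affine_isometry_on K f \<longleftrightarrow>
     (\<exists>A b. linear A \<and> (\<forall>z. norm (A z) = norm z) \<and> (\<forall>z\<in>K. f z = A z + b))"

definition isometric_on_triangles ::
    "complex set \<Rightarrow> complex set set \<Rightarrow> (complex set \<Rightarrow> real^3) \<Rightarrow> bool" where
  "isometric_on_triangles \<Lambda> \<T> \<phi> \<longleftrightarrow> (\<forall>K\<in>\<T>. affine_isometry_on K (\<phi> \<circ> torus_proj \<Lambda>))"

definition piecewise_isometric :: "complex set \<Rightarrow> (complex set \<Rightarrow> real^3) \<Rightarrow> bool" where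
  "piecewise_isometric \<Lambda> \<phi> \<longleftrightarrow>
     continuous_map (torus_topology \<Lambda>) euclidean \<phi> \<and>
     (\<exists>\<T>. torus_triangulation \<Lambda> \<T> \<and> isometric_on_triangles \<Lambda> \<T> \<phi>)"

definition paper_torus :: "nat \<Rightarrow> complex set \<Rightarrow> (complex set \<Rightarrow> real^3) \<Rightarrow> bool" where
  "paper_torus n \<Lambda> \<phi> \<longleftrightarrow>
     planar_lattice \<Lambda> \<and>
     embedding_map (torus_topology \<Lambda>) euclidean \<phi> \<and>
     (\<exists>\<T>. torus_triangulation \<Lambda> \<T> \<and> card (torus_vertices \<Lambda> \<T>) = n \<and>
          isometric_on_triangles \<Lambda> \<T> \<phi>)"

definition generically_to_one :: "nat \<Rightarrow> complex set \<Rightarrow> (complex set \<Rightarrow> real^3) \<Rightarrow> bool" where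
  "generically_to_one k \<Lambda> \<phi> \<longleftrightarrow>
     (\<exists>E. finite E \<and>
        (\<forall>q \<in> \<phi> ` flat_torus \<Lambda> - (\<Union>(a, b)\<in>E. closed_segment a b).
           finite {p \<in> flat_torus \<Lambda>. \<phi> p = q} \<and> card {p \<in> flat_torus \<Lambda>. \<phi> p = q} = k))"

definition is_equilateral_triangle :: "(real^3) set \<Rightarrow> bool" where
  "is_equilateral_triangle S \<longleftrightarrow>
     (\<exists>a b c. a \<noteq> b \<and> dist a b = dist b c \<and> dist b c = dist c a \<and> S = convex hull {a, b, c})"

section \<open>Uniform distance\<close>

definition torus_bilipschitz ::
    "real \<Rightarrow> complex set \<Rightarrow> complex set \<Rightarrow> (complex set \<Rightarrow> complex set) \<Rightarrow> bool" where
  "torus_bilipschitz C \<Lambda>1 \<Lambda>2 \<alpha> \<longleftrightarrow>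
     \<alpha> \<in> flat_torus \<Lambda>1 \<rightarrow> flat_torus \<Lambda>2 \<and>
     (\<forall>p\<in>flat_torus \<Lambda>1. \<forall>q\<in>flat_torus \<Lambda>1.
        setdist p q / C \<le> setdist (\<alpha> p) (\<alpha> q) \<and> setdist (\<alpha> p) (\<alpha> q) \<le> C * setdist p q)"

text \<open>The infimum is taken in the extended reals, so that it would be \<open>\<infinity>\<close> if no \<open>\<epsilon>\<close> were
  admissible. A bilipschitz map between flat tori is automatically onto, by invariance of
  domain, so the distance is symmetric.\<close>

definition uniform_distance ::
    "complex set \<Rightarrow> (complex set \<Rightarrow> real^3) \<Rightarrow> complex set \<Rightarrow> (complex set \<Rightarrow> real^3) \<Rightarrow> ereal" where
  "uniform_distance \<Lambda>1 \<phi>1 \<Lambda>2 \<phi>2 =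
     Inf {ereal \<epsilon> | \<epsilon>. 0 \<le> \<epsilon> \<and>
            (\<exists>\<alpha>. torus_bilipschitz (1 + \<epsilon>) \<Lambda>1 \<Lambda>2 \<alpha> \<and>
                 (\<forall>p\<in>flat_torus \<Lambda>1. dist (\<phi>1 p) (\<phi>2 (\<alpha> p)) \<le> \<epsilon>))}"

end

theory Submission
  imports Defs
begin

text \<open>The map folds the hexagonal torus along its six triangles around one point, each an equilateral
  triangle with side \<open>1/\<surd>3\<close>. It is approximated by tori whose eight vertices are invariant under a
  half-turn of space; in the limit they collapse onto the three corners of the triangle. Scaling the
  deviations from the limit by powers of a small parameter \<open>e\<close>, the equality of corresponding edge lengths in
  the plane and in space becomes a system \<open>F\<^sub>0(w) + e F\<^sub>1(w, e) = 0\<close> in fourteen unknowns for which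
  \<open>F\<^sub>0\<close> has a zero with invertible derivative, so that Brouwer's theorem gives solutions for all small
  \<open>e > 0\<close>. Embeddedness follows from the signs of the leading coefficients of the volumes spanned by
  four vertices: for each pair of triangles some plane through three vertices separates them. That a
  list of plane triangles whose edges match up tiles the plane is deduced from local coverage
  and connectedness; comparing areas shows that the tiles do not overlap.\<close>

text \<open>In the limit ten of the sixteen triangles degenerate to segments, and all eight points
  lie in one plane, so every volume is zero there. Neither the length equations nor the embedding
  can therefore be settled at the limit itself. This forces the unequal powers of \<open>e\<close>:
  each length equation vanishes to its own order, between \<open>e\<close> and \<open>e^4\<close>,
  and is divided by that power before the limit is taken; each volume is likewise judged by its
  first nonzero coefficient. The half-turn fixes the four edges joining a vertex to its image and
  pairs the other twenty, so the 24 edges give 14 length equations. The unknowns match this number: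
  eleven planar coordinates and the first coordinates of \<open>P\<close>, \<open>R\<close> and
  \<open>C\<close>, while all other coordinates in space are prescribed functions of
  \<open>e\<close>. The triangulation of the approximating tori has no counterpart on the hexagonal
  torus. The comparison is made through barycentric coordinates, which keep their meaning when
  triangles collapse.\<close>

section \<open>Zeros of perturbed maps\<close>

text \<open>Brouwer's theorem enters as \<open>sussmann_open_mapping\<close>, which asks for
  continuity and for a derivative with a right inverse at a single point. The open set
  \<open>T\<close> carries all strict side conditions along with the equation.\<close>

lemma perturbed_zero:
  fixes F :: "'a::euclidean_space \<Rightarrow> 'a" and H :: "'a \<times> real \<Rightarrow> 'a"
  assumes der: "(F has_derivative F') (at X0)" and inj: "inj F'" and zero: "F X0 = 0"
    and cF: "continuous_on UNIV F" and cH: "continuous_on UNIV H"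
    and T: "open T" "(X0, 0) \<in> T"
  shows "\<forall>\<^sub>F \<epsilon> in at_right 0. \<exists>X. (X, \<epsilon>) \<in> T \<and> F X + \<epsilon> *\<^sub>R H (X, \<epsilon>) = 0"
proof -
  \<comment> \<open>Replacing the parameter by \<open>t\<^sup>2\<close> makes the perturbation
    \<open>o(t)\<close> for any continuous \<open>H\<close>. The derivative is then the product of
    \<open>F'\<close> and the identity, and its right inverse is the product of \<open>g\<close> and
    the identity. The second component of \<open>G\<close> records \<open>t\<close>.\<close>
  define G where "G = (\<lambda>(X, t :: real). (F X + t\<^sup>2 *\<^sub>R H (X, t\<^sup>2), t))"
  define G' where "G' = (\<lambda>(X, t :: real). (F' X, t))"
  define S where "S = (\<lambda>(X, t :: real). (X, t\<^sup>2)) -` T"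
  have lin: "linear F'" using der has_derivative_linear by blast
  obtain g where g: "linear g" "F' \<circ> g = id"
    using linear_surjective_right_inverse[OF lin linear_injective_imp_surjective[OF lin inj]] by blast
  have "open S" unfolding S_def
    by (rule open_vimage[OF T(1)]) (auto intro!: continuous_intros simp: case_prod_beta)
  have "continuous_on UNIV G"
    unfolding G_def case_prod_beta
    by (intro continuous_intros continuous_on_compose2[OF cF] continuous_on_compose2[OF cH]) auto
  have dH: "((\<lambda>p :: 'a \<times> real. (snd p)\<^sup>2 *\<^sub>R H (fst p, (snd p)\<^sup>2)) has_derivative (\<lambda>_. 0)) (at (X0, 0))"
  proof -
    have "isCont (\<lambda>p :: 'a \<times> real. H (fst p, (snd p)\<^sup>2)) (X0, 0)"
    proof -
      have "continuous_on UNIV (\<lambda>p :: 'a \<times> real. H (fst p, (snd p)\<^sup>2))"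
        by (intro continuous_intros continuous_on_compose2[OF cH]) auto
      then show ?thesis by (simp add: continuous_on_eq_continuous_at)
    qed
    then have "((\<lambda>p :: 'a \<times> real. H (fst p, (snd p)\<^sup>2)) \<longlongrightarrow> H (X0, 0)) (at (X0, 0))"
      by (simp add: isCont_def)
    then have "((\<lambda>p :: 'a \<times> real. \<bar>snd p\<bar> *\<^sub>R H (fst p, (snd p)\<^sup>2)) \<longlongrightarrow> \<bar>snd (X0, 0::real)\<bar> *\<^sub>R H (X0, 0)) (at (X0, 0))"
      by (intro tendsto_intros) auto
    then have lim: "((\<lambda>p :: 'a \<times> real. norm (\<bar>snd p\<bar> *\<^sub>R H (fst p, (snd p)\<^sup>2))) \<longlongrightarrow> 0) (at (X0, 0))"
      by (intro tendsto_norm_zero) simp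
    have "((\<lambda>p :: 'a \<times> real. norm ((snd p)\<^sup>2 *\<^sub>R H (fst p, (snd p)\<^sup>2)) / norm (p - (X0, 0))) \<longlongrightarrow> 0) (at (X0, 0))"
    proof (rule tendsto_sandwich[OF _ _ tendsto_const lim])
      show "\<forall>\<^sub>F p in at (X0, 0). norm ((snd p)\<^sup>2 *\<^sub>R H (fst p, (snd p)\<^sup>2)) / norm (p - (X0, 0))
          \<le> norm (\<bar>snd p\<bar> *\<^sub>R H (fst p, (snd p)\<^sup>2))"
      proof (rule always_eventually, rule allI)
        fix p :: "'a \<times> real"
        have "\<bar>snd p\<bar> \<le> norm (p - (X0, 0))"
          using norm_snd_le[of "snd p" "fst p - X0"] by (simp add: minus_prod_def)
        then have "\<bar>snd p\<bar> * norm (\<bar>snd p\<bar> *\<^sub>R H (fst p, (snd p)\<^sup>2)) \<le> norm (p - (X0, 0)) * norm (\<bar>snd p\<bar> *\<^sub>R H (fst p, (snd p)\<^sup>2))"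
          by (intro mult_right_mono) auto
        moreover have "norm ((snd p)\<^sup>2 *\<^sub>R H (fst p, (snd p)\<^sup>2)) = \<bar>snd p\<bar> * norm (\<bar>snd p\<bar> *\<^sub>R H (fst p, (snd p)\<^sup>2))"
          by (simp add: power2_eq_square abs_mult mult.assoc)
        ultimately have "norm ((snd p)\<^sup>2 *\<^sub>R H (fst p, (snd p)\<^sup>2)) \<le> norm (\<bar>snd p\<bar> *\<^sub>R H (fst p, (snd p)\<^sup>2)) * norm (p - (X0, 0))"
          by (simp only: mult.commute)
        then show "norm ((snd p)\<^sup>2 *\<^sub>R H (fst p, (snd p)\<^sup>2)) / norm (p - (X0, 0))
          \<le> norm (\<bar>snd p\<bar> *\<^sub>R H (fst p, (snd p)\<^sup>2))"
          by (cases "p = (X0, 0)") (auto simp: divide_le_eq)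
      qed
    qed auto
    then show ?thesis
      by (simp add: has_derivative_iff_norm)
  qed
  have dF: "((\<lambda>p. F (fst p)) has_derivative (\<lambda>p. F' (fst p))) (at (X0, 0::real))"
    by (rule has_derivative_compose[OF has_derivative_fst[OF has_derivative_ident]]) (simp add: der)
  have "(G has_derivative G') (at (X0, 0))"
    unfolding G_def G'_def case_prod_beta
    using has_derivative_Pair[OF has_derivative_add[OF dF dH] has_derivative_snd[OF has_derivative_ident]]
    by simp
  moreover have "bounded_linear (\<lambda>(X, t :: real). (g X, t))"
    unfolding case_prod_beta using g(1)
    by (intro bounded_linear_intros) (auto simp: linear_conv_bounded_linear[symmetric] intro: linear_compose[unfolded o_def, OF linear_fst])
  moreover have "G' \<circ> (\<lambda>(X, t :: real). (g X, t)) = id"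
    using g(2) by (auto simp: G'_def fun_eq_iff)
  moreover have "(X0, 0) \<in> interior S"
    using \<open>open S\<close> T(2) by (simp add: interior_open S_def)
  ultimately have "G (X0, 0) \<in> interior (G ` S)"
    using sussmann_open_mapping[of UNIV G "(X0, 0)" G' _ S] \<open>continuous_on UNIV G\<close> by auto
  then obtain \<delta> where \<delta>: "\<delta> > 0" "ball (0, 0) \<delta> \<subseteq> G ` S"
    using zero by (auto simp: G_def mem_interior zero_prod_def)
  have "\<exists>X. (X, \<epsilon>) \<in> T \<and> F X + \<epsilon> *\<^sub>R H (X, \<epsilon>) = 0" if "0 < \<epsilon>" "\<epsilon> < \<delta>\<^sup>2" for \<epsilon>
  proof -
    \<comment> \<open>In a preimage of \<open>(0, sqrt \<epsilon>)\<close> the second component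
      forces \<open>t = sqrt \<epsilon>\<close>, hence the parameter is exactly
      \<open>\<epsilon>\<close>.\<close>
    have "sqrt \<epsilon> < \<delta>" using that \<delta>(1) by (simp add: real_less_lsqrt)
    then have "(0, sqrt \<epsilon>) \<in> ball (0 :: 'a, 0) \<delta>" using that by (simp add: dist_prod_def dist_real_def)
    then obtain X t where "(X, t) \<in> S" "G (X, t) = (0, sqrt \<epsilon>)" using \<delta>(2) by force
    then show ?thesis using that by (auto simp: G_def S_def)
  qed
  then show ?thesis
    unfolding eventually_at_right_field using \<delta>(1) by (intro exI[of _ "\<delta>\<^sup>2"]) auto
qed

section \<open>Signed areas and triangles in the plane\<close>

text \<open>Twice the signed area of the triangle, positive when \<open>a\<close>, \<open>b\<close>,
  \<open>c\<close> run counterclockwise.\<close>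

definition orient :: "complex \<Rightarrow> complex \<Rightarrow> complex \<Rightarrow> real" where
  "orient a b c = (Re b - Re a) * (Im c - Im a) - (Im b - Im a) * (Re c - Re a)"

lemma orient_cycle: "orient b c a = orient a b c"
  by (simp add: orient_def algebra_simps)

lemma orient_swap: "orient b a c = - orient a b c"
  by (simp add: orient_def algebra_simps)

lemma orient_add: "orient b c w + orient c a w + orient a b w = orient a b c"
  by (simp add: orient_def algebra_simps)

lemma orient_translate: "orient (a + t) (b + t) (c + t) = orient a b c"
  by (simp add: orient_def)

lemma continuous_on_orient [continuous_intros]:
  "continuous_on S f \<Longrightarrow> continuous_on S g \<Longrightarrow> continuous_on S h \<Longrightarrow> continuous_on S (\<lambda>x. orient (f x) (g x) (h x))"
  unfolding orient_def by (intro continuous_intros)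

text \<open>Cramer's rule: the three subtriangles at \<open>w\<close> are the barycentric
  coordinates of \<open>w\<close>, up to the common factor \<open>orient a b c\<close>.\<close>

lemma orient_barycentric:
  "orient a b c *\<^sub>R w = orient b c w *\<^sub>R a + orient c a w *\<^sub>R b + orient a b w *\<^sub>R c"
  by (simp add: orient_def complex_eq_iff algebra_simps)

lemma orient_affine:
  assumes "x + y + z = 1"
  shows "orient p q (x *\<^sub>R a + y *\<^sub>R b + z *\<^sub>R c) = x * orient p q a + y * orient p q b + z * orient p q c"
proof -
  have "x = 1 - y - z" using assms by simp
  show ?thesis unfolding \<open>x = 1 - y - z\<close> by (simp add: orient_def algebra_simps)
qed

lemma orient_affine2:
  "x + y = 1 \<Longrightarrow> orient p q (x *\<^sub>R a + y *\<^sub>R b) = x * orient p q a + y * orient p q b"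
  using orient_affine[of x y 0 p q a b a] by simp

lemma orient_self [simp]: "orient a a b = 0" "orient a b a = 0" "orient b a a = 0"
  by (simp_all add: orient_def)

lemma mem_triangle_iff:
  assumes "orient a b c > 0"
  shows "w \<in> convex hull {a, b, c} \<longleftrightarrow> 0 \<le> orient a b w \<and> 0 \<le> orient b c w \<and> 0 \<le> orient c a w"
proof
  assume "w \<in> convex hull {a, b, c}"
  then obtain x y z where "0 \<le> x" "0 \<le> y" "0 \<le> z" "x + y + z = 1" and w: "w = x *\<^sub>R a + y *\<^sub>R b + z *\<^sub>R c"
    by (auto simp: convex_hull_3)
  then show "0 \<le> orient a b w \<and> 0 \<le> orient b c w \<and> 0 \<le> orient c a w"
    using assms orient_cycle[of a b c] orient_cycle[of b c a] by (simp add: orient_affine)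
next
  assume *: "0 \<le> orient a b w \<and> 0 \<le> orient b c w \<and> 0 \<le> orient c a w"
  let ?D = "orient a b c"
  have "w = (1 / ?D) *\<^sub>R (?D *\<^sub>R w)" using assms by simp
  also have "\<dots> = (orient b c w / ?D) *\<^sub>R a + (orient c a w / ?D) *\<^sub>R b + (orient a b w / ?D) *\<^sub>R c"
    by (simp only: orient_barycentric[of a b c w]) (simp add: scaleR_add_right)
  finally have "w = (orient b c w / ?D) *\<^sub>R a + (orient c a w / ?D) *\<^sub>R b + (orient a b w / ?D) *\<^sub>R c" .
  moreover have "orient b c w / ?D + orient c a w / ?D + orient a b w / ?D = 1"
    using assms orient_add[of b c w a] by (simp flip: add_divide_distrib)
  ultimately show "w \<in> convex hull {a, b, c}"
    using * assms unfolding convex_hull_3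
    by (intro CollectI exI[of _ "orient b c w / ?D"] exI[of _ "orient c a w / ?D"] exI[of _ "orient a b w / ?D"]) auto
qed

lemma orient_both_zero:
  assumes "orient a b c \<noteq> 0" "orient a b w = 0" "orient c a w = 0"
  shows "w = a"
proof -
  have "orient b c w = orient a b c"
    using assms orient_add[of b c w a] by simp
  then show ?thesis using orient_barycentric[of a b c w] assms by simp
qed

lemma affine_independent_orient:
  assumes "orient a b c \<noteq> 0"
  shows "\<not> affine_dependent {a, b, c}"
proof -
  have "a \<noteq> b" "b \<noteq> c" "a \<noteq> c" using assms by (auto simp: orient_def)
  moreover have "\<not> collinear {a, b, c}"
  proof
    assume "collinear {a, b, c}"
    then obtain u where u: "\<And>x y. x \<in> {a,b,c} \<Longrightarrow> y \<in> {a,b,c} \<Longrightarrow> \<exists>c. x - y = c *\<^sub>R u"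
      unfolding collinear_def by blast
    obtain s where s: "b - a = s *\<^sub>R u" using u by blast
    obtain t where t: "c - a = t *\<^sub>R u" using u by blast
    have "b = a + s *\<^sub>R u" "c = a + t *\<^sub>R u" using s t by (auto simp: algebra_simps)
    then show False using assms by (simp add: orient_def)
  qed
  ultimately show ?thesis
    by (simp add: affine_dependent_imp_collinear_3 insert_commute collinear_3_eq_affine_dependent)
qed

section \<open>Families of triangles with matching edges\<close>

text \<open>The frontiers of the sets in \<open>\<B>\<close> are negligible, whereas the interior of
  \<open>A\<close> meets the interior of the union in a nonempty open set. A point of that open set
  off all frontiers is interior to some \<open>B\<close>.\<close>

lemma interior_Union_meets:
  fixes A :: "'a::euclidean_space set" and \<B> :: "'a set set"
  assumes "finite \<B>" and cvx: "\<And>B. B \<in> \<B> \<Longrightarrow> convex B \<and> closed B"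
    and w: "w \<in> A" "w \<in> interior (\<Union>\<B>)" and A: "convex A" "interior A \<noteq> {}"
  obtains B where "B \<in> \<B>" "interior A \<inter> interior B \<noteq> {}"
proof -
  have "w \<in> closure (interior A)"
    using convex_closure_interior[OF A] w(1) closure_subset by blast
  then have ne: "interior (\<Union>\<B>) \<inter> interior A \<noteq> {}"
    using w(2) open_Int_closure_eq_empty[of "interior (\<Union>\<B>)" "interior A"] by auto
  have nn: "\<not> negligible (interior (\<Union>\<B>) \<inter> interior A)"
    using ne open_not_negligible[of "interior (\<Union>\<B>) \<inter> interior A"] by auto
  have "negligible (\<Union>B\<in>\<B>. frontier B)"
    using assms(1) cvx by (intro negligible_Union) (auto intro: negligible_convex_frontier)
  then obtain x where x: "x \<in> interior (\<Union>\<B>)" "x \<in> interior A" "\<And>B. B \<in> \<B> \<Longrightarrow> x \<notin> frontier B"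
  proof -
    have "\<not> interior (\<Union>\<B>) \<inter> interior A \<subseteq> (\<Union>B\<in>\<B>. frontier B)"
      using nn \<open>negligible (\<Union>B\<in>\<B>. frontier B)\<close> negligible_subset by blast
    then show ?thesis using that by blast
  qed
  then obtain B where "B \<in> \<B>" "x \<in> B" using interior_subset by blast
  then have "x \<in> interior B"
    using x(3) cvx by (auto simp: frontier_def)
  then show ?thesis using that \<open>B \<in> \<B>\<close> x(2) by blast
qed

text \<open>Used twice: with \<open>W\<close> a punctured disc around a vertex, and with
  \<open>W\<close> the whole plane.\<close>

lemma clopen_in_connected_subset:
  assumes "connected W" "closedin (top_of_set W) (W \<inter> S)"
    and "\<And>w. w \<in> W \<Longrightarrow> w \<in> S \<Longrightarrow> w \<in> interior S" and "W \<inter> S \<noteq> {}"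
  shows "W \<subseteq> S"
proof -
  have "W \<inter> S = W \<inter> interior S"
    using assms(3) interior_subset by blast
  then have "openin (top_of_set W) (W \<inter> S)"
    using openin_open_Int[OF open_interior, of W S] by simp
  then have "W \<inter> S = {} \<or> W \<inter> S = W"
    using assms(1,2) connected_clopen[of W] by blast
  then show ?thesis using assms(4) by blast
qed

text \<open>The labels are lifted vertices, and \<open>\<K>\<close> is closed under rotation of the
  triples. Matching says only that the reversed edge occurs somewhere; tiles may still overlap at
  this stage. The two finiteness conditions make stars closed and make the union of all tiles
  closed.\<close>

locale tiling =
  fixes vp :: "'l \<Rightarrow> complex" and \<K> :: "('l \<times> 'l \<times> 'l) set"
  assumes cyc: "(p, q, r) \<in> \<K> \<Longrightarrow> (q, r, p) \<in> \<K>"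
    and pos: "(p, q, r) \<in> \<K> \<Longrightarrow> 0 < orient (vp p) (vp q) (vp r)"
    and matched: "(p, q, r) \<in> \<K> \<Longrightarrow> \<exists>r'. (q, p, r') \<in> \<K>"
    and vertex_finite: "finite {t \<in> \<K>. fst t = p}"
    and locally_finite: "finite {(p, q, r) \<in> \<K>. convex hull {vp p, vp q, vp r} \<inter> cball 0 R \<noteq> {}}"
    and nonempty: "\<K> \<noteq> {}"
begin

fun tile :: "'l \<times> 'l \<times> 'l \<Rightarrow> complex set" where
  "tile (p, q, r) = convex hull {vp p, vp q, vp r}"

fun verts :: "'l \<times> 'l \<times> 'l \<Rightarrow> 'l set" where
  "verts (p, q, r) = {p, q, r}"

lemma cyc': "(p, q, r) \<in> \<K> \<Longrightarrow> (r, p, q) \<in> \<K>"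
  using cyc by blast

lemma tile_rotate: "tile (q, r, p) = tile (p, q, r)"
  by (simp add: insert_commute)

lemma verts_rotate: "verts (q, r, p) = verts (p, q, r)"
  by auto

lemma compact_tile: "compact (tile t)"
  by (cases t) (auto intro: finite_imp_compact_convex_hull)

lemma closed_tile: "closed (tile t)" and convex_tile: "convex (tile t)"
  using compact_tile compact_imp_closed by (blast, cases t, simp)

lemma mem_tile:
  "(p, q, r) \<in> \<K> \<Longrightarrow> w \<in> tile (p, q, r) \<longleftrightarrow>
    0 \<le> orient (vp p) (vp q) w \<and> 0 \<le> orient (vp q) (vp r) w \<and> 0 \<le> orient (vp r) (vp p) w"
  using mem_triangle_iff[OF pos] by simp

lemma interior_tile_nonempty:
  assumes "t \<in> \<K>" shows "interior (tile t) \<noteq> {}"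
proof (cases t)
  case (fields p q r)
  have "\<not> affine_dependent {vp p, vp q, vp r}" and "card {vp p, vp q, vp r} = 3"
    using pos[of p q r] assms fields affine_independent_orient[of "vp p" "vp q" "vp r"]
    by (auto simp: orient_def card_insert_if)
  then show ?thesis
    using fields interior_convex_hull_eq_empty[of "{vp p, vp q, vp r}"] by simp
qed

lemma interior_star_face:
  assumes "(p, q, r) \<in> \<K>" and "orient (vp p) (vp q) w > 0" "orient (vp q) (vp r) w > 0" "orient (vp r) (vp p) w > 0"
  shows "w \<in> interior (tile (p, q, r))"
proof (rule interiorI)
  let ?U = "{w. orient (vp p) (vp q) w > 0 \<and> orient (vp q) (vp r) w > 0 \<and> orient (vp r) (vp p) w > 0}"
  show "open ?U" by (intro open_Collect_conj open_Collect_less continuous_intros)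
  show "w \<in> ?U" using assms by simp
  show "?U \<subseteq> tile (p, q, r)" using mem_tile[OF assms(1)] by (auto intro: less_imp_le)
qed

text \<open>Both triangles are positively oriented and traverse the common edge in opposite
  directions, so they lie on opposite sides of it. Near a point in the relative interior of the
  edge, every point belongs to one of them according to the sign of
  \<open>orient (vp p) (vp q)\<close>.\<close>

lemma interior_star_edge:
  assumes K: "(p, q, r) \<in> \<K>" and z: "orient (vp p) (vp q) w = 0"
    and "orient (vp q) (vp r) w > 0" "orient (vp r) (vp p) w > 0"
  obtains r' where "(q, p, r') \<in> \<K>" "w \<in> interior (tile (p, q, r) \<union> tile (q, p, r'))"
proof -
  obtain r' where K': "(q, p, r') \<in> \<K>" using matched[OF K] by blast
  let ?D = "orient (vp p) (vp q) (vp r)"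
  have D: "?D > 0" using pos[OF K] .
  have D': "orient (vp q) (vp p) (vp r') > 0" using pos[OF K'] .
  define x y where "x = orient (vp q) (vp r) w / ?D" and "y = orient (vp r) (vp p) w / ?D"
  have xy: "x > 0" "y > 0" "x + y = 1"
    using assms D orient_add[of "vp q" "vp r" w "vp p"] by (auto simp: x_def y_def simp flip: add_divide_distrib)
  have "w = (1 / ?D) *\<^sub>R (?D *\<^sub>R w)" using D by simp
  also have "\<dots> = x *\<^sub>R vp p + y *\<^sub>R vp q"
    by (simp only: orient_barycentric[of "vp p" "vp q" "vp r" w]) (simp add: z x_def y_def scaleR_add_right)
  finally have w: "w = x *\<^sub>R vp p + y *\<^sub>R vp q" .
  have "orient (vp p) (vp r') w > 0" "orient (vp r') (vp q) w > 0"
    unfolding w using xy D' orient_cycle[of "vp p" "vp r'" "vp q"] orient_cycle[of "vp r'" "vp q" "vp p"]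
    by (simp_all add: orient_affine2)
  define U where "U = {v. orient (vp q) (vp r) v > 0 \<and> orient (vp r) (vp p) v > 0 \<and>
     orient (vp p) (vp r') v > 0 \<and> orient (vp r') (vp q) v > 0}"
  have "open U" unfolding U_def by (intro open_Collect_conj open_Collect_less continuous_intros)
  moreover have "w \<in> U" unfolding U_def using assms \<open>orient (vp p) (vp r') w > 0\<close> \<open>orient (vp r') (vp q) w > 0\<close> by simp
  moreover have "U \<subseteq> tile (p, q, r) \<union> tile (q, p, r')"
  proof
    fix v assume "v \<in> U"
    then show "v \<in> tile (p, q, r) \<union> tile (q, p, r')"
      using mem_tile[OF K, of v] mem_tile[OF K', of v] orient_swap[of "vp q" "vp p" v]
      by (cases "orient (vp p) (vp q) v \<ge> 0") (auto simp: U_def)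
  qed
  ultimately have "w \<in> interior (tile (p, q, r) \<union> tile (q, p, r'))"
    by (rule interiorI)
  then show ?thesis using that K' by blast
qed

text \<open>The coordinates belonging to the two sides at \<open>p\<close> cannot both vanish when
  \<open>w\<close> differs from the vertex. So \<open>w\<close> is interior to the tile or to one of
  these two sides, and a single neighbour suffices.\<close>

lemma interior_star_side:
  assumes K: "(p, q, r) \<in> \<K>" and w: "w \<in> tile (p, q, r)" "w \<noteq> vp p" "orient (vp q) (vp r) w > 0"
  shows "\<exists>M\<subseteq>\<K>. finite M \<and> (\<forall>t\<in>M. p \<in> verts t) \<and> w \<in> interior (\<Union>(tile ` M))"
proof -
  have nn: "0 \<le> orient (vp p) (vp q) w" "0 \<le> orient (vp r) (vp p) w"
    using w mem_tile[OF K] by auto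
  have nz: "\<not> (orient (vp p) (vp q) w = 0 \<and> orient (vp r) (vp p) w = 0)"
    using orient_both_zero[of "vp p" "vp q" "vp r" w] pos[OF K] w(2) by auto
  consider (int) "orient (vp p) (vp q) w > 0" "orient (vp r) (vp p) w > 0"
    | (pq) "orient (vp p) (vp q) w = 0" "orient (vp r) (vp p) w > 0"
    | (rp) "orient (vp p) (vp q) w > 0" "orient (vp r) (vp p) w = 0"
    using nn nz by linarith
  then show ?thesis
  proof cases
    case int
    then show ?thesis using interior_star_face[OF K] w K by (intro exI[of _ "{(p, q, r)}"]) auto
  next
    case pq
    obtain r' where "(q, p, r') \<in> \<K>" "w \<in> interior (tile (p, q, r) \<union> tile (q, p, r'))"
      using interior_star_edge[OF K pq(1) w(3) pq(2)] .
    then show ?thesis using K by (intro exI[of _ "{(p, q, r), (q, p, r')}"]) auto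
  next
    case rp
    obtain q' where "(p, r, q') \<in> \<K>" "w \<in> interior (tile (r, p, q) \<union> tile (p, r, q'))"
      using interior_star_edge[OF cyc'[OF K] rp(2) rp(1) w(3)] .
    then show ?thesis using cyc'[OF K] by (intro exI[of _ "{(r, p, q), (p, r, q')}"]) auto
  qed
qed

definition star :: "'l \<Rightarrow> ('l \<times> 'l \<times> 'l) set" where
  "star p = {t \<in> \<K>. fst t = p}"

lemma verts_star:
  assumes "t \<in> \<K>" "p \<in> verts t"
  shows "\<exists>t'\<in>star p. tile t' = tile t \<and> verts t' = verts t"
proof -
  obtain a b c where t: "t = (a, b, c)" by (cases t)
  have K: "(a, b, c) \<in> \<K>" "(b, c, a) \<in> \<K>" "(c, a, b) \<in> \<K>"
    using assms(1) cyc cyc' unfolding t by blast+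
  have "p = a \<or> p = b \<or> p = c" using assms(2) by (simp add: t)
  then show ?thesis
  proof (elim disjE)
    assume "p = a"
    then show ?thesis using K(1) by (intro bexI[of _ t]) (simp_all add: star_def t)
  next
    assume "p = b"
    then show ?thesis using K(2) tile_rotate[of b c a] verts_rotate[of b c a]
      by (intro bexI[of _ "(b, c, a)"] conjI) (simp_all only: star_def t mem_Collect_eq fst_conv)
  next
    assume "p = c"
    then show ?thesis using K(3) tile_rotate[of a b c] verts_rotate[of a b c]
      by (intro bexI[of _ "(c, a, b)"] conjI) (simp_all only: star_def t mem_Collect_eq fst_conv)
  qed
qed

lemma star_Union:
  assumes "M \<subseteq> \<K>" "\<forall>t\<in>M. p \<in> verts t"
  shows "\<Union>(tile ` M) \<subseteq> \<Union>(tile ` star p)"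
proof
  fix w assume "w \<in> \<Union>(tile ` M)"
  then obtain t where t: "t \<in> M" "w \<in> tile t" by blast
  then have "\<exists>t'\<in>star p. tile t' = tile t \<and> verts t' = verts t"
    using verts_star assms by (simp add: subset_eq)
  then show "w \<in> \<Union>(tile ` star p)" using t(2) by (metis UN_I)
qed

text \<open>Connectedness of a punctured disc replaces the proof that the triangles at a vertex
  close up cyclically: the star meets the punctured disc in a nonempty set that is closed because
  the star is finite, and open by \<open>interior_star_side\<close>.\<close>

lemma interior_star_vertex:
  assumes "star p \<noteq> {}"
  shows "vp p \<in> interior (\<Union>(tile ` star p))"
proof -
  let ?S = "\<Union>(tile ` star p)"
  have fin: "finite (star p)" using vertex_finite by (simp add: star_def)
  \<comment> \<open>Within this neighbourhood of the vertex no point lies on the side opposite to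
    the vertex in a tile of the star, which is the hypothesis of
    \<open>interior_star_side\<close>.\<close>
  define U where "U = (\<Inter>(x, q, r)\<in>star p. {w. orient (vp q) (vp r) w > 0})"
  have "open U" unfolding U_def
    by (intro open_INT fin) (auto intro!: open_Collect_less continuous_intros)
  moreover have "vp p \<in> U"
  proof -
    have "orient (vp q) (vp r) (vp p) > 0" if "(p, q, r) \<in> \<K>" for q r
      using pos[OF that] orient_cycle[of "vp q" "vp r" "vp p"] by simp
    then show ?thesis by (auto simp: U_def star_def)
  qed
  ultimately obtain \<rho> where \<rho>: "\<rho> > 0" "ball (vp p) \<rho> \<subseteq> U"
    using openE by blast
  define W where "W = ball (vp p) \<rho> - {vp p}"
  have "W \<subseteq> ?S"
  proof (rule clopen_in_connected_subset)
    show "connected W" unfolding W_def by (rule connected_punctured_ball) simp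
    show "closedin (top_of_set W) (W \<inter> ?S)"
      using fin closed_tile by (intro closedin_closed_Int closed_UN) auto
    show "w \<in> interior ?S" if w: "w \<in> W" "w \<in> ?S" for w
    proof -
      obtain q r where t: "(p, q, r) \<in> \<K>" "w \<in> tile (p, q, r)"
        using w(2) by (auto simp: star_def)
      have "(p, q, r) \<in> star p" using t by (simp add: star_def)
      moreover have "w \<in> U" using w(1) \<rho>(2) by (auto simp: W_def)
      ultimately have "orient (vp q) (vp r) w > 0" unfolding U_def by auto
      moreover have "w \<noteq> vp p" using w(1) by (simp add: W_def)
      ultimately obtain M where "M \<subseteq> \<K>" "\<forall>t\<in>M. p \<in> verts t" "w \<in> interior (\<Union>(tile ` M))"
        using interior_star_side[OF t(1) t(2)] by blast
      then show ?thesis using interior_mono[OF star_Union[of M p]] by blast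
    qed
    obtain q r where K: "(p, q, r) \<in> \<K>" using assms by (auto simp: star_def)
    \<comment> \<open>The witness for nonemptiness is a point on the edge from \<open>p\<close> to
      \<open>q\<close>, taken so close to \<open>p\<close> that it stays in the disc.\<close>
    define s where "s = min (1/2) (\<rho> / (2 * (1 + dist (vp p) (vp q))))"
    have "0 < s" unfolding s_def using \<rho>(1) by (simp add: add_pos_nonneg)
    moreover have "s \<le> 1/2" unfolding s_def by (rule min.cobounded1)
    ultimately have s: "0 < s" "s \<le> 1/2" by simp_all
    have "s * dist (vp p) (vp q) \<le> \<rho> / (2 * (1 + dist (vp p) (vp q))) * dist (vp p) (vp q)"
      by (intro mult_right_mono) (auto simp: s_def)
    also have "\<dots> < \<rho>"
      using \<rho>(1) by (simp add: divide_simps add_pos_nonneg) (simp add: algebra_simps add_pos_nonneg)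
    finally have sd: "s * dist (vp p) (vp q) < \<rho>" .
    define w where "w = vp p + s *\<^sub>R (vp q - vp p)"
    have "w = (1 - s) *\<^sub>R vp p + s *\<^sub>R vp q + 0 *\<^sub>R vp r" by (simp add: w_def algebra_simps)
    then have "w \<in> tile (p, q, r)" using s unfolding tile.simps convex_hull_3
      by (intro CollectI exI[of _ "1 - s"] exI[of _ s] exI[of _ 0]) auto
    moreover have "vp q \<noteq> vp p" using pos[OF K] by auto
    moreover have "dist (vp p) w = s * dist (vp p) (vp q)" using s by (simp add: w_def dist_norm norm_minus_commute)
    ultimately have "w \<in> W \<inter> ?S" using sd s K by (auto simp: W_def star_def w_def)
    then show "W \<inter> ?S \<noteq> {}" by blast
  qed
  moreover have "vp p \<in> ?S"
    using assms by (force simp: star_def intro: hull_inc)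
  ultimately have "ball (vp p) \<rho> \<subseteq> ?S" unfolding W_def by blast
  then show ?thesis using \<rho>(1) mem_interior by blast
qed

text \<open>The point of the statement is that all tiles of \<open>M\<close> contain
  \<open>p\<close>, for any vertex \<open>p\<close> whose coordinate at \<open>w\<close> is
  positive; \<open>carrier_vertex\<close> depends on it.\<close>

lemma interior_star:
  assumes K: "(p, q, r) \<in> \<K>" and w: "w \<in> tile (p, q, r)" "orient (vp q) (vp r) w > 0"
  shows "\<exists>M\<subseteq>\<K>. finite M \<and> (\<forall>t\<in>M. p \<in> verts t) \<and> w \<in> interior (\<Union>(tile ` M))"
proof (cases "w = vp p")
  case True
  have "star p \<subseteq> \<K>" "finite (star p)" "\<forall>t\<in>star p. p \<in> verts t"
    using vertex_finite by (auto simp: star_def)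
  moreover have "star p \<noteq> {}" using K by (auto simp: star_def)
  ultimately show ?thesis using interior_star_vertex True by (intro exI[of _ "star p"]) blast
next
  case False
  then show ?thesis using interior_star_side[OF K w(1) False w(2)] by blast
qed

lemma mem_tile_vertex_pos:
  assumes K: "(p, q, r) \<in> \<K>" and w: "w \<in> tile (p, q, r)"
  shows "orient (vp q) (vp r) w > 0 \<or> orient (vp r) (vp p) w > 0 \<or> orient (vp p) (vp q) w > 0"
  using orient_add[of "vp q" "vp r" w "vp p"] pos[OF K] by linarith

lemma tiles_meeting_finite: "finite {t \<in> \<K>. tile t \<inter> cball 0 R \<noteq> {}}"
  by (rule finite_subset[OF _ locally_finite[of R]]) auto

lemma covers: "(\<Union>t\<in>\<K>. tile t) = UNIV"
proof -
  let ?S = "\<Union>t\<in>\<K>. tile t"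
  have cl: "closed ?S"
    unfolding closed_def
  proof (rule Topological_Spaces.openI)
    fix w assume w: "w \<in> - ?S"
    \<comment> \<open>The radius \<open>norm w + 1\<close> makes the large ball contain the unit
      ball around \<open>w\<close>, so that only finitely many tiles have to be removed from the
      latter.\<close>
    define F where "F = {t \<in> \<K>. tile t \<inter> cball 0 (norm w + 1) \<noteq> {}}"
    define U where "U = ball w 1 - (\<Union>t\<in>F. tile t)"
    have "finite F" unfolding F_def by (rule tiles_meeting_finite)
    then have "closed (\<Union>t\<in>F. tile t)" using closed_tile by (simp add: closed_UN)
    then have "open U" unfolding U_def by (rule open_Diff[OF open_ball])
    moreover have "w \<in> U" using w by (auto simp: U_def F_def)
    moreover have "U \<subseteq> - ?S"
    proof
      fix x assume x: "x \<in> U"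
      have "norm x \<le> norm w + 1"
        using x norm_triangle_ineq2[of x w] by (simp add: U_def dist_norm norm_minus_commute)
      then have "x \<in> cball 0 (norm w + 1)" by simp
      then show "x \<in> - ?S" using x unfolding U_def F_def by blast
    qed
    ultimately show "\<exists>T. open T \<and> w \<in> T \<and> T \<subseteq> - ?S" by blast
  qed
  have int: "w \<in> interior ?S" if w: "w \<in> ?S" for w
  proof -
    obtain t where t: "t \<in> \<K>" "w \<in> tile t" using w by blast
    obtain p q r where "t = (p, q, r)" by (cases t)
    then have K: "(p, q, r) \<in> \<K>" "w \<in> tile (p, q, r)" using t by blast+
    have w': "w \<in> tile (q, r, p)" "w \<in> tile (r, p, q)"
      using K(2) tile_rotate[of q r p] tile_rotate[of p q r] by simp_all
    have "\<exists>a. \<exists>M\<subseteq>\<K>. finite M \<and> (\<forall>t\<in>M. a \<in> verts t) \<and> w \<in> interior (\<Union>(tile ` M))"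
      using mem_tile_vertex_pos[OF K]
    proof (elim disjE)
      assume "orient (vp q) (vp r) w > 0"
      from interior_star[OF K this] show ?thesis by (rule exI)
    next
      assume "orient (vp r) (vp p) w > 0"
      from interior_star[OF cyc[OF K(1)] w'(1) this] show ?thesis by (rule exI)
    next
      assume "orient (vp p) (vp q) w > 0"
      from interior_star[OF cyc'[OF K(1)] w'(2) this] show ?thesis by (rule exI)
    qed
    then obtain M where "M \<subseteq> \<K>" "w \<in> interior (\<Union>(tile ` M))" by blast
    moreover from this(1) have "\<Union>(tile ` M) \<subseteq> ?S" by blast
    ultimately show ?thesis using interior_mono by blast
  qed
  have "UNIV \<subseteq> ?S"
  proof (rule clopen_in_connected_subset)
    show "connected (UNIV :: complex set)" by (rule convex_connected[OF convex_UNIV])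
    show "closedin (top_of_set UNIV) (UNIV \<inter> ?S)" using cl by simp
    show "UNIV \<inter> ?S \<noteq> {}"
    proof -
      obtain t where "t \<in> \<K>" using nonempty by blast
      then show ?thesis using interior_tile_nonempty[of t] interior_subset[of "tile t"] by blast
    qed
  qed (use int in auto)
  then show ?thesis by blast
qed

end

text \<open>Only the vertex sets are required to agree, because \<open>\<K>\<close> contains all
  three rotations of a triangle.\<close>

locale tiling_disjoint = tiling vp \<K> for vp :: "'l \<Rightarrow> complex" and \<K> +
  assumes disjoint: "t \<in> \<K> \<Longrightarrow> t' \<in> \<K> \<Longrightarrow> interior (tile t) \<inter> interior (tile t') \<noteq> {} \<Longrightarrow> verts t = verts t'"
begin

text \<open>Tiles with vertex \<open>p\<close> fill a neighbourhood of \<open>w\<close>, so the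
  interior of \<open>t\<close> meets the interior of one of them; disjointness then gives
  \<open>t\<close> the same vertices. This is the statement that a point has the same carrier face
  in every tile containing it.\<close>

lemma carrier_vertex:
  assumes K: "(p, q, r) \<in> \<K>" and w: "w \<in> tile (p, q, r)" "orient (vp q) (vp r) w > 0"
    and t: "t \<in> \<K>" "w \<in> tile t"
  shows "p \<in> verts t"
proof -
  obtain M where M: "M \<subseteq> \<K>" "finite M" "\<forall>t\<in>M. p \<in> verts t" "w \<in> interior (\<Union>(tile ` M))"
    using interior_star[OF K w] by blast
  obtain B where "B \<in> tile ` M" "interior (tile t) \<inter> interior B \<noteq> {}"
  proof (rule interior_Union_meets)
    show "finite (tile ` M)" using M(2) by simp
    show "convex B \<and> closed B" if "B \<in> tile ` M" for B
      using that convex_tile closed_tile by blast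
    show "convex (tile t)" by (rule convex_tile)
    show "interior (tile t) \<noteq> {}" by (rule interior_tile_nonempty[OF t(1)])
  qed (use M t in auto)
  then obtain m where m: "m \<in> M" "interior (tile t) \<inter> interior (tile m) \<noteq> {}" by blast
  then have "m \<in> \<K>" using M(1) by blast
  then show ?thesis using disjoint[OF t(1) _ m(2)] M(3) m(1) by simp
qed

end

section \<open>Areas of triangles and of a fundamental parallelogram\<close>

text \<open>It brings \<open>content_triangle\<close>, a statement about \<open>real^2\<close>, to
  bear on triangles of complex numbers.\<close>

lemma emeasure_lborel_complex:
  assumes "A \<in> sets borel"
  shows "emeasure lborel (A :: complex set) = emeasure lborel ((\<lambda>x :: real^2. Complex (x $ 1) (x $ 2)) -` A)"
proof -
  let ?T = "\<lambda>x :: real^2. Complex (x $ 1) (x $ 2)"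
  have cont: "continuous_on UNIV ?T"
    unfolding Complex_eq by (intro continuous_intros)
  have T[measurable]: "?T \<in> borel_measurable borel"
    by (rule borel_measurable_continuous_onI[OF cont])
  have "lborel = distr lborel borel ?T"
  proof (rule lborel_eqI)
    fix l w :: complex
    assume le: "\<And>b. b \<in> Basis \<Longrightarrow> l \<bullet> b \<le> w \<bullet> b"
    have "?T -` box l w = box (vector [Re l, Im l]) (vector [Re w, Im w])"
      by (auto simp: in_box_complex_iff mem_box_cart forall_2)
    moreover have "Re l \<le> Re w" "Im l \<le> Im w"
      using le[of 1] le[of \<i>] by (auto simp: Basis_complex_def)
    moreover have "emeasure lborel (box (vector [Re l, Im l]) (vector [Re w, Im w] :: real^2)) =
        ennreal (\<Prod>i\<in>UNIV. (vector [Re w, Im w] - vector [Re l, Im l] :: real^2) $ i)"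
    proof -
      have "(\<Prod>b\<in>Basis. (vector [Re w, Im w] - vector [Re l, Im l] :: real^2) \<bullet> b) =
        (\<Prod>i\<in>UNIV. (vector [Re w, Im w] - vector [Re l, Im l] :: real^2) $ i)"
        by (simp add: Basis_vec_def UNION_singleton_eq_range prod.reindex inj_on_def axis_eq_axis inner_axis)
      moreover have "(vector [Re l, Im l] :: real^2) \<bullet> b \<le> vector [Re w, Im w] \<bullet> b"
        if b: "b \<in> Basis" for b
      proof -
        obtain i where "b = axis i 1" using b by (auto simp: Basis_vec_def)
        then show ?thesis using exhaust_2[of i] \<open>Re l \<le> Re w\<close> \<open>Im l \<le> Im w\<close> by (auto simp: inner_axis)
      qed
      ultimately show ?thesis by (simp add: emeasure_lborel_box)
    qed
    ultimately show "emeasure (distr lborel borel ?T) (box l w) = ennreal (\<Prod>b\<in>Basis. (w - l) \<bullet> b)"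
      by (simp add: emeasure_distr prod.insert UNIV_2 Basis_complex_def)
  qed simp
  then have "emeasure lborel A = emeasure (distr lborel borel ?T) A" by simp
  also have "\<dots> = emeasure lborel (?T -` A)"
    using assms by (simp add: emeasure_distr)
  finally show ?thesis .
qed

lemma emeasure_triangle:
  "emeasure lborel (convex hull {a, b, c :: complex}) = ennreal (\<bar>orient a b c\<bar> / 2)"
proof -
  let ?T = "\<lambda>x :: real^2. Complex (x $ 1) (x $ 2)"
  let ?S = "\<lambda>z. vector [Re z, Im z] :: real^2"
  have [simp]: "?T (?S z) = z" for z by simp
  have S: "vector [x $ 1, x $ 2] = x" for x :: "real^2" by (simp add: vec_eq_iff forall_2)
  have lin: "linear ?T" by (rule linearI) (auto simp: complex_eq_iff)
  have "?T -` (convex hull {a, b, c}) = convex hull {?S a, ?S b, ?S c}" (is "?L = ?R")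
  proof -
    have im: "?T ` ?R = convex hull {a, b, c}"
      using convex_hull_linear_image[OF lin, of "{?S a, ?S b, ?S c}"] by simp
    have "x \<in> ?L \<longleftrightarrow> x \<in> ?R" for x
    proof -
      have "inj ?T" by (rule inj_on_inverseI[of _ ?S]) (simp add: S)
      then show ?thesis unfolding im[symmetric] using inj_image_mem_iff[of ?T x ?R] by simp
    qed
    then show ?thesis by blast
  qed
  moreover have "convex hull {a, b, c} \<in> sets borel"
    by (intro borel_closed compact_imp_closed finite_imp_compact_convex_hull) simp
  ultimately have "emeasure lborel (convex hull {a, b, c}) = emeasure lborel (convex hull {?S a, ?S b, ?S c})"
    by (simp add: emeasure_lborel_complex)
  also have "\<dots> = ennreal (measure lborel (convex hull {?S a, ?S b, ?S c}))"
  proof (rule emeasure_eq_ennreal_measure)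
    have "compact (convex hull {?S a, ?S b, ?S c})" by (rule finite_imp_compact_convex_hull) simp
    then show "emeasure lborel (convex hull {?S a, ?S b, ?S c}) \<noteq> top"
      using emeasure_compact_finite by (metis infinity_ennreal_def less_irrefl)
  qed
  also have "measure lborel (convex hull {?S a, ?S b, ?S c}) = \<bar>orient a b c\<bar> / 2"
    by (subst content_triangle) (simp add: orient_def abs_minus_commute algebra_simps)
  finally show ?thesis .
qed

text \<open>The coordinates of \<open>z\<close> in the basis \<open>u\<close>, \<open>v\<close>,
  multiplied by \<open>orient 0 u v\<close>, are the two signed areas. Each ranges over a half-open
  interval, so that every coset has exactly one representative.\<close>

definition fund :: "complex \<Rightarrow> complex \<Rightarrow> complex set" where
  "fund u v = {z. 0 \<le> orient 0 z v \<and> orient 0 z v < orient 0 u v \<and> 0 \<le> orient 0 u z \<and> orient 0 u z < orient 0 u v}"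

lemma orient_coords:
  "orient 0 u v *\<^sub>R z = orient 0 z v *\<^sub>R u + orient 0 u z *\<^sub>R v"
  by (simp add: orient_def complex_eq_iff algebra_simps)

lemma orient_lincomb:
  "orient 0 (z + (x *\<^sub>R u + y *\<^sub>R v)) v = orient 0 z v + x * orient 0 u v"
  "orient 0 u (z + (x *\<^sub>R u + y *\<^sub>R v)) = orient 0 u z + y * orient 0 u v"
  by (simp_all add: orient_def algebra_simps)

lemma fund_unique:
  assumes D: "orient 0 u v > 0"
  shows "\<exists>!s :: int \<times> int. z + (of_int (fst s) *\<^sub>R u + of_int (snd s) *\<^sub>R v) \<in> fund u v"
proof -
  let ?D = "orient 0 u v"
  have iff: "z + (of_int m *\<^sub>R u + of_int n *\<^sub>R v) \<in> fund u v \<longleftrightarrow>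
      m = - \<lfloor>orient 0 z v / ?D\<rfloor> \<and> n = - \<lfloor>orient 0 u z / ?D\<rfloor>" for m n :: int
  proof -
    have *: "0 \<le> a + of_int m * ?D \<and> a + of_int m * ?D < ?D \<longleftrightarrow> m = - \<lfloor>a / ?D\<rfloor>" for a and m :: int
    proof -
      have "0 \<le> a + of_int m * ?D \<and> a + of_int m * ?D < ?D \<longleftrightarrow> of_int (- m) \<le> a / ?D \<and> a / ?D < of_int (- m) + 1"
        using D by (auto simp: field_simps)
      also have "\<dots> \<longleftrightarrow> \<lfloor>a / ?D\<rfloor> = - m" by (simp only: floor_eq_iff)
      also have "\<dots> \<longleftrightarrow> m = - \<lfloor>a / ?D\<rfloor>" by auto
      finally show ?thesis .
    qed
    show ?thesis unfolding fund_def mem_Collect_eq orient_lincomb using *[of "orient 0 z v" m] *[of "orient 0 u z" n] by blast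
  qed
  show ?thesis
  proof (rule ex1I[of _ "(- \<lfloor>orient 0 z v / ?D\<rfloor>, - \<lfloor>orient 0 u z / ?D\<rfloor>)"])
    show "z + (of_int (fst (- \<lfloor>orient 0 z v / ?D\<rfloor>, - \<lfloor>orient 0 u z / ?D\<rfloor>)) *\<^sub>R u +
        of_int (snd (- \<lfloor>orient 0 z v / ?D\<rfloor>, - \<lfloor>orient 0 u z / ?D\<rfloor>)) *\<^sub>R v) \<in> fund u v"
      unfolding iff by simp
    show "s = (- \<lfloor>orient 0 z v / ?D\<rfloor>, - \<lfloor>orient 0 u z / ?D\<rfloor>)"
      if "z + (of_int (fst s) *\<^sub>R u + of_int (snd s) *\<^sub>R v) \<in> fund u v" for s
      using that unfolding iff by (simp add: prod_eq_iff)
  qed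
qed

lemma bounded_fund: "bounded (fund u v)"
proof -
  have "norm z \<le> norm u + norm v" if z: "z \<in> fund u v" for z
  proof -
    let ?D = "orient 0 u v"
    have "?D > 0" using z by (auto simp: fund_def)
    have "?D * norm z = norm (?D *\<^sub>R z)" using \<open>?D > 0\<close> by simp
    also have "\<dots> \<le> norm (orient 0 z v *\<^sub>R u) + norm (orient 0 u z *\<^sub>R v)"
      by (subst orient_coords) (rule norm_triangle_ineq)
    also have "\<dots> \<le> ?D * norm u + ?D * norm v"
      using z by (auto simp: fund_def intro!: add_mono mult_right_mono)
    finally have "?D * norm z \<le> ?D * (norm u + norm v)" by (simp add: algebra_simps)
    then show ?thesis using \<open>?D > 0\<close> by simp
  qed
  then show ?thesis by (auto simp: bounded_iff)
qed

lemma borel_fund [measurable]: "fund u v \<in> sets borel"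
proof -
  have "continuous_on UNIV (\<lambda>z. orient 0 z v)" "continuous_on UNIV (\<lambda>z. orient 0 u z)"
    by (intro continuous_intros)+
  then have [measurable]: "(\<lambda>z. orient 0 z v) \<in> borel_measurable borel" "(\<lambda>z. orient 0 u z) \<in> borel_measurable borel"
    by (simp_all add: borel_measurable_continuous_onI)
  show ?thesis unfolding fund_def by measurable
qed

lemma emeasure_interior_triangle:
  assumes "orient a b c > 0"
  shows "emeasure lborel (interior (convex hull {a, b, c :: complex})) = ennreal (orient a b c / 2)"
proof -
  let ?H = "convex hull {a, b, c}"
  have cl: "closed ?H" by (intro compact_imp_closed finite_imp_compact_convex_hull) simp
  have "frontier ?H \<in> null_sets lborel"
    using negligible_convex_frontier[of ?H] cl
    by (simp add: negligible_iff_null_sets null_sets_completion_iff borel_closed frontier_closed)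
  then have "emeasure lborel (?H - frontier ?H) = emeasure lborel ?H"
    using cl by (intro emeasure_Diff_null_set) (auto simp: borel_closed)
  moreover have "?H - frontier ?H = interior ?H"
    using cl interior_subset by (auto simp: frontier_def)
  ultimately show ?thesis using assms by (simp add: emeasure_triangle)
qed

text \<open>Two open triangles on either side of the diagonal already have the required total area.
  A lower bound is what the comparison with the total area of the tiles uses.\<close>

lemma emeasure_fund_ge:
  assumes D: "orient 0 u v > 0"
  shows "ennreal (orient 0 u v) \<le> emeasure lborel (fund u v)"
proof -
  let ?A = "interior (convex hull {0, u, u + v})" and ?B = "interior (convex hull {0, u + v, v})"
  have oA: "orient 0 u (u + v) = orient 0 u v" "orient u (u + v) 0 = orient 0 u v" "orient (u + v) 0 u = orient 0 u v"
    and oB: "orient 0 (u + v) v = orient 0 u v" "orient (u + v) v 0 = orient 0 u v" "orient v 0 (u + v) = orient 0 u v"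
    by (simp_all add: orient_def algebra_simps)
  have strict: "0 < orient a b w" if o: "0 < orient a b c" "w \<in> interior (convex hull {a, b, c})" for a b c w
  proof -
    obtain e where e: "e > 0" "ball w e \<subseteq> convex hull {a, b, c}" using o(2) mem_interior by blast
    \<comment> \<open>Moving \<open>w\<close> slightly away from \<open>c\<close> keeps it in the
      triangle. As \<open>orient a b\<close> is affine and positive at \<open>c\<close>, its
      nonnegativity at the moved point forces strict positivity at \<open>w\<close>.\<close>
    define d where "d = (e / (2 * (1 + norm (c - w)))) "
    have "d > 0" using e(1) by (simp add: d_def add_pos_nonneg)
    have "norm (d *\<^sub>R (c - w)) < e"
    proof -
      have "norm (d *\<^sub>R (c - w)) = e * (norm (c - w) / (2 * (1 + norm (c - w))))"
        using \<open>d > 0\<close> e(1) by (simp add: d_def)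
      also have "\<dots> < e * 1"
        by (intro mult_strict_left_mono e) (simp add: divide_less_eq add_pos_nonneg add_nonneg_pos)
      finally show ?thesis by simp
    qed
    then have "w - d *\<^sub>R (c - w) \<in> ball w e" by (simp add: dist_norm)
    then have "0 \<le> orient a b (w - d *\<^sub>R (c - w))" using e(2) mem_triangle_iff[OF o(1)] by blast
    moreover have "orient a b (w - d *\<^sub>R (c - w)) = (1 + d) * orient a b w - d * orient a b c"
      by (simp add: orient_def algebra_simps)
    ultimately have "0 < (1 + d) * orient a b w" using o(1) \<open>d > 0\<close> by (smt (verit) mult_pos_pos)
    then show ?thesis using \<open>d > 0\<close> by (simp add: zero_less_mult_iff)
  qed
  have A: "?A \<subseteq> fund u v \<inter> {w. orient 0 u w < orient 0 w v}"
  proof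
    fix w assume w: "w \<in> ?A"
    have "0 < orient 0 u w" using strict[of 0 u "u + v" w] w D oA by simp
    moreover have "0 < orient u (u + v) w" using strict[of u "u + v" 0 w] w D oA
      by (simp add: insert_commute)
    moreover have "0 < orient (u + v) 0 w" using strict[of "u + v" 0 u w] w D oA
      by (simp add: insert_commute)
    ultimately show "w \<in> fund u v \<inter> {w. orient 0 u w < orient 0 w v}"
      by (simp add: fund_def orient_def algebra_simps)
  qed
  have B: "?B \<subseteq> fund u v \<inter> {w. orient 0 w v < orient 0 u w}"
  proof
    fix w assume w: "w \<in> ?B"
    have "0 < orient 0 (u + v) w" using strict[of 0 "u + v" v w] w D oB by simp
    moreover have "0 < orient (u + v) v w" using strict[of "u + v" v 0 w] w D oB
      by (simp add: insert_commute)
    moreover have "0 < orient v 0 w" using strict[of v 0 "u + v" w] w D oB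
      by (simp add: insert_commute)
    ultimately show "w \<in> fund u v \<inter> {w. orient 0 w v < orient 0 u w}"
      by (simp add: fund_def orient_def algebra_simps)
  qed
  have "ennreal (orient 0 u v) = ennreal (orient 0 u v / 2) + ennreal (orient 0 u v / 2)"
    using D by (simp flip: ennreal_plus)
  also have "\<dots> = emeasure lborel ?A + emeasure lborel ?B"
    using D by (simp add: emeasure_interior_triangle oA oB)
  also have "\<dots> = emeasure lborel (?A \<union> ?B)"
  proof (intro plus_emeasure)
    show "?A \<inter> ?B = {}" by (auto dest!: subsetD[OF A] subsetD[OF B])
  qed auto
  also have "\<dots> \<le> emeasure lborel (fund u v)"
    using A B by (intro emeasure_mono) auto
  finally show ?thesis .
qed

section \<open>Combinatorial tori and their lifts to the plane\<close>

type_synonym lvertex = "nat \<times> int \<times> int"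
type_synonym ltriangle = "lvertex \<times> lvertex \<times> lvertex"

fun rotations :: "ltriangle \<Rightarrow> ltriangle list" where
  "rotations (p, q, r) = [(p, q, r), (q, r, p), (r, p, q)]"

fun corners :: "ltriangle \<Rightarrow> lvertex list" where
  "corners (p, q, r) = [p, q, r]"

text \<open>A vertex \<open>(i, m, n)\<close> is the translate by \<open>m u + n v\<close> of the chosen representative of
  vertex number \<open>i\<close>. The list contains one positively oriented lift of each triangle.\<close>

definition matched_torus :: "nat \<Rightarrow> ltriangle list \<Rightarrow> bool" where
  "matched_torus n Ts \<longleftrightarrow> distinct Ts \<and> Ts \<noteq> [] \<and>
     (\<forall>t\<in>set Ts. \<forall>(p, q, r)\<in>set (rotations t).
        fst p \<noteq> fst q \<and> fst p < n \<and>
        (\<exists>t'\<in>set Ts. \<exists>(q', p', r')\<in>set (rotations t').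
           fst q' = fst q \<and> fst p' = fst p \<and>
           fst (snd p') - fst (snd q') = fst (snd p) - fst (snd q) \<and>
           snd (snd p') - snd (snd q') = snd (snd p) - snd (snd q))) \<and>
     (\<forall>i<n. \<exists>t\<in>set Ts. i \<in> fst ` set (corners t))"

text \<open>The first new clause makes the intersection of two triangles a proper face. The second
  lets one lattice translation match all their common vertex classes, so that they meet in one face
  instead of several translates of faces.\<close>

definition simplicial_torus :: "nat \<Rightarrow> ltriangle list \<Rightarrow> bool" where
  "simplicial_torus n Ts \<longleftrightarrow> matched_torus n Ts \<and>
     (\<forall>t\<in>set Ts. \<forall>t'\<in>set Ts. t \<noteq> t' \<longrightarrow>
        \<not> fst ` set (corners t) \<subseteq> fst ` set (corners t') \<and>
        (\<forall>p\<in>set (corners t). \<forall>q\<in>set (corners t). \<forall>p'\<in>set (corners t'). \<forall>q'\<in>set (corners t').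
           fst p = fst p' \<longrightarrow> fst q = fst q' \<longrightarrow>
           fst (snd p') - fst (snd q') = fst (snd p) - fst (snd q) \<and>
           snd (snd p') - snd (snd q') = snd (snd p) - snd (snd q)))"

fun shift :: "int \<times> int \<Rightarrow> lvertex \<Rightarrow> lvertex" where
  "shift (a, b) (i, m, n) = (i, m + a, n + b)"

fun shift3 :: "int \<times> int \<Rightarrow> ltriangle \<Rightarrow> ltriangle" where
  "shift3 s (p, q, r) = (shift s p, shift s q, shift s r)"

lemma corners_rotation: "t' \<in> set (rotations t) \<Longrightarrow> set (corners t') = set (corners t)"
  by (cases t) auto

lemma corners_shift3: "set (corners (shift3 s t)) = shift s ` set (corners t)"
  by (cases t) auto

locale torus_complex =
  fixes u v :: complex and pos :: "nat \<Rightarrow> complex" and N :: nat and Ts :: "ltriangle list"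
  assumes lattice_pos: "orient 0 u v > 0"
    and matched_list: "matched_torus N Ts"
begin

definition lat :: "int \<times> int \<Rightarrow> complex" where
  "lat s = of_int (fst s) *\<^sub>R u + of_int (snd s) *\<^sub>R v"

definition vp :: "lvertex \<Rightarrow> complex" where
  "vp x = pos (fst x) + lat (snd x)"

definition \<K> :: "ltriangle set" where
  "\<K> = {shift3 s t' | s t' t. t \<in> set Ts \<and> t' \<in> set (rotations t)}"

lemma lat_add: "lat (s + s') = lat s + lat s'"
  by (simp add: lat_def algebra_simps)

lemma lat_0 [simp]: "lat (0, 0) = 0"
  by (simp add: lat_def)

lemma vp_shift: "vp (shift s x) = vp x + lat s"
  by (cases s; cases x) (simp add: vp_def lat_def algebra_simps)

lemma shift_shift: "shift s (shift s' x) = shift (s + s') x"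
  by (cases s; cases s'; cases x) (simp add: algebra_simps)

lemma shift_zero [simp]: "shift 0 x = x"
  by (cases x) (simp add: zero_prod_def)

lemma fst_shift [simp]: "fst (shift s x) = fst x"
  by (cases s; cases x) simp

lemma snd_shift [simp]: "snd (shift s x) = snd x + s"
  by (cases s; cases x) simp

lemma shift_eqI: "fst x = fst y \<Longrightarrow> snd y = snd x + s \<Longrightarrow> y = shift s x"
  by (cases s; cases x; cases y) auto

lemma shift3_shift3: "shift3 s (shift3 s' t) = shift3 (s + s') t"
  by (cases t) (simp add: shift_shift)

lemma shift3_zero [simp]: "shift3 0 t = t"
  by (cases t) simp

lemma shift3_in: "t \<in> \<K> \<Longrightarrow> shift3 s t \<in> \<K>"
proof -
  assume "t \<in> \<K>"
  then obtain s' t' t0 where t: "t0 \<in> set Ts" "t' \<in> set (rotations t0)" "t = shift3 s' t'"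
    unfolding \<K>_def by blast
  then have "shift3 s t = shift3 (s + s') t'" by (simp add: shift3_shift3)
  then show ?thesis using t(1,2) unfolding \<K>_def by blast
qed

lemma Ts_in: "t \<in> set Ts \<Longrightarrow> t \<in> \<K>"
proof -
  assume "t \<in> set Ts"
  moreover have "t \<in> set (rotations t)" by (cases t) simp
  moreover have "t = shift3 0 t" by simp
  ultimately show ?thesis unfolding \<K>_def by blast
qed

lemma cyc: "(p, q, r) \<in> \<K> \<Longrightarrow> (q, r, p) \<in> \<K>"
proof -
  assume "(p, q, r) \<in> \<K>"
  then obtain s t' t where t: "t \<in> set Ts" "t' \<in> set (rotations t)" "(p, q, r) = shift3 s t'"
    unfolding \<K>_def by blast
  obtain a b c where abc: "t' = (a, b, c)" by (cases t')
  have "(b, c, a) \<in> set (rotations t)" using t(2) abc by (cases t) auto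
  moreover have "(q, r, p) = shift3 s (b, c, a)" using t(3) abc by simp
  ultimately show ?thesis unfolding \<K>_def using t(1) by blast
qed

lemma \<K>E:
  assumes "t \<in> \<K>"
  obtains s t0 where "t0 \<in> set Ts" "t \<in> shift3 s ` set (rotations t0)"
    "set (corners t) = shift s ` set (corners t0)"
proof -
  obtain s t' t0 where t: "t0 \<in> set Ts" "t' \<in> set (rotations t0)" "t = shift3 s t'"
    using assms unfolding \<K>_def by blast
  moreover have "set (corners t) = shift s ` set (corners t0)"
    using t by (simp add: corners_shift3 corners_rotation)
  ultimately show ?thesis using that by blast
qed

lemma matched: "(p, q, r) \<in> \<K> \<Longrightarrow> \<exists>r'. (q, p, r') \<in> \<K>"
proof -
  assume "(p, q, r) \<in> \<K>"
  then obtain s t' t where t: "t \<in> set Ts" "t' \<in> set (rotations t)" "(p, q, r) = shift3 s t'"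
    unfolding \<K>_def by blast
  obtain a b c where abc: "t' = (a, b, c)" by (cases t')
  have "\<exists>t'\<in>set Ts. \<exists>(q', p', r')\<in>set (rotations t').
           fst q' = fst b \<and> fst p' = fst a \<and>
           fst (snd p') - fst (snd q') = fst (snd a) - fst (snd b) \<and>
           snd (snd p') - snd (snd q') = snd (snd a) - snd (snd b)"
    using matched_list t(1,2) abc unfolding matched_torus_def by fast
  then obtain t2 b' a' c' where t2: "t2 \<in> set Ts" "(b', a', c') \<in> set (rotations t2)"
    "fst b' = fst b" "fst a' = fst a" "snd a' - snd b' = snd a - snd b"
    by (force simp: prod_eq_iff)
  \<comment> \<open>This translation carries \<open>b'\<close> to \<open>q\<close>. Since the offset
    differences along the two edges agree, it also carries \<open>a'\<close> to
    \<open>p\<close>.\<close>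
  define s' where "s' = snd b - snd b' + s"
  have "q = shift s' b'"
    using t(3) abc t2(3) by (intro shift_eqI) (auto simp: s'_def)
  moreover have "p = shift s' a'"
    using t(3) abc t2(4,5) by (intro shift_eqI) (auto simp: s'_def algebra_simps)
  ultimately have "(q, p, shift s' c') = shift3 s' (b', a', c')" by simp
  then show ?thesis using t2(1,2) unfolding \<K>_def by blast
qed

text \<open>A tile never contains two lattice translates of one vertex; this is the source of
  injectivity of the projection on a tile.\<close>

lemma distinct_classes:
  assumes "t \<in> \<K>" "p \<in> set (corners t)" "q \<in> set (corners t)" "fst p = fst q"
  shows "p = q"
proof -
  obtain s t0 where t: "t0 \<in> set Ts" "set (corners t) = shift s ` set (corners t0)"
    using \<K>E[OF assms(1)] by metis
  obtain a b c where abc: "t0 = (a, b, c)" by (cases t0)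
  have "\<forall>(p, q, r)\<in>set (rotations t0). fst p \<noteq> fst q"
    using matched_list t(1) unfolding matched_torus_def by fast
  then have "fst a \<noteq> fst b" "fst b \<noteq> fst c" "fst c \<noteq> fst a" by (auto simp: abc)
  then show ?thesis using assms(2-4) t(2) by (auto simp: abc)
qed

lemma finite_class_tiles: "finite {t \<in> \<K>. fst t = p}"
proof -
  \<comment> \<open>Prescribing the first vertex determines the translation as a difference of
    offsets. The finite set \<open>A\<close> collects these differences for all corners of all
    listed triangles.\<close>
  define A where "A = (\<lambda>(t', q). shift3 (snd p - snd q) t') ` (\<Union>t\<in>set Ts. set (rotations t) \<times> set (corners t))"
  have "finite A" unfolding A_def by auto
  moreover have "{t \<in> \<K>. fst t = p} \<subseteq> A"
  proof
    fix x assume x: "x \<in> {t \<in> \<K>. fst t = p}"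
    then obtain s t' t where t: "t \<in> set Ts" "t' \<in> set (rotations t)" "x = shift3 s t'"
      unfolding \<K>_def by blast
    have "p = shift s (fst t')" using x t(3) by (cases t') auto
    then have "s = snd p - snd (fst t')" by simp
    moreover have "fst t' \<in> set (corners t)" using t(2) by (cases t) auto
    ultimately show "x \<in> A" unfolding A_def using t by force
  qed
  ultimately show ?thesis by (rule finite_subset[rotated])
qed

text \<open>By Cramer's rule the two integers are quotients of signed areas, and a signed area is at
  most the product of the two lengths.\<close>

lemma finite_lat_bounded: "finite {s. norm (lat s) \<le> R}"
proof -
  let ?D = "orient 0 u v"
  define B where "B = \<lceil>R * (norm u + norm v) / ?D\<rceil>"
  have cs: "\<bar>orient 0 a b\<bar> \<le> norm a * norm b" for a b
  proof -
    have "orient 0 a b = Im (cnj a * b)" by (simp add: orient_def)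
    then show ?thesis using abs_Im_le_cmod[of "cnj a * b"] by (simp add: norm_mult)
  qed
  have "{s. norm (lat s) \<le> R} \<subseteq> {-B..B} \<times> {-B..B}"
  proof
    fix s assume "s \<in> {s. norm (lat s) \<le> R}"
    then have R: "norm (lat s) \<le> R" by simp
    have o: "orient 0 (lat s) v = of_int (fst s) * ?D" "orient 0 u (lat s) = of_int (snd s) * ?D"
      by (simp_all add: lat_def orient_def algebra_simps)
    have "R \<ge> 0" using R norm_ge_zero order_trans by blast
    have "\<bar>of_int (fst s) * ?D\<bar> \<le> norm (lat s) * norm v" using cs[of "lat s" v] o(1) by simp
    also have "\<dots> \<le> R * (norm u + norm v)" using R \<open>R \<ge> 0\<close> by (intro mult_mono) auto
    finally have 1: "\<bar>of_int (fst s)\<bar> \<le> R * (norm u + norm v) / ?D"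
      using lattice_pos by (simp add: abs_mult field_simps)
    have "\<bar>of_int (snd s) * ?D\<bar> \<le> norm u * norm (lat s)" using cs[of u "lat s"] o(2) by simp
    also have "\<dots> \<le> (norm u + norm v) * R" using R \<open>R \<ge> 0\<close> by (intro mult_mono) auto
    finally have 2: "\<bar>of_int (snd s)\<bar> \<le> R * (norm u + norm v) / ?D"
      using lattice_pos by (simp add: abs_mult field_simps)
    have "\<bar>k\<bar> \<le> B" if "\<bar>of_int k\<bar> \<le> R * (norm u + norm v) / ?D" for k :: int
    proof -
      have "(of_int \<bar>k\<bar> :: real) \<le> of_int B" using that le_of_int_ceiling[of "R * (norm u + norm v) / ?D"] unfolding B_def by linarith
      then show ?thesis by linarith
    qed
    then have "\<bar>fst s\<bar> \<le> B" "\<bar>snd s\<bar> \<le> B" using 1 2 by blast+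
    then show "s \<in> {-B..B} \<times> {-B..B}" by (cases s) auto
  qed
  then show ?thesis using finite_subset by blast
qed

fun hull3 :: "ltriangle \<Rightarrow> complex set" where
  "hull3 (p, q, r) = convex hull {vp p, vp q, vp r}"

lemma hull3_corners: "hull3 t = convex hull (vp ` set (corners t))"
  by (cases t) simp

lemma hull3_shift3: "hull3 (shift3 s t) = (\<lambda>z. z + lat s) ` hull3 t"
  by (cases t) (simp add: vp_shift convex_hull_translation[symmetric] add.commute[of _ "lat s"])

lemma mem_hull3_shift3: "w \<in> hull3 (shift3 s t) \<longleftrightarrow> w - lat s \<in> hull3 t"
  by (auto simp: hull3_shift3 image_iff intro: bexI[of _ "w - lat s"])

lemma finite_tiles_meeting: "finite {t \<in> \<K>. hull3 t \<inter> cball 0 R \<noteq> {}}"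
proof -
  define T where "T = (\<Union>t\<in>set Ts. set (rotations t))"
  have "finite T" unfolding T_def by simp
  have "bounded (\<Union>t\<in>T. hull3 t)"
    using \<open>finite T\<close> by (intro bounded_UN ballI) (auto simp: hull3_corners intro!: bounded_convex_hull)
  then obtain B where B: "\<And>z. z \<in> (\<Union>t\<in>T. hull3 t) \<Longrightarrow> norm z \<le> B" by (auto simp: bounded_iff)
  have "{t \<in> \<K>. hull3 t \<inter> cball 0 R \<noteq> {}} \<subseteq> (\<lambda>(s, t). shift3 s t) ` ({s. norm (lat s) \<le> R + B} \<times> T)"
  proof
    fix x assume x: "x \<in> {t \<in> \<K>. hull3 t \<inter> cball 0 R \<noteq> {}}"
    then obtain s t where t: "t \<in> T" "x = shift3 s t" unfolding \<K>_def T_def by blast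
    obtain z where z: "z \<in> hull3 t" "norm (z + lat s) \<le> R"
      using x t(2) by (auto simp: hull3_shift3)
    have "norm z \<le> B" using B z(1) t(1) by blast
    then have "norm (lat s) \<le> R + B" using z(2) norm_triangle_ineq4[of "z + lat s" z] by simp
    then show "x \<in> (\<lambda>(s, t). shift3 s t) ` ({s. norm (lat s) \<le> R + B} \<times> T)" using t by force
  qed
  then show ?thesis using \<open>finite T\<close> finite_lat_bounded by (meson finite_SigmaI finite_imageI finite_subset)
qed

end

locale positive_torus_complex = torus_complex +
  assumes oriented: "(p, q, r) \<in> set Ts \<Longrightarrow> orient (vp p) (vp q) (vp r) > 0"
begin

lemma oriented_tile: "(p, q, r) \<in> \<K> \<Longrightarrow> orient (vp p) (vp q) (vp r) > 0"
proof -
  assume "(p, q, r) \<in> \<K>"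
  then obtain s t' t where t: "t \<in> set Ts" "t' \<in> set (rotations t)" "(p, q, r) = shift3 s t'"
    unfolding \<K>_def by blast
  obtain a b c where abc: "t = (a, b, c)" by (cases t)
  have o: "orient (vp a) (vp b) (vp c) > 0" using oriented t(1) abc by blast
  have "t' = (a, b, c) \<or> t' = (b, c, a) \<or> t' = (c, a, b)" using t(2) abc by auto
  then show ?thesis
    using t(3) o orient_cycle[of "vp b" "vp c" "vp a"] orient_cycle[of "vp c" "vp a" "vp b"]
    by (auto simp: vp_shift orient_translate)
qed

sublocale tiling vp \<K>
proof
  show "\<exists>r'. (q, p, r') \<in> \<K>" if "(p, q, r) \<in> \<K>" for p q r using matched that .
  show "finite {(p, q, r) \<in> \<K>. convex hull {vp p, vp q, vp r} \<inter> cball 0 R \<noteq> {}}" for R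
    by (rule finite_subset[OF _ finite_tiles_meeting[of R]]) auto
  have "hd Ts \<in> set Ts" using matched_list by (simp add: matched_torus_def)
  then show "\<K> \<noteq> {}" using Ts_in by blast
  show "(q, r, p) \<in> \<K>" if "(p, q, r) \<in> \<K>" for p q r using cyc that .
  show "orient (vp p) (vp q) (vp r) > 0" if "(p, q, r) \<in> \<K>" for p q r using oriented_tile that .
  show "finite {t \<in> \<K>. fst t = p}" for p by (rule finite_class_tiles)
qed

end

section \<open>Absence of overlaps by comparison of areas\<close>

text \<open>The overlap of \<open>A i\<close> and \<open>A j\<close> is counted twice in the sum and
  once in the union.\<close>

lemma emeasure_UN_Int_le_sum:
  assumes "finite J" "i \<in> J" "j \<in> J" "i \<noteq> j" and A: "\<And>k. k \<in> J \<Longrightarrow> A k \<in> sets M"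
  shows "emeasure M (\<Union>k\<in>J. A k) + emeasure M (A i \<inter> A j) \<le> (\<Sum>k\<in>J. emeasure M (A k))"
proof -
  let ?R = "J - {i, j}"
  have J: "J = insert i (insert j ?R)" using assms by blast
  have "emeasure M (\<Union>k\<in>J. A k) \<le> emeasure M (A i \<union> A j) + emeasure M (\<Union>k\<in>?R. A k)"
  proof -
    have "(\<Union>k\<in>J. A k) = (A i \<union> A j) \<union> (\<Union>k\<in>?R. A k)" using assms by blast
    then show ?thesis using assms by (auto intro!: emeasure_subadditive sets.finite_UN)
  qed
  also have "emeasure M (\<Union>k\<in>?R. A k) \<le> (\<Sum>k\<in>?R. emeasure M (A k))"
    using assms by (intro emeasure_subadditive_finite) auto
  finally have "emeasure M (\<Union>k\<in>J. A k) + emeasure M (A i \<inter> A j) \<le>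
      (emeasure M (A i \<union> A j) + emeasure M (A i \<inter> A j)) + (\<Sum>k\<in>?R. emeasure M (A k))"
    by (simp add: add_mono ac_simps add_left_mono)
  also have "\<dots> = (emeasure M (A i) + emeasure M (A j)) + (\<Sum>k\<in>?R. emeasure M (A k))"
    using emeasure_Un_Int[of "A i" M "A j"] A assms(2,3) by simp
  also have "\<dots> = (\<Sum>k\<in>J. emeasure M (A k))"
    by (subst J) (use assms in \<open>simp add: ac_simps\<close>)
  finally show ?thesis .
qed

text \<open>Each \<open>orient\<close> is twice an area, so the condition says that the listed
  triangles together have the area \<open>orient 0 u v\<close> of the torus.\<close>

locale torus_tiling = positive_torus_complex +
  assumes area: "(\<Sum>t\<leftarrow>Ts. case t of (p, q, r) \<Rightarrow> orient (vp p) (vp q) (vp r)) = 2 * orient 0 u v"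
begin

lemma tile_eq_hull3: "tile t = hull3 t"
  by (cases t) simp

lemma verts_eq_corners: "verts t = set (corners t)"
  by (cases t) auto

lemma borel_hull3 [measurable]: "hull3 t \<in> sets borel"
  using closed_tile[of t] by (simp add: tile_eq_hull3 borel_closed)

lemma emeasure_hull3:
  "t \<in> set Ts \<Longrightarrow> emeasure lborel (hull3 t) = ennreal ((case t of (p, q, r) \<Rightarrow> orient (vp p) (vp q) (vp r)) / 2)"
  using oriented by (cases t) (force simp: emeasure_triangle)

lemma sum_emeasure_hull3: "(\<Sum>t\<in>set Ts. emeasure lborel (hull3 t)) = ennreal (orient 0 u v)"
proof -
  let ?o = "\<lambda>t. case t of (p, q, r) \<Rightarrow> orient (vp p) (vp q) (vp r)"
  have pos: "0 \<le> ?o t" if "t \<in> set Ts" for t using oriented that by (cases t) (force intro: less_imp_le)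
  have "(\<Sum>t\<in>set Ts. emeasure lborel (hull3 t)) = (\<Sum>t\<in>set Ts. ennreal (?o t / 2))"
    by (intro sum.cong emeasure_hull3) auto
  also have "\<dots> = ennreal (\<Sum>t\<in>set Ts. ?o t / 2)"
    using pos by (intro sum_ennreal) simp
  also have "(\<Sum>t\<in>set Ts. ?o t / 2) = (\<Sum>t\<leftarrow>Ts. ?o t) / 2"
    using matched_list by (simp add: matched_torus_def sum_list_distinct_conv_sum_set sum_divide_distrib[symmetric])
  finally show ?thesis using area by simp
qed

text \<open>The translated tiles cover the fundamental parallelogram, and the pieces they cut from
  it have total area at most that of the listed triangles, which is at most that of the
  parallelogram. An overlap of positive measure would make the covering strictly more
  expensive.\<close>

lemma interiors_disjoint:
  assumes K: "t \<in> \<K>" "t' \<in> \<K>" and ne: "interior (tile t) \<inter> interior (tile t') \<noteq> {}"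
  shows "verts t = verts t'"
proof (rule ccontr)
  assume neq: "verts t \<noteq> verts t'"
  obtain s1 t1 where t1: "t1 \<in> set Ts" "set (corners t) = shift s1 ` set (corners t1)" using \<K>E[OF K(1)] by metis
  obtain s2 t2 where t2: "t2 \<in> set Ts" "set (corners t') = shift s2 ` set (corners t2)" using \<K>E[OF K(2)] by metis
  have hull: "tile t = hull3 (shift3 s1 t1)" "tile t' = hull3 (shift3 s2 t2)"
    using t1(2) t2(2) by (simp_all add: tile_eq_hull3 hull3_corners corners_shift3)
  have ne12: "(s1, t1) \<noteq> (s2, t2)" using neq t1(2) t2(2) by (auto simp: verts_eq_corners)
  \<comment> \<open>The piece of the translate by \<open>s\<close> of triangle \<open>t\<close> that
    lies in the fundamental parallelogram.\<close>
  define A where "A = (\<lambda>(s, t). hull3 (shift3 s t) \<inter> fund u v)"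
  have Ab: "A j \<in> sets lborel" for j
    using sets.Int[OF borel_hull3 borel_fund] by (simp add: A_def split_beta)
  let ?O = "interior (tile t) \<inter> interior (tile t')"
  obtain s where s: "emeasure lborel (A (s1 + s, t1) \<inter> A (s2 + s, t2)) > 0"
  proof (rule ccontr)
    assume "\<not> thesis"
    then have z: "emeasure lborel (A (s1 + s, t1) \<inter> A (s2 + s, t2)) = 0" for s
      using that not_gr_zero by blast
    \<comment> \<open>Translating the overlap piecewise into the fundamental parallelogram shows
      that it is covered by countably many sets \<open>F s\<close>. If each were null, the overlap,
      a nonempty open set, would be negligible.\<close>
    define F where "F = (\<lambda>s. (\<lambda>w. - lat s + w) ` (A (s1 + s, t1) \<inter> A (s2 + s, t2)))"
    have F0: "F s \<in> null_sets lborel" for s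
    proof -
      have "A (s1 + s, t1) \<inter> A (s2 + s, t2) \<in> null_sets lborel"
        using z[of s] Ab by (intro null_setsI sets.Int) auto
      moreover have "F s = {x. x - (- lat s) \<in> A (s1 + s, t1) \<inter> A (s2 + s, t2)}"
        unfolding F_def by (auto simp: image_iff algebra_simps intro!: exI[of _ "_ + lat s"] bexI[of _ "_ + lat s"])
      ultimately show ?thesis
        using null_sets_translation[of "A (s1 + s, t1) \<inter> A (s2 + s, t2)" "- lat s"] by (simp only:)
    qed
    have "(\<Union>s. F s) \<in> null_sets lborel" using F0 by (intro null_sets_UN) auto
    moreover have "?O \<subseteq> (\<Union>s. F s)"
    proof
      fix w assume w: "w \<in> ?O"
      obtain s where s: "w + lat s \<in> fund u v"
        using fund_unique[OF lattice_pos, of w] by (auto simp: lat_def)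
      have "w \<in> hull3 (shift3 s1 t1)" "w \<in> hull3 (shift3 s2 t2)"
        using w interior_subset hull by blast+
      then have "w + lat s \<in> A (s1 + s, t1) \<inter> A (s2 + s, t2)"
        using s by (simp add: A_def mem_hull3_shift3 lat_add)
      then have "- lat s + (w + lat s) \<in> F s" unfolding F_def by (rule imageI)
      then have "w \<in> F s" by simp
      then show "w \<in> (\<Union>s. F s)" by blast
    qed
    moreover have "?O \<in> sets lborel" by (simp add: open_Int)
    ultimately have "?O \<in> null_sets lborel"
      using null_sets_subset by blast
    then have "negligible ?O" by (simp add: negligible_iff_null_sets null_sets_completionI)
    then show False using ne open_not_negligible[of ?O] by auto
  qed
  obtain B1 where B1: "\<And>z. z \<in> fund u v \<Longrightarrow> norm z \<le> B1" using bounded_fund[of u v] unfolding bounded_iff by blast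
  have "bounded (\<Union>t\<in>set Ts. hull3 t)"
    by (intro bounded_UN ballI) (auto simp: hull3_corners intro!: bounded_convex_hull)
  then obtain B2 where B2: "\<And>t z. t \<in> set Ts \<Longrightarrow> z \<in> hull3 t \<Longrightarrow> norm z \<le> B2" unfolding bounded_iff by blast
  \<comment> \<open>A translate that meets the parallelogram moves its tile by at most the sum of
    the two radii, which leaves finitely many indices.\<close>
  define J where "J = {s. norm (lat s) \<le> B1 + B2} \<times> set Ts"
  have "finite J" unfolding J_def using finite_lat_bounded by simp
  have J: "(s, t) \<in> J" if ts: "t \<in> set Ts" "A (s, t) \<noteq> {}" for s t
  proof -
    obtain z where z: "z \<in> hull3 t" "z + lat s \<in> fund u v" using ts(2) by (auto simp: A_def hull3_shift3)
    have "norm (lat s) \<le> norm (z + lat s) + norm z" using norm_triangle_ineq4[of "z + lat s" z] by simp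
    then show ?thesis using B1[OF z(2)] B2[OF ts(1) z(1)] ts(1) by (simp add: J_def)
  qed
  have cover: "fund u v \<subseteq> (\<Union>j\<in>J. A j)"
  proof
    fix w assume w: "w \<in> fund u v"
    obtain t where t: "t \<in> \<K>" "w \<in> tile t" using covers by blast
    obtain s t0 where "t0 \<in> set Ts" "set (corners t) = shift s ` set (corners t0)" using \<K>E[OF t(1)] by metis
    then have "t0 \<in> set Ts" "w \<in> A (s, t0)"
      using t(2) w by (simp_all add: A_def tile_eq_hull3 hull3_corners corners_shift3)
    then show "w \<in> (\<Union>j\<in>J. A j)" using J by blast
  qed
  have in_J: "(s1 + s, t1) \<in> J" "(s2 + s, t2) \<in> J"
  proof -
    have "A (s1 + s, t1) \<inter> A (s2 + s, t2) \<noteq> {}" using s by auto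
    then show "(s1 + s, t1) \<in> J" "(s2 + s, t2) \<in> J" using J t1(1) t2(1) by blast+
  qed
  have "emeasure lborel (fund u v) + emeasure lborel (A (s1 + s, t1) \<inter> A (s2 + s, t2)) \<le>
      emeasure lborel (\<Union>j\<in>J. A j) + emeasure lborel (A (s1 + s, t1) \<inter> A (s2 + s, t2))"
    using cover Ab \<open>finite J\<close> by (intro add_right_mono emeasure_mono) auto
  also have "\<dots> \<le> (\<Sum>j\<in>J. emeasure lborel (A j))"
    by (rule emeasure_UN_Int_le_sum[OF \<open>finite J\<close> in_J]) (use ne12 Ab in auto)
  also have "\<dots> = (\<Sum>s\<in>{s. norm (lat s) \<le> B1 + B2}. \<Sum>t\<in>set Ts. emeasure lborel (A (s, t)))"
    unfolding J_def by (simp add: sum.cartesian_product split_beta)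
  also have "\<dots> = (\<Sum>t\<in>set Ts. \<Sum>s\<in>{s. norm (lat s) \<le> B1 + B2}. emeasure lborel (A (s, t)))"
    by (rule sum.swap)
  also have "\<dots> \<le> (\<Sum>t\<in>set Ts. emeasure lborel (hull3 t))"
  proof (rule sum_mono)
    fix t assume "t \<in> set Ts"
    \<comment> \<open>The same piece moved back into \<open>t\<close>. For different
      \<open>s\<close> these are disjoint, since a point has only one translate in the
      parallelogram; hence their areas add up to at most the area of \<open>t\<close>.\<close>
    define G where "G = (\<lambda>s. hull3 t \<inter> (\<lambda>w. w + lat s) -` fund u v)"
    have Gb: "G s \<in> sets lborel" for s unfolding G_def by measurable
    have "emeasure lborel (A (s, t)) = emeasure lborel (G s)" for s
    proof -
      have "G s = (\<lambda>w. w + lat s) -` A (s, t)" by (auto simp: G_def A_def hull3_shift3)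
      moreover have "lborel = distr lborel borel (\<lambda>w. w + lat s)"
      proof -
        have "(\<lambda>w. w + lat s) = (+) (lat s)" by (simp add: fun_eq_iff add.commute)
        then show ?thesis using lborel_distr_plus[of "lat s"] by metis
      qed
      then have "emeasure lborel (A (s, t)) = emeasure lborel ((\<lambda>w. w + lat s) -` A (s, t))"
        using Ab[of "(s, t)"] emeasure_distr[of "\<lambda>w. w + lat s" lborel borel "A (s, t)"] by simp
      ultimately show ?thesis by simp
    qed
    then have "(\<Sum>s\<in>{s. norm (lat s) \<le> B1 + B2}. emeasure lborel (A (s, t))) =
        (\<Sum>s\<in>{s. norm (lat s) \<le> B1 + B2}. emeasure lborel (G s))" by simp
    also have "\<dots> = emeasure lborel (\<Union>s\<in>{s. norm (lat s) \<le> B1 + B2}. G s)"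
    proof (rule sum_emeasure)
      show "G ` {s. norm (lat s) \<le> B1 + B2} \<subseteq> sets lborel" using Gb by blast
      show "finite {s. norm (lat s) \<le> B1 + B2}" by (rule finite_lat_bounded)
      have "s = s'" if "w \<in> G s" "w \<in> G s'" for w s s'
        using that fund_unique[OF lattice_pos, of w] by (auto simp: G_def lat_def)
      then show "disjoint_family_on G {s. norm (lat s) \<le> B1 + B2}"
        by (auto simp: disjoint_family_on_def)
    qed
    also have "\<dots> \<le> emeasure lborel (hull3 t)"
      by (rule emeasure_mono) (auto simp: G_def)
    finally show "(\<Sum>s\<in>{s. norm (lat s) \<le> B1 + B2}. emeasure lborel (A (s, t))) \<le> emeasure lborel (hull3 t)" .
  qed
  also have "\<dots> \<le> emeasure lborel (fund u v)"
    unfolding sum_emeasure_hull3 by (rule emeasure_fund_ge[OF lattice_pos])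
  finally have le: "emeasure lborel (fund u v) + emeasure lborel (A (s1 + s, t1) \<inter> A (s2 + s, t2)) \<le> emeasure lborel (fund u v)" .
  have "emeasure lborel (fund u v) < \<infinity>"
    using bounded_fund by (rule emeasure_bounded_finite)
  moreover have "emeasure lborel (fund u v) + emeasure lborel (A (s1 + s, t1) \<inter> A (s2 + s, t2)) \<le> emeasure lborel (fund u v) + 0"
    using le by simp
  ultimately have "emeasure lborel (A (s1 + s, t1) \<inter> A (s2 + s, t2)) \<le> 0"
    unfolding ennreal_add_left_cancel_le by auto
  then show False using s by simp
qed

sublocale tiling_disjoint vp \<K>
  by unfold_locales (rule interiors_disjoint)

end

section \<open>Barycentric coordinates and piecewise linear maps\<close>

context tiling
begin

text \<open>Barycentric coordinates, continued by zero to all labels so that coordinates in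
  different tiles can be compared as functions.\<close>

fun weight :: "'l \<times> 'l \<times> 'l \<Rightarrow> complex \<Rightarrow> 'l \<Rightarrow> real" where
  "weight (p, q, r) z x = (if x = p then orient (vp q) (vp r) z else if x = q then orient (vp r) (vp p) z
     else if x = r then orient (vp p) (vp q) z else 0) / orient (vp p) (vp q) (vp r)"

lemma distinct_verts:
  assumes "(p, q, r) \<in> \<K>" shows "p \<noteq> q" "q \<noteq> r" "p \<noteq> r"
  using pos[OF assms] by auto

lemma finite_verts [simp]: "finite (verts t)"
  by (cases t) simp

lemma sum_verts:
  assumes "(p, q, r) \<in> \<K>"
  shows "(\<Sum>x\<in>verts (p, q, r). g x) = g p + g q + (g r :: 'b :: comm_monoid_add)"
  using distinct_verts[OF assms] by (simp add: add.assoc)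

lemma weight_outside: "x \<notin> verts t \<Longrightarrow> weight t z x = 0"
  by (cases t) auto

lemma weight_unique:
  assumes t: "t \<in> \<K>" and g: "(\<Sum>x\<in>verts t. g x) = 1" "z = (\<Sum>x\<in>verts t. g x *\<^sub>R vp x)" and x: "x \<in> verts t"
  shows "weight t z x = g x"
proof -
  obtain p q r where pqr: "t = (p, q, r)" by (cases t)
  have K: "(p, q, r) \<in> \<K>" using t pqr by simp
  have s: "g p + g q + g r = 1" and z: "z = g p *\<^sub>R vp p + g q *\<^sub>R vp q + g r *\<^sub>R vp r"
    using g sum_verts[OF K] unfolding pqr by metis+
  have D: "orient (vp p) (vp q) (vp r) > 0" using pos[OF K] .
  have "orient (vp q) (vp r) z = g p * orient (vp p) (vp q) (vp r)"
    "orient (vp r) (vp p) z = g q * orient (vp p) (vp q) (vp r)"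
    "orient (vp p) (vp q) z = g r * orient (vp p) (vp q) (vp r)"
    unfolding z orient_affine[OF s] using orient_cycle[of "vp q" "vp r" "vp p"] orient_cycle[of "vp r" "vp p" "vp q"]
    by simp_all
  then show ?thesis using x D distinct_verts[OF K] unfolding pqr by auto
qed

lemma weight_sum:
  assumes "t \<in> \<K>" shows "(\<Sum>x\<in>verts t. weight t z x) = 1"
proof -
  obtain p q r where pqr: "t = (p, q, r)" by (cases t)
  have K: "(p, q, r) \<in> \<K>" using assms pqr by simp
  show ?thesis unfolding pqr sum_verts[OF K]
    using distinct_verts[OF K] pos[OF K] orient_add[of "vp q" "vp r" z "vp p"]
    by (simp flip: add_divide_distrib)
qed

lemma weight_combination:
  assumes "t \<in> \<K>" shows "(\<Sum>x\<in>verts t. weight t z x *\<^sub>R vp x) = z"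
proof -
  obtain p q r where pqr: "t = (p, q, r)" by (cases t)
  have K: "(p, q, r) \<in> \<K>" using assms pqr by simp
  let ?D = "orient (vp p) (vp q) (vp r)"
  have "(\<Sum>x\<in>verts t. weight t z x *\<^sub>R vp x) = (1 / ?D) *\<^sub>R (?D *\<^sub>R z)"
    unfolding pqr sum_verts[OF K] unfolding orient_barycentric[of "vp p" "vp q" "vp r" z]
    using distinct_verts[OF K] by (simp add: scaleR_add_right)
  then show ?thesis using pos[OF K] by simp
qed

lemma weight_nonneg:
  assumes "t \<in> \<K>" "z \<in> tile t" shows "0 \<le> weight t z x"
proof -
  obtain p q r where pqr: "t = (p, q, r)" by (cases t)
  have K: "(p, q, r) \<in> \<K>" using assms pqr by simp
  have "z \<in> tile (p, q, r)" using assms(2) pqr by simp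
  then have "0 \<le> orient (vp p) (vp q) z \<and> 0 \<le> orient (vp q) (vp r) z \<and> 0 \<le> orient (vp r) (vp p) z"
    using mem_tile[OF K] by blast
  then show ?thesis unfolding pqr using pos[OF K] by simp
qed

lemma continuous_on_weight: "continuous_on S (\<lambda>z. weight t z x)"
proof (cases t)
  case (fields p q r)
  have "continuous_on S (\<lambda>z. (if x = p then orient (vp q) (vp r) z else if x = q then orient (vp r) (vp p) z
     else if x = r then orient (vp p) (vp q) z else 0) * inverse (orient (vp p) (vp q) (vp r)))"
    by (intro continuous_on_mult continuous_on_const)
      (cases "x = p"; cases "x = q"; cases "x = r"; simp add: continuous_on_orient)
  then show ?thesis unfolding fields weight.simps divide_inverse .
qed

end

context tiling_disjoint
begin

text \<open>Each of the three cases is \<open>carrier_vertex\<close> for one rotation of the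
  triple.\<close>

lemma weight_pos_common:
  assumes "t \<in> \<K>" "z \<in> tile t" "weight t z x > 0" "t' \<in> \<K>" "z \<in> tile t'"
  shows "x \<in> verts t'"
proof -
  obtain p q r where pqr: "t = (p, q, r)" by (cases t)
  have K: "(p, q, r) \<in> \<K>" "(q, r, p) \<in> \<K>" "(r, p, q) \<in> \<K>" using assms(1) pqr cyc cyc' by blast+
  have z: "z \<in> tile (p, q, r)" "z \<in> tile (q, r, p)" "z \<in> tile (r, p, q)"
    using assms(2) pqr tile_rotate[of q r p] tile_rotate[of p q r] by simp_all
  have D: "orient (vp p) (vp q) (vp r) > 0" using pos[OF K(1)] .
  have x: "x \<in> verts t" using weight_outside[of x t z] assms(3) by (cases "x \<in> verts t") simp_all
  then have "x = p \<or> x = q \<or> x = r" by (simp add: pqr)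
  then show ?thesis
  proof (elim disjE)
    assume "x = p"
    then have "orient (vp q) (vp r) z > 0" using assms(3) D by (simp add: pqr zero_less_divide_iff)
    then show ?thesis using carrier_vertex[OF K(1) z(1) _ assms(4,5)] \<open>x = p\<close> by simp
  next
    assume "x = q"
    then have "orient (vp r) (vp p) z > 0" using assms(3) D distinct_verts[OF K(1)] by (simp add: pqr zero_less_divide_iff)
    then show ?thesis using carrier_vertex[OF K(2) z(2) _ assms(4,5)] \<open>x = q\<close> by simp
  next
    assume "x = r"
    then have "orient (vp p) (vp q) z > 0" using assms(3) D distinct_verts[OF K(1)] by (simp add: pqr zero_less_divide_iff)
    then show ?thesis using carrier_vertex[OF K(3) z(3) _ assms(4,5)] \<open>x = r\<close> by simp
  qed
qed

text \<open>Weights outside the common vertices vanish. The function \<open>h\<close> serves for the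
  sum of the weights, for the position of the point and for the value of the interpolated map
  alike.\<close>

lemma sum_weight_restrict:
  assumes "t \<in> \<K>" "z \<in> tile t" "t' \<in> \<K>" "z \<in> tile t'" and h0: "\<And>x. h x 0 = (0 :: 'b :: comm_monoid_add)"
  shows "(\<Sum>x\<in>verts t'. h x (weight t z x)) = (\<Sum>x\<in>verts t. h x (weight t z x))"
proof -
  have "weight t z x = 0" if "x \<in> verts t - verts t' \<or> x \<in> verts t' - verts t" for x
    using that weight_pos_common[OF assms(1,2) _ assms(3,4), of x] weight_nonneg[OF assms(1,2), of x]
      weight_outside[of x t z] by force
  then have "(\<Sum>x\<in>verts t'. h x (weight t z x)) = (\<Sum>x\<in>verts t \<inter> verts t'. h x (weight t z x))"
    "(\<Sum>x\<in>verts t. h x (weight t z x)) = (\<Sum>x\<in>verts t \<inter> verts t'. h x (weight t z x))"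
    using h0 by (intro sum.mono_neutral_right; force)+
  then show ?thesis by simp
qed

lemma weight_agree:
  assumes "t \<in> \<K>" "z \<in> tile t" "t' \<in> \<K>" "z \<in> tile t'"
  shows "weight t z = weight t' z"
proof
  fix x
  show "weight t z x = weight t' z x"
  proof (cases "x \<in> verts t'")
    case True
    have "(\<Sum>x\<in>verts t'. weight t z x) = 1"
      using sum_weight_restrict[OF assms, of "\<lambda>_ y. y"] weight_sum[OF assms(1)] by simp
    moreover have "z = (\<Sum>x\<in>verts t'. weight t z x *\<^sub>R vp x)"
      using sum_weight_restrict[OF assms, of "\<lambda>x y. y *\<^sub>R vp x"] weight_combination[OF assms(1)] by simp
    ultimately show ?thesis using weight_unique[OF assms(3) _ _ True] by metis
  next
    case False
    then have "\<not> weight t z x > 0" using weight_pos_common[OF assms(1,2) _ assms(3,4)] by blast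
    then show ?thesis using weight_nonneg[OF assms(1,2), of x] weight_outside[OF False] by simp
  qed
qed

text \<open>The piecewise linear interpolation of \<open>f\<close>; by \<open>weight_agree\<close>
  the tile that is chosen does not affect the value.\<close>

definition pl :: "('l \<Rightarrow> 'b :: real_vector) \<Rightarrow> complex \<Rightarrow> 'b" where
  "pl f z = (let t = (SOME t. t \<in> \<K> \<and> z \<in> tile t) in \<Sum>x\<in>verts t. weight t z x *\<^sub>R f x)"

lemma pl_eq:
  assumes "t \<in> \<K>" "z \<in> tile t"
  shows "pl f z = (\<Sum>x\<in>verts t. weight t z x *\<^sub>R f x)"
proof -
  define t' where "t' = (SOME t. t \<in> \<K> \<and> z \<in> tile t)"
  have t': "t' \<in> \<K>" "z \<in> tile t'"
    using someI[of "\<lambda>t. t \<in> \<K> \<and> z \<in> tile t" t] assms unfolding t'_def by blast+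
  have "pl f z = (\<Sum>x\<in>verts t'. weight t' z x *\<^sub>R f x)" by (simp add: pl_def t'_def Let_def)
  also have "\<dots> = (\<Sum>x\<in>verts t'. weight t z x *\<^sub>R f x)" using weight_agree[OF t' assms] by simp
  also have "\<dots> = (\<Sum>x\<in>verts t. weight t z x *\<^sub>R f x)"
    using sum_weight_restrict[OF assms t', of "\<lambda>x y. y *\<^sub>R f x"] by simp
  finally show ?thesis .
qed

lemma pl_combination:
  assumes t: "t \<in> \<K>" and g: "\<And>x. x \<in> verts t \<Longrightarrow> 0 \<le> g x" "(\<Sum>x\<in>verts t. g x) = 1"
  shows "pl f (\<Sum>x\<in>verts t. g x *\<^sub>R vp x) = (\<Sum>x\<in>verts t. g x *\<^sub>R f x)"
proof -
  define z where "z = (\<Sum>x\<in>verts t. g x *\<^sub>R vp x)"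
  have hull: "tile t = convex hull (vp ` verts t)" by (cases t) simp
  have "z \<in> tile t" unfolding z_def hull
    by (rule convex_sum) (use g in \<open>auto intro: hull_inc\<close>)
  then show ?thesis unfolding z_def[symmetric]
    using pl_eq[OF t] weight_unique[OF t g(2) z_def] by (metis (no_types, lifting) sum.cong)
qed

lemma continuous_on_pl:
  fixes f :: "'l \<Rightarrow> 'b :: real_normed_vector"
  shows "continuous_on UNIV (pl f)"
proof -
  have tile: "continuous_on (tile t) (pl f)" if "t \<in> \<K>" for t
  proof -
    have "continuous_on (tile t) (\<lambda>z. \<Sum>x\<in>verts t. weight t z x *\<^sub>R f x)"
      by (intro continuous_intros continuous_on_weight)
    then show ?thesis
      by (rule continuous_on_eq) (simp add: pl_eq[OF that])
  qed
  \<comment> \<open>Only finitely many closed tiles meet a ball, so the pieces can be glued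
    there.\<close>
  have "continuous_on (ball 0 R) (pl f)" for R
  proof -
    let ?F = "{t \<in> \<K>. tile t \<inter> cball 0 R \<noteq> {}}"
    have "continuous_on (\<Union>t\<in>?F. tile t) (pl f)"
      by (rule continuous_on_closed_Union[OF tiles_meeting_finite]) (use tile closed_tile in auto)
    moreover have "ball 0 R \<subseteq> (\<Union>t\<in>?F. tile t)"
    proof
      fix z :: complex assume "z \<in> ball 0 R"
      then have "z \<in> cball 0 R" by simp
      moreover obtain t where "t \<in> \<K>" "z \<in> tile t" using covers by blast
      ultimately show "z \<in> (\<Union>t\<in>?F. tile t)" by blast
    qed
    ultimately show ?thesis by (rule continuous_on_subset)
  qed
  then have "isCont (pl f) z" for z
    using continuous_on_interior[of "ball 0 (norm z + 1)" "pl f" z] by simp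
  then show ?thesis by (simp add: continuous_at_imp_continuous_on)
qed

end

text \<open>Congruence by three sides: the side lengths determine the inner product of the two edge
  vectors at \<open>a\<close>, and the linear map sending edge vectors to edge vectors then
  preserves all norms. The conclusion speaks of affine combinations because these are the values of
  the interpolated map.\<close>

lemma isometry_from_triangle:
  fixes a b c :: complex and A B C :: "real^3"
  assumes o: "orient a b c \<noteq> 0"
    and d: "dist A B = dist a b" "dist B C = dist b c" "dist A C = dist a c"
  shows "\<exists>L w. linear L \<and> (\<forall>z. norm (L z) = norm z) \<and>
    (\<forall>x y z. x + y + z = 1 \<longrightarrow> x *\<^sub>R A + y *\<^sub>R B + z *\<^sub>R C = L (x *\<^sub>R a + y *\<^sub>R b + z *\<^sub>R c) + w)"
proof -
  define e f where "e = b - a" and "f = c - a"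
  define E F where "E = B - A" and "F = C - A"
  define D where "D = orient 0 e f"
  have D: "D \<noteq> 0" using o by (simp add: D_def e_def f_def orient_def)
  have n: "E \<bullet> E = e \<bullet> e" "F \<bullet> F = f \<bullet> f" "(F - E) \<bullet> (F - E) = (f - e) \<bullet> (f - e)"
  proof -
    have "norm E = norm e" "norm F = norm f" "norm (F - E) = norm (f - e)"
      using d by (simp_all add: e_def f_def E_def F_def dist_norm norm_minus_commute)
    then show "E \<bullet> E = e \<bullet> e" "F \<bullet> F = f \<bullet> f" "(F - E) \<bullet> (F - E) = (f - e) \<bullet> (f - e)"
      by (simp_all add: dot_square_norm)
  qed
  then have EF: "E \<bullet> F = e \<bullet> f" by (simp add: inner_diff_left inner_diff_right inner_commute)
  define L where "L = (\<lambda>z. (orient 0 z f / D) *\<^sub>R E + (orient 0 e z / D) *\<^sub>R F)"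
  have "linear L"
    by (rule linearI) (simp_all add: L_def orient_def algebra_simps add_divide_distrib diff_divide_distrib)
  have Lc: "L (s *\<^sub>R e + t *\<^sub>R f) = s *\<^sub>R E + t *\<^sub>R F" for s t
  proof -
    have "orient 0 (s *\<^sub>R e + t *\<^sub>R f) f = s * D" "orient 0 e (s *\<^sub>R e + t *\<^sub>R f) = t * D"
      by (simp_all add: D_def orient_def algebra_simps)
    then show ?thesis using D by (simp add: L_def)
  qed
  have "norm (L z) = norm z" for z
  proof -
    define s t where "s = orient 0 z f / D" and "t = orient 0 e z / D"
    have "z = (1 / D) *\<^sub>R (D *\<^sub>R z)" using D by simp
    also have "D *\<^sub>R z = orient 0 z f *\<^sub>R e + orient 0 e z *\<^sub>R f"
      unfolding D_def by (rule orient_coords)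
    finally have z: "z = s *\<^sub>R e + t *\<^sub>R f" by (simp add: s_def t_def scaleR_add_right)
    have "L z \<bullet> L z = z \<bullet> z"
      unfolding z Lc using n(1,2) EF by (simp add: inner_add_left inner_add_right inner_commute)
    then show ?thesis by (simp add: norm_eq_sqrt_inner)
  qed
  moreover have "x *\<^sub>R A + y *\<^sub>R B + z *\<^sub>R C = L (x *\<^sub>R a + y *\<^sub>R b + z *\<^sub>R c) + (A - L a)" if "x + y + z = 1" for x y z
  proof -
    have x: "x = 1 - y - z" using that by simp
    have "x *\<^sub>R a + y *\<^sub>R b + z *\<^sub>R c = a + (y *\<^sub>R e + z *\<^sub>R f)"
      unfolding x by (simp add: e_def f_def algebra_simps)
    then have "L (x *\<^sub>R a + y *\<^sub>R b + z *\<^sub>R c) = L a + (y *\<^sub>R E + z *\<^sub>R F)"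
      using linear_add[OF \<open>linear L\<close>] Lc by simp
    then show ?thesis unfolding x by (simp add: E_def F_def algebra_simps)
  qed
  ultimately show ?thesis using \<open>linear L\<close> by blast
qed

section \<open>From tiles of the plane to a triangulation of the torus\<close>

context torus_tiling
begin

abbreviation "\<Lambda> \<equiv> lattice_span u v"

lemma lattice_eq: "\<Lambda> = range lat"
  unfolding lattice_span_def lat_def image_def by (simp add: split_paired_Ex)

lemma planar_lattice: "planar_lattice \<Lambda>"
proof -
  have "\<not> affine_dependent (insert 0 {u, v})"
    using affine_independent_orient[of 0 u v] lattice_pos by simp
  moreover have "0 \<notin> {u, v}" using lattice_pos by (auto simp: orient_def)
  ultimately have "independent {u, v}"
    using affine_dependent_iff_dependent[of 0 "{u, v}"] by simp
  moreover have "u \<noteq> v" using lattice_pos by (auto simp: orient_def)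
  ultimately show ?thesis unfolding planar_lattice_def by blast
qed

lemma proj_shift: "torus_proj \<Lambda> (z + lat s) = torus_proj \<Lambda> z"
proof -
  have "\<exists>s'. z + lat s + lat s1 = z + lat s'" "\<exists>s'. z + lat s1 = z + lat s + lat s'" for s1
    using lat_add[of s s1] lat_add[of s "s1 - s"] by (metis add.assoc, metis add.assoc diff_add_cancel add.commute)
  then show ?thesis unfolding torus_proj_def lattice_eq by (auto simp: image_iff)
qed

lemma proj_eqD: assumes "torus_proj \<Lambda> z = torus_proj \<Lambda> w" obtains s where "w = z + lat s"
proof -
  have "w \<in> torus_proj \<Lambda> w"
    unfolding torus_proj_def lattice_eq by (auto simp: image_iff intro!: exI[of _ 0] exI[of _ "0 :: int"])
  then have "w \<in> torus_proj \<Lambda> z" using assms by simp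
  then show ?thesis using that unfolding torus_proj_def lattice_eq by auto
qed

lemma inj_shift: "inj (shift s)"
proof
  fix x y assume "shift s x = shift s y"
  then have "shift (- s) (shift s x) = shift (- s) (shift s y)" by simp
  then show "x = y" by (simp add: shift_shift)
qed

lemma verts_shift3: "verts (shift3 s t) = shift s ` verts t"
  by (simp add: verts_eq_corners corners_shift3)

lemma tile_shift3: "w \<in> tile (shift3 s t) \<longleftrightarrow> w - lat s \<in> tile t"
  by (simp add: tile_eq_hull3 mem_hull3_shift3)

lemma tile_eq_hull_verts: "tile t = convex hull (vp ` verts t)"
  by (simp add: tile_eq_hull3 hull3_corners verts_eq_corners)

lemma weight_zero_face:
  assumes t: "t \<in> \<K>" and S: "S \<subseteq> verts t" "z \<in> convex hull (vp ` S)" and y: "y \<in> verts t - S"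
  shows "weight t z y = 0"
proof -
  have "finite S" using S(1) finite_verts finite_subset by blast
  have inj: "inj_on vp (verts t)"
  proof -
    obtain p q r where "t = (p, q, r)" by (cases t)
    then show ?thesis using oriented_tile[of p q r] t by (auto simp: inj_on_def)
  qed
  then have injS: "inj_on vp S" using S(1) inj_on_subset by blast
  obtain g where g: "\<forall>x\<in>vp ` S. 0 \<le> g x" "sum g (vp ` S) = 1" "(\<Sum>x\<in>vp ` S. g x *\<^sub>R x) = z"
    using S(2) \<open>finite S\<close> by (auto simp: convex_hull_finite)
  define h where "h = (\<lambda>x. if x \<in> S then g (vp x) else 0)"
  have "(\<Sum>x\<in>verts t. h x) = (\<Sum>x\<in>S. h x)"
    by (rule sum.mono_neutral_right[OF finite_verts S(1)]) (simp add: h_def)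
  moreover have "(\<Sum>x\<in>verts t. h x *\<^sub>R vp x) = (\<Sum>x\<in>S. h x *\<^sub>R vp x)"
    by (rule sum.mono_neutral_right[OF finite_verts S(1)]) (simp add: h_def)
  moreover have "(\<Sum>x\<in>S. h x) = 1" "(\<Sum>x\<in>S. h x *\<^sub>R vp x) = z"
    using g(2,3) by (simp_all add: h_def sum.reindex[OF injS])
  ultimately have "weight t z y = h y"
    using weight_unique[OF t, of h z y] y by simp
  then show ?thesis using y by (simp add: h_def)
qed

lemma face_of_weights:
  assumes t: "t \<in> \<K>" "z \<in> tile t" and S: "\<And>x. weight t z x > 0 \<Longrightarrow> x \<in> S" "S \<subseteq> verts t"
  shows "z \<in> convex hull (vp ` S)"
proof -
  have zero: "weight t z x = 0" if "x \<in> verts t - S" for x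
    using that S(1)[of x] weight_nonneg[OF t, of x] by force
  have "finite S" using S(2) finite_verts finite_subset by blast
  have "(\<Sum>x\<in>S. weight t z x) = 1" "(\<Sum>x\<in>S. weight t z x *\<^sub>R vp x) = z"
    using weight_sum[OF t(1), of z] weight_combination[OF t(1), of z] zero S(2)
    by (simp_all add: sum.mono_neutral_left[OF finite_verts S(2)])
  moreover have "(\<Sum>x\<in>S. weight t z x *\<^sub>R vp x) \<in> convex hull (vp ` S)"
    by (rule convex_sum) (use \<open>finite S\<close> calculation(1) weight_nonneg[OF t] in \<open>auto intro: hull_inc\<close>)
  ultimately show ?thesis by simp
qed

lemma weight_vertex:
  assumes "t \<in> \<K>" "x \<in> verts t" shows "weight t (vp x) y = (if y = x then 1 else 0)"
proof (cases "y \<in> verts t")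
  case True
  have "(\<Sum>y\<in>verts t. if y = x then 1 else 0 :: real) = 1" using assms(2) by simp
  moreover have "vp x = (\<Sum>y\<in>verts t. (if y = x then 1 else 0 :: real) *\<^sub>R vp y)"
  proof -
    have "(\<Sum>y\<in>verts t. (if y = x then 1 else 0 :: real) *\<^sub>R vp y) = (\<Sum>y\<in>verts t. if y = x then vp y else 0)"
      by (intro sum.cong) auto
    then show ?thesis using assms(2) by simp
  qed
  ultimately show ?thesis by (rule weight_unique[OF assms(1) _ _ True])
next
  case False
  then show ?thesis using weight_outside[OF False] assms(2) by auto
qed

lemma affine_independent_tile:
  assumes "t \<in> \<K>" shows "\<not> affine_dependent (vp ` verts t)" "card (vp ` verts t) = 3"
proof -
  obtain p q r where pqr: "t = (p, q, r)" by (cases t)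
  have "orient (vp p) (vp q) (vp r) > 0" using oriented_tile[of p q r] assms pqr by simp
  then show "\<not> affine_dependent (vp ` verts t)" "card (vp ` verts t) = 3"
    using affine_independent_orient[of "vp p" "vp q" "vp r"] by (auto simp: pqr card_insert_if)
qed

text \<open>If \<open>z\<close> and \<open>z + lat s\<close> lie in one tile, a vertex with positive
  weight at the latter point belongs to the tile and to its translate by \<open>s\<close>. It is
  therefore the translate of a vertex of the same class in the same tile, hence of itself, and
  \<open>s\<close> is zero.\<close>

lemma inj_on_proj: assumes t: "t \<in> \<K>" shows "inj_on (torus_proj \<Lambda>) (tile t)"
proof
  fix z z' assume z: "z \<in> tile t" "z' \<in> tile t" "torus_proj \<Lambda> z = torus_proj \<Lambda> z'"
  obtain s where s: "z' = z + lat s" using proj_eqD[OF z(3)] .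
  have t': "shift3 s t \<in> \<K>" "z' \<in> tile (shift3 s t)" using shift3_in[OF t] z(1) s by (simp_all add: tile_shift3)
  have "\<exists>x\<in>verts t. weight t z' x > 0"
  proof (rule ccontr)
    assume "\<not> ?thesis"
    then have "(\<Sum>x\<in>verts t. weight t z' x) \<le> 0" by (intro sum_nonpos) (auto simp: not_less)
    then show False using weight_sum[OF t, of z'] by simp
  qed
  then obtain x where x: "x \<in> verts t" "weight t z' x > 0" by blast
  then have "x \<in> shift s ` verts t" using weight_pos_common[OF t z(2) x(2) t'] by (simp add: verts_shift3)
  then obtain y where y: "y \<in> verts t" "x = shift s y" by blast
  then have "x = y" using distinct_classes[OF t, of x y] x(1) by (simp add: verts_eq_corners)
  then have "snd y = snd y + s" using y(2) by (metis snd_shift)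
  then have "s = (0, 0)" by (simp add: zero_prod_def)
  then show "z = z'" using s by simp
qed

end

locale simplicial_tiling = torus_tiling +
  assumes simplicial: "simplicial_torus N Ts"
begin

lemma distinct_triangles:
  assumes "t \<in> set Ts" "t' \<in> set Ts" "t \<noteq> t'"
  shows "\<not> fst ` set (corners t) \<subseteq> fst ` set (corners t')"
    and "\<forall>p\<in>set (corners t). \<forall>q\<in>set (corners t). \<forall>p'\<in>set (corners t'). \<forall>q'\<in>set (corners t').
           fst p = fst p' \<longrightarrow> fst q = fst q' \<longrightarrow>
           fst (snd p') - fst (snd q') = fst (snd p) - fst (snd q) \<and>
           snd (snd p') - snd (snd q') = snd (snd p) - snd (snd q)"
proof -
  have "\<forall>t\<in>set Ts. \<forall>t'\<in>set Ts. t \<noteq> t' \<longrightarrow>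
        \<not> fst ` set (corners t) \<subseteq> fst ` set (corners t') \<and>
        (\<forall>p\<in>set (corners t). \<forall>q\<in>set (corners t). \<forall>p'\<in>set (corners t'). \<forall>q'\<in>set (corners t').
           fst p = fst p' \<longrightarrow> fst q = fst q' \<longrightarrow>
           fst (snd p') - fst (snd q') = fst (snd p) - fst (snd q) \<and>
           snd (snd p') - snd (snd q') = snd (snd p) - snd (snd q))"
    by (rule simplicial[unfolded simplicial_torus_def, THEN conjunct2])
  note * = mp[OF bspec[OF bspec[OF this assms(1)] assms(2)] assms(3)]
  show "\<not> fst ` set (corners t) \<subseteq> fst ` set (corners t')" by (rule conjunct1[OF *])
  show "\<forall>p\<in>set (corners t). \<forall>q\<in>set (corners t). \<forall>p'\<in>set (corners t'). \<forall>q'\<in>set (corners t').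
           fst p = fst p' \<longrightarrow> fst q = fst q' \<longrightarrow>
           fst (snd p') - fst (snd q') = fst (snd p) - fst (snd q) \<and>
           snd (snd p') - snd (snd q') = snd (snd p) - snd (snd q)" by (rule conjunct2[OF *])
qed

text \<open>One translation serves all common classes at once. For equal triangles it is zero, and
  for triangles without common classes any will do.\<close>

lemma common_shift:
  assumes "t \<in> set Ts" "t' \<in> set Ts"
  obtains s where "\<And>p p'. p \<in> verts t \<Longrightarrow> p' \<in> verts t' \<Longrightarrow> fst p = fst p' \<Longrightarrow> p' = shift s p"
proof (cases "t = t'")
  case True
  then show ?thesis using that[of 0] distinct_classes[OF Ts_in[OF assms(1)]] by (auto simp: verts_eq_corners)
next
  case False
  show ?thesis
  proof (cases "\<exists>p0\<in>verts t. \<exists>p0'\<in>verts t'. fst p0 = fst p0'")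
    case True
    then obtain p0 p0' where p0: "p0 \<in> verts t" "p0' \<in> verts t'" "fst p0 = fst p0'" by blast
    note * = distinct_triangles(2)[OF assms False]
    have "p' = shift (snd p0' - snd p0) p" if p: "p \<in> verts t" "p' \<in> verts t'" "fst p = fst p'" for p p'
    proof (rule shift_eqI[OF p(3)])
      have "fst (snd p') - fst (snd p0') = fst (snd p) - fst (snd p0) \<and>
        snd (snd p') - snd (snd p0') = snd (snd p) - snd (snd p0)"
        using * p p0 unfolding verts_eq_corners by blast
      then show "snd p' = snd p + (snd p0' - snd p0)" by (simp add: prod_eq_iff)
    qed
    then show ?thesis using that by blast
  next
    case False
    then show ?thesis using that by blast
  qed
qed

text \<open>The face is formed inside the lift \<open>t\<close>; \<open>common_face t' t\<close> is
  the corresponding face of the other lift.\<close>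

definition common_face :: "ltriangle \<Rightarrow> ltriangle \<Rightarrow> lvertex set" where
  "common_face t t' = {x \<in> verts t. fst x \<in> fst ` verts t'}"

text \<open>A point common to both images has its positive weights at vertices of common classes.
  Conversely \<open>common_shift\<close> translates the whole face of \<open>t\<close> into
  \<open>t'\<close> at once.\<close>

lemma proj_Int:
  assumes T: "t \<in> set Ts" "t' \<in> set Ts"
  shows "torus_proj \<Lambda> ` tile t \<inter> torus_proj \<Lambda> ` tile t' = torus_proj \<Lambda> ` (convex hull (vp ` common_face t t'))"
proof (intro equalityI subsetI)
  fix X assume "X \<in> torus_proj \<Lambda> ` tile t \<inter> torus_proj \<Lambda> ` tile t'"
  then obtain z z' where z: "z \<in> tile t" "X = torus_proj \<Lambda> z" "z' \<in> tile t'" "torus_proj \<Lambda> z' = torus_proj \<Lambda> z" by auto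
  obtain s where s: "z = z' + lat s" using proj_eqD[OF z(4)] .
  have t': "shift3 s t' \<in> \<K>" "z \<in> tile (shift3 s t')"
    using shift3_in[OF Ts_in[OF T(2)]] z(3) s by (simp_all add: tile_shift3)
  have "x \<in> common_face t t'" if "weight t z x > 0" for x
  proof -
    have "x \<in> verts t" using that weight_outside[of x t z] by (cases "x \<in> verts t") simp_all
    moreover have "x \<in> shift s ` verts t'"
      using weight_pos_common[OF Ts_in[OF T(1)] z(1) that t'] by (simp add: verts_shift3)
    then obtain y where "y \<in> verts t'" "fst x = fst y" using fst_shift by blast
    ultimately show ?thesis unfolding common_face_def by blast
  qed
  then have "z \<in> convex hull (vp ` common_face t t')"
    by (rule face_of_weights[OF Ts_in[OF T(1)] z(1)]) (auto simp: common_face_def)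
  then show "X \<in> torus_proj \<Lambda> ` (convex hull (vp ` common_face t t'))" using z(2) by blast
next
  fix X assume "X \<in> torus_proj \<Lambda> ` (convex hull (vp ` common_face t t'))"
  then obtain z where z: "z \<in> convex hull (vp ` common_face t t')" "X = torus_proj \<Lambda> z" by blast
  obtain s where s: "\<And>p p'. p \<in> verts t \<Longrightarrow> p' \<in> verts t' \<Longrightarrow> fst p = fst p' \<Longrightarrow> p' = shift s p"
    using common_shift[OF T] by blast
  have "vp ` common_face t t' \<subseteq> vp ` verts t" by (auto simp: common_face_def)
  then have "z \<in> tile t" using z(1) hull_mono unfolding tile_eq_hull_verts by blast
  moreover have "z + lat s \<in> tile t'"
  proof -
    have "z + lat s \<in> (\<lambda>w. lat s + w) ` (convex hull (vp ` common_face t t'))" using z(1) by (auto simp: add.commute)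
    also have "\<dots> = convex hull ((\<lambda>w. lat s + w) ` vp ` common_face t t')" by (rule convex_hull_translation[symmetric])
    also have "\<dots> \<subseteq> convex hull (vp ` verts t')"
    proof (rule hull_mono, safe)
      fix x y z assume x: "(x, y, z) \<in> common_face t t'"
      then obtain p' where p': "p' \<in> verts t'" "fst (x, y, z) = fst p'" by (auto simp: common_face_def)
      then have "p' = shift s (x, y, z)" using s x by (simp add: common_face_def)
      then have "lat s + vp (x, y, z) = vp p'" by (simp only: vp_shift add.commute)
      then show "lat s + vp (x, y, z) \<in> vp ` verts t'" using p'(1) by simp
    qed
    finally show ?thesis unfolding tile_eq_hull_verts .
  qed
  ultimately show "X \<in> torus_proj \<Lambda> ` tile t \<inter> torus_proj \<Lambda> ` tile t'"
    using z(2) proj_shift[of z s] by (metis IntI imageI)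
qed

lemma common_face_proper:
  assumes T: "t \<in> set Ts" "t' \<in> set Ts" "t \<noteq> t'"
  shows "(convex hull (vp ` common_face t t')) face_of tile t" "convex hull (vp ` common_face t t') \<noteq> tile t"
proof -
  have K: "t \<in> \<K>" using Ts_in T(1) .
  have sub: "common_face t t' \<subseteq> verts t" by (auto simp: common_face_def)
  then show "(convex hull (vp ` common_face t t')) face_of tile t"
    unfolding tile_eq_hull_verts face_of_convex_hull_affine_independent[OF affine_independent_tile(1)[OF K]] by blast
  have "\<not> fst ` verts t \<subseteq> fst ` verts t'"
    using distinct_triangles(1)[OF T] by (simp add: verts_eq_corners)
  then obtain x where x: "x \<in> verts t" "x \<notin> common_face t t'" by (auto simp: common_face_def)
  then have "vp x \<notin> convex hull (vp ` common_face t t')"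
    using weight_zero_face[OF K sub, of "vp x" x] weight_vertex[OF K x(1), of x] by auto
  moreover have "vp x \<in> tile t" using x(1) by (auto simp: tile_eq_hull_verts intro: hull_inc)
  ultimately show "convex hull (vp ` common_face t t') \<noteq> tile t" by blast
qed

theorem triangulation: "torus_triangulation \<Lambda> (tile ` set Ts)"
  unfolding torus_triangulation_def
proof (intro conjI ballI impI)
  show "2 simplex K" if "K \<in> tile ` set Ts" for K
  proof -
    obtain t where t: "t \<in> \<K>" "K = tile t" using \<open>K \<in> tile ` set Ts\<close> Ts_in by blast
    show ?thesis unfolding simplex_def t(2) tile_eq_hull_verts
      using affine_independent_tile[OF t(1)] by (intro exI[of _ "vp ` verts t"]) simp
  qed
  show "inj_on (torus_proj \<Lambda>) K" if "K \<in> tile ` set Ts" for K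
    using that inj_on_proj Ts_in by blast
  show "(\<Union>K\<in>tile ` set Ts. torus_proj \<Lambda> ` K) = flat_torus \<Lambda>"
  proof (intro equalityI subsetI)
    fix X assume "X \<in> flat_torus \<Lambda>"
    then obtain z where z: "X = torus_proj \<Lambda> z" by (auto simp: flat_torus_def)
    obtain t where t: "t \<in> \<K>" "z \<in> tile t" using covers by blast
    obtain s t0 where t0: "t0 \<in> set Ts" "set (corners t) = shift s ` set (corners t0)" using \<K>E[OF t(1)] by metis
    then have "tile t = tile (shift3 s t0)" by (simp add: tile_eq_hull_verts corners_shift3 verts_eq_corners)
    then have "z - lat s \<in> tile t0" using t(2) by (simp add: tile_shift3)
    moreover have "X = torus_proj \<Lambda> (z - lat s)" using z proj_shift[of "z - lat s" s] by simp
    ultimately show "X \<in> (\<Union>K\<in>tile ` set Ts. torus_proj \<Lambda> ` K)" using t0(1) by blast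
  qed (auto simp: flat_torus_def)
  fix K L assume KL: "K \<in> tile ` set Ts" "L \<in> tile ` set Ts" "K \<noteq> L"
  then obtain t t' where t: "t \<in> set Ts" "t' \<in> set Ts" "t \<noteq> t'" "K = tile t" "L = tile t'" by blast
  show "\<exists>F G. F face_of K \<and> F \<noteq> K \<and> G face_of L \<and> G \<noteq> L \<and>
           torus_proj \<Lambda> ` K \<inter> torus_proj \<Lambda> ` L = torus_proj \<Lambda> ` F \<and>
           torus_proj \<Lambda> ` K \<inter> torus_proj \<Lambda> ` L = torus_proj \<Lambda> ` G"
    unfolding t(4,5)
  proof (intro exI conjI)
    show "(convex hull (vp ` common_face t t')) face_of tile t" "convex hull (vp ` common_face t t') \<noteq> tile t"
      using common_face_proper[OF t(1-3)] by blast+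
    show "(convex hull (vp ` common_face t' t)) face_of tile t'" "convex hull (vp ` common_face t' t) \<noteq> tile t'"
      using common_face_proper[OF t(2,1) t(3)[symmetric]] by blast+
    show "torus_proj \<Lambda> ` tile t \<inter> torus_proj \<Lambda> ` tile t' = torus_proj \<Lambda> ` (convex hull (vp ` common_face t t'))"
      by (rule proj_Int[OF t(1,2)])
    show "torus_proj \<Lambda> ` tile t \<inter> torus_proj \<Lambda> ` tile t' = torus_proj \<Lambda> ` (convex hull (vp ` common_face t' t))"
      using proj_Int[OF t(2,1)] by (simp only: Int_commute)
  qed
qed simp

lemma exists_tile_class:
  assumes "i < N" obtains t where "t \<in> \<K>" "(i, s) \<in> verts t"
proof -
  obtain t where t: "t \<in> set Ts" "i \<in> fst ` set (corners t)"
    using matched_list assms unfolding matched_torus_def by blast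
  then obtain x where x: "x \<in> verts t" "fst x = i" by (auto simp: verts_eq_corners)
  have "(i, s) = shift (s - snd x) x" by (rule shift_eqI) (use x in auto)
  then have "(i, s) \<in> verts (shift3 (s - snd x) t)" using x(1) by (auto simp: verts_shift3)
  then show ?thesis using that shift3_in[OF Ts_in[OF t(1)]] by blast
qed

text \<open>Were two classes at the same point of the torus, two lifts would coincide in the plane.
  The weights at that point are concentrated on a single label, which is the same for every tile
  containing it.\<close>

lemma inj_on_proj_pos: "inj_on (\<lambda>i. torus_proj \<Lambda> (pos i)) {..<N}"
proof
  fix i j assume ij: "i \<in> {..<N}" "j \<in> {..<N}" "torus_proj \<Lambda> (pos i) = torus_proj \<Lambda> (pos j)"
  obtain s where s: "pos j = pos i + lat s" using proj_eqD[OF ij(3)] .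
  obtain t where t: "t \<in> \<K>" "(i, s) \<in> verts t" using exists_tile_class ij(1) by blast
  obtain t' where t': "t' \<in> \<K>" "(j, 0, 0) \<in> verts t'" using exists_tile_class ij(2) by blast
  have e: "vp (i, s) = vp (j, 0, 0)" using s by (simp add: vp_def)
  have "vp (i, s) \<in> tile t"
    unfolding tile_eq_hull_verts by (rule hull_inc[OF imageI[OF t(2)]])
  moreover have "vp (i, s) \<in> tile t'"
    unfolding tile_eq_hull_verts e by (rule hull_inc[OF imageI[OF t'(2)]])
  ultimately have "weight t (vp (i, s)) = weight t' (vp (j, 0, 0))"
    using weight_agree[OF t(1) _ t'(1)] e by simp
  then have "weight t (vp (i, s)) (i, s) = weight t' (vp (j, 0, 0)) (i, s)" by simp
  then show "i = j"
    using weight_vertex[OF t, of "(i, s)"] weight_vertex[OF t', of "(i, s)"] by (auto split: if_splits)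
qed

theorem card_vertices: "card (torus_vertices \<Lambda> (tile ` set Ts)) = N"
proof -
  have "torus_vertices \<Lambda> (tile ` set Ts) = (\<lambda>i. torus_proj \<Lambda> (pos i)) ` {..<N}"
  proof (intro equalityI subsetI)
    fix X assume "X \<in> torus_vertices \<Lambda> (tile ` set Ts)"
    then obtain t z where t: "t \<in> set Ts" "z extreme_point_of tile t" "X = torus_proj \<Lambda> z"
      by (auto simp: torus_vertices_def)
    have "z \<in> vp ` verts t"
      using t(2) extreme_point_of_convex_hull_affine_independent[OF affine_independent_tile(1)[OF Ts_in[OF t(1)]]]
      by (simp add: tile_eq_hull_verts)
    then obtain x where x: "x \<in> verts t" "z = vp x" by blast
    have "fst x < N"
    proof -
      obtain a b c where abc: "t = (a, b, c)" by (cases t)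
      have "\<forall>(p, q, r)\<in>set (rotations t). fst p < N" using matched_list t(1) unfolding matched_torus_def by fast
      then show ?thesis using x(1) by (auto simp: abc)
    qed
    moreover have "X = torus_proj \<Lambda> (pos (fst x))" using t(3) x(2) proj_shift by (simp add: vp_def)
    ultimately show "X \<in> (\<lambda>i. torus_proj \<Lambda> (pos i)) ` {..<N}" by blast
  next
    fix X assume "X \<in> (\<lambda>i. torus_proj \<Lambda> (pos i)) ` {..<N}"
    then obtain i where i: "i < N" "X = torus_proj \<Lambda> (pos i)" by blast
    obtain t where t: "t \<in> set Ts" "i \<in> fst ` set (corners t)"
      using matched_list i(1) unfolding matched_torus_def by blast
    then obtain x where x: "x \<in> verts t" "fst x = i" by (auto simp: verts_eq_corners)
    have "vp x extreme_point_of tile t"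
      using x(1) extreme_point_of_convex_hull_affine_independent[OF affine_independent_tile(1)[OF Ts_in[OF t(1)]]]
      by (simp add: tile_eq_hull_verts)
    moreover have "X = torus_proj \<Lambda> (vp x)" using i(2) x(2) proj_shift by (simp add: vp_def)
    ultimately show "X \<in> torus_vertices \<Lambda> (tile ` set Ts)" using t(1) by (auto simp: torus_vertices_def)
  qed
  then show ?thesis using card_image[OF inj_on_proj_pos] by simp
qed

end

section \<open>Maps on the torus given by the images of the vertices\<close>

context torus_tiling
begin

definition plane_map :: "(nat \<Rightarrow> real^3) \<Rightarrow> complex \<Rightarrow> real^3" where
  "plane_map f = pl (\<lambda>x. f (fst x))"

text \<open>A point of the torus is a coset; the choice of its representative is harmless by
  \<open>plane_map_shift\<close>.\<close>

definition torus_map :: "(nat \<Rightarrow> real^3) \<Rightarrow> complex set \<Rightarrow> real^3" where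
  "torus_map f X = plane_map f (SOME z. z \<in> X)"

lemma obtain_tile:
  obtains t s where "t \<in> set Ts" "z - lat s \<in> tile t"
proof -
  obtain t where t: "t \<in> \<K>" "z \<in> tile t" using covers by blast
  obtain s t0 where t0: "t0 \<in> set Ts" "set (corners t) = shift s ` set (corners t0)" using \<K>E[OF t(1)] by metis
  then have "tile t = tile (shift3 s t0)" by (simp add: tile_eq_hull_verts corners_shift3 verts_eq_corners)
  then show ?thesis using that[OF t0(1)] t(2) by (simp add: tile_shift3)
qed

text \<open>Translation carries weights to weights, and the values at vertices depend only on their
  classes.\<close>

lemma plane_map_shift: "plane_map f (z + lat s) = plane_map f z"
proof -
  obtain t where t: "t \<in> \<K>" "z \<in> tile t" using covers by blast
  have t': "shift3 s t \<in> \<K>" "z + lat s \<in> tile (shift3 s t)" using shift3_in t by (simp_all add: tile_shift3)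
  have inj: "inj_on (shift s) (verts t)" using inj_shift inj_on_subset by blast
  define g where "g = (\<lambda>y. weight t z (shift (- s) y))"
  have g: "g (shift s x) = weight t z x" for x by (simp add: g_def shift_shift)
  have "(\<Sum>y\<in>verts (shift3 s t). g y) = 1"
    using weight_sum[OF t(1), of z] by (simp add: verts_shift3 sum.reindex[OF inj] g)
  moreover have "z + lat s = (\<Sum>y\<in>verts (shift3 s t). g y *\<^sub>R vp y)"
  proof -
    have "(\<Sum>y\<in>verts (shift3 s t). g y *\<^sub>R vp y) = (\<Sum>x\<in>verts t. weight t z x *\<^sub>R vp x) + (\<Sum>x\<in>verts t. weight t z x) *\<^sub>R lat s"
      by (simp add: verts_shift3 sum.reindex[OF inj] g vp_shift scaleR_add_right sum.distrib scaleR_left.sum)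
    then show ?thesis using weight_sum[OF t(1), of z] weight_combination[OF t(1), of z] by simp
  qed
  ultimately have w: "weight (shift3 s t) (z + lat s) y = g y" if "y \<in> verts (shift3 s t)" for y
    using weight_unique[OF t'(1)] that by blast
  have "plane_map f (z + lat s) = (\<Sum>y\<in>verts (shift3 s t). g y *\<^sub>R f (fst y))"
    unfolding plane_map_def pl_eq[OF t'] by (rule sum.cong) (simp_all add: w)
  also have "\<dots> = plane_map f z"
    unfolding plane_map_def pl_eq[OF t] by (simp add: verts_shift3 sum.reindex[OF inj] g)
  finally show ?thesis .
qed

lemma torus_map_proj: "torus_map f (torus_proj \<Lambda> z) = plane_map f z"
proof -
  have "z + lat (0, 0) \<in> torus_proj \<Lambda> z" unfolding torus_proj_def lattice_eq by blast
  then have "(SOME w. w \<in> torus_proj \<Lambda> z) \<in> torus_proj \<Lambda> z" by (rule someI)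
  then obtain s where "(SOME w. w \<in> torus_proj \<Lambda> z) = z + lat s" unfolding torus_proj_def lattice_eq by blast
  then show ?thesis by (simp add: torus_map_def plane_map_shift)
qed

lemma plane_map_vertex_sum:
  assumes "(p, q, r) \<in> \<K>" "0 \<le> x" "0 \<le> y" "0 \<le> w" "x + y + w = 1"
  shows "plane_map f (x *\<^sub>R vp p + y *\<^sub>R vp q + w *\<^sub>R vp r) = x *\<^sub>R f (fst p) + y *\<^sub>R f (fst q) + w *\<^sub>R f (fst r)"
proof -
  define g where "g = (\<lambda>l. if l = p then x else if l = q then y else w)"
  have d: "p \<noteq> q" "q \<noteq> r" "p \<noteq> r" using distinct_verts[OF assms(1)] by blast+
  have "plane_map f (\<Sum>l\<in>verts (p, q, r). g l *\<^sub>R vp l) = (\<Sum>l\<in>verts (p, q, r). g l *\<^sub>R f (fst l))"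
    unfolding plane_map_def
    by (rule pl_combination[OF assms(1)]) (use assms d in \<open>auto simp: g_def sum_verts[OF assms(1)] simp del: verts.simps\<close>)
  then show ?thesis using d by (simp add: sum_verts[OF assms(1)] g_def del: verts.simps)
qed

lemma continuous_plane_map: "continuous_on UNIV (plane_map f)"
  unfolding plane_map_def by (rule continuous_on_pl)

lemma continuous_torus_map: "continuous_map (torus_topology \<Lambda>) euclidean (torus_map f)"
proof (rule continuous_compose_quotient_map[OF quotient_map_torus_proj])
  have "torus_map f \<circ> torus_proj \<Lambda> = plane_map f" by (simp add: fun_eq_iff torus_map_proj)
  then show "continuous_map euclidean euclidean (torus_map f \<circ> torus_proj \<Lambda>)"
    using continuous_plane_map by simp
qed

lemma isometric_torus_map:
  assumes d: "\<And>p q r. (p, q, r) \<in> set Ts \<Longrightarrow> dist (f (fst p)) (f (fst q)) = dist (vp p) (vp q) \<and>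
      dist (f (fst q)) (f (fst r)) = dist (vp q) (vp r) \<and> dist (f (fst p)) (f (fst r)) = dist (vp p) (vp r)"
  shows "isometric_on_triangles \<Lambda> (tile ` set Ts) (torus_map f)"
  unfolding isometric_on_triangles_def
proof
  fix K assume "K \<in> tile ` set Ts"
  then obtain t where t: "t \<in> set Ts" "K = tile t" by blast
  obtain p q r where pqr: "t = (p, q, r)" by (cases t)
  have K: "(p, q, r) \<in> \<K>" using Ts_in t(1) pqr by simp
  obtain L w where L: "linear L" "\<forall>z. norm (L z) = norm z"
    "\<And>x y z. x + y + z = 1 \<Longrightarrow> x *\<^sub>R f (fst p) + y *\<^sub>R f (fst q) + z *\<^sub>R f (fst r) =
       L (x *\<^sub>R vp p + y *\<^sub>R vp q + z *\<^sub>R vp r) + w"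
    using isometry_from_triangle[of "vp p" "vp q" "vp r" "f (fst p)" "f (fst q)" "f (fst r)"]
      oriented_tile[OF K] d[of p q r] t(1) pqr by auto
  have "(torus_map f \<circ> torus_proj \<Lambda>) z = L z + w" if z: "z \<in> K" for z
  proof -
    obtain x y s where xy: "0 \<le> x" "0 \<le> y" "0 \<le> s" "x + y + s = 1" "z = x *\<^sub>R vp p + y *\<^sub>R vp q + s *\<^sub>R vp r"
      using z unfolding t(2) pqr tile.simps convex_hull_3 by blast
    then show ?thesis
      using plane_map_vertex_sum[OF K xy(1-4), of f] L(3)[OF xy(4)] by (simp add: torus_map_proj)
  qed
  then show "affine_isometry_on K (torus_map f \<circ> torus_proj \<Lambda>)"
    unfolding affine_isometry_on_def using L(1,2) by blast
qed

end

context simplicial_tiling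
begin

lemma compact_torus: "compact_space (torus_topology \<Lambda>)"
proof -
  have "compactin euclidean (\<Union>t\<in>set Ts. tile t)"
    using compact_tile by (simp add: compact_UN)
  then have "compactin (torus_topology \<Lambda>) (torus_proj \<Lambda> ` (\<Union>t\<in>set Ts. tile t))"
    by (rule image_compactin[OF _ quotient_imp_continuous_map[OF quotient_map_torus_proj]])
  moreover have "torus_proj \<Lambda> ` (\<Union>t\<in>set Ts. tile t) = topspace (torus_topology \<Lambda>)"
  proof -
    have "(\<Union>K\<in>tile ` set Ts. torus_proj \<Lambda> ` K) = flat_torus \<Lambda>"
      using triangulation unfolding torus_triangulation_def by blast
    then show ?thesis by (simp add: image_UN)
  qed
  ultimately show ?thesis by (simp add: compact_space_def)
qed

text \<open>The hypothesis says that the images of two triangles meet only in the image of their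
  common face, stated for barycentric coordinates indexed by vertex numbers.\<close>

lemma embedding_torus_map:
  assumes emb: "\<And>t t' G G'. t \<in> set Ts \<Longrightarrow> t' \<in> set Ts \<Longrightarrow> (\<And>i. 0 \<le> G i) \<Longrightarrow> (\<And>i. 0 \<le> G' i) \<Longrightarrow>
      (\<And>i. i \<notin> fst ` set (corners t) \<Longrightarrow> G i = 0) \<Longrightarrow> (\<And>i. i \<notin> fst ` set (corners t') \<Longrightarrow> G' i = 0) \<Longrightarrow>
      (\<Sum>i\<in>fst ` set (corners t). G i) = 1 \<Longrightarrow> (\<Sum>i\<in>fst ` set (corners t'). G' i) = 1 \<Longrightarrow>
      (\<Sum>i\<in>fst ` set (corners t). G i *\<^sub>R f i) = (\<Sum>i\<in>fst ` set (corners t'). G' i *\<^sub>R f i) \<Longrightarrow> G = G'"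
  shows "embedding_map (torus_topology \<Lambda>) euclidean (torus_map f)"
proof (rule injective_closed_imp_embedding_map[OF continuous_torus_map])
  show "closed_map (torus_topology \<Lambda>) euclidean (torus_map f)"
    by (rule T1_Spaces.continuous_imp_closed_map[OF continuous_torus_map compact_torus]) simp
  show "inj_on (torus_map f) (topspace (torus_topology \<Lambda>))"
  proof
    fix X Y assume "X \<in> topspace (torus_topology \<Lambda>)" "Y \<in> topspace (torus_topology \<Lambda>)" and XY: "torus_map f X = torus_map f Y"
    then obtain z0 w0 where z0: "X = torus_proj \<Lambda> z0" "Y = torus_proj \<Lambda> w0" by (auto simp: flat_torus_def)
    obtain t s where t: "t \<in> set Ts" "z0 - lat s \<in> tile t" using obtain_tile .
    obtain t' s' where t': "t' \<in> set Ts" "w0 - lat s' \<in> tile t'" using obtain_tile .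
    define z w where "z = z0 - lat s" and "w = w0 - lat s'"
    have X: "X = torus_proj \<Lambda> z" using z0(1) proj_shift[of z s] by (simp add: z_def)
    have Y: "Y = torus_proj \<Lambda> w" using z0(2) proj_shift[of w s'] by (simp add: w_def)
    have K: "t \<in> \<K>" "z \<in> tile t" "t' \<in> \<K>" "w \<in> tile t'" using t t' Ts_in by (simp_all add: z_def w_def)
    \<comment> \<open>The vertex of \<open>t\<close> with class \<open>i\<close>. For classes that
      do not occur in \<open>t\<close> it is unspecified, but there \<open>g\<close> is
      zero.\<close>
    define c where "c = (\<lambda>t i. THE x. x \<in> verts t \<and> fst x = i)"
    have c: "c t (fst x) = x" if "t \<in> \<K>" "x \<in> verts t" for t x
      unfolding c_def using that distinct_classes[OF that(1)] by (intro the_equality) (auto simp: verts_eq_corners)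
    define g where "g = (\<lambda>t z i. if i \<in> fst ` verts t then weight t z (c t i) else 0)"
    have inj: "inj_on fst (verts t)" if "t \<in> \<K>" for t
      by (rule inj_on_inverseI[of _ "c t"]) (rule c[OF that])
    have gv: "g t z (fst x) = weight t z x" if "t \<in> \<K>" "x \<in> verts t" for t z x
      using that c by (simp add: g_def)
    have gs: "(\<Sum>i\<in>fst ` verts t. g t z i) = 1"
      "(\<Sum>i\<in>fst ` verts t. g t z i *\<^sub>R f i) = (\<Sum>x\<in>verts t. weight t z x *\<^sub>R f (fst x))" if "t \<in> \<K>" for t z
      using weight_sum[OF that, of z] by (simp_all add: sum.reindex[OF inj[OF that]] gv[OF that])
    have "g t z = g t' w"
    proof (rule emb[OF t(1) t'(1)])
      show "0 \<le> g t z i" "0 \<le> g t' w i" for i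
        using weight_nonneg[OF K(1,2)] weight_nonneg[OF K(3,4)] by (auto simp: g_def)
      show "g t z i = 0" if "i \<notin> fst ` set (corners t)" for i using that by (auto simp: g_def verts_eq_corners)
      show "g t' w i = 0" if "i \<notin> fst ` set (corners t')" for i using that by (auto simp: g_def verts_eq_corners)
      show "(\<Sum>i\<in>fst ` set (corners t). g t z i) = 1" "(\<Sum>i\<in>fst ` set (corners t'). g t' w i) = 1"
        using gs(1)[OF K(1), of z] gs(1)[OF K(3), of w] by (simp_all add: verts_eq_corners)
      show "(\<Sum>i\<in>fst ` set (corners t). g t z i *\<^sub>R f i) = (\<Sum>i\<in>fst ` set (corners t'). g t' w i *\<^sub>R f i)"
        using gs(2)[OF K(1), of z] gs(2)[OF K(3), of w] XY
        by (simp add: X Y torus_map_proj plane_map_def pl_eq[OF K(1,2)] pl_eq[OF K(3,4)] verts_eq_corners)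
    qed
    obtain s where s: "\<And>p p'. p \<in> verts t \<Longrightarrow> p' \<in> verts t' \<Longrightarrow> fst p = fst p' \<Longrightarrow> p' = shift s p"
      using common_shift[OF t(1) t'(1)] by blast
    \<comment> \<open>Vertices with equal class differ by the common translation \<open>s\<close>,
      and the others carry no weight. Summing over all classes therefore identifies \<open>w\<close>
      as \<open>z + lat s\<close>.\<close>
    have "weight t z p *\<^sub>R vp (shift s p) = g t' w (fst p) *\<^sub>R vp (c t' (fst p))" if p: "p \<in> verts t" for p
    proof (cases "fst p \<in> fst ` verts t'")
      case True
      then obtain p' where p': "p' \<in> verts t'" "fst p = fst p'" by blast
      then show ?thesis using s[OF p p'] c[OF K(3) p'(1)] gv[OF K(1) p, of z] \<open>g t z = g t' w\<close> by simp
    next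
      case False
      then have "g t' w (fst p) = 0" by (simp add: g_def)
      then show ?thesis using gv[OF K(1) p, of z] \<open>g t z = g t' w\<close> by simp
    qed
    then have "(\<Sum>p\<in>verts t. weight t z p *\<^sub>R vp (shift s p)) = (\<Sum>i\<in>fst ` verts t. g t' w i *\<^sub>R vp (c t' i))"
      by (simp add: sum.reindex[OF inj[OF K(1)]])
    also have "\<dots> = (\<Sum>i\<in>fst ` verts t \<union> fst ` verts t'. g t' w i *\<^sub>R vp (c t' i))"
    proof (rule sum.mono_neutral_left)
      show "\<forall>i\<in>fst ` verts t \<union> fst ` verts t' - fst ` verts t. g t' w i *\<^sub>R vp (c t' i) = 0"
        using \<open>g t z = g t' w\<close> by (metis (no_types, lifting) DiffD2 g_def scaleR_zero_left)
    qed auto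
    also have "\<dots> = (\<Sum>i\<in>fst ` verts t'. g t' w i *\<^sub>R vp (c t' i))"
      by (rule sum.mono_neutral_right) (auto simp: g_def)
    also have "\<dots> = (\<Sum>x\<in>verts t'. weight t' w x *\<^sub>R vp x)"
      by (simp add: sum.reindex[OF inj[OF K(3)]] gv[OF K(3)] c[OF K(3)])
    finally have "(\<Sum>p\<in>verts t. weight t z p *\<^sub>R vp p) + (\<Sum>p\<in>verts t. weight t z p) *\<^sub>R lat s = w"
      using weight_combination[OF K(3), of w] by (simp add: vp_shift scaleR_add_right sum.distrib scaleR_left.sum)
    then have "w = z + lat s" using weight_sum[OF K(1), of z] weight_combination[OF K(1), of z] by simp
    then show "X = Y" using X Y proj_shift by simp
  qed
qed

end

section \<open>Oriented volumes and separating planes\<close>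

text \<open>Six times the signed volume of the tetrahedron; in \<open>x\<close> it is an affine
  function vanishing on the plane through \<open>a\<close>, \<open>b\<close>,
  \<open>c\<close>.\<close>

definition vol :: "real^3 \<Rightarrow> real^3 \<Rightarrow> real^3 \<Rightarrow> real^3 \<Rightarrow> real" where
  "vol a b c x =
     (b$1 - a$1) * ((c$2 - a$2) * (x$3 - a$3) - (c$3 - a$3) * (x$2 - a$2))
   - (b$2 - a$2) * ((c$1 - a$1) * (x$3 - a$3) - (c$3 - a$3) * (x$1 - a$1))
   + (b$3 - a$3) * ((c$1 - a$1) * (x$2 - a$2) - (c$2 - a$2) * (x$1 - a$1))"

lemma vol_self [simp]: "vol a b c a = 0" "vol a b c b = 0" "vol a b c c = 0"
  by (simp_all add: vol_def algebra_simps)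

lemma vol_sum:
  assumes "finite S" "(\<Sum>i\<in>S. G i) = 1"
  shows "vol a b c (\<Sum>i\<in>S. G i *\<^sub>R f i) = (\<Sum>i\<in>S. G i * vol a b c (f i))"
proof -
  \<comment> \<open>The cross product of \<open>b - a\<close> and \<open>c - a\<close>, a normal
    vector of the plane.\<close>
  define n :: "real^3" where "n = vector [
    (b$2 - a$2) * (c$3 - a$3) - (b$3 - a$3) * (c$2 - a$2),
    (b$3 - a$3) * (c$1 - a$1) - (b$1 - a$1) * (c$3 - a$3),
    (b$1 - a$1) * (c$2 - a$2) - (b$2 - a$2) * (c$1 - a$1)]"
  have v: "vol a b c x = n \<bullet> x - n \<bullet> a" for x
    by (simp add: vol_def n_def inner_vec_def sum_3 algebra_simps)
  have "vol a b c (\<Sum>i\<in>S. G i *\<^sub>R f i) = (\<Sum>i\<in>S. G i * (n \<bullet> f i)) - (\<Sum>i\<in>S. G i) * (n \<bullet> a)"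
    by (simp add: v inner_sum_right assms(2))
  also have "\<dots> = (\<Sum>i\<in>S. G i * vol a b c (f i))"
    by (simp add: v right_diff_distrib sum_subtractf sum_distrib_right)
  finally show ?thesis .
qed

text \<open>The plane through \<open>f i\<close>, \<open>f j\<close>, \<open>f k\<close> weakly separates the two simplices and contains no
  further vertex of either.\<close>

lemma separated_weights:
  fixes f :: "nat \<Rightarrow> real^3" and s :: real
  assumes fin: "finite A" "finite B"
    and G: "\<And>i. 0 \<le> G i" "\<And>i. i \<notin> A \<Longrightarrow> G i = 0" "(\<Sum>i\<in>A. G i) = 1"
    and G': "\<And>i. 0 \<le> G' i" "\<And>i. i \<notin> B \<Longrightarrow> G' i = 0" "(\<Sum>i\<in>B. G' i) = 1"
    and eq: "(\<Sum>i\<in>A. G i *\<^sub>R f i) = (\<Sum>i\<in>B. G' i *\<^sub>R f i)"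
    and ne: "i \<noteq> j" "j \<noteq> k" "i \<noteq> k" "vol (f i) (f j) (f k) (f l) \<noteq> 0"
    and A: "\<And>x. x \<in> A \<Longrightarrow> x \<notin> {i, j, k} \<Longrightarrow> s * vol (f i) (f j) (f k) (f x) > 0"
    and B: "\<And>x. x \<in> B \<Longrightarrow> x \<notin> {i, j, k} \<Longrightarrow> s * vol (f i) (f j) (f k) (f x) < 0"
  shows "G = G'"
proof -
  define S where "S = A \<union> B \<union> {i, j, k}"
  have S: "finite S" "A \<subseteq> S" "B \<subseteq> S" "i \<in> S" "j \<in> S" "k \<in> S" using fin by (auto simp: S_def)
  have sum1: "(\<Sum>i\<in>S. G i) = 1" "(\<Sum>i\<in>S. G' i) = 1"
    using G(2,3) G'(2,3) sum.mono_neutral_left[OF S(1,2), of G] sum.mono_neutral_left[OF S(1,3), of G'] by simp_all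
  have eqS: "(\<Sum>i\<in>S. G i *\<^sub>R f i) = (\<Sum>i\<in>S. G' i *\<^sub>R f i)"
    using eq G(2) G'(2) sum.mono_neutral_left[OF S(1,2), of "\<lambda>i. G i *\<^sub>R f i"]
      sum.mono_neutral_left[OF S(1,3), of "\<lambda>i. G' i *\<^sub>R f i"] by simp
  have volS: "(\<Sum>x\<in>S. G x * vol a b c (f x)) = (\<Sum>x\<in>S. G' x * vol a b c (f x))" for a b c
    using vol_sum[OF S(1) sum1(1), of a b c f] vol_sum[OF S(1) sum1(2), of a b c f] eqS by simp
  let ?v = "\<lambda>x. s * vol (f i) (f j) (f k) (f x)"
  have in3: "vol (f i) (f j) (f k) (f x) = 0" if "x \<in> {i, j, k}" for x using that by auto
  \<comment> \<open>The two sums of weighted volumes agree, while every term is nonnegative on one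
    side and nonpositive on the other. So all terms vanish, and the weights live on
    \<open>i\<close>, \<open>j\<close>, \<open>k\<close> alone.\<close>
  have nn: "0 \<le> G x * ?v x" "0 \<le> - (G' x * ?v x)" for x
  proof -
    show "0 \<le> G x * ?v x" using A[of x] G(1)[of x] G(2)[of x] in3[of x]
      by (cases "x \<in> A"; cases "x \<in> {i, j, k}") (auto simp del: insert_iff intro: mult_nonneg_nonneg less_imp_le)
    have "G' x * ?v x \<le> 0" using B[of x] G'(1)[of x] G'(2)[of x] in3[of x]
      by (cases "x \<in> B"; cases "x \<in> {i, j, k}") (auto simp del: insert_iff intro: mult_nonneg_nonpos less_imp_le)
    then show "0 \<le> - (G' x * ?v x)" by simp
  qed
  have "(\<Sum>x\<in>S. G x * ?v x + - (G' x * ?v x)) = s * ((\<Sum>x\<in>S. G x * vol (f i) (f j) (f k) (f x)) - (\<Sum>x\<in>S. G' x * vol (f i) (f j) (f k) (f x)))"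
    by (simp add: sum_subtractf sum_distrib_left right_diff_distrib mult.left_commute)
  then have "(\<Sum>x\<in>S. G x * ?v x + - (G' x * ?v x)) = 0" by (simp add: volS)
  then have z: "G x * ?v x + - (G' x * ?v x) = 0" if "x \<in> S" for x
    using sum_nonneg_0[OF S(1) add_nonneg_nonneg[OF nn], of "\<lambda>x. x" "\<lambda>x. x" x] that by blast
  have zero: "G x = 0 \<and> G' x = 0" if "x \<notin> {i, j, k}" for x
  proof -
    have "G x * ?v x = 0" "G' x * ?v x = 0" if "x \<in> S" using z[OF that] nn[of x] by linarith+
    moreover have "x \<in> S" if "x \<in> A \<or> x \<in> B" using that S by blast
    ultimately show ?thesis
      using A[of x] B[of x] G(2)[of x] G'(2)[of x] \<open>x \<notin> {i, j, k}\<close>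
      by (cases "x \<in> A"; cases "x \<in> B") auto
  qed
  have red: "(\<Sum>x\<in>S. H x * vol a b c (f x)) = H i * vol a b c (f i) + (H j * vol a b c (f j) + H k * vol a b c (f k))"
    if "\<And>x. x \<notin> {i, j, k} \<Longrightarrow> H x = 0" for H a b c
  proof -
    have "(\<Sum>x\<in>S. H x * vol a b c (f x)) = (\<Sum>x\<in>{i, j, k}. H x * vol a b c (f x))"
      using that by (intro sum.mono_neutral_right) (use S in auto)
    then show ?thesis using ne by simp
  qed
  have vv: "G i * vol a b c (f i) + (G j * vol a b c (f j) + G k * vol a b c (f k)) =
      G' i * vol a b c (f i) + (G' j * vol a b c (f j) + G' k * vol a b c (f k))" for a b c
    using volS[of a b c] red[of G a b c] red[of G' a b c] zero by simp
  \<comment> \<open>The vertex \<open>l\<close> off the plane shows that the three points are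
    affinely independent: each remaining weight is read off by the plane through \<open>f l\<close>
    and the other two points.\<close>
  have "vol (f j) (f k) (f l) (f i) \<noteq> 0" "vol (f i) (f k) (f l) (f j) \<noteq> 0" "vol (f i) (f j) (f l) (f k) \<noteq> 0"
    using ne(4) by (simp_all add: vol_def algebra_simps)
  then have "G i = G' i" "G j = G' j" "G k = G' k"
    using vv[of "f j" "f k" "f l"] vv[of "f i" "f k" "f l"] vv[of "f i" "f j" "f l"] by simp_all
  then show ?thesis using zero by (intro ext) (metis insert_iff empty_iff)
qed

section \<open>The combinatorial eight-vertex torus and its embedding certificate\<close>

text \<open>The eight vertices are numbered \<open>Q, P, C, Q', C', R', R, P'\<close>, where \<open>'\<close> is the half-turn about
  the first coordinate axis.\<close>

definition torus_triangles :: "ltriangle list" where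
  "torus_triangles =
  [((0, 0, 0), (5, 0, 0), (4, 0, 0)),
   ((0, 0, 0), (4, 0, 0), (3, 0, 0)),
   ((0, 0, 0), (3, 0, 0), (2, 0, 0)),
   ((0, 0, 0), (2, 0, 0), (1, 0, 0)),
   ((0, 0, 0), (1, 0, 0), (7, 0, 0)),
   ((0, 0, 0), (7, 0, 0), (6, 0, 0)),
   ((0, 0, 0), (6, 0, 0), (5, 0, 0)),
   ((1, 0, 0), (2, 0, 0), (5, 1, 0)),
   ((1, 0, 0), (5, 1, 0), (3, 0, 1)),
   ((2, 0, 0), (4, 1, 0), (5, 1, 0)),
   ((3, 0, 0), (4, 0, 0), (7, 0, -1)),
   ((3, 0, 0), (7, 0, -1), (1, 0, -1)),
   ((7, 0, -1), (4, 0, 0), (6, 0, -1)),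
   ((3, 0, 0), (5, 1, -1), (6, 1, -1)),
   ((3, 0, 0), (6, 1, -1), (2, 0, 0)),
   ((4, 0, 0), (2, -1, 0), (6, 0, -1))]"

text \<open>The signs of \<open>vol3\<close> for small \<open>e\<close>. Of the 70 quadruples 59 are
  listed; \<open>look_sign\<close> gives 0 to the others, so these can never certify a
  separation.\<close>

definition volume_signs :: "((nat \<times> nat \<times> nat \<times> nat) \<times> int) list" where
  "volume_signs =
  [((0, 1, 2, 3), -1), ((0, 1, 2, 5), 1), ((0, 1, 2, 7), -1), ((0, 1, 3, 4), 1), ((0, 1, 3, 5), 1),
   ((0, 1, 3, 7), -1), ((0, 1, 4, 5), 1), ((0, 1, 5, 6), 1), ((0, 1, 5, 7), -1), ((0, 1, 6, 7), 1),
   ((0, 2, 3, 4), 1), ((0, 2, 3, 6), 1), ((0, 2, 3, 7), 1), ((0, 2, 4, 5), 1), ((0, 2, 4, 6), -1), ((0,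
   2, 4, 7), -1), ((0, 2, 5, 6), 1), ((0, 2, 6, 7), -1), ((0, 3, 4, 5), 1), ((0, 3, 4, 6), -1), ((0, 3,
   4, 7), -1), ((0, 3, 5, 6), 1), ((0, 3, 6, 7), -1), ((0, 4, 5, 6), 1), ((0, 4, 5, 7), 1), ((0, 4, 6,
   7), -1), ((0, 5, 6, 7), 1), ((1, 2, 3, 4), 1), ((1, 2, 3, 5), -1), ((1, 2, 3, 6), 1), ((1, 2, 3, 7),
   1), ((1, 2, 4, 5), 1), ((1, 2, 4, 6), -1), ((1, 2, 4, 7), -1), ((1, 2, 5, 6), 1), ((1, 2, 5, 7), 1),
   ((1, 2, 6, 7), -1), ((1, 3, 4, 5), 1), ((1, 3, 4, 6), -1), ((1, 3, 4, 7), -1), ((1, 3, 5, 6), 1),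
   ((1, 3, 5, 7), 1), ((1, 3, 6, 7), -1), ((1, 4, 5, 7), 1), ((1, 4, 6, 7), -1), ((1, 5, 6, 7), 1),
   ((2, 3, 4, 5), -1), ((2, 3, 4, 6), 1), ((2, 3, 4, 7), 1), ((2, 3, 5, 6), 1), ((2, 3, 6, 7), -1),
   ((2, 4, 5, 6), -1), ((2, 4, 5, 7), -1), ((2, 4, 6, 7), 1), ((3, 4, 5, 6), -1), ((3, 4, 5, 7), -1),
   ((3, 4, 6, 7), 1), ((3, 5, 6, 7), -1), ((4, 5, 6, 7), 1)]"

text \<open>For the \<open>a\<close>-th and the \<open>b\<close>-th triangle (\<open>a \<le> b\<close>), three vertices whose plane separates them, and
  the side of the first triangle.\<close>

definition separators :: "(nat \<times> nat \<times> nat \<times> int) list list" where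
  "separators =
  [
   [(0, 4, 5, -1), (0, 4, 5, -1), (0, 4, 5, -1), (0, 4, 5, -1), (0, 5, 7, 1), (0, 5, 7, 1), (0, 5,
     6, 1), (1, 4, 5, -1), (1, 4, 5, -1), (2, 4, 5, -1), (4, 5, 7, -1), (1, 4, 5, -1), (4, 6, 7, 1), (4,
     5, 6, -1), (4, 5, 6, -1), (4, 5, 6, -1)],
   [(0, 3, 4, -1), (0, 3, 4, -1), (0, 3, 4, -1), (0, 3, 7, 1), (0, 6, 7, -1), (0, 5, 6, 1), (1, 3,
     4, -1), (1, 3, 5, -1), (3, 4, 5, -1), (3, 4, 7, 1), (1, 3, 7, 1), (3, 4, 7, 1), (3, 5, 6, -1), (3,
     4, 6, 1), (3, 4, 6, 1)],
   [(0, 2, 3, -1), (0, 2, 3, 1), (0, 3, 7, 1), (0, 6, 7, -1), (0, 5, 6, 1), (1, 2, 3, 1), (1, 3, 5,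
     -1), (2, 4, 5, -1), (2, 3, 4, -1), (1, 3, 7, 1), (2, 4, 7, 1), (3, 5, 6, -1), (2, 3, 6, -1), (2, 4,
     6, 1)],
   [(0, 1, 2, -1), (0, 1, 7, 1), (0, 2, 7, -1), (0, 5, 6, 1), (1, 2, 5, -1), (1, 3, 5, -1), (2, 4,
     5, -1), (2, 3, 4, -1), (1, 3, 7, 1), (2, 4, 7, 1), (3, 5, 6, -1), (2, 3, 6, -1), (2, 4, 6, 1)],
   [(0, 1, 7, -1), (0, 6, 7, 1), (0, 5, 6, 1), (1, 2, 7, 1), (1, 3, 7, 1), (4, 5, 7, -1), (3, 4, 7,
     1), (1, 3, 7, 1), (4, 6, 7, 1), (5, 6, 7, -1), (2, 6, 7, 1), (4, 6, 7, 1)],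
   [(0, 6, 7, -1), (0, 6, 7, -1), (1, 2, 7, 1), (1, 3, 7, 1), (4, 5, 7, -1), (4, 6, 7, 1), (1, 3, 7,
     1), (4, 6, 7, 1), (5, 6, 7, -1), (2, 6, 7, 1), (4, 6, 7, 1)],
   [(0, 5, 6, -1), (1, 5, 6, -1), (1, 5, 6, -1), (4, 5, 6, -1), (4, 6, 7, 1), (1, 5, 6, -1), (4, 6,
     7, 1), (3, 5, 6, -1), (2, 5, 6, -1), (4, 5, 6, -1)],
   [(1, 2, 5, -1), (1, 3, 5, -1), (2, 4, 5, -1), (2, 3, 4, -1), (1, 3, 5, -1), (2, 4, 7, 1), (3, 5,
     6, -1), (2, 5, 6, -1), (2, 4, 6, 1)],
   [(1, 3, 5, -1), (3, 4, 5, -1), (3, 4, 7, 1), (1, 3, 7, -1), (3, 4, 7, 1), (3, 5, 6, -1), (2, 3,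
     6, -1), (3, 4, 6, 1)],
   [(2, 4, 5, -1), (3, 4, 5, 1), (3, 4, 5, 1), (4, 5, 7, 1), (3, 5, 6, -1), (2, 5, 6, -1), (2, 4, 6,
     1)],
   [(3, 4, 7, -1), (3, 4, 7, -1), (4, 6, 7, -1), (3, 6, 7, 1), (3, 4, 7, 1), (3, 4, 7, 1)],
   [(1, 3, 7, -1), (3, 4, 7, 1), (3, 6, 7, 1), (2, 3, 7, -1), (3, 4, 7, 1)],
   [(4, 6, 7, -1), (5, 6, 7, -1), (4, 6, 7, 1), (4, 6, 7, 1)],
   [(3, 5, 6, -1), (3, 5, 6, 1), (3, 5, 6, 1)],
   [(2, 3, 6, -1), (2, 4, 6, 1)],
   [(2, 4, 6, -1)]]"

fun look_sign :: "nat \<times> nat \<times> nat \<times> nat \<Rightarrow> int" where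
  "look_sign q = (case map_of volume_signs q of Some s \<Rightarrow> s | None \<Rightarrow> 0)"

text \<open>Moving \<open>x\<close> from the last place to its place in the sorted quadruple takes
  3, 2, 1 or 0 transpositions, whence the alternating signs.\<close>

definition side :: "nat \<Rightarrow> nat \<Rightarrow> nat \<Rightarrow> nat \<Rightarrow> int" where
  "side i j k x = (if x < i then - look_sign (x, i, j, k) else if x < j then look_sign (i, x, j, k)
     else if x < k then - look_sign (i, j, x, k) else look_sign (i, j, k, x))"

text \<open>The last condition supplies a vertex off the plane and thus excludes collinear
  \<open>i\<close>, \<open>j\<close>, \<open>k\<close>. For a triangle paired with itself the three
  vertices must be its own, since no further vertex can satisfy both sign conditions.\<close>

fun separates :: "nat list \<Rightarrow> nat list \<Rightarrow> nat \<times> nat \<times> nat \<times> int \<Rightarrow> bool" where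
  "separates A B (i, j, k, s) \<longleftrightarrow> i < j \<and> j < k \<and>
     list_all (\<lambda>x. x = i \<or> x = j \<or> x = k \<or> s * side i j k x > 0) A \<and>
     list_all (\<lambda>x. x = i \<or> x = j \<or> x = k \<or> s * side i j k x < 0) B \<and>
     list_ex (\<lambda>x. x \<noteq> i \<and> x \<noteq> j \<and> x \<noteq> k \<and> side i j k x \<noteq> 0) [0, 1, 2, 3, 4, 5, 6, 7]"

lemma simplicial_torus_triangles: "simplicial_torus 8 torus_triangles"
  by code_simp

lemma separators_check:
  "list_all (\<lambda>a. list_all (\<lambda>b. a \<le> b \<longrightarrow> separates (map fst (corners (torus_triangles ! a)))
     (map fst (corners (torus_triangles ! b))) (separators ! a ! (b - a))) [0..<16]) [0..<16]"
  by code_simp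

section \<open>Rational coordinates in the plane and in space\<close>

text \<open>The similarity that turns and scales the limit lattice, generated by
  \<open>(-3, 1)\<close> and \<open>(-3, -1)\<close> in rational coordinates, onto the hexagonal
  lattice with first generator 1. Its factor \<open>norm kap\<close> is applied in space as well, so
  that isometry is unaffected.\<close>

definition kap :: complex where
  "kap = inverse (Complex (-3) (sqrt 3))"

lemma norm_kap: "norm kap > 0" "norm kap ^ 2 = 1 / 12"
  by (simp_all add: kap_def norm_inverse complex_norm power_inverse complex_eq_iff)

lemma orient_mult: "orient (k * a) (k * b) (k * c) = (norm k)\<^sup>2 * orient a b c"
  unfolding cmod_power2 by (simp add: orient_def algebra_simps power2_eq_square)

text \<open>Planar points are written \<open>(u, \<surd>3 v)\<close> and points of space \<open>(\<surd>3 X, y, \<surd>3 Z)\<close>; this keeps all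
  coordinates of the limit rational.\<close>

definition point2 :: "real \<Rightarrow> real \<Rightarrow> complex" where
  "point2 u v = kap * Complex u (sqrt 3 * v)"

definition point3 :: "real \<Rightarrow> real \<Rightarrow> real \<Rightarrow> real^3" where
  "point3 x y z = norm kap *\<^sub>R vector [sqrt 3 * x, y, sqrt 3 * z]"

lemma orient_point2:
  "orient (point2 u v) (point2 u' v') (point2 u'' v'') =
    (norm kap)\<^sup>2 * sqrt 3 * ((u' - u) * (v'' - v) - (v' - v) * (u'' - u))"
  unfolding point2_def orient_mult by (simp add: orient_def algebra_simps)

lemma dist_point2: "dist (point2 u v) (point2 u' v') = norm kap * sqrt ((u - u')\<^sup>2 + 3 * (v - v')\<^sup>2)"
proof -
  have "Complex u (sqrt 3 * v) - Complex u' (sqrt 3 * v') = Complex (u - u') (sqrt 3 * (v - v'))"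
    by (simp add: complex_eq_iff right_diff_distrib)
  then have "dist (point2 u v) (point2 u' v') = norm (kap * Complex (u - u') (sqrt 3 * (v - v')))"
    unfolding dist_norm point2_def right_diff_distrib[symmetric] by simp
  then show ?thesis by (simp add: norm_mult complex_norm power_mult_distrib)
qed

lemma dist_point3: "dist (point3 x y z) (point3 x' y' z') = norm kap * sqrt (3 * (x - x')\<^sup>2 + (y - y')\<^sup>2 + 3 * (z - z')\<^sup>2)"
proof -
  have "dist (point3 x y z) (point3 x' y' z') = norm kap * norm (vector [sqrt 3 * (x - x'), y - y', sqrt 3 * (z - z')] :: real^3)"
  proof -
    have "point3 x y z - point3 x' y' z' = norm kap *\<^sub>R vector [sqrt 3 * (x - x'), y - y', sqrt 3 * (z - z')]"
      by (simp add: point3_def vec_eq_iff forall_3 algebra_simps)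
    then show ?thesis by (simp add: dist_norm)
  qed
  then show ?thesis by (simp add: norm_vec_def L2_set_def sum_3 power_mult_distrib)
qed

definition vol3 :: "real \<times> real \<times> real \<Rightarrow> real \<times> real \<times> real \<Rightarrow> real \<times> real \<times> real \<Rightarrow> real \<times> real \<times> real \<Rightarrow> real" where
  "vol3 = (\<lambda>(a1, a2, a3) (b1, b2, b3) (c1, c2, c3) (x1, x2, x3).
     (b1 - a1) * ((c2 - a2) * (x3 - a3) - (c3 - a3) * (x2 - a2))
   - (b2 - a2) * ((c1 - a1) * (x3 - a3) - (c3 - a3) * (x1 - a1))
   + (b3 - a3) * ((c1 - a1) * (x2 - a2) - (c2 - a2) * (x1 - a1)))"

text \<open>The factor 3 comes from the two coordinates scaled by \<open>sqrt 3\<close>. Since the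
  total factor is positive, signs may be decided by \<open>vol3\<close>.\<close>

lemma vol_point3:
  "vol (point3 a1 a2 a3) (point3 b1 b2 b3) (point3 c1 c2 c3) (point3 x1 x2 x3) =
    3 * norm kap ^ 3 * vol3 (a1, a2, a3) (b1, b2, b3) (c1, c2, c3) (x1, x2, x3)"
proof -
  define k s where "k = norm kap" and "s = sqrt 3"
  have s: "s * s = 3" by (simp add: s_def)
  have d: "k * x - k * y = k * (x - y)" "s * x - s * y = s * (x - y)" for x y
    by (simp_all add: right_diff_distrib)
  have id: "(k * (s * B1)) * ((k * C2) * (k * (s * X3)) - (k * (s * C3)) * (k * X2))
      - (k * B2) * ((k * (s * C1)) * (k * (s * X3)) - (k * (s * C3)) * (k * (s * X1)))
      + (k * (s * B3)) * ((k * (s * C1)) * (k * X2) - (k * C2) * (k * (s * X1))) =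
      3 * k ^ 3 * (B1 * (C2 * X3 - C3 * X2) - B2 * (C1 * X3 - C3 * X1) + B3 * (C1 * X2 - C2 * X1))"
    for B1 B2 B3 C1 C2 C3 X1 X2 X3
    unfolding s[symmetric] by (simp add: power3_eq_cube algebra_simps)
  show ?thesis
    unfolding vol_def point3_def vol3_def k_def[symmetric] s_def[symmetric] by (simp add: d) (rule id)
qed

section \<open>The length equations of a torus with half-turn symmetry\<close>

text \<open>In rational coordinates squared lengths are \<open>u\<^sup>2 + 3 v\<^sup>2\<close> in
  the plane and \<open>3 x\<^sup>2 + y\<^sup>2 + 3 z\<^sup>2\<close> in space. The equations are the
  14 edge lengths recombined: instead of the edges from one vertex to another and to its half-turn
  image, they use half-edges, medians and inner products. Half of the edge from a vertex to its
  image is \<open>D\<close> for \<open>Q\<close>, \<open>g\<close> for \<open>C\<close> and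
  \<open>(al, 0) + D + G\<close> for \<open>R\<close>. The scalar \<open>al\<close> stands for the
  horizontal vector \<open>(al, 0)\<close>, half the difference of the edges \<open>a\<close> and
  \<open>b\<close> at \<open>Q\<close>; this fixes the rotation of the plane.\<close>

locale folded_data =
  fixes al au av Du Dv Eu Ev gu gv Gu Gv q2 q3 p1 p2 p3 r1 r2 r3 c1 c2 :: real
  assumes AA: "al * al = q2 * q2 + 3 * q3 * q3 + 3 * p1 * p1"
    and aA: "au * al = 3 * p1 * p1 - (q2 * (p2 - q2) + 3 * q3 * (p3 - q3))"
    and aa: "au * au + 3 * av * av = 3 * p1 * p1 + (p2 - q2)\<^sup>2 + 3 * (p3 - q3)\<^sup>2"
    and DD: "Du * Du + 3 * Dv * Dv = q2 * q2 + 3 * q3 * q3"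
    and gg: "gu * gu + 3 * gv * gv = c2 * c2"
    and PP: "(al + Eu + gu)\<^sup>2 + 3 * (Ev + gv)\<^sup>2 = c2 * c2 + 3 * c1 * c1"
    and PD: "(al + Eu + gu) * Du + 3 * (Ev + gv) * Dv = q2 * c2"
    and EE: "Eu * Eu + 3 * Ev * Ev = q2 * q2 + 3 * q3 * q3 + 3 * r1 * r1"
    and MM: "(al + Du + Gu)\<^sup>2 + 3 * (Dv + Gv)\<^sup>2 = r2 * r2 + 3 * r3 * r3"
    and ee: "(Eu - (al + Du + Gu))\<^sup>2 + 3 * (Ev - (Dv + Gv))\<^sup>2 = 3 * r1 * r1 + (q2 - r2)\<^sup>2 + 3 * (q3 - r3)\<^sup>2"
    and GG: "Gu * Gu + 3 * Gv * Gv = r2 * r2 + 3 * r3 * r3 + 3 * (r1 - c1)\<^sup>2"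
    and Gg: "Gu * gu + 3 * Gv * gv = r2 * c2"
    and ac: "au * ((al + Eu + gu) - Du) + 3 * av * ((Ev + gv) - Dv) =
      3 * c1 * p1 - ((p2 - q2) * (q2 - c2) + 3 * (p3 - q3) * q3)"
    and be: "(au - 2 * al - (Eu - (al + Du + Gu)))\<^sup>2 + 3 * (av - (Ev - (Dv + Gv)))\<^sup>2 =
      3 * (p1 - r1)\<^sup>2 + (p2 + r2)\<^sup>2 + 3 * (p3 + r3)\<^sup>2"
begin

definition "cu = (al + Eu + gu) - Du"
definition "cv = (Ev + gv) - Dv"
definition "du = (al + Eu + gu) + Du"
definition "dv = (Ev + gv) + Dv"
definition "eu = Eu - (al + Du + Gu)"
definition "ev = Ev - (Dv + Gv)"
definition "fu = Eu + (al + Du + Gu)"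
definition "fv = Ev + (Dv + Gv)"
definition "bu = au - 2 * al"

text \<open>On the torus the half-turn acts as a point reflection, so corresponding edges are
  opposite vectors. The edges \<open>P R'\<close> and \<open>P' R\<close> yield the first generator,
  the edges \<open>P Q'\<close> and \<open>P' Q\<close> the second.\<close>

definition "l1u = bu - au - eu - fu"
definition "l1v = av - av - ev - fv"
definition "l2u = bu - au - du + cu"
definition "l2v = av - av - dv + cv"

text \<open>\<open>Q\<close> is at the origin, and \<open>Q\<close>, \<open>C\<close>,
  \<open>Q'\<close>, \<open>C'\<close> form a parallelogram.\<close>

definition planar_u :: "nat \<Rightarrow> real" where "planar_u i = [0, - au, - cu, du - cu, du, fu, eu, bu] ! i"
definition planar_v :: "nat \<Rightarrow> real" where "planar_v i = [0, - av, - cv, dv - cv, dv, fv, ev, av] ! i"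

definition space :: "nat \<Rightarrow> real \<times> real \<times> real" where
  "space i = [(0, q2, q3), (p1, p2, p3), (c1, c2, 0), (0, - q2, - q3), (c1, - c2, 0),
     (r1, - r2, - r3), (r1, r2, r3), (p1, - p2, - p3)] ! i"

definition label_u :: "lvertex \<Rightarrow> real" where
  "label_u x = planar_u (fst x) + of_int (fst (snd x)) * l1u + of_int (snd (snd x)) * l2u"
definition label_v :: "lvertex \<Rightarrow> real" where
  "label_v x = planar_v (fst x) + of_int (fst (snd x)) * l1v + of_int (snd (snd x)) * l2v"

definition label_orient :: "ltriangle \<Rightarrow> real" where
  "label_orient = (\<lambda>(p, q, r). (label_u q - label_u p) * (label_v r - label_v p) - (label_v q - label_v p) * (label_u r - label_u p))"

definition pos :: "nat \<Rightarrow> complex" where "pos i = point2 (planar_u i) (planar_v i)"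
definition f :: "nat \<Rightarrow> real^3" where "f i = (case space i of (x, y, z) \<Rightarrow> point3 x y z)"

definition "sqdist i j = (case space i of (x, y, z) \<Rightarrow> case space j of (x', y', z') \<Rightarrow>
  3 * (x - x')\<^sup>2 + (y - y')\<^sup>2 + 3 * (z - z')\<^sup>2)"

lemmas planar_defs = cu_def cv_def du_def dv_def eu_def ev_def fu_def fv_def bu_def

text \<open>Each identity undoes the recombination by expanding the square of a sum or difference of
  two vectors. There is one identity for each class of edges under the half-turn.\<close>

lemma base_lengths:
  "au\<^sup>2 + 3 * av\<^sup>2 = 3 * p1\<^sup>2 + (p2 - q2)\<^sup>2 + 3 * (p3 - q3)\<^sup>2"
  "bu\<^sup>2 + 3 * av\<^sup>2 = 3 * p1\<^sup>2 + (p2 + q2)\<^sup>2 + 3 * (p3 + q3)\<^sup>2"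
  "(au + bu)\<^sup>2 + 3 * (av + av)\<^sup>2 = 4 * p2\<^sup>2 + 12 * p3\<^sup>2"
  "cu\<^sup>2 + 3 * cv\<^sup>2 = 3 * c1\<^sup>2 + (q2 - c2)\<^sup>2 + 3 * q3\<^sup>2"
  "du\<^sup>2 + 3 * dv\<^sup>2 = 3 * c1\<^sup>2 + (q2 + c2)\<^sup>2 + 3 * q3\<^sup>2"
  "(du - cu)\<^sup>2 + 3 * (dv - cv)\<^sup>2 = 4 * q2\<^sup>2 + 12 * q3\<^sup>2"
  "eu\<^sup>2 + 3 * ev\<^sup>2 = 3 * r1\<^sup>2 + (q2 - r2)\<^sup>2 + 3 * (q3 - r3)\<^sup>2"
  "fu\<^sup>2 + 3 * fv\<^sup>2 = 3 * r1\<^sup>2 + (q2 + r2)\<^sup>2 + 3 * (q3 + r3)\<^sup>2"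
  "(fu - eu)\<^sup>2 + 3 * (fv - ev)\<^sup>2 = 4 * r2\<^sup>2 + 12 * r3\<^sup>2"
  "(Gu - gu)\<^sup>2 + 3 * (Gv - gv)\<^sup>2 = 3 * (r1 - c1)\<^sup>2 + (r2 - c2)\<^sup>2 + 3 * r3\<^sup>2"
  "(Gu + gu)\<^sup>2 + 3 * (Gv + gv)\<^sup>2 = 3 * (r1 - c1)\<^sup>2 + (r2 + c2)\<^sup>2 + 3 * r3\<^sup>2"
  "(2 * gu)\<^sup>2 + 3 * (2 * gv)\<^sup>2 = 4 * c2\<^sup>2"
  "(au - cu)\<^sup>2 + 3 * (av - cv)\<^sup>2 = 3 * (p1 - c1)\<^sup>2 + (p2 - c2)\<^sup>2 + 3 * p3\<^sup>2"
  "(bu - eu)\<^sup>2 + 3 * (av - ev)\<^sup>2 = 3 * (p1 - r1)\<^sup>2 + (p2 + r2)\<^sup>2 + 3 * (p3 + r3)\<^sup>2"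
  subgoal using aa by (simp add: power2_eq_square algebra_simps)
  subgoal unfolding planar_defs using aa aA AA by (simp add: power2_eq_square algebra_simps)
  subgoal unfolding planar_defs using aa aA AA by (simp add: power2_eq_square algebra_simps)
  subgoal unfolding planar_defs using PP DD PD by (simp add: power2_eq_square algebra_simps)
  subgoal unfolding planar_defs using PP DD PD by (simp add: power2_eq_square algebra_simps)
  subgoal unfolding planar_defs using DD by (simp add: power2_eq_square algebra_simps)
  subgoal unfolding planar_defs using ee by (simp add: power2_eq_square algebra_simps)
  subgoal unfolding planar_defs using ee EE MM by (simp add: power2_eq_square algebra_simps)
  subgoal unfolding planar_defs using MM by (simp add: power2_eq_square algebra_simps)
  subgoal using GG gg Gg by (simp add: power2_eq_square algebra_simps)
  subgoal using GG gg Gg by (simp add: power2_eq_square algebra_simps)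
  subgoal using gg by (simp add: power2_eq_square algebra_simps)
  subgoal unfolding planar_defs using aa ac PP DD PD by (simp add: power2_eq_square algebra_simps)
  subgoal unfolding planar_defs using be by (simp add: power2_eq_square algebra_simps)
  done

lemmas edge_simps = label_u_def label_v_def planar_u_def planar_v_def l1u_def l1v_def l2u_def l2v_def planar_defs

text \<open>In the names the first index is the position of the triangle in
  \<open>torus_triangles\<close> and the second its side: first to second, second to third, first to
  third vertex. Every edge vector reduces, up to sign, to one of the 14 in
  \<open>base_lengths\<close>.\<close>

lemma edge_0_0: "(label_u (0, 0, 0) - label_u (5, 0, 0))\<^sup>2 + 3 * (label_v (0, 0, 0) - label_v (5, 0, 0))\<^sup>2 = sqdist 0 5"
proof -
  have u: "label_u (0, 0, 0) - label_u (5, 0, 0) = - fu" "label_v (0, 0, 0) - label_v (5, 0, 0) = - fv"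
    by (simp_all add: edge_simps)
  have s: "sqdist 0 5 = 3 * (0 - r1)\<^sup>2 + (q2 - (- r2))\<^sup>2 + 3 * (q3 - (- r3))\<^sup>2"
    by (simp add: sqdist_def space_def)
  show ?thesis unfolding u s using base_lengths(8) by (simp add: power2_eq_square algebra_simps)
qed

lemma edge_0_1: "(label_u (5, 0, 0) - label_u (4, 0, 0))\<^sup>2 + 3 * (label_v (5, 0, 0) - label_v (4, 0, 0))\<^sup>2 = sqdist 5 4"
proof -
  have u: "label_u (5, 0, 0) - label_u (4, 0, 0) = (Gu - gu)" "label_v (5, 0, 0) - label_v (4, 0, 0) = (Gv - gv)"
    by (simp_all add: edge_simps)
  have s: "sqdist 5 4 = 3 * (r1 - c1)\<^sup>2 + (- r2 - (- c2))\<^sup>2 + 3 * (- r3 - 0)\<^sup>2"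
    by (simp add: sqdist_def space_def)
  show ?thesis unfolding u s using base_lengths(10) by (simp add: power2_eq_square algebra_simps)
qed

lemma edge_0_2: "(label_u (0, 0, 0) - label_u (4, 0, 0))\<^sup>2 + 3 * (label_v (0, 0, 0) - label_v (4, 0, 0))\<^sup>2 = sqdist 0 4"
proof -
  have u: "label_u (0, 0, 0) - label_u (4, 0, 0) = - du" "label_v (0, 0, 0) - label_v (4, 0, 0) = - dv"
    by (simp_all add: edge_simps)
  have s: "sqdist 0 4 = 3 * (0 - c1)\<^sup>2 + (q2 - (- c2))\<^sup>2 + 3 * (q3 - 0)\<^sup>2"
    by (simp add: sqdist_def space_def)
  show ?thesis unfolding u s using base_lengths(5) by (simp add: power2_eq_square algebra_simps)
qed

lemma edge_1_0: "(label_u (0, 0, 0) - label_u (4, 0, 0))\<^sup>2 + 3 * (label_v (0, 0, 0) - label_v (4, 0, 0))\<^sup>2 = sqdist 0 4"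
proof -
  have u: "label_u (0, 0, 0) - label_u (4, 0, 0) = - du" "label_v (0, 0, 0) - label_v (4, 0, 0) = - dv"
    by (simp_all add: edge_simps)
  have s: "sqdist 0 4 = 3 * (0 - c1)\<^sup>2 + (q2 - (- c2))\<^sup>2 + 3 * (q3 - 0)\<^sup>2"
    by (simp add: sqdist_def space_def)
  show ?thesis unfolding u s using base_lengths(5) by (simp add: power2_eq_square algebra_simps)
qed

lemma edge_1_1: "(label_u (4, 0, 0) - label_u (3, 0, 0))\<^sup>2 + 3 * (label_v (4, 0, 0) - label_v (3, 0, 0))\<^sup>2 = sqdist 4 3"
proof -
  have u: "label_u (4, 0, 0) - label_u (3, 0, 0) = cu" "label_v (4, 0, 0) - label_v (3, 0, 0) = cv"
    by (simp_all add: edge_simps)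
  have s: "sqdist 4 3 = 3 * (c1 - 0)\<^sup>2 + (- c2 - (- q2))\<^sup>2 + 3 * (0 - (- q3))\<^sup>2"
    by (simp add: sqdist_def space_def)
  show ?thesis unfolding u s using base_lengths(4) by (simp add: power2_eq_square algebra_simps)
qed

lemma edge_1_2: "(label_u (0, 0, 0) - label_u (3, 0, 0))\<^sup>2 + 3 * (label_v (0, 0, 0) - label_v (3, 0, 0))\<^sup>2 = sqdist 0 3"
proof -
  have u: "label_u (0, 0, 0) - label_u (3, 0, 0) = - (du - cu)" "label_v (0, 0, 0) - label_v (3, 0, 0) = - (dv - cv)"
    by (simp_all add: edge_simps)
  have s: "sqdist 0 3 = 3 * (0 - 0)\<^sup>2 + (q2 - (- q2))\<^sup>2 + 3 * (q3 - (- q3))\<^sup>2"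
    by (simp add: sqdist_def space_def)
  show ?thesis unfolding u s using base_lengths(6) by (simp add: power2_eq_square algebra_simps)
qed

lemma edge_2_0: "(label_u (0, 0, 0) - label_u (3, 0, 0))\<^sup>2 + 3 * (label_v (0, 0, 0) - label_v (3, 0, 0))\<^sup>2 = sqdist 0 3"
proof -
  have u: "label_u (0, 0, 0) - label_u (3, 0, 0) = - (du - cu)" "label_v (0, 0, 0) - label_v (3, 0, 0) = - (dv - cv)"
    by (simp_all add: edge_simps)
  have s: "sqdist 0 3 = 3 * (0 - 0)\<^sup>2 + (q2 - (- q2))\<^sup>2 + 3 * (q3 - (- q3))\<^sup>2"
    by (simp add: sqdist_def space_def)
  show ?thesis unfolding u s using base_lengths(6) by (simp add: power2_eq_square algebra_simps)
qed

lemma edge_2_1: "(label_u (3, 0, 0) - label_u (2, 0, 0))\<^sup>2 + 3 * (label_v (3, 0, 0) - label_v (2, 0, 0))\<^sup>2 = sqdist 3 2"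
proof -
  have u: "label_u (3, 0, 0) - label_u (2, 0, 0) = du" "label_v (3, 0, 0) - label_v (2, 0, 0) = dv"
    by (simp_all add: edge_simps)
  have s: "sqdist 3 2 = 3 * (0 - c1)\<^sup>2 + (- q2 - c2)\<^sup>2 + 3 * (- q3 - 0)\<^sup>2"
    by (simp add: sqdist_def space_def)
  show ?thesis unfolding u s using base_lengths(5) by (simp add: power2_eq_square algebra_simps)
qed

lemma edge_2_2: "(label_u (0, 0, 0) - label_u (2, 0, 0))\<^sup>2 + 3 * (label_v (0, 0, 0) - label_v (2, 0, 0))\<^sup>2 = sqdist 0 2"
proof -
  have u: "label_u (0, 0, 0) - label_u (2, 0, 0) = cu" "label_v (0, 0, 0) - label_v (2, 0, 0) = cv"
    by (simp_all add: edge_simps)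
  have s: "sqdist 0 2 = 3 * (0 - c1)\<^sup>2 + (q2 - c2)\<^sup>2 + 3 * (q3 - 0)\<^sup>2"
    by (simp add: sqdist_def space_def)
  show ?thesis unfolding u s using base_lengths(4) by (simp add: power2_eq_square algebra_simps)
qed

lemma edge_3_0: "(label_u (0, 0, 0) - label_u (2, 0, 0))\<^sup>2 + 3 * (label_v (0, 0, 0) - label_v (2, 0, 0))\<^sup>2 = sqdist 0 2"
proof -
  have u: "label_u (0, 0, 0) - label_u (2, 0, 0) = cu" "label_v (0, 0, 0) - label_v (2, 0, 0) = cv"
    by (simp_all add: edge_simps)
  have s: "sqdist 0 2 = 3 * (0 - c1)\<^sup>2 + (q2 - c2)\<^sup>2 + 3 * (q3 - 0)\<^sup>2"
    by (simp add: sqdist_def space_def)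
  show ?thesis unfolding u s using base_lengths(4) by (simp add: power2_eq_square algebra_simps)
qed

lemma edge_3_1: "(label_u (2, 0, 0) - label_u (1, 0, 0))\<^sup>2 + 3 * (label_v (2, 0, 0) - label_v (1, 0, 0))\<^sup>2 = sqdist 2 1"
proof -
  have u: "label_u (2, 0, 0) - label_u (1, 0, 0) = (au - cu)" "label_v (2, 0, 0) - label_v (1, 0, 0) = (av - cv)"
    by (simp_all add: edge_simps)
  have s: "sqdist 2 1 = 3 * (c1 - p1)\<^sup>2 + (c2 - p2)\<^sup>2 + 3 * (0 - p3)\<^sup>2"
    by (simp add: sqdist_def space_def)
  show ?thesis unfolding u s using base_lengths(13) by (simp add: power2_eq_square algebra_simps)
qed

lemma edge_3_2: "(label_u (0, 0, 0) - label_u (1, 0, 0))\<^sup>2 + 3 * (label_v (0, 0, 0) - label_v (1, 0, 0))\<^sup>2 = sqdist 0 1"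
proof -
  have u: "label_u (0, 0, 0) - label_u (1, 0, 0) = au" "label_v (0, 0, 0) - label_v (1, 0, 0) = av"
    by (simp_all add: edge_simps)
  have s: "sqdist 0 1 = 3 * (0 - p1)\<^sup>2 + (q2 - p2)\<^sup>2 + 3 * (q3 - p3)\<^sup>2"
    by (simp add: sqdist_def space_def)
  show ?thesis unfolding u s using base_lengths(1) by (simp add: power2_eq_square algebra_simps)
qed

lemma edge_4_0: "(label_u (0, 0, 0) - label_u (1, 0, 0))\<^sup>2 + 3 * (label_v (0, 0, 0) - label_v (1, 0, 0))\<^sup>2 = sqdist 0 1"
proof -
  have u: "label_u (0, 0, 0) - label_u (1, 0, 0) = au" "label_v (0, 0, 0) - label_v (1, 0, 0) = av"
    by (simp_all add: edge_simps)
  have s: "sqdist 0 1 = 3 * (0 - p1)\<^sup>2 + (q2 - p2)\<^sup>2 + 3 * (q3 - p3)\<^sup>2"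
    by (simp add: sqdist_def space_def)
  show ?thesis unfolding u s using base_lengths(1) by (simp add: power2_eq_square algebra_simps)
qed

lemma edge_4_1: "(label_u (1, 0, 0) - label_u (7, 0, 0))\<^sup>2 + 3 * (label_v (1, 0, 0) - label_v (7, 0, 0))\<^sup>2 = sqdist 1 7"
proof -
  have u: "label_u (1, 0, 0) - label_u (7, 0, 0) = - (au + bu)" "label_v (1, 0, 0) - label_v (7, 0, 0) = - (av + av)"
    by (simp_all add: edge_simps)
  have s: "sqdist 1 7 = 3 * (p1 - p1)\<^sup>2 + (p2 - (- p2))\<^sup>2 + 3 * (p3 - (- p3))\<^sup>2"
    by (simp add: sqdist_def space_def)
  show ?thesis unfolding u s using base_lengths(3) by (simp add: power2_eq_square algebra_simps)
qed

lemma edge_4_2: "(label_u (0, 0, 0) - label_u (7, 0, 0))\<^sup>2 + 3 * (label_v (0, 0, 0) - label_v (7, 0, 0))\<^sup>2 = sqdist 0 7"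
proof -
  have u: "label_u (0, 0, 0) - label_u (7, 0, 0) = - bu" "label_v (0, 0, 0) - label_v (7, 0, 0) = - av"
    by (simp_all add: edge_simps)
  have s: "sqdist 0 7 = 3 * (0 - p1)\<^sup>2 + (q2 - (- p2))\<^sup>2 + 3 * (q3 - (- p3))\<^sup>2"
    by (simp add: sqdist_def space_def)
  show ?thesis unfolding u s using base_lengths(2) by (simp add: power2_eq_square algebra_simps)
qed

lemma edge_5_0: "(label_u (0, 0, 0) - label_u (7, 0, 0))\<^sup>2 + 3 * (label_v (0, 0, 0) - label_v (7, 0, 0))\<^sup>2 = sqdist 0 7"
proof -
  have u: "label_u (0, 0, 0) - label_u (7, 0, 0) = - bu" "label_v (0, 0, 0) - label_v (7, 0, 0) = - av"
    by (simp_all add: edge_simps)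
  have s: "sqdist 0 7 = 3 * (0 - p1)\<^sup>2 + (q2 - (- p2))\<^sup>2 + 3 * (q3 - (- p3))\<^sup>2"
    by (simp add: sqdist_def space_def)
  show ?thesis unfolding u s using base_lengths(2) by (simp add: power2_eq_square algebra_simps)
qed

lemma edge_5_1: "(label_u (7, 0, 0) - label_u (6, 0, 0))\<^sup>2 + 3 * (label_v (7, 0, 0) - label_v (6, 0, 0))\<^sup>2 = sqdist 7 6"
proof -
  have u: "label_u (7, 0, 0) - label_u (6, 0, 0) = (bu - eu)" "label_v (7, 0, 0) - label_v (6, 0, 0) = (av - ev)"
    by (simp_all add: edge_simps)
  have s: "sqdist 7 6 = 3 * (p1 - r1)\<^sup>2 + (- p2 - r2)\<^sup>2 + 3 * (- p3 - r3)\<^sup>2"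
    by (simp add: sqdist_def space_def)
  show ?thesis unfolding u s using base_lengths(14) by (simp add: power2_eq_square algebra_simps)
qed

lemma edge_5_2: "(label_u (0, 0, 0) - label_u (6, 0, 0))\<^sup>2 + 3 * (label_v (0, 0, 0) - label_v (6, 0, 0))\<^sup>2 = sqdist 0 6"
proof -
  have u: "label_u (0, 0, 0) - label_u (6, 0, 0) = - eu" "label_v (0, 0, 0) - label_v (6, 0, 0) = - ev"
    by (simp_all add: edge_simps)
  have s: "sqdist 0 6 = 3 * (0 - r1)\<^sup>2 + (q2 - r2)\<^sup>2 + 3 * (q3 - r3)\<^sup>2"
    by (simp add: sqdist_def space_def)
  show ?thesis unfolding u s using base_lengths(7) by (simp add: power2_eq_square algebra_simps)
qed

lemma edge_6_0: "(label_u (0, 0, 0) - label_u (6, 0, 0))\<^sup>2 + 3 * (label_v (0, 0, 0) - label_v (6, 0, 0))\<^sup>2 = sqdist 0 6"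
proof -
  have u: "label_u (0, 0, 0) - label_u (6, 0, 0) = - eu" "label_v (0, 0, 0) - label_v (6, 0, 0) = - ev"
    by (simp_all add: edge_simps)
  have s: "sqdist 0 6 = 3 * (0 - r1)\<^sup>2 + (q2 - r2)\<^sup>2 + 3 * (q3 - r3)\<^sup>2"
    by (simp add: sqdist_def space_def)
  show ?thesis unfolding u s using base_lengths(7) by (simp add: power2_eq_square algebra_simps)
qed

lemma edge_6_1: "(label_u (6, 0, 0) - label_u (5, 0, 0))\<^sup>2 + 3 * (label_v (6, 0, 0) - label_v (5, 0, 0))\<^sup>2 = sqdist 6 5"
proof -
  have u: "label_u (6, 0, 0) - label_u (5, 0, 0) = - (fu - eu)" "label_v (6, 0, 0) - label_v (5, 0, 0) = - (fv - ev)"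
    by (simp_all add: edge_simps)
  have s: "sqdist 6 5 = 3 * (r1 - r1)\<^sup>2 + (r2 - (- r2))\<^sup>2 + 3 * (r3 - (- r3))\<^sup>2"
    by (simp add: sqdist_def space_def)
  show ?thesis unfolding u s using base_lengths(9) by (simp add: power2_eq_square algebra_simps)
qed

lemma edge_6_2: "(label_u (0, 0, 0) - label_u (5, 0, 0))\<^sup>2 + 3 * (label_v (0, 0, 0) - label_v (5, 0, 0))\<^sup>2 = sqdist 0 5"
proof -
  have u: "label_u (0, 0, 0) - label_u (5, 0, 0) = - fu" "label_v (0, 0, 0) - label_v (5, 0, 0) = - fv"
    by (simp_all add: edge_simps)
  have s: "sqdist 0 5 = 3 * (0 - r1)\<^sup>2 + (q2 - (- r2))\<^sup>2 + 3 * (q3 - (- r3))\<^sup>2"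
    by (simp add: sqdist_def space_def)
  show ?thesis unfolding u s using base_lengths(8) by (simp add: power2_eq_square algebra_simps)
qed

lemma edge_7_0: "(label_u (1, 0, 0) - label_u (2, 0, 0))\<^sup>2 + 3 * (label_v (1, 0, 0) - label_v (2, 0, 0))\<^sup>2 = sqdist 1 2"
proof -
  have u: "label_u (1, 0, 0) - label_u (2, 0, 0) = - (au - cu)" "label_v (1, 0, 0) - label_v (2, 0, 0) = - (av - cv)"
    by (simp_all add: edge_simps)
  have s: "sqdist 1 2 = 3 * (p1 - c1)\<^sup>2 + (p2 - c2)\<^sup>2 + 3 * (p3 - 0)\<^sup>2"
    by (simp add: sqdist_def space_def)
  show ?thesis unfolding u s using base_lengths(13) by (simp add: power2_eq_square algebra_simps)
qed

lemma edge_7_1: "(label_u (2, 0, 0) - label_u (5, 1, 0))\<^sup>2 + 3 * (label_v (2, 0, 0) - label_v (5, 1, 0))\<^sup>2 = sqdist 2 5"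
proof -
  have u: "label_u (2, 0, 0) - label_u (5, 1, 0) = - (Gu + gu)" "label_v (2, 0, 0) - label_v (5, 1, 0) = - (Gv + gv)"
    by (simp_all add: edge_simps)
  have s: "sqdist 2 5 = 3 * (c1 - r1)\<^sup>2 + (c2 - (- r2))\<^sup>2 + 3 * (0 - (- r3))\<^sup>2"
    by (simp add: sqdist_def space_def)
  show ?thesis unfolding u s using base_lengths(11) by (simp add: power2_eq_square algebra_simps)
qed

lemma edge_7_2: "(label_u (1, 0, 0) - label_u (5, 1, 0))\<^sup>2 + 3 * (label_v (1, 0, 0) - label_v (5, 1, 0))\<^sup>2 = sqdist 1 5"
proof -
  have u: "label_u (1, 0, 0) - label_u (5, 1, 0) = - (bu - eu)" "label_v (1, 0, 0) - label_v (5, 1, 0) = - (av - ev)"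
    by (simp_all add: edge_simps)
  have s: "sqdist 1 5 = 3 * (p1 - r1)\<^sup>2 + (p2 - (- r2))\<^sup>2 + 3 * (p3 - (- r3))\<^sup>2"
    by (simp add: sqdist_def space_def)
  show ?thesis unfolding u s using base_lengths(14) by (simp add: power2_eq_square algebra_simps)
qed

lemma edge_8_0: "(label_u (1, 0, 0) - label_u (5, 1, 0))\<^sup>2 + 3 * (label_v (1, 0, 0) - label_v (5, 1, 0))\<^sup>2 = sqdist 1 5"
proof -
  have u: "label_u (1, 0, 0) - label_u (5, 1, 0) = - (bu - eu)" "label_v (1, 0, 0) - label_v (5, 1, 0) = - (av - ev)"
    by (simp_all add: edge_simps)
  have s: "sqdist 1 5 = 3 * (p1 - r1)\<^sup>2 + (p2 - (- r2))\<^sup>2 + 3 * (p3 - (- r3))\<^sup>2"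
    by (simp add: sqdist_def space_def)
  show ?thesis unfolding u s using base_lengths(14) by (simp add: power2_eq_square algebra_simps)
qed

lemma edge_8_1: "(label_u (5, 1, 0) - label_u (3, 0, 1))\<^sup>2 + 3 * (label_v (5, 1, 0) - label_v (3, 0, 1))\<^sup>2 = sqdist 5 3"
proof -
  have u: "label_u (5, 1, 0) - label_u (3, 0, 1) = - eu" "label_v (5, 1, 0) - label_v (3, 0, 1) = - ev"
    by (simp_all add: edge_simps)
  have s: "sqdist 5 3 = 3 * (r1 - 0)\<^sup>2 + (- r2 - (- q2))\<^sup>2 + 3 * (- r3 - (- q3))\<^sup>2"
    by (simp add: sqdist_def space_def)
  show ?thesis unfolding u s using base_lengths(7) by (simp add: power2_eq_square algebra_simps)
qed

lemma edge_8_2: "(label_u (1, 0, 0) - label_u (3, 0, 1))\<^sup>2 + 3 * (label_v (1, 0, 0) - label_v (3, 0, 1))\<^sup>2 = sqdist 1 3"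
proof -
  have u: "label_u (1, 0, 0) - label_u (3, 0, 1) = - bu" "label_v (1, 0, 0) - label_v (3, 0, 1) = - av"
    by (simp_all add: edge_simps)
  have s: "sqdist 1 3 = 3 * (p1 - 0)\<^sup>2 + (p2 - (- q2))\<^sup>2 + 3 * (p3 - (- q3))\<^sup>2"
    by (simp add: sqdist_def space_def)
  show ?thesis unfolding u s using base_lengths(2) by (simp add: power2_eq_square algebra_simps)
qed

lemma edge_9_0: "(label_u (2, 0, 0) - label_u (4, 1, 0))\<^sup>2 + 3 * (label_v (2, 0, 0) - label_v (4, 1, 0))\<^sup>2 = sqdist 2 4"
proof -
  have u: "label_u (2, 0, 0) - label_u (4, 1, 0) = - (2 * gu)" "label_v (2, 0, 0) - label_v (4, 1, 0) = - (2 * gv)"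
    by (simp_all add: edge_simps)
  have s: "sqdist 2 4 = 3 * (c1 - c1)\<^sup>2 + (c2 - (- c2))\<^sup>2 + 3 * (0 - 0)\<^sup>2"
    by (simp add: sqdist_def space_def)
  show ?thesis unfolding u s using base_lengths(12) by (simp add: power2_eq_square algebra_simps)
qed

lemma edge_9_1: "(label_u (4, 1, 0) - label_u (5, 1, 0))\<^sup>2 + 3 * (label_v (4, 1, 0) - label_v (5, 1, 0))\<^sup>2 = sqdist 4 5"
proof -
  have u: "label_u (4, 1, 0) - label_u (5, 1, 0) = - (Gu - gu)" "label_v (4, 1, 0) - label_v (5, 1, 0) = - (Gv - gv)"
    by (simp_all add: edge_simps)
  have s: "sqdist 4 5 = 3 * (c1 - r1)\<^sup>2 + (- c2 - (- r2))\<^sup>2 + 3 * (0 - (- r3))\<^sup>2"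
    by (simp add: sqdist_def space_def)
  show ?thesis unfolding u s using base_lengths(10) by (simp add: power2_eq_square algebra_simps)
qed

lemma edge_9_2: "(label_u (2, 0, 0) - label_u (5, 1, 0))\<^sup>2 + 3 * (label_v (2, 0, 0) - label_v (5, 1, 0))\<^sup>2 = sqdist 2 5"
proof -
  have u: "label_u (2, 0, 0) - label_u (5, 1, 0) = - (Gu + gu)" "label_v (2, 0, 0) - label_v (5, 1, 0) = - (Gv + gv)"
    by (simp_all add: edge_simps)
  have s: "sqdist 2 5 = 3 * (c1 - r1)\<^sup>2 + (c2 - (- r2))\<^sup>2 + 3 * (0 - (- r3))\<^sup>2"
    by (simp add: sqdist_def space_def)
  show ?thesis unfolding u s using base_lengths(11) by (simp add: power2_eq_square algebra_simps)
qed

lemma edge_10_0: "(label_u (3, 0, 0) - label_u (4, 0, 0))\<^sup>2 + 3 * (label_v (3, 0, 0) - label_v (4, 0, 0))\<^sup>2 = sqdist 3 4"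
proof -
  have u: "label_u (3, 0, 0) - label_u (4, 0, 0) = - cu" "label_v (3, 0, 0) - label_v (4, 0, 0) = - cv"
    by (simp_all add: edge_simps)
  have s: "sqdist 3 4 = 3 * (0 - c1)\<^sup>2 + (- q2 - (- c2))\<^sup>2 + 3 * (- q3 - 0)\<^sup>2"
    by (simp add: sqdist_def space_def)
  show ?thesis unfolding u s using base_lengths(4) by (simp add: power2_eq_square algebra_simps)
qed

lemma edge_10_1: "(label_u (4, 0, 0) - label_u (7, 0, -1))\<^sup>2 + 3 * (label_v (4, 0, 0) - label_v (7, 0, -1))\<^sup>2 = sqdist 4 7"
proof -
  have u: "label_u (4, 0, 0) - label_u (7, 0, -1) = - (au - cu)" "label_v (4, 0, 0) - label_v (7, 0, -1) = - (av - cv)"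
    by (simp_all add: edge_simps)
  have s: "sqdist 4 7 = 3 * (c1 - p1)\<^sup>2 + (- c2 - (- p2))\<^sup>2 + 3 * (0 - (- p3))\<^sup>2"
    by (simp add: sqdist_def space_def)
  show ?thesis unfolding u s using base_lengths(13) by (simp add: power2_eq_square algebra_simps)
qed

lemma edge_10_2: "(label_u (3, 0, 0) - label_u (7, 0, -1))\<^sup>2 + 3 * (label_v (3, 0, 0) - label_v (7, 0, -1))\<^sup>2 = sqdist 3 7"
proof -
  have u: "label_u (3, 0, 0) - label_u (7, 0, -1) = - au" "label_v (3, 0, 0) - label_v (7, 0, -1) = - av"
    by (simp_all add: edge_simps)
  have s: "sqdist 3 7 = 3 * (0 - p1)\<^sup>2 + (- q2 - (- p2))\<^sup>2 + 3 * (- q3 - (- p3))\<^sup>2"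
    by (simp add: sqdist_def space_def)
  show ?thesis unfolding u s using base_lengths(1) by (simp add: power2_eq_square algebra_simps)
qed

lemma edge_11_0: "(label_u (3, 0, 0) - label_u (7, 0, -1))\<^sup>2 + 3 * (label_v (3, 0, 0) - label_v (7, 0, -1))\<^sup>2 = sqdist 3 7"
proof -
  have u: "label_u (3, 0, 0) - label_u (7, 0, -1) = - au" "label_v (3, 0, 0) - label_v (7, 0, -1) = - av"
    by (simp_all add: edge_simps)
  have s: "sqdist 3 7 = 3 * (0 - p1)\<^sup>2 + (- q2 - (- p2))\<^sup>2 + 3 * (- q3 - (- p3))\<^sup>2"
    by (simp add: sqdist_def space_def)
  show ?thesis unfolding u s using base_lengths(1) by (simp add: power2_eq_square algebra_simps)
qed

lemma edge_11_1: "(label_u (7, 0, -1) - label_u (1, 0, -1))\<^sup>2 + 3 * (label_v (7, 0, -1) - label_v (1, 0, -1))\<^sup>2 = sqdist 7 1"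
proof -
  have u: "label_u (7, 0, -1) - label_u (1, 0, -1) = (au + bu)" "label_v (7, 0, -1) - label_v (1, 0, -1) = (av + av)"
    by (simp_all add: edge_simps)
  have s: "sqdist 7 1 = 3 * (p1 - p1)\<^sup>2 + (- p2 - p2)\<^sup>2 + 3 * (- p3 - p3)\<^sup>2"
    by (simp add: sqdist_def space_def)
  show ?thesis unfolding u s using base_lengths(3) by (simp add: power2_eq_square algebra_simps)
qed

lemma edge_11_2: "(label_u (3, 0, 0) - label_u (1, 0, -1))\<^sup>2 + 3 * (label_v (3, 0, 0) - label_v (1, 0, -1))\<^sup>2 = sqdist 3 1"
proof -
  have u: "label_u (3, 0, 0) - label_u (1, 0, -1) = bu" "label_v (3, 0, 0) - label_v (1, 0, -1) = av"
    by (simp_all add: edge_simps)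
  have s: "sqdist 3 1 = 3 * (0 - p1)\<^sup>2 + (- q2 - p2)\<^sup>2 + 3 * (- q3 - p3)\<^sup>2"
    by (simp add: sqdist_def space_def)
  show ?thesis unfolding u s using base_lengths(2) by (simp add: power2_eq_square algebra_simps)
qed

lemma edge_12_0: "(label_u (7, 0, -1) - label_u (4, 0, 0))\<^sup>2 + 3 * (label_v (7, 0, -1) - label_v (4, 0, 0))\<^sup>2 = sqdist 7 4"
proof -
  have u: "label_u (7, 0, -1) - label_u (4, 0, 0) = (au - cu)" "label_v (7, 0, -1) - label_v (4, 0, 0) = (av - cv)"
    by (simp_all add: edge_simps)
  have s: "sqdist 7 4 = 3 * (p1 - c1)\<^sup>2 + (- p2 - (- c2))\<^sup>2 + 3 * (- p3 - 0)\<^sup>2"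
    by (simp add: sqdist_def space_def)
  show ?thesis unfolding u s using base_lengths(13) by (simp add: power2_eq_square algebra_simps)
qed

lemma edge_12_1: "(label_u (4, 0, 0) - label_u (6, 0, -1))\<^sup>2 + 3 * (label_v (4, 0, 0) - label_v (6, 0, -1))\<^sup>2 = sqdist 4 6"
proof -
  have u: "label_u (4, 0, 0) - label_u (6, 0, -1) = (Gu + gu)" "label_v (4, 0, 0) - label_v (6, 0, -1) = (Gv + gv)"
    by (simp_all add: edge_simps)
  have s: "sqdist 4 6 = 3 * (c1 - r1)\<^sup>2 + (- c2 - r2)\<^sup>2 + 3 * (0 - r3)\<^sup>2"
    by (simp add: sqdist_def space_def)
  show ?thesis unfolding u s using base_lengths(11) by (simp add: power2_eq_square algebra_simps)
qed

lemma edge_12_2: "(label_u (7, 0, -1) - label_u (6, 0, -1))\<^sup>2 + 3 * (label_v (7, 0, -1) - label_v (6, 0, -1))\<^sup>2 = sqdist 7 6"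
proof -
  have u: "label_u (7, 0, -1) - label_u (6, 0, -1) = (bu - eu)" "label_v (7, 0, -1) - label_v (6, 0, -1) = (av - ev)"
    by (simp_all add: edge_simps)
  have s: "sqdist 7 6 = 3 * (p1 - r1)\<^sup>2 + (- p2 - r2)\<^sup>2 + 3 * (- p3 - r3)\<^sup>2"
    by (simp add: sqdist_def space_def)
  show ?thesis unfolding u s using base_lengths(14) by (simp add: power2_eq_square algebra_simps)
qed

lemma edge_13_0: "(label_u (3, 0, 0) - label_u (5, 1, -1))\<^sup>2 + 3 * (label_v (3, 0, 0) - label_v (5, 1, -1))\<^sup>2 = sqdist 3 5"
proof -
  have u: "label_u (3, 0, 0) - label_u (5, 1, -1) = eu" "label_v (3, 0, 0) - label_v (5, 1, -1) = ev"
    by (simp_all add: edge_simps)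
  have s: "sqdist 3 5 = 3 * (0 - r1)\<^sup>2 + (- q2 - (- r2))\<^sup>2 + 3 * (- q3 - (- r3))\<^sup>2"
    by (simp add: sqdist_def space_def)
  show ?thesis unfolding u s using base_lengths(7) by (simp add: power2_eq_square algebra_simps)
qed

lemma edge_13_1: "(label_u (5, 1, -1) - label_u (6, 1, -1))\<^sup>2 + 3 * (label_v (5, 1, -1) - label_v (6, 1, -1))\<^sup>2 = sqdist 5 6"
proof -
  have u: "label_u (5, 1, -1) - label_u (6, 1, -1) = (fu - eu)" "label_v (5, 1, -1) - label_v (6, 1, -1) = (fv - ev)"
    by (simp_all add: edge_simps)
  have s: "sqdist 5 6 = 3 * (r1 - r1)\<^sup>2 + (- r2 - r2)\<^sup>2 + 3 * (- r3 - r3)\<^sup>2"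
    by (simp add: sqdist_def space_def)
  show ?thesis unfolding u s using base_lengths(9) by (simp add: power2_eq_square algebra_simps)
qed

lemma edge_13_2: "(label_u (3, 0, 0) - label_u (6, 1, -1))\<^sup>2 + 3 * (label_v (3, 0, 0) - label_v (6, 1, -1))\<^sup>2 = sqdist 3 6"
proof -
  have u: "label_u (3, 0, 0) - label_u (6, 1, -1) = fu" "label_v (3, 0, 0) - label_v (6, 1, -1) = fv"
    by (simp_all add: edge_simps)
  have s: "sqdist 3 6 = 3 * (0 - r1)\<^sup>2 + (- q2 - r2)\<^sup>2 + 3 * (- q3 - r3)\<^sup>2"
    by (simp add: sqdist_def space_def)
  show ?thesis unfolding u s using base_lengths(8) by (simp add: power2_eq_square algebra_simps)
qed

lemma edge_14_0: "(label_u (3, 0, 0) - label_u (6, 1, -1))\<^sup>2 + 3 * (label_v (3, 0, 0) - label_v (6, 1, -1))\<^sup>2 = sqdist 3 6"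
proof -
  have u: "label_u (3, 0, 0) - label_u (6, 1, -1) = fu" "label_v (3, 0, 0) - label_v (6, 1, -1) = fv"
    by (simp_all add: edge_simps)
  have s: "sqdist 3 6 = 3 * (0 - r1)\<^sup>2 + (- q2 - r2)\<^sup>2 + 3 * (- q3 - r3)\<^sup>2"
    by (simp add: sqdist_def space_def)
  show ?thesis unfolding u s using base_lengths(8) by (simp add: power2_eq_square algebra_simps)
qed

lemma edge_14_1: "(label_u (6, 1, -1) - label_u (2, 0, 0))\<^sup>2 + 3 * (label_v (6, 1, -1) - label_v (2, 0, 0))\<^sup>2 = sqdist 6 2"
proof -
  have u: "label_u (6, 1, -1) - label_u (2, 0, 0) = - (Gu - gu)" "label_v (6, 1, -1) - label_v (2, 0, 0) = - (Gv - gv)"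
    by (simp_all add: edge_simps)
  have s: "sqdist 6 2 = 3 * (r1 - c1)\<^sup>2 + (r2 - c2)\<^sup>2 + 3 * (r3 - 0)\<^sup>2"
    by (simp add: sqdist_def space_def)
  show ?thesis unfolding u s using base_lengths(10) by (simp add: power2_eq_square algebra_simps)
qed

lemma edge_14_2: "(label_u (3, 0, 0) - label_u (2, 0, 0))\<^sup>2 + 3 * (label_v (3, 0, 0) - label_v (2, 0, 0))\<^sup>2 = sqdist 3 2"
proof -
  have u: "label_u (3, 0, 0) - label_u (2, 0, 0) = du" "label_v (3, 0, 0) - label_v (2, 0, 0) = dv"
    by (simp_all add: edge_simps)
  have s: "sqdist 3 2 = 3 * (0 - c1)\<^sup>2 + (- q2 - c2)\<^sup>2 + 3 * (- q3 - 0)\<^sup>2"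
    by (simp add: sqdist_def space_def)
  show ?thesis unfolding u s using base_lengths(5) by (simp add: power2_eq_square algebra_simps)
qed

lemma edge_15_0: "(label_u (4, 0, 0) - label_u (2, -1, 0))\<^sup>2 + 3 * (label_v (4, 0, 0) - label_v (2, -1, 0))\<^sup>2 = sqdist 4 2"
proof -
  have u: "label_u (4, 0, 0) - label_u (2, -1, 0) = (2 * gu)" "label_v (4, 0, 0) - label_v (2, -1, 0) = (2 * gv)"
    by (simp_all add: edge_simps)
  have s: "sqdist 4 2 = 3 * (c1 - c1)\<^sup>2 + (- c2 - c2)\<^sup>2 + 3 * (0 - 0)\<^sup>2"
    by (simp add: sqdist_def space_def)
  show ?thesis unfolding u s using base_lengths(12) by (simp add: power2_eq_square algebra_simps)
qed

lemma edge_15_1: "(label_u (2, -1, 0) - label_u (6, 0, -1))\<^sup>2 + 3 * (label_v (2, -1, 0) - label_v (6, 0, -1))\<^sup>2 = sqdist 2 6"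
proof -
  have u: "label_u (2, -1, 0) - label_u (6, 0, -1) = (Gu - gu)" "label_v (2, -1, 0) - label_v (6, 0, -1) = (Gv - gv)"
    by (simp_all add: edge_simps)
  have s: "sqdist 2 6 = 3 * (c1 - r1)\<^sup>2 + (c2 - r2)\<^sup>2 + 3 * (0 - r3)\<^sup>2"
    by (simp add: sqdist_def space_def)
  show ?thesis unfolding u s using base_lengths(10) by (simp add: power2_eq_square algebra_simps)
qed

lemma edge_15_2: "(label_u (4, 0, 0) - label_u (6, 0, -1))\<^sup>2 + 3 * (label_v (4, 0, 0) - label_v (6, 0, -1))\<^sup>2 = sqdist 4 6"
proof -
  have u: "label_u (4, 0, 0) - label_u (6, 0, -1) = (Gu + gu)" "label_v (4, 0, 0) - label_v (6, 0, -1) = (Gv + gv)"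
    by (simp_all add: edge_simps)
  have s: "sqdist 4 6 = 3 * (c1 - r1)\<^sup>2 + (- c2 - r2)\<^sup>2 + 3 * (0 - r3)\<^sup>2"
    by (simp add: sqdist_def space_def)
  show ?thesis unfolding u s using base_lengths(11) by (simp add: power2_eq_square algebra_simps)
qed

lemma edge_lengths:
  assumes "(p, q, r) \<in> set torus_triangles"
  shows "(label_u p - label_u q)\<^sup>2 + 3 * (label_v p - label_v q)\<^sup>2 = sqdist (fst p) (fst q) \<and>
    (label_u q - label_u r)\<^sup>2 + 3 * (label_v q - label_v r)\<^sup>2 = sqdist (fst q) (fst r) \<and>
    (label_u p - label_u r)\<^sup>2 + 3 * (label_v p - label_v r)\<^sup>2 = sqdist (fst p) (fst r)"
proof -
  have "list_all (\<lambda>(p, q, r). (label_u p - label_u q)\<^sup>2 + 3 * (label_v p - label_v q)\<^sup>2 = sqdist (fst p) (fst q) \<and>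
    (label_u q - label_u r)\<^sup>2 + 3 * (label_v q - label_v r)\<^sup>2 = sqdist (fst q) (fst r) \<and>
    (label_u p - label_u r)\<^sup>2 + 3 * (label_v p - label_v r)\<^sup>2 = sqdist (fst p) (fst r)) torus_triangles"
    unfolding torus_triangles_def
    by (simp only: list.pred_inject prod.case fst_conv simp_thms
      edge_0_0 edge_0_1 edge_0_2 edge_1_0 edge_1_1 edge_1_2 edge_2_0 edge_2_1 
      edge_2_2 edge_3_0 edge_3_1 edge_3_2 edge_4_0 edge_4_1 edge_4_2 edge_5_0 
      edge_5_1 edge_5_2 edge_6_0 edge_6_1 edge_6_2 edge_7_0 edge_7_1 edge_7_2 
      edge_8_0 edge_8_1 edge_8_2 edge_9_0 edge_9_1 edge_9_2 edge_10_0 edge_10_1 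
      edge_10_2 edge_11_0 edge_11_1 edge_11_2 edge_12_0 edge_12_1 edge_12_2 edge_13_0 
      edge_13_1 edge_13_2 edge_14_0 edge_14_1 edge_14_2 edge_15_0 edge_15_1 edge_15_2)
  from this[unfolded list_all_iff, rule_format, OF assms] show ?thesis by simp
qed

text \<open>The boundary terms of the sixteen triangles cancel in pairs, up to the lattice
  translations that match them; what remains depends only on the generators.\<close>

lemma area_identity:
  "(\<Sum>t\<leftarrow>torus_triangles. label_orient t) = 2 * (l1u * l2v - l1v * l2u)"
proof -
  note defs = label_orient_def label_u_def label_v_def planar_u_def planar_v_def
  \<comment> \<open>With the generators as independent variables, the definitions become linear
    relations that eliminate four of the positions and leave a polynomial identity.\<close>
  obtain L1u L1v L2u L2v where l: "l1u = L1u" "l1v = L1v" "l2u = L2u" "l2v = L2v" by blast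
  have b: "bu = L2u + au + du - cu" "fu = bu - au - eu - L1u" "dv = cv - L2v" "fv = - ev - L1v"
    using l by (simp_all add: l1u_def l1v_def l2u_def l2v_def)
  show ?thesis unfolding torus_triangles_def
    by (simp add: defs l b) (simp add: algebra_simps)
qed

end

section \<open>From signs of volumes to a paper torus\<close>

lemma vol_perm:
  "vol x i j k = - vol i j k x" "vol i x j k = vol i j k x" "vol i j x k = - vol i j k x"
  by (simp_all add: vol_def algebra_simps)

text \<open>Agrees with \<open>vp\<close> of the locale, but is meaningful before the generators are
  known to span a lattice and can be quantified over.\<close>

definition lvp :: "complex \<Rightarrow> complex \<Rightarrow> (nat \<Rightarrow> complex) \<Rightarrow> lvertex \<Rightarrow> complex" where
  "lvp u v pos x = pos (fst x) + (of_int (fst (snd x)) *\<^sub>R u + of_int (snd (snd x)) *\<^sub>R v)"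

context folded_data
begin

lemma vol_f: "vol (f i) (f j) (f k) (f l) = 3 * norm kap ^ 3 * vol3 (space i) (space j) (space k) (space l)"
  unfolding f_def
  by (cases "space i"; cases "space j"; cases "space k"; cases "space l") (simp only: vol_point3 prod.case)

text \<open>The parity in \<open>side\<close> cancels against the antisymmetry of
  \<open>vol\<close>, leaving the sign of the sorted quadruple.\<close>

lemma side_sign:
  assumes signs: "\<And>i j k l s. ((i, j, k, l), s) \<in> set volume_signs \<Longrightarrow> 0 < of_int s * vol3 (space i) (space j) (space k) (space l)"
    and ne: "side i j k x \<noteq> 0"
  shows "0 < of_int (side i j k x) * vol (f i) (f j) (f k) (f x)"
proof -
  have look: "0 < of_int (look_sign (a, b, c, d)) * vol (f a) (f b) (f c) (f d)" if nz: "look_sign (a, b, c, d) \<noteq> 0" for a b c d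
  proof -
    obtain s where s: "map_of volume_signs (a, b, c, d) = Some s"
      using nz by (cases "map_of volume_signs (a, b, c, d)") auto
    then have "0 < of_int s * vol3 (space a) (space b) (space c) (space d)"
      using signs map_of_SomeD by fast
    then have "0 < 3 * norm kap ^ 3 * (of_int s * vol3 (space a) (space b) (space c) (space d))"
      using norm_kap(1) by simp
    then show ?thesis using s by (simp add: vol_f ac_simps)
  qed
  show ?thesis
    using ne look[of x i j k] look[of i x j k] look[of i j x k] look[of i j k x]
      vol_perm(1)[of "f x" "f i" "f j" "f k"] vol_perm(2)[of "f i" "f x" "f j" "f k"] vol_perm(3)[of "f i" "f j" "f x" "f k"]
    unfolding side_def by (auto simp del: look_sign.simps split: if_splits)
qed

text \<open>Row \<open>a\<close> of \<open>separators\<close> starts with the pair of triangle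
  \<open>a\<close> with itself, hence the index \<open>b - a\<close> and the restriction to
  \<open>a \<le> b\<close>; the other order follows by exchanging \<open>G\<close> and
  \<open>G'\<close>.\<close>

lemma embedded_le:
  assumes signs: "\<And>i j k l s. ((i, j, k, l), s) \<in> set volume_signs \<Longrightarrow> 0 < of_int s * vol3 (space i) (space j) (space k) (space l)"
    and ab: "a \<le> b" "b < 16"
    and A: "A = fst ` set (corners (torus_triangles ! a))" and B: "B = fst ` set (corners (torus_triangles ! b))"
    and G: "\<And>i. 0 \<le> G i" "\<And>i. i \<notin> A \<Longrightarrow> G i = 0" "(\<Sum>i\<in>A. G i) = 1"
    and G': "\<And>i. 0 \<le> G' i" "\<And>i. i \<notin> B \<Longrightarrow> G' i = 0" "(\<Sum>i\<in>B. G' i) = 1"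
    and eq: "(\<Sum>i\<in>A. G i *\<^sub>R f i) = (\<Sum>i\<in>B. G' i *\<^sub>R f i)"
  shows "G = G'"
proof -
  obtain i j k s where c: "separators ! a ! (b - a) = (i, j, k, s)" by (cases "separators ! a ! (b - a)") blast
  have "a \<in> set [0..<16]" "b \<in> set [0..<16]" using ab by auto
  from separators_check[unfolded list_all_iff, rule_format, OF this ab(1)]
  have "separates (map fst (corners (torus_triangles ! a))) (map fst (corners (torus_triangles ! b))) (i, j, k, s)"
    unfolding c .
  then have *: "i < j" "j < k" "\<And>x. x \<in> A \<Longrightarrow> x = i \<or> x = j \<or> x = k \<or> 0 < s * side i j k x"
    "\<And>x. x \<in> B \<Longrightarrow> x = i \<or> x = j \<or> x = k \<or> s * side i j k x < 0"
    "\<exists>x. x \<noteq> i \<and> x \<noteq> j \<and> x \<noteq> k \<and> side i j k x \<noteq> 0"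
    unfolding separates.simps list_all_iff list_ex_iff A B set_map by blast+
  obtain l where "side i j k l \<noteq> 0" using *(5) by blast
  then have vn: "vol (f i) (f j) (f k) (f l) \<noteq> 0" using side_sign[OF signs] by force
  have sA: "0 < of_int s * vol (f i) (f j) (f k) (f x)" if "x \<in> A" "x \<notin> {i, j, k}" for x
  proof -
    have p: "0 < s * side i j k x" using *(3)[OF that(1)] that(2) by blast
    then have "0 < of_int (side i j k x) * vol (f i) (f j) (f k) (f x)" using side_sign[OF signs] by force
    moreover have "0 < (of_int s :: real) * of_int (side i j k x)" using p by (simp flip: of_int_mult)
    ultimately show ?thesis by (auto simp: zero_less_mult_iff)
  qed
  have sB: "of_int s * vol (f i) (f j) (f k) (f x) < 0" if "x \<in> B" "x \<notin> {i, j, k}" for x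
  proof -
    have p: "s * side i j k x < 0" using *(4)[OF that(1)] that(2) by blast
    then have "0 < of_int (side i j k x) * vol (f i) (f j) (f k) (f x)" using side_sign[OF signs] by force
    moreover have "(of_int s :: real) * of_int (side i j k x) < 0" using p by (simp flip: of_int_mult)
    ultimately show ?thesis by (auto simp: zero_less_mult_iff mult_less_0_iff)
  qed
  have fin: "finite A" "finite B" by (simp_all add: A B)
  show ?thesis
    by (rule separated_weights[OF fin G G' eq _ _ _ vn sA sB]) (use *(1,2) in auto)
qed

lemma paper_torus_folded:
  assumes signs: "\<And>i j k l s. ((i, j, k, l), s) \<in> set volume_signs \<Longrightarrow> 0 < of_int s * vol3 (space i) (space j) (space k) (space l)"
    and o: "\<And>t. t \<in> set torus_triangles \<Longrightarrow> 0 < label_orient t"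
  shows "\<exists>\<phi>. orient 0 (point2 l1u l1v) (point2 l2u l2v) > 0 \<and>
    paper_torus 8 (lattice_span (point2 l1u l1v) (point2 l2u l2v)) \<phi> \<and>
    (\<forall>z. \<exists>p q r x y w m n. (p, q, r) \<in> set torus_triangles \<and> 0 \<le> x \<and> 0 \<le> y \<and> 0 \<le> w \<and> x + y + w = 1 \<and>
      z = x *\<^sub>R lvp (point2 l1u l1v) (point2 l2u l2v) pos p + y *\<^sub>R lvp (point2 l1u l1v) (point2 l2u l2v) pos q +
        w *\<^sub>R lvp (point2 l1u l1v) (point2 l2u l2v) pos r + (of_int m *\<^sub>R point2 l1u l1v + of_int n *\<^sub>R point2 l2u l2v) \<and>
      \<phi> (torus_proj (lattice_span (point2 l1u l1v) (point2 l2u l2v)) z) = x *\<^sub>R f (fst p) + y *\<^sub>R f (fst q) + w *\<^sub>R f (fst r))"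
proof -
  let ?u = "point2 l1u l1v" and ?v = "point2 l2u l2v"
  have k: "0 < (norm kap)\<^sup>2 * sqrt 3" using norm_kap(1) by simp
  have o3: "orient 0 ?u ?v = (norm kap)\<^sup>2 * sqrt 3 * (l1u * l2v - l1v * l2u)"
    using orient_point2[of 0 0 l1u l1v l2u l2v] by (simp add: point2_def zero_complex.code[symmetric])
  have vp: "lvp ?u ?v pos x = point2 (label_u x) (label_v x)" for x
    by (simp add: lvp_def pos_def point2_def label_u_def label_v_def complex_eq_iff algebra_simps)
  \<comment> \<open>By \<open>area_identity\<close> the positive orientation of the triangles
    implies that of the generators, which must be known before the torus locales apply.\<close>
  have "0 \<le> (\<Sum>t\<leftarrow>torus_triangles. label_orient t)"
    using o by (intro sum_list_nonneg) (auto intro: less_imp_le)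
  moreover have "(\<Sum>t\<leftarrow>torus_triangles. label_orient t) = label_orient (hd torus_triangles) + (\<Sum>t\<leftarrow>tl torus_triangles. label_orient t)"
    by (simp add: torus_triangles_def)
  moreover have "0 \<le> (\<Sum>t\<leftarrow>tl torus_triangles. label_orient t)"
    using o by (intro sum_list_nonneg) (auto simp: torus_triangles_def intro: less_imp_le)
  moreover have "0 < label_orient (hd torus_triangles)" by (rule o) (simp add: torus_triangles_def)
  ultimately have "0 < (\<Sum>t\<leftarrow>torus_triangles. label_orient t)" by linarith
  then have pos2: "0 < l1u * l2v - l1v * l2u" by (simp add: area_identity)
  interpret TC: torus_complex ?u ?v pos 8 torus_triangles
    by unfold_locales (use o3 k pos2 simplicial_torus_triangles in \<open>auto simp: simplicial_torus_def\<close>)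
  have vpT: "TC.vp x = point2 (label_u x) (label_v x)" for x
    using vp[of x] by (simp add: TC.vp_def lvp_def TC.lat_def)
  have orT: "orient (TC.vp p) (TC.vp q) (TC.vp r) = (norm kap)\<^sup>2 * sqrt 3 * label_orient (p, q, r)" for p q r
    by (simp add: vpT orient_point2 label_orient_def)
  interpret T: simplicial_tiling ?u ?v pos 8 torus_triangles
  proof (unfold_locales)
    show "0 < orient (TC.vp p) (TC.vp q) (TC.vp r)" if "(p, q, r) \<in> set torus_triangles" for p q r
      unfolding orT using o[OF that] k by simp
    have "(\<Sum>t\<leftarrow>torus_triangles. case t of (p, q, r) \<Rightarrow> orient (TC.vp p) (TC.vp q) (TC.vp r)) =
        (\<Sum>t\<leftarrow>torus_triangles. (norm kap)\<^sup>2 * sqrt 3 * label_orient t)"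
      by (intro arg_cong[where f = sum_list] map_cong refl) (auto simp: orT)
    then show "(\<Sum>t\<leftarrow>torus_triangles. case t of (p, q, r) \<Rightarrow> orient (TC.vp p) (TC.vp q) (TC.vp r)) = 2 * orient 0 ?u ?v"
      by (simp add: sum_list_const_mult area_identity o3)
    show "simplicial_torus 8 torus_triangles" by (rule simplicial_torus_triangles)
  qed
  have "embedding_map (torus_topology T.\<Lambda>) euclidean (T.torus_map f)"
  proof (rule T.embedding_torus_map)
    fix t t' G G'
    assume *: "t \<in> set torus_triangles" "t' \<in> set torus_triangles" "\<And>i. 0 \<le> G i" "\<And>i. 0 \<le> G' i"
      "\<And>i. i \<notin> fst ` set (corners t) \<Longrightarrow> G i = 0" "\<And>i. i \<notin> fst ` set (corners t') \<Longrightarrow> G' i = 0"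
      "(\<Sum>i\<in>fst ` set (corners t). G i) = 1" "(\<Sum>i\<in>fst ` set (corners t'). G' i) = 1"
      "(\<Sum>i\<in>fst ` set (corners t). G i *\<^sub>R f i) = (\<Sum>i\<in>fst ` set (corners t'). G' i *\<^sub>R f i)"
    have len: "length torus_triangles = 16" by (simp add: torus_triangles_def)
    obtain a where a: "a < 16" "t = torus_triangles ! a" using *(1) len by (auto simp: in_set_conv_nth)
    obtain b where b: "b < 16" "t' = torus_triangles ! b" using *(2) len by (auto simp: in_set_conv_nth)
    show "G = G'"
    proof (cases "a \<le> b")
      case True
      show ?thesis by (rule embedded_le[OF signs True b(1) refl refl]) (use * a(2) b(2) in auto)
    next
      case False
      then have "b \<le> a" by simp
      have "G' = G" by (rule embedded_le[OF signs \<open>b \<le> a\<close> a(1) refl refl]) (use * a(2) b(2) in auto)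
      then show ?thesis by simp
    qed
  qed
  moreover have "isometric_on_triangles T.\<Lambda> (T.tile ` set torus_triangles) (T.torus_map f)"
  proof (rule T.isometric_torus_map)
    fix p q r assume t: "(p, q, r) \<in> set torus_triangles"
    have sd: "dist (f i) (f j) = norm kap * sqrt (sqdist i j)" for i j
      by (cases "space i"; cases "space j") (simp add: f_def sqdist_def dist_point3)
    show "dist (f (fst p)) (f (fst q)) = dist (TC.vp p) (TC.vp q) \<and>
      dist (f (fst q)) (f (fst r)) = dist (TC.vp q) (TC.vp r) \<and> dist (f (fst p)) (f (fst r)) = dist (TC.vp p) (TC.vp r)"
      using edge_lengths[OF t] by (simp add: vpT sd dist_point2)
  qed
  ultimately have "paper_torus 8 T.\<Lambda> (T.torus_map f)"
    unfolding paper_torus_def using T.planar_lattice T.triangulation T.card_vertices by blast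
  moreover have "\<exists>p q r x y w m n. (p, q, r) \<in> set torus_triangles \<and> 0 \<le> x \<and> 0 \<le> y \<and> 0 \<le> w \<and> x + y + w = 1 \<and>
      z = x *\<^sub>R lvp ?u ?v pos p + y *\<^sub>R lvp ?u ?v pos q + w *\<^sub>R lvp ?u ?v pos r + (of_int m *\<^sub>R ?u + of_int n *\<^sub>R ?v) \<and>
      T.torus_map f (torus_proj T.\<Lambda> z) = x *\<^sub>R f (fst p) + y *\<^sub>R f (fst q) + w *\<^sub>R f (fst r)" for z
  proof -
    obtain t s where ts: "t \<in> set torus_triangles" "z - TC.lat s \<in> T.tile t" using T.obtain_tile .
    obtain p q r where pqr: "t = (p, q, r)" by (cases t)
    obtain x y w where xyw: "0 \<le> x" "0 \<le> y" "0 \<le> w" "x + y + w = 1" "z - TC.lat s = x *\<^sub>R TC.vp p + y *\<^sub>R TC.vp q + w *\<^sub>R TC.vp r"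
      using ts(2) unfolding pqr T.tile.simps convex_hull_3 by blast
    have "T.torus_map f (torus_proj T.\<Lambda> z) = T.plane_map f (z - TC.lat s)"
      using T.plane_map_shift[of f "z - TC.lat s" s] by (simp add: T.torus_map_proj)
    also have "\<dots> = x *\<^sub>R f (fst p) + y *\<^sub>R f (fst q) + w *\<^sub>R f (fst r)"
      unfolding xyw(5) by (rule T.plane_map_vertex_sum) (use xyw ts(1) pqr TC.Ts_in in auto)
    finally show ?thesis
      using xyw ts(1) pqr vp vpT
      by (intro exI[of _ p] exI[of _ q] exI[of _ r] exI[of _ x] exI[of _ y] exI[of _ w] exI[of _ "fst s"] exI[of _ "snd s"])
        (simp add: TC.lat_def algebra_simps)
  qed
  ultimately show ?thesis using TC.lattice_pos by blast
qed

end

section \<open>The length equations as a perturbed system\<close>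

text \<open>The lowest coefficients in \<open>e\<close> of the 14 equations of
  \<open>folded_data\<close>, in that order, under the substitution of
  \<open>folded_equations\<close>. They occur at the powers 2, 3, 4, 1, 2, 1, 1, 1, 1, 2, 1, 1, 2, 1
  of \<open>e\<close>. All components are affine except the third, the fifth and the tenth, which
  are quadratic.\<close>

definition leading :: "real \<times> real \<times> real \<times> real \<times> real \<times> real \<times> real \<times> real \<times> real \<times> real \<times> real \<times> real \<times> real \<times> real \<Rightarrow>
    real \<times> real \<times> real \<times> real \<times> real \<times> real \<times> real \<times> real \<times> real \<times> real \<times> real \<times> real \<times> real \<times> real" where
  "leading = (\<lambda>(l, m, w, a, d1, d2, e1, e2, h1, h2, g1, g2, x, c).
    (- 3 + 2 * l,
     9 + m + 9 * l,
     - 27 - 3 * a^2 + 3 * w^2 + 18 * m,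
     3 * d2 + d1,
     - 256 + 3 * h2^2 + h1^2,
     - 6 * c - 3 * h2 + 3 * h1 - 3 * e2 + 3 * e1,
     16 + 3/2 * h2 + 1/2 * h1 + 3/2 * e2 + 1/2 * e1 - 3/2 * d2 + 3/2 * d1,
     - 3 * e2 + e1,
     10 - 3 * g2 + g1 - 3 * d2 + d1,
     - 73 - 3 * x^2 + 3 * g2^2 + g1^2 - 6 * e2 * g2 + 3 * e2^2 - 2 * e1 * g1 + e1^2 + 6 * d2 * g2 - 6 * d2 * e2 + 3 * d2^2 + 2 * d1 * g1 - 2 * d1 * e1 + d1^2,
     10 - 6 * c - 6 * x - 6 * g2 - 2 * g1,
     16 - 3 * h2 - h1,
     - 144 + 9 * h1 + 9 * e1 - 9 * d1 - 3 * a - 3 * w,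
     20 - 4 * g1 + 4 * e1 - 4 * d1))"

text \<open>What is left of each equation after subtracting the leading coefficient, divided by a
  further \<open>e\<close>. The fifth entry is 0 because \<open>gu\<close>, \<open>gv\<close> and
  \<open>c2\<close> are exact multiples of \<open>e\<close>.\<close>

definition higher :: "(real \<times> real \<times> real \<times> real \<times> real \<times> real \<times> real \<times> real \<times> real \<times> real \<times> real \<times> real \<times> real \<times> real) \<times> real \<Rightarrow>
    real \<times> real \<times> real \<times> real \<times> real \<times> real \<times> real \<times> real \<times> real \<times> real \<times> real \<times> real \<times> real \<times> real" where
  "higher = (\<lambda>((l, m, w, a, d1, d2, e1, e2, h1, h2, g1, g2, x, c), e).
    (- 3 * e * a^2 + e * l^2,
     - 3 * a^2 + e * l * m,
     e * m^2,
     - 3 + 3 * d2^2 + d1^2,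
     0,
     - 256 - 3 * c^2 + 3 * h2^2 + h1^2 + 6 * e2 * h2 + 3 * e2^2 + 2 * e1 * h1 + e1^2 + 3 * l + 2 * e
     * l * h1 + 2 * e * l * e1 + e^2 * l^2,
     3 * d2 * h2 + 3 * d2 * e2 + d1 * h1 + d1 * e1 + 1/2 * l + e * l * d1,
     - 3 - 3 * x^2 + 3 * e2^2 + e1^2,
     - 52 + 3 * g2^2 + g1^2 + 6 * d2 * g2 + 3 * d2^2 + 2 * d1 * g1 + d1^2 + l + 2 * e * l * g1 + 2 *
     e * l * d1 + e^2 * l^2,
     2 * l * g1 - 2 * l * e1 + 2 * l * d1 + e * l^2,
     - 52 - 3 * c^2 - 6 * x * c - 3 * x^2 + 3 * g2^2 + g1^2,
     - 80 + 3 * h2 * g2 + h1 * g1,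
     9 - 3 * a * c + 3 * w * h2 + 3 * w * e2 - 3 * w * d2 + m + 9 * l + e * m * h1 + e * m * e1 - e *
     m * d1 + e^2 * l * m,
     - 127 - 3 * x^2 + 3 * g2^2 + 18 * g1 + g1^2 - 6 * e2 * g2 + 3 * e2^2 - 18 * e1 - 2 * e1 * g1 +
     e1^2 + 6 * d2 * g2 - 6 * d2 * e2 + 3 * d2^2 + 18 * d1 + 2 * d1 * g1 - 2 * d1 * e1 + d1^2 + 4 * l
     + 36 * e - 6 * e * a * x + 6 * e * w * g2 - 6 * e * w * e2 + 6 * e * w * d2 - 4 * e * m - 18 * e
     * l - 2 * e * l * g1 + 2 * e * l * e1 - 2 * e * l * d1 - 27 * e^2 - 3 * e^2 * a^2 + 3 * e^2 *
     w^2 + 18 * e^2 * m + 2 * e^2 * m * g1 - 2 * e^2 * m * e1 + 2 * e^2 * m * d1 + e^2 * l^2 - 2 *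
     e^3 * l * m + e^4 * m^2))"

text \<open>The Jacobian at the zero chosen in \<open>has_derivative_leading\<close>: for instance
  \<open>-120\<close> and \<open>96\<close> are \<open>6 w\<close> and \<open>- 6 a\<close> at
  \<open>w = -20\<close>, \<open>a = -16\<close>.\<close>

definition leading_deriv :: "real \<times> real \<times> real \<times> real \<times> real \<times> real \<times> real \<times> real \<times> real \<times> real \<times> real \<times> real \<times> real \<times> real \<Rightarrow>
    real \<times> real \<times> real \<times> real \<times> real \<times> real \<times> real \<times> real \<times> real \<times> real \<times> real \<times> real \<times> real \<times> real" where
  "leading_deriv = (\<lambda>(l, m, w, a, d1, d2, e1, e2, h1, h2, g1, g2, x, c).
    (2 * l,
     9 * l + m,
     18 * m - 120 * w + 96 * a,
     d1 + 3 * d2,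
     - 16 * h1 + 48 * h2,
     3 * e1 - 3 * e2 + 3 * h1 - 3 * h2 - 6 * c,
     3/2 * d1 - 3/2 * d2 + 1/2 * e1 + 3/2 * e2 + 1/2 * h1 + 3/2 * h2,
     e1 - 3 * e2,
     d1 - 3 * d2 + g1 - 3 * g2,
     10 * d1 + 30 * d2 - 10 * e1 - 30 * e2 + 10 * g1 + 30 * g2 - 18 * x,
     - 2 * g1 - 6 * g2 - 6 * x - 6 * c,
     - h1 - 3 * h2,
     - 3 * w - 3 * a - 9 * d1 + 9 * e1 + 9 * h1,
     - 4 * d1 + 4 * e1 - 4 * g1))"

lemma tuple14:
  obtains l m w a d1 d2 e1 e2 h1 h2 g1 g2 x c where "X = (l, m, w, a, d1, d2, e1, e2, h1, h2, g1, g2, x, c)"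
proof -
  have "X = (fst (X), fst (snd (X)), fst (snd (snd (X))), fst (snd (snd (snd (X)))), fst (snd (snd (snd (snd (X))))), fst (snd (snd (snd (snd (snd (X)))))), fst (snd (snd (snd (snd (snd (snd (X))))))), fst (snd (snd (snd (snd (snd (snd (snd (X)))))))), fst (snd (snd (snd (snd (snd (snd (snd (snd (X))))))))), fst (snd (snd (snd (snd (snd (snd (snd (snd (snd (X)))))))))), fst (snd (snd (snd (snd (snd (snd (snd (snd (snd (snd (X))))))))))), fst (snd (snd (snd (snd (snd (snd (snd (snd (snd (snd (snd (X)))))))))))), fst (snd (snd (snd (snd (snd (snd (snd (snd (snd (snd (snd (snd (X))))))))))))), snd (snd (snd (snd (snd (snd (snd (snd (snd (snd (snd (snd (snd (X))))))))))))))"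
    by simp
  then show thesis by (rule that)
qed

lemma has_derivative_leading: "(leading has_derivative leading_deriv) (at (3/2, -45/2, -20, -16, -12, 4, 0, 0, -8, 8, 17, 1, 3, -8))"
  unfolding leading_def leading_deriv_def case_prod_beta
  by (intro has_derivative_Pair; (auto intro!: derivative_eq_intros)[1])

lemma inj_leading_deriv: "inj leading_deriv"
proof -
  have "linear leading_deriv"
    using has_derivative_leading has_derivative_linear by blast
  moreover have "X = 0" if "leading_deriv X = 0" for X
  proof -
    obtain l m w a d1 d2 e1 e2 h1 h2 g1 g2 x c where X: "X = (l, m, w, a, d1, d2, e1, e2, h1, h2, g1, g2, x, c)" by (rule tuple14)
    show ?thesis using that unfolding X leading_deriv_def zero_prod_def prod.case prod.inject
      by (intro conjI; linarith)
  qed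
  ultimately show ?thesis by (simp add: linear_injective_0)
qed

lemma continuous_leading: "continuous_on UNIV leading"
  unfolding leading_def case_prod_beta by (intro continuous_intros)

lemma continuous_higher: "continuous_on UNIV higher"
  unfolding higher_def case_prod_beta by (intro continuous_intros)

text \<open>The strict inequalities are 35 volumes and 8 areas with their power of \<open>e\<close>
  divided out, followed by the 20 deviations from the limit. The half-turn accounts for the numbers:
  59 volumes share 35 polynomials, and 16 triangles share 8. All conditions are open, so they
  persist near the zero of the leading system.\<close>

lemma exists_folded:
  assumes "\<eta> > 0"
  shows "\<exists>l m w a d1 d2 e1 e2 h1 h2 g1 g2 x c e. e > 0 \<and> leading (l, m, w, a, d1, d2, e1, e2, h1, h2, g1, g2, x, c) + e *\<^sub>R higher ((l, m, w, a, d1, d2, e1, e2, h1, h2, g1, g2, x, c), e) = 0 \<and>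
    0 < 24 + 24 * e * c - 32 * e^2 * a \<and>
    0 < 12 + 15 * e + 12 * e * c - 12 * e * x - 4 * e * a + 15 * e^2 * c - 48 * e^2 * x - 27 * e^2 *
     a \<and>
    0 < 24 + 24 * e * c - 56 * e^2 * a - 96 * e^3 * a \<and>
    0 < 24 + 24 * e * c + 32 * e^2 * a \<and>
    0 < - 24 * x - 8 * a + 10 * e * a \<and>
    0 < - 48 * a \<and>
    0 < 12 + 15 * e + 12 * e * c - 12 * e * x - 4 * e * a + 15 * e^2 * c + 48 * e^2 * x + 37 * e^2 *
     a \<and>
    0 < 48 * x + 8 * a + 30 * e * x - 10 * e * a \<and>
    0 < - 24 * x - 8 * a + 34 * e * a + 30 * e^2 * a \<and>
    0 < 24 * x - 8 * a + 82 * e * a + 30 * e^2 * a \<and>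
    0 < 64 + 64 * e * c \<and>
    0 < 8 - 10 * e + 8 * e * c - 10 * e^2 * c - 32 * e^2 * x \<and>
    0 < 64 + 64 * e * c - 32 * e * x \<and>
    0 < 128 + 128 * e * c + 32 * e * x \<and>
    0 < 64 + 96 * e + 64 * e * c + 96 * e^2 * c - 32 * e^2 * a \<and>
    0 < 8 - 10 * e + 8 * e * c + 8 * e * x - 10 * e^2 * c + 86 * e^2 * x \<and>
    0 < 8 - 46 * e + 8 * e * c - 15 * e^2 - 46 * e^2 * c - 44 * e^2 * x - 4 * e^2 * a - 15 * e^3 * c
     - 48 * e^3 * x - 59 * e^3 * a \<and>
    0 < 8 - 10 * e + 8 * e * c - 10 * e^2 * c + 32 * e^2 * x \<and>
    0 < 16 * x - 20 * e * x \<and>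
    0 < 8 - 10 * e + 8 * e * c + 8 * e * x - 10 * e^2 * c - 106 * e^2 * x \<and>
    0 < 8 - 22 * e + 8 * e * c - 15 * e^2 - 22 * e^2 * c - 20 * e^2 * x - 4 * e^2 * a - 15 * e^3 * c
     - 48 * e^3 * x + 37 * e^3 * a \<and>
    0 < 8 - 46 * e + 8 * e * c - 15 * e^2 - 46 * e^2 * c + 20 * e^2 * x - 4 * e^2 * a - 15 * e^3 * c
     + 48 * e^3 * x + 69 * e^3 * a \<and>
    0 < 16 * x - 68 * e * x + 8 * e * a - 30 * e^2 * x - 10 * e^2 * a \<and>
    0 < 24 + 24 * e * c + 8 * e^2 * a + 96 * e^3 * a \<and>
    0 < 64 - 96 * e + 64 * e * c - 32 * e * x - 96 * e^2 * c - 96 * e^2 * x - 96 * e^2 * a \<and>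
    0 < 128 + 96 * e + 128 * e * c + 32 * e * x + 96 * e^2 * c + 96 * e^2 * x - 96 * e^2 * a \<and>
    0 < 64 + 192 * e + 64 * e * c + 192 * e^2 * c - 64 * e^2 * a - 192 * e^3 * a \<and>
    0 < 8 - 58 * e + 8 * e * c + 8 * e * x - 30 * e^2 - 58 * e^2 * c + 38 * e^2 * x - 30 * e^3 * c -
     30 * e^3 * x + 96 * e^3 * a \<and>
    0 < 8 - 58 * e + 8 * e * c - 30 * e^2 - 58 * e^2 * c + 32 * e^2 * x - 8 * e^2 * a - 30 * e^3 * c
     + 96 * e^3 * x + 90 * e^3 * a + 126 * e^4 * a \<and>
    0 < 8 - 58 * e + 8 * e * c - 30 * e^2 - 58 * e^2 * c - 32 * e^2 * x - 8 * e^2 * a - 30 * e^3 * c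
     - 96 * e^3 * x + 26 * e^3 * a - 66 * e^4 * a \<and>
    0 < 8 - 22 * e + 8 * e * c - 15 * e^2 - 22 * e^2 * c + 44 * e^2 * x - 4 * e^2 * a - 15 * e^3 * c
     + 48 * e^3 * x - 27 * e^3 * a \<and>
    0 < 16 * x - 116 * e * x + 16 * e * a - 60 * e^2 * x - 116 * e^2 * a - 60 * e^3 * a \<and>
    0 < 96 + 96 * e * c + 32 * e * a \<and>
    0 < 192 + 192 * e * c + 192 * e * x \<and>
    0 < 36 + 15 * e + 36 * e * c + 12 * e * x - 4 * e * a + 15 * e^2 * c + 48 * e^2 * x - 59 * e^2 *
     a \<and>
    0 < 2 - 2 * e * g2 + e * h2 + e * h1 - e * e2 + e * e1 - e * d2 + e * d1 + e^2 * h2 * g1 - e^2 *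
     h1 * g2 + e^2 * e2 * g1 - e^2 * e2 * h1 - e^2 * e1 * g2 + e^2 * e1 * h2 + e^2 * d2 * g1 - e^2 *
     d2 * h1 - e^2 * d1 * g2 + e^2 * d1 * h2 + e^2 * l - e^3 * l * g2 + e^3 * l * h2 \<and>
    0 < 2 - e * h2 + e * h1 - e * e2 + e * e1 + 3 * e * d2 + e * d1 + 2 * e^2 * d2 * h1 + 2 * e^2 *
     d2 * e1 - 2 * e^2 * d1 * h2 - 2 * e^2 * d1 * e2 + e^2 * l + 2 * e^3 * l * d2 \<and>
    0 < 9 - 9 * e * h2 - 9 * e * e2 + 9 * e * d2 + e * w + e^2 * w * h1 + e^2 * w * e1 - e^2 * w *
     d1 + e^2 * m - e^3 * m * h2 - e^3 * m * e2 + e^3 * m * d2 + e^3 * l * w \<and>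
    0 < - 2 * w - 2 * e^2 * l * w \<and>
    0 < 2 * g2 - 2 * e2 + 2 * d2 - 9 * e * g2 + 9 * e * e2 - 9 * e * d2 + e^2 * w * g1 - e^2 * w *
     e1 + e^2 * w * d1 + 2 * e^2 * l * g2 - 2 * e^2 * l * e2 + 2 * e^2 * l * d2 - e^3 * m * g2 + e^3
     * m * e2 - e^3 * m * d2 + e^3 * l * w \<and>
    0 < g2 + g1 - e2 - e1 + d2 + d1 - 2 * e * e2 * g1 + 2 * e * e1 * g2 + 2 * e * d2 * e1 - 2 * e *
     d1 * e2 + e * l - 2 * e^2 * l * e2 \<and>
    0 < 2 - 9 * e - e * g2 - e * g1 - 2 * e * h2 - e * e2 + e * e1 + e * d2 - e * d1 + 9 * e^2 * g2
     + 9 * e^2 * h2 + e^2 * h2 * g1 - e^2 * h1 * g2 + e^2 * e2 * g1 + e^2 * e2 * h1 - e^2 * e1 * g2 -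
     e^2 * e1 * h2 - e^2 * d2 * g1 - e^2 * d2 * h1 + e^2 * d1 * g2 + e^2 * d1 * h2 + e^2 * w + e^2 *
     l - e^3 * w * g1 - e^3 * w * h1 - e^3 * m - e^3 * l * g2 - e^3 * l * h2 + e^4 * m * g2 + e^4 * m
     * h2 \<and>
    0 < 2 * h2 - 2 * h1 - 2 * e * h2 * g1 + 2 * e * h1 * g2 \<and>
    \<bar>e^2 * l\<bar> < \<eta> \<and>
    \<bar>9 * e + e^3 * m\<bar> < \<eta> \<and>
    \<bar>e^2 * w\<bar> < \<eta> \<and>
    \<bar>e * d1\<bar> < \<eta> \<and>
    \<bar>e * d2\<bar> < \<eta> \<and>
    \<bar>e * e1\<bar> < \<eta> \<and>
    \<bar>e * e2\<bar> < \<eta> \<and>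
    \<bar>e * h1\<bar> < \<eta> \<and>
    \<bar>e * h2\<bar> < \<eta> \<and>
    \<bar>e * g1\<bar> < \<eta> \<and>
    \<bar>e * g2\<bar> < \<eta> \<and>
    \<bar>e\<bar> < \<eta> \<and>
    \<bar>e^2 * a\<bar> < \<eta> \<and>
    \<bar>- 9 * e\<bar> < \<eta> \<and>
    \<bar>e + 3 * e^2\<bar> < \<eta> \<and>
    \<bar>- e * x\<bar> < \<eta> \<and>
    \<bar>- 5 * e\<bar> < \<eta> \<and>
    \<bar>- 3 * e\<bar> < \<eta> \<and>
    \<bar>e * c\<bar> < \<eta> \<and>
    \<bar>- 16 * e\<bar> < \<eta>"
proof -
  define T where "T = {((l, m, w, a, d1, d2, e1, e2, h1, h2, g1, g2, x, c), e).
    0 < 24 + 24 * e * c - 32 * e^2 * a \<and>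
    0 < 12 + 15 * e + 12 * e * c - 12 * e * x - 4 * e * a + 15 * e^2 * c - 48 * e^2 * x - 27 * e^2 *
     a \<and>
    0 < 24 + 24 * e * c - 56 * e^2 * a - 96 * e^3 * a \<and>
    0 < 24 + 24 * e * c + 32 * e^2 * a \<and>
    0 < - 24 * x - 8 * a + 10 * e * a \<and>
    0 < - 48 * a \<and>
    0 < 12 + 15 * e + 12 * e * c - 12 * e * x - 4 * e * a + 15 * e^2 * c + 48 * e^2 * x + 37 * e^2 *
     a \<and>
    0 < 48 * x + 8 * a + 30 * e * x - 10 * e * a \<and>
    0 < - 24 * x - 8 * a + 34 * e * a + 30 * e^2 * a \<and>
    0 < 24 * x - 8 * a + 82 * e * a + 30 * e^2 * a \<and>
    0 < 64 + 64 * e * c \<and>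
    0 < 8 - 10 * e + 8 * e * c - 10 * e^2 * c - 32 * e^2 * x \<and>
    0 < 64 + 64 * e * c - 32 * e * x \<and>
    0 < 128 + 128 * e * c + 32 * e * x \<and>
    0 < 64 + 96 * e + 64 * e * c + 96 * e^2 * c - 32 * e^2 * a \<and>
    0 < 8 - 10 * e + 8 * e * c + 8 * e * x - 10 * e^2 * c + 86 * e^2 * x \<and>
    0 < 8 - 46 * e + 8 * e * c - 15 * e^2 - 46 * e^2 * c - 44 * e^2 * x - 4 * e^2 * a - 15 * e^3 * c
     - 48 * e^3 * x - 59 * e^3 * a \<and>
    0 < 8 - 10 * e + 8 * e * c - 10 * e^2 * c + 32 * e^2 * x \<and>
    0 < 16 * x - 20 * e * x \<and>
    0 < 8 - 10 * e + 8 * e * c + 8 * e * x - 10 * e^2 * c - 106 * e^2 * x \<and>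
    0 < 8 - 22 * e + 8 * e * c - 15 * e^2 - 22 * e^2 * c - 20 * e^2 * x - 4 * e^2 * a - 15 * e^3 * c
     - 48 * e^3 * x + 37 * e^3 * a \<and>
    0 < 8 - 46 * e + 8 * e * c - 15 * e^2 - 46 * e^2 * c + 20 * e^2 * x - 4 * e^2 * a - 15 * e^3 * c
     + 48 * e^3 * x + 69 * e^3 * a \<and>
    0 < 16 * x - 68 * e * x + 8 * e * a - 30 * e^2 * x - 10 * e^2 * a \<and>
    0 < 24 + 24 * e * c + 8 * e^2 * a + 96 * e^3 * a \<and>
    0 < 64 - 96 * e + 64 * e * c - 32 * e * x - 96 * e^2 * c - 96 * e^2 * x - 96 * e^2 * a \<and>
    0 < 128 + 96 * e + 128 * e * c + 32 * e * x + 96 * e^2 * c + 96 * e^2 * x - 96 * e^2 * a \<and>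
    0 < 64 + 192 * e + 64 * e * c + 192 * e^2 * c - 64 * e^2 * a - 192 * e^3 * a \<and>
    0 < 8 - 58 * e + 8 * e * c + 8 * e * x - 30 * e^2 - 58 * e^2 * c + 38 * e^2 * x - 30 * e^3 * c -
     30 * e^3 * x + 96 * e^3 * a \<and>
    0 < 8 - 58 * e + 8 * e * c - 30 * e^2 - 58 * e^2 * c + 32 * e^2 * x - 8 * e^2 * a - 30 * e^3 * c
     + 96 * e^3 * x + 90 * e^3 * a + 126 * e^4 * a \<and>
    0 < 8 - 58 * e + 8 * e * c - 30 * e^2 - 58 * e^2 * c - 32 * e^2 * x - 8 * e^2 * a - 30 * e^3 * c
     - 96 * e^3 * x + 26 * e^3 * a - 66 * e^4 * a \<and>
    0 < 8 - 22 * e + 8 * e * c - 15 * e^2 - 22 * e^2 * c + 44 * e^2 * x - 4 * e^2 * a - 15 * e^3 * c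
     + 48 * e^3 * x - 27 * e^3 * a \<and>
    0 < 16 * x - 116 * e * x + 16 * e * a - 60 * e^2 * x - 116 * e^2 * a - 60 * e^3 * a \<and>
    0 < 96 + 96 * e * c + 32 * e * a \<and>
    0 < 192 + 192 * e * c + 192 * e * x \<and>
    0 < 36 + 15 * e + 36 * e * c + 12 * e * x - 4 * e * a + 15 * e^2 * c + 48 * e^2 * x - 59 * e^2 *
     a \<and>
    0 < 2 - 2 * e * g2 + e * h2 + e * h1 - e * e2 + e * e1 - e * d2 + e * d1 + e^2 * h2 * g1 - e^2 *
     h1 * g2 + e^2 * e2 * g1 - e^2 * e2 * h1 - e^2 * e1 * g2 + e^2 * e1 * h2 + e^2 * d2 * g1 - e^2 *
     d2 * h1 - e^2 * d1 * g2 + e^2 * d1 * h2 + e^2 * l - e^3 * l * g2 + e^3 * l * h2 \<and>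
    0 < 2 - e * h2 + e * h1 - e * e2 + e * e1 + 3 * e * d2 + e * d1 + 2 * e^2 * d2 * h1 + 2 * e^2 *
     d2 * e1 - 2 * e^2 * d1 * h2 - 2 * e^2 * d1 * e2 + e^2 * l + 2 * e^3 * l * d2 \<and>
    0 < 9 - 9 * e * h2 - 9 * e * e2 + 9 * e * d2 + e * w + e^2 * w * h1 + e^2 * w * e1 - e^2 * w *
     d1 + e^2 * m - e^3 * m * h2 - e^3 * m * e2 + e^3 * m * d2 + e^3 * l * w \<and>
    0 < - 2 * w - 2 * e^2 * l * w \<and>
    0 < 2 * g2 - 2 * e2 + 2 * d2 - 9 * e * g2 + 9 * e * e2 - 9 * e * d2 + e^2 * w * g1 - e^2 * w *
     e1 + e^2 * w * d1 + 2 * e^2 * l * g2 - 2 * e^2 * l * e2 + 2 * e^2 * l * d2 - e^3 * m * g2 + e^3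
     * m * e2 - e^3 * m * d2 + e^3 * l * w \<and>
    0 < g2 + g1 - e2 - e1 + d2 + d1 - 2 * e * e2 * g1 + 2 * e * e1 * g2 + 2 * e * d2 * e1 - 2 * e *
     d1 * e2 + e * l - 2 * e^2 * l * e2 \<and>
    0 < 2 - 9 * e - e * g2 - e * g1 - 2 * e * h2 - e * e2 + e * e1 + e * d2 - e * d1 + 9 * e^2 * g2
     + 9 * e^2 * h2 + e^2 * h2 * g1 - e^2 * h1 * g2 + e^2 * e2 * g1 + e^2 * e2 * h1 - e^2 * e1 * g2 -
     e^2 * e1 * h2 - e^2 * d2 * g1 - e^2 * d2 * h1 + e^2 * d1 * g2 + e^2 * d1 * h2 + e^2 * w + e^2 *
     l - e^3 * w * g1 - e^3 * w * h1 - e^3 * m - e^3 * l * g2 - e^3 * l * h2 + e^4 * m * g2 + e^4 * m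
     * h2 \<and>
    0 < 2 * h2 - 2 * h1 - 2 * e * h2 * g1 + 2 * e * h1 * g2 \<and>
    \<bar>e^2 * l\<bar> < \<eta> \<and>
    \<bar>9 * e + e^3 * m\<bar> < \<eta> \<and>
    \<bar>e^2 * w\<bar> < \<eta> \<and>
    \<bar>e * d1\<bar> < \<eta> \<and>
    \<bar>e * d2\<bar> < \<eta> \<and>
    \<bar>e * e1\<bar> < \<eta> \<and>
    \<bar>e * e2\<bar> < \<eta> \<and>
    \<bar>e * h1\<bar> < \<eta> \<and>
    \<bar>e * h2\<bar> < \<eta> \<and>
    \<bar>e * g1\<bar> < \<eta> \<and>
    \<bar>e * g2\<bar> < \<eta> \<and>
    \<bar>e\<bar> < \<eta> \<and>
    \<bar>e^2 * a\<bar> < \<eta> \<and>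
    \<bar>- 9 * e\<bar> < \<eta> \<and>
    \<bar>e + 3 * e^2\<bar> < \<eta> \<and>
    \<bar>- e * x\<bar> < \<eta> \<and>
    \<bar>- 5 * e\<bar> < \<eta> \<and>
    \<bar>- 3 * e\<bar> < \<eta> \<and>
    \<bar>e * c\<bar> < \<eta> \<and>
    \<bar>- 16 * e\<bar> < \<eta>}"
  have "open T"
    unfolding T_def case_prod_beta
    by (intro open_Collect_conj open_Collect_less continuous_intros)
  \<comment> \<open>At \<open>e = 0\<close> only the leading coefficients of the volumes and areas
    survive, and the deviations vanish.\<close>
  moreover have "((3/2, -45/2, -20, -16, -12, 4, 0, 0, -8, 8, 17, 1, 3, -8), 0) \<in> T"
    using assms by (simp add: T_def)
  moreover have "leading (3/2, -45/2, -20, -16, -12, 4, 0, 0, -8, 8, 17, 1, 3, -8) = 0"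
    by (simp add: leading_def zero_prod_def)
  ultimately have "\<forall>\<^sub>F e in at_right 0. \<exists>X. (X, e) \<in> T \<and> leading X + e *\<^sub>R higher (X, e) = 0"
    using perturbed_zero[OF has_derivative_leading inj_leading_deriv _ continuous_leading continuous_higher] by blast
  then have "\<forall>\<^sub>F e in at_right 0. e > (0 :: real) \<and> (\<exists>X. (X, e) \<in> T \<and> leading X + e *\<^sub>R higher (X, e) = 0)"
    by (intro eventually_conj eventually_at_right_less)
  then obtain e X where e: "e > (0 :: real)" "(X, e) \<in> T" "leading X + e *\<^sub>R higher (X, e) = 0"
    using eventually_happens'[OF trivial_limit_at_right_real] by blast
  obtain l m w a d1 d2 e1 e2 h1 h2 g1 g2 x c where X: "X = (l, m, w, a, d1, d2, e1, e2, h1, h2, g1, g2, x, c)" by (rule tuple14)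
  show ?thesis
    using e unfolding X T_def mem_Collect_eq prod.case by blast
qed

text \<open>Each of the fourteen unknowns corrects one parameter at a chosen power of
  \<open>e\<close>; \<open>q2\<close>, \<open>q3\<close>, \<open>p2\<close>, \<open>p3\<close>,
  \<open>r2\<close>, \<open>r3\<close> and \<open>c2\<close> are prescribed.\<close>

lemma folded_equations:
  fixes l m w a d1 d2 e1 e2 h1 h2 g1 g2 x c e :: real
  assumes al: "al = 1 + e^2 * l"
  and au: "au = 9 * e + e^3 * m"
  and av: "av = e^2 * w"
  and Du: "Du = 1/2 + e * d1"
  and Dv: "Dv = 1/2 + e * d2"
  and Eu: "Eu = 1/2 + e * e1"
  and Ev: "Ev = - 1/2 + e * e2"
  and gu: "gu = e * h1"
  and gv: "gv = e * h2"
  and Gu: "Gu = - 1 + e * g1"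
  and Gv: "Gv = - 1 + e * g2"
  and q2: "q2 = 1"
  and q3: "q3 = e"
  and p1: "p1 = e^2 * a"
  and p2: "p2 = 1 - 9 * e"
  and p3: "p3 = e + 3 * e^2"
  and r1: "r1 = - e * x"
  and r2: "r2 = 1 - 5 * e"
  and r3: "r3 = - 3 * e"
  and c1: "c1 = 1 + e * c"
  and c2: "c2 = - 16 * e"
    and zero: "leading (l, m, w, a, d1, d2, e1, e2, h1, h2, g1, g2, x, c) + e *\<^sub>R higher ((l, m, w, a, d1, d2, e1, e2, h1, h2, g1, g2, x, c), e) = 0"
  shows "folded_data al au av Du Dv Eu Ev gu gv Gu Gv q2 q3 p1 p2 p3 r1 r2 r3 c1 c2"
proof -
  note defs = al au av Du Dv Eu Ev gu gv Gu Gv q2 q3 p1 p2 p3 r1 r2 r3 c1 c2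
  have z: "- 3 + 2 * l + e * (- 3 * e * a^2 + e * l^2) = 0"
    "9 + m + 9 * l + e * (- 3 * a^2 + e * l * m) = 0"
    "- 27 - 3 * a^2 + 3 * w^2 + 18 * m + e * (e * m^2) = 0"
    "3 * d2 + d1 + e * (- 3 + 3 * d2^2 + d1^2) = 0"
    "- 256 + 3 * h2^2 + h1^2 + e * (0) = 0"
    "- 6 * c - 3 * h2 + 3 * h1 - 3 * e2 + 3 * e1 + e * (- 256 - 3 * c^2 + 3 * h2^2 + h1^2 + 6 * e2 * h2 + 3 * e2^2 + 2 * e1 * h1 + e1^2 + 3 * l + 2 * e
     * l * h1 + 2 * e * l * e1 + e^2 * l^2) = 0"
    "16 + 3/2 * h2 + 1/2 * h1 + 3/2 * e2 + 1/2 * e1 - 3/2 * d2 + 3/2 * d1 + e * (3 * d2 * h2 + 3 * d2 * e2 + d1 * h1 + d1 * e1 + 1/2 * l + e * l * d1) = 0"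
    "- 3 * e2 + e1 + e * (- 3 - 3 * x^2 + 3 * e2^2 + e1^2) = 0"
    "10 - 3 * g2 + g1 - 3 * d2 + d1 + e * (- 52 + 3 * g2^2 + g1^2 + 6 * d2 * g2 + 3 * d2^2 + 2 * d1 * g1 + d1^2 + l + 2 * e * l * g1 + 2 *
     e * l * d1 + e^2 * l^2) = 0"
    "- 73 - 3 * x^2 + 3 * g2^2 + g1^2 - 6 * e2 * g2 + 3 * e2^2 - 2 * e1 * g1 + e1^2 + 6 * d2 * g2 - 6 * d2 * e2 + 3 * d2^2 + 2 * d1 * g1 - 2 * d1 * e1 + d1^2 + e * (2 * l * g1 - 2 * l * e1 + 2 * l * d1 + e * l^2) = 0"
    "10 - 6 * c - 6 * x - 6 * g2 - 2 * g1 + e * (- 52 - 3 * c^2 - 6 * x * c - 3 * x^2 + 3 * g2^2 + g1^2) = 0"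
    "16 - 3 * h2 - h1 + e * (- 80 + 3 * h2 * g2 + h1 * g1) = 0"
    "- 144 + 9 * h1 + 9 * e1 - 9 * d1 - 3 * a - 3 * w + e * (9 - 3 * a * c + 3 * w * h2 + 3 * w * e2 - 3 * w * d2 + m + 9 * l + e * m * h1 + e * m * e1 - e *
     m * d1 + e^2 * l * m) = 0"
    "20 - 4 * g1 + 4 * e1 - 4 * d1 + e * (- 127 - 3 * x^2 + 3 * g2^2 + 18 * g1 + g1^2 - 6 * e2 * g2 + 3 * e2^2 - 18 * e1 - 2 * e1 * g1 +
     e1^2 + 6 * d2 * g2 - 6 * d2 * e2 + 3 * d2^2 + 18 * d1 + 2 * d1 * g1 - 2 * d1 * e1 + d1^2 + 4 * l
     + 36 * e - 6 * e * a * x + 6 * e * w * g2 - 6 * e * w * e2 + 6 * e * w * d2 - 4 * e * m - 18 * e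
     * l - 2 * e * l * g1 + 2 * e * l * e1 - 2 * e * l * d1 - 27 * e^2 - 3 * e^2 * a^2 + 3 * e^2 *
     w^2 + 18 * e^2 * m + 2 * e^2 * m * g1 - 2 * e^2 * m * e1 + 2 * e^2 * m * d1 + e^2 * l^2 - 2 *
     e^3 * l * m + e^4 * m^2) = 0"
    using zero by (simp_all add: leading_def higher_def zero_prod_def)
  show ?thesis
  proof
    \<comment> \<open>As in all the following cases, the difference of the two sides is a power of
      \<open>e\<close> times the corresponding component of the perturbed system.\<close>
    have "(al * al) - (q2 * q2 + 3 * q3 * q3 + 3 * p1 * p1) = e^2 * (- 3 + 2 * l + e * (- 3 * e * a^2 + e * l^2))"
      unfolding defs by (simp add: power2_eq_square power3_eq_cube eval_nat_numeral algebra_simps)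
    then show "al * al = q2 * q2 + 3 * q3 * q3 + 3 * p1 * p1" unfolding z(1) by simp
    have "(au * al) - (3 * p1 * p1 - (q2 * (p2 - q2) + 3 * q3 * (p3 - q3))) = e^3 * (9 + m + 9 * l + e * (- 3 * a^2 + e * l * m))"
      unfolding defs by (simp add: power2_eq_square power3_eq_cube eval_nat_numeral algebra_simps)
    then show "au * al = 3 * p1 * p1 - (q2 * (p2 - q2) + 3 * q3 * (p3 - q3))" unfolding z(2) by simp
    have "(au * au + 3 * av * av) - (3 * p1 * p1 + (p2 - q2)^2 + 3 * (p3 - q3)^2) = e^4 * (- 27 - 3 * a^2 + 3 * w^2 + 18 * m + e * (e * m^2))"
      unfolding defs by (simp add: power2_eq_square power3_eq_cube eval_nat_numeral algebra_simps)
    then show "au * au + 3 * av * av = 3 * p1 * p1 + (p2 - q2)\<^sup>2 + 3 * (p3 - q3)\<^sup>2" unfolding z(3) by simp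
    have "(Du * Du + 3 * Dv * Dv) - (q2 * q2 + 3 * q3 * q3) = e^1 * (3 * d2 + d1 + e * (- 3 + 3 * d2^2 + d1^2))"
      unfolding defs by (simp add: power2_eq_square power3_eq_cube eval_nat_numeral algebra_simps)
    then show "Du * Du + 3 * Dv * Dv = q2 * q2 + 3 * q3 * q3" unfolding z(4) by simp
    have "(gu * gu + 3 * gv * gv) - (c2 * c2) = e^2 * (- 256 + 3 * h2^2 + h1^2 + e * (0))"
      unfolding defs by (simp add: power2_eq_square power3_eq_cube eval_nat_numeral algebra_simps)
    then show "gu * gu + 3 * gv * gv = c2 * c2" unfolding z(5) by simp
    have "((al + Eu + gu)^2 + 3 * (Ev + gv)^2) - (c2 * c2 + 3 * c1 * c1) = e^1 * (- 6 * c - 3 * h2 + 3 * h1 - 3 * e2 + 3 * e1 + e * (- 256 - 3 * c^2 + 3 * h2^2 + h1^2 + 6 * e2 * h2 + 3 * e2^2 + 2 * e1 * h1 + e1^2 + 3 * l + 2 * e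
     * l * h1 + 2 * e * l * e1 + e^2 * l^2))"
      unfolding defs by (simp add: power2_eq_square power3_eq_cube eval_nat_numeral algebra_simps)
    then show "(al + Eu + gu)\<^sup>2 + 3 * (Ev + gv)\<^sup>2 = c2 * c2 + 3 * c1 * c1" unfolding z(6) by simp
    have "((al + Eu + gu) * Du + 3 * (Ev + gv) * Dv) - (q2 * c2) = e^1 * (16 + 3/2 * h2 + 1/2 * h1 + 3/2 * e2 + 1/2 * e1 - 3/2 * d2 + 3/2 * d1 + e * (3 * d2 * h2 + 3 * d2 * e2 + d1 * h1 + d1 * e1 + 1/2 * l + e * l * d1))"
      unfolding defs by (simp add: power2_eq_square power3_eq_cube eval_nat_numeral algebra_simps)
    then show "(al + Eu + gu) * Du + 3 * (Ev + gv) * Dv = q2 * c2" unfolding z(7) by simp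
    have "(Eu * Eu + 3 * Ev * Ev) - (q2 * q2 + 3 * q3 * q3 + 3 * r1 * r1) = e^1 * (- 3 * e2 + e1 + e * (- 3 - 3 * x^2 + 3 * e2^2 + e1^2))"
      unfolding defs by (simp add: power2_eq_square power3_eq_cube eval_nat_numeral algebra_simps)
    then show "Eu * Eu + 3 * Ev * Ev = q2 * q2 + 3 * q3 * q3 + 3 * r1 * r1" unfolding z(8) by simp
    have "((al + Du + Gu)^2 + 3 * (Dv + Gv)^2) - (r2 * r2 + 3 * r3 * r3) = e^1 * (10 - 3 * g2 + g1 - 3 * d2 + d1 + e * (- 52 + 3 * g2^2 + g1^2 + 6 * d2 * g2 + 3 * d2^2 + 2 * d1 * g1 + d1^2 + l + 2 * e * l * g1 + 2 *
     e * l * d1 + e^2 * l^2))"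
      unfolding defs by (simp add: power2_eq_square power3_eq_cube eval_nat_numeral algebra_simps)
    then show "(al + Du + Gu)\<^sup>2 + 3 * (Dv + Gv)\<^sup>2 = r2 * r2 + 3 * r3 * r3" unfolding z(9) by simp
    have "((Eu - (al + Du + Gu))^2 + 3 * (Ev - (Dv + Gv))^2) - (3 * r1 * r1 + (q2 - r2)^2 + 3 * (q3 - r3)^2) = e^2 * (- 73 - 3 * x^2 + 3 * g2^2 + g1^2 - 6 * e2 * g2 + 3 * e2^2 - 2 * e1 * g1 + e1^2 + 6 * d2 * g2 - 6 * d2 * e2 + 3 * d2^2 + 2 * d1 * g1 - 2 * d1 * e1 + d1^2 + e * (2 * l * g1 - 2 * l * e1 + 2 * l * d1 + e * l^2))"
      unfolding defs by (simp add: power2_eq_square power3_eq_cube eval_nat_numeral algebra_simps)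
    then show "(Eu - (al + Du + Gu))\<^sup>2 + 3 * (Ev - (Dv + Gv))\<^sup>2 = 3 * r1 * r1 + (q2 - r2)\<^sup>2 + 3 * (q3 - r3)\<^sup>2" unfolding z(10) by simp
    have "(Gu * Gu + 3 * Gv * Gv) - (r2 * r2 + 3 * r3 * r3 + 3 * (r1 - c1)^2) = e^1 * (10 - 6 * c - 6 * x - 6 * g2 - 2 * g1 + e * (- 52 - 3 * c^2 - 6 * x * c - 3 * x^2 + 3 * g2^2 + g1^2))"
      unfolding defs by (simp add: power2_eq_square power3_eq_cube eval_nat_numeral algebra_simps)
    then show "Gu * Gu + 3 * Gv * Gv = r2 * r2 + 3 * r3 * r3 + 3 * (r1 - c1)\<^sup>2" unfolding z(11) by simp
    have "(Gu * gu + 3 * Gv * gv) - (r2 * c2) = e^1 * (16 - 3 * h2 - h1 + e * (- 80 + 3 * h2 * g2 + h1 * g1))"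
      unfolding defs by (simp add: power2_eq_square power3_eq_cube eval_nat_numeral algebra_simps)
    then show "Gu * gu + 3 * Gv * gv = r2 * c2" unfolding z(12) by simp
    have "(au * ((al + Eu + gu) - Du) + 3 * av * ((Ev + gv) - Dv)) - (3 * c1 * p1 - ((p2 - q2) * (q2 - c2) + 3 * (p3 - q3) * q3)) = e^2 * (- 144 + 9 * h1 + 9 * e1 - 9 * d1 - 3 * a - 3 * w + e * (9 - 3 * a * c + 3 * w * h2 + 3 * w * e2 - 3 * w * d2 + m + 9 * l + e * m * h1 + e * m * e1 - e *
     m * d1 + e^2 * l * m))"
      unfolding defs by (simp add: power2_eq_square power3_eq_cube eval_nat_numeral algebra_simps)
    then show "au * ((al + Eu + gu) - Du) + 3 * av * ((Ev + gv) - Dv) = 3 * c1 * p1 - ((p2 - q2) * (q2 - c2) + 3 * (p3 - q3) * q3)" unfolding z(13) by simp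
    have "((au - 2 * al - (Eu - (al + Du + Gu)))^2 + 3 * (av - (Ev - (Dv + Gv)))^2) - (3 * (p1 - r1)^2 + (p2 + r2)^2 + 3 * (p3 + r3)^2) = e^1 * (20 - 4 * g1 + 4 * e1 - 4 * d1 + e * (- 127 - 3 * x^2 + 3 * g2^2 + 18 * g1 + g1^2 - 6 * e2 * g2 + 3 * e2^2 - 18 * e1 - 2 * e1 * g1 +
     e1^2 + 6 * d2 * g2 - 6 * d2 * e2 + 3 * d2^2 + 18 * d1 + 2 * d1 * g1 - 2 * d1 * e1 + d1^2 + 4 * l
     + 36 * e - 6 * e * a * x + 6 * e * w * g2 - 6 * e * w * e2 + 6 * e * w * d2 - 4 * e * m - 18 * e
     * l - 2 * e * l * g1 + 2 * e * l * e1 - 2 * e * l * d1 - 27 * e^2 - 3 * e^2 * a^2 + 3 * e^2 *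
     w^2 + 18 * e^2 * m + 2 * e^2 * m * g1 - 2 * e^2 * m * e1 + 2 * e^2 * m * d1 + e^2 * l^2 - 2 *
     e^3 * l * m + e^4 * m^2))"
      unfolding defs by (simp add: power2_eq_square power3_eq_cube eval_nat_numeral algebra_simps)
    then show "(au - 2 * al - (Eu - (al + Du + Gu)))\<^sup>2 + 3 * (av - (Ev - (Dv + Gv)))\<^sup>2 = 3 * (p1 - r1)\<^sup>2 + (p2 + r2)\<^sup>2 + 3 * (p3 + r3)\<^sup>2" unfolding z(14) by simp
  qed
qed

section \<open>Paper tori close to the limit configuration\<close>

text \<open>Limit positions of the chosen lifts in rational coordinates. Vertices 0, 1 and 6
  coincide; others coincide only after a lattice translation, which \<open>collapse\<close> keeps
  track of.\<close>

definition limit_u :: "nat \<Rightarrow> real" where "limit_u i = [0, 0, -1, 1, 2, 1, 0, -2] ! i"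
definition limit_v :: "nat \<Rightarrow> real" where "limit_v i = [0, 0, 1, 1, 0, -1, 0, 0] ! i"
definition limit_space :: "nat \<Rightarrow> real^3" where
  "limit_space i = [point3 0 1 0, point3 0 1 0, point3 1 0 0, point3 0 (-1) 0, point3 1 0 0,
     point3 0 (-1) 0, point3 0 1 0, point3 0 (-1) 0] ! i"

lemma all_less_8: "(\<forall>i<8. P i) \<longleftrightarrow> P 0 \<and> P 1 \<and> P 2 \<and> P 3 \<and> P 4 \<and> P 5 \<and> P 6 \<and> P (7 :: nat)"
proof -
  have "i < 8 \<longleftrightarrow> i \<in> {0, 1, 2, 3, 4, 5, 6, 7}" for i :: nat
    unfolding insert_iff empty_iff by presburger
  then show ?thesis by (simp add: all_conj_distrib)
qed

lemma norm_kap_less: "norm kap < 1"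
  using norm_kap(2) by (intro power2_less_imp_less[of _ 1]) auto

text \<open>Every planar coordinate and generator is a combination of the parameters with
  coefficients of total absolute value at most four, hence the tolerance
  \<open>4 * \<delta>\<close>. Coordinates in space are single parameters up to sign.\<close>

lemma dist_point2_less:
  assumes "\<bar>u - u'\<bar> \<le> 4 * \<delta>" "\<bar>v - v'\<bar> \<le> 4 * \<delta>" "0 < \<delta>"
  shows "dist (point2 u v) (point2 u' v') < 10 * \<delta>"
proof -
  have "(u - u')\<^sup>2 \<le> (4 * \<delta>)\<^sup>2" "(v - v')\<^sup>2 \<le> (4 * \<delta>)\<^sup>2"
    unfolding abs_le_square_iff[symmetric] using assms by auto
  then have "(u - u')\<^sup>2 + 3 * (v - v')\<^sup>2 \<le> (8 * \<delta>)\<^sup>2" by (simp add: power_mult_distrib)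
  then have "sqrt ((u - u')\<^sup>2 + 3 * (v - v')\<^sup>2) \<le> 8 * \<delta>" using assms(3) by (intro real_le_lsqrt) auto
  then have "norm kap * sqrt ((u - u')\<^sup>2 + 3 * (v - v')\<^sup>2) \<le> 1 * (8 * \<delta>)"
    using norm_kap_less assms(3) by (intro mult_mono) auto
  then show ?thesis using assms(3) by (simp add: dist_point2)
qed

lemma dist_point3_less:
  assumes "\<bar>x - x'\<bar> \<le> \<delta>" "\<bar>y - y'\<bar> \<le> \<delta>" "\<bar>z - z'\<bar> \<le> \<delta>" "0 < \<delta>"
  shows "dist (point3 x y z) (point3 x' y' z') < 10 * \<delta>"
proof -
  have "(x - x')\<^sup>2 \<le> \<delta>\<^sup>2" "(y - y')\<^sup>2 \<le> \<delta>\<^sup>2" "(z - z')\<^sup>2 \<le> \<delta>\<^sup>2"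
    unfolding abs_le_square_iff[symmetric] using assms by auto
  moreover have "0 \<le> \<delta>\<^sup>2" by simp
  ultimately have "3 * (x - x')\<^sup>2 + (y - y')\<^sup>2 + 3 * (z - z')\<^sup>2 \<le> 9 * \<delta>\<^sup>2" by linarith
  also have "\<dots> = (3 * \<delta>)\<^sup>2" by (simp add: power_mult_distrib)
  finally have "sqrt (3 * (x - x')\<^sup>2 + (y - y')\<^sup>2 + 3 * (z - z')\<^sup>2) \<le> 3 * \<delta>" using assms(4) by (intro real_le_lsqrt) auto
  then have "norm kap * sqrt (3 * (x - x')\<^sup>2 + (y - y')\<^sup>2 + 3 * (z - z')\<^sup>2) \<le> 1 * (3 * \<delta>)"
    using norm_kap_less assms(4) by (intro mult_mono) auto
  then show ?thesis using assms(4) by (simp add: dist_point3)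
qed

lemma point2_limits: "point2 (-3) 1 = 1" "point2 (-3) (-1) = Complex (1/2) (sqrt 3 / 2)"
proof -
  have nz: "Complex (-3) (sqrt 3) \<noteq> 0" by (simp add: complex_eq_iff)
  then show "point2 (-3) 1 = 1" by (simp add: point2_def kap_def)
  have "Complex (-3) (- sqrt 3) = Complex (-3) (sqrt 3) * Complex (1/2) (sqrt 3 / 2)"
    by (simp add: complex_eq_iff)
  then show "point2 (-3) (-1) = Complex (1/2) (sqrt 3 / 2)"
    using nz by (simp add: point2_def kap_def field_simps)
qed

text \<open>All reference to the parameters is removed here: only generators, vertex positions,
  vertex images and the barycentric form of the map remain.\<close>

lemma paper_tori_near_limit:
  assumes "\<eta> > 0"
  shows "\<exists>u v pos f \<phi>. 0 < orient 0 u v \<and> paper_torus 8 (lattice_span u v) \<phi> \<and>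
    (\<forall>z. \<exists>p q r x y w m n. (p, q, r) \<in> set torus_triangles \<and> 0 \<le> x \<and> 0 \<le> y \<and> 0 \<le> w \<and> x + y + w = 1 \<and>
      z = x *\<^sub>R lvp u v pos p + y *\<^sub>R lvp u v pos q + w *\<^sub>R lvp u v pos r + (of_int m *\<^sub>R u + of_int n *\<^sub>R v) \<and>
      \<phi> (torus_proj (lattice_span u v) z) = x *\<^sub>R f (fst p) + y *\<^sub>R f (fst q) + w *\<^sub>R f (fst r)) \<and>
    dist u 1 < \<eta> \<and> dist v (Complex (1/2) (sqrt 3 / 2)) < \<eta> \<and>
    (\<forall>i<8. dist (pos i) (point2 (limit_u i) (limit_v i)) < \<eta> \<and> dist (f i) (limit_space i) < \<eta>)"
proof -
  define \<delta> where "\<delta> = \<eta> / 10"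
  have \<delta>: "\<delta> > 0" "\<eta> = 10 * \<delta>" using assms by (simp_all add: \<delta>_def)
  show ?thesis using exists_folded[OF \<delta>(1)]
  proof (elim exE conjE)
    fix l m w a d1 d2 e1 e2 h1 h2 g1 g2 x c e :: real
    assume e: "0 < e" and zero: "leading (l, m, w, a, d1, d2, e1, e2, h1, h2, g1, g2, x, c) + e *\<^sub>R higher ((l, m, w, a, d1, d2, e1, e2, h1, h2, g1, g2, x, c), e) = 0"
    assume G0: "0 < 24 + 24 * e * c - 32 * e^2 * a"
    assume G1: "0 < 12 + 15 * e + 12 * e * c - 12 * e * x - 4 * e * a + 15 * e^2 * c - 48 * e^2 * x - 27 * e^2 * a"
    assume G2: "0 < 24 + 24 * e * c - 56 * e^2 * a - 96 * e^3 * a"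
    assume G3: "0 < 24 + 24 * e * c + 32 * e^2 * a"
    assume G4: "0 < - 24 * x - 8 * a + 10 * e * a"
    assume G5: "0 < - 48 * a"
    assume G6: "0 < 12 + 15 * e + 12 * e * c - 12 * e * x - 4 * e * a + 15 * e^2 * c + 48 * e^2 * x + 37 * e^2 * a"
    assume G7: "0 < 48 * x + 8 * a + 30 * e * x - 10 * e * a"
    assume G8: "0 < - 24 * x - 8 * a + 34 * e * a + 30 * e^2 * a"
    assume G9: "0 < 24 * x - 8 * a + 82 * e * a + 30 * e^2 * a"
    assume G10: "0 < 64 + 64 * e * c"
    assume G11: "0 < 8 - 10 * e + 8 * e * c - 10 * e^2 * c - 32 * e^2 * x"
    assume G12: "0 < 64 + 64 * e * c - 32 * e * x"
    assume G13: "0 < 128 + 128 * e * c + 32 * e * x"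
    assume G14: "0 < 64 + 96 * e + 64 * e * c + 96 * e^2 * c - 32 * e^2 * a"
    assume G15: "0 < 8 - 10 * e + 8 * e * c + 8 * e * x - 10 * e^2 * c + 86 * e^2 * x"
    assume G16: "0 < 8 - 46 * e + 8 * e * c - 15 * e^2 - 46 * e^2 * c - 44 * e^2 * x - 4 * e^2 * a - 15 * e^3 * c -
     48 * e^3 * x - 59 * e^3 * a"
    assume G17: "0 < 8 - 10 * e + 8 * e * c - 10 * e^2 * c + 32 * e^2 * x"
    assume G18: "0 < 16 * x - 20 * e * x"
    assume G19: "0 < 8 - 10 * e + 8 * e * c + 8 * e * x - 10 * e^2 * c - 106 * e^2 * x"
    assume G20: "0 < 8 - 22 * e + 8 * e * c - 15 * e^2 - 22 * e^2 * c - 20 * e^2 * x - 4 * e^2 * a - 15 * e^3 * c -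
     48 * e^3 * x + 37 * e^3 * a"
    assume G21: "0 < 8 - 46 * e + 8 * e * c - 15 * e^2 - 46 * e^2 * c + 20 * e^2 * x - 4 * e^2 * a - 15 * e^3 * c +
     48 * e^3 * x + 69 * e^3 * a"
    assume G22: "0 < 16 * x - 68 * e * x + 8 * e * a - 30 * e^2 * x - 10 * e^2 * a"
    assume G23: "0 < 24 + 24 * e * c + 8 * e^2 * a + 96 * e^3 * a"
    assume G24: "0 < 64 - 96 * e + 64 * e * c - 32 * e * x - 96 * e^2 * c - 96 * e^2 * x - 96 * e^2 * a"
    assume G25: "0 < 128 + 96 * e + 128 * e * c + 32 * e * x + 96 * e^2 * c + 96 * e^2 * x - 96 * e^2 * a"
    assume G26: "0 < 64 + 192 * e + 64 * e * c + 192 * e^2 * c - 64 * e^2 * a - 192 * e^3 * a"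
    assume G27: "0 < 8 - 58 * e + 8 * e * c + 8 * e * x - 30 * e^2 - 58 * e^2 * c + 38 * e^2 * x - 30 * e^3 * c - 30
     * e^3 * x + 96 * e^3 * a"
    assume G28: "0 < 8 - 58 * e + 8 * e * c - 30 * e^2 - 58 * e^2 * c + 32 * e^2 * x - 8 * e^2 * a - 30 * e^3 * c +
     96 * e^3 * x + 90 * e^3 * a + 126 * e^4 * a"
    assume G29: "0 < 8 - 58 * e + 8 * e * c - 30 * e^2 - 58 * e^2 * c - 32 * e^2 * x - 8 * e^2 * a - 30 * e^3 * c -
     96 * e^3 * x + 26 * e^3 * a - 66 * e^4 * a"
    assume G30: "0 < 8 - 22 * e + 8 * e * c - 15 * e^2 - 22 * e^2 * c + 44 * e^2 * x - 4 * e^2 * a - 15 * e^3 * c +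
     48 * e^3 * x - 27 * e^3 * a"
    assume G31: "0 < 16 * x - 116 * e * x + 16 * e * a - 60 * e^2 * x - 116 * e^2 * a - 60 * e^3 * a"
    assume G32: "0 < 96 + 96 * e * c + 32 * e * a"
    assume G33: "0 < 192 + 192 * e * c + 192 * e * x"
    assume G34: "0 < 36 + 15 * e + 36 * e * c + 12 * e * x - 4 * e * a + 15 * e^2 * c + 48 * e^2 * x - 59 * e^2 * a"
    assume G35: "0 < 2 - 2 * e * g2 + e * h2 + e * h1 - e * e2 + e * e1 - e * d2 + e * d1 + e^2 * h2 * g1 - e^2 * h1
     * g2 + e^2 * e2 * g1 - e^2 * e2 * h1 - e^2 * e1 * g2 + e^2 * e1 * h2 + e^2 * d2 * g1 - e^2 * d2
     * h1 - e^2 * d1 * g2 + e^2 * d1 * h2 + e^2 * l - e^3 * l * g2 + e^3 * l * h2"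
    assume G36: "0 < 2 - e * h2 + e * h1 - e * e2 + e * e1 + 3 * e * d2 + e * d1 + 2 * e^2 * d2 * h1 + 2 * e^2 * d2 *
     e1 - 2 * e^2 * d1 * h2 - 2 * e^2 * d1 * e2 + e^2 * l + 2 * e^3 * l * d2"
    assume G37: "0 < 9 - 9 * e * h2 - 9 * e * e2 + 9 * e * d2 + e * w + e^2 * w * h1 + e^2 * w * e1 - e^2 * w * d1 +
     e^2 * m - e^3 * m * h2 - e^3 * m * e2 + e^3 * m * d2 + e^3 * l * w"
    assume G38: "0 < - 2 * w - 2 * e^2 * l * w"
    assume G39: "0 < 2 * g2 - 2 * e2 + 2 * d2 - 9 * e * g2 + 9 * e * e2 - 9 * e * d2 + e^2 * w * g1 - e^2 * w * e1 +
     e^2 * w * d1 + 2 * e^2 * l * g2 - 2 * e^2 * l * e2 + 2 * e^2 * l * d2 - e^3 * m * g2 + e^3 * m *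
     e2 - e^3 * m * d2 + e^3 * l * w"
    assume G40: "0 < g2 + g1 - e2 - e1 + d2 + d1 - 2 * e * e2 * g1 + 2 * e * e1 * g2 + 2 * e * d2 * e1 - 2 * e * d1 *
     e2 + e * l - 2 * e^2 * l * e2"
    assume G41: "0 < 2 - 9 * e - e * g2 - e * g1 - 2 * e * h2 - e * e2 + e * e1 + e * d2 - e * d1 + 9 * e^2 * g2 + 9
     * e^2 * h2 + e^2 * h2 * g1 - e^2 * h1 * g2 + e^2 * e2 * g1 + e^2 * e2 * h1 - e^2 * e1 * g2 - e^2
     * e1 * h2 - e^2 * d2 * g1 - e^2 * d2 * h1 + e^2 * d1 * g2 + e^2 * d1 * h2 + e^2 * w + e^2 * l -
     e^3 * w * g1 - e^3 * w * h1 - e^3 * m - e^3 * l * g2 - e^3 * l * h2 + e^4 * m * g2 + e^4 * m *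
     h2"
    assume G42: "0 < 2 * h2 - 2 * h1 - 2 * e * h2 * g1 + 2 * e * h1 * g2"
    assume cl_al: "\<bar>e^2 * l\<bar> < \<delta>"
    assume cl_au: "\<bar>9 * e + e^3 * m\<bar> < \<delta>"
    assume cl_av: "\<bar>e^2 * w\<bar> < \<delta>"
    assume cl_Du: "\<bar>e * d1\<bar> < \<delta>"
    assume cl_Dv: "\<bar>e * d2\<bar> < \<delta>"
    assume cl_Eu: "\<bar>e * e1\<bar> < \<delta>"
    assume cl_Ev: "\<bar>e * e2\<bar> < \<delta>"
    assume cl_gu: "\<bar>e * h1\<bar> < \<delta>"
    assume cl_gv: "\<bar>e * h2\<bar> < \<delta>"
    assume cl_Gu: "\<bar>e * g1\<bar> < \<delta>"
    assume cl_Gv: "\<bar>e * g2\<bar> < \<delta>"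
    assume cl_q3: "\<bar>e\<bar> < \<delta>"
    assume cl_p1: "\<bar>e^2 * a\<bar> < \<delta>"
    assume cl_p2: "\<bar>- 9 * e\<bar> < \<delta>"
    assume cl_p3: "\<bar>e + 3 * e^2\<bar> < \<delta>"
    assume cl_r1: "\<bar>- e * x\<bar> < \<delta>"
    assume cl_r2: "\<bar>- 5 * e\<bar> < \<delta>"
    assume cl_r3: "\<bar>- 3 * e\<bar> < \<delta>"
    assume cl_c1: "\<bar>e * c\<bar> < \<delta>"
    assume cl_c2: "\<bar>- 16 * e\<bar> < \<delta>"
    define al where "al = 1 + e^2 * l"
    define au where "au = 9 * e + e^3 * m"
    define av where "av = e^2 * w"
    define Du where "Du = 1/2 + e * d1"
    define Dv where "Dv = 1/2 + e * d2"
    define Eu where "Eu = 1/2 + e * e1"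
    define Ev where "Ev = - 1/2 + e * e2"
    define gu where "gu = e * h1"
    define gv where "gv = e * h2"
    define Gu where "Gu = - 1 + e * g1"
    define Gv where "Gv = - 1 + e * g2"
    define q2 :: real where "q2 = 1"
    define q3 where "q3 = e"
    define p1 where "p1 = e^2 * a"
    define p2 where "p2 = 1 - 9 * e"
    define p3 where "p3 = e + 3 * e^2"
    define r1 where "r1 = - e * x"
    define r2 where "r2 = 1 - 5 * e"
    define r3 where "r3 = - 3 * e"
    define c1 where "c1 = 1 + e * c"
    define c2 where "c2 = - 16 * e"
    note defs = al_def au_def av_def Du_def Dv_def Eu_def Ev_def gu_def gv_def Gu_def Gv_def q2_def q3_def p1_def p2_def p3_def r1_def r2_def r3_def c1_def c2_def
    have diffs: "al - 1 = e^2 * l"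
      "au - 0 = 9 * e + e^3 * m"
      "av - 0 = e^2 * w"
      "Du - 1/2 = e * d1"
      "Dv - 1/2 = e * d2"
      "Eu - 1/2 = e * e1"
      "Ev - (-1/2) = e * e2"
      "gu - 0 = e * h1"
      "gv - 0 = e * h2"
      "Gu - (-1) = e * g1"
      "Gv - (-1) = e * g2"
      "q3 - 0 = e"
      "p1 - 0 = e^2 * a"
      "p2 - 1 = - 9 * e"
      "p3 - 0 = e + 3 * e^2"
      "r1 - 0 = - e * x"
      "r2 - 1 = - 5 * e"
      "r3 - 0 = - 3 * e"
      "c1 - 1 = e * c"
      "c2 - 0 = - 16 * e"
      by (simp_all add: defs)
    note cl = cl_al cl_au cl_av cl_Du cl_Dv cl_Eu cl_Ev cl_gu cl_gv cl_Gu cl_Gv cl_q3 cl_p1 cl_p2 cl_p3 cl_r1 cl_r2 cl_r3 cl_c1 cl_c2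
    have close: "\<bar>al - 1\<bar> \<le> \<delta>"
      "\<bar>au - 0\<bar> \<le> \<delta>"
      "\<bar>av - 0\<bar> \<le> \<delta>"
      "\<bar>Du - 1/2\<bar> \<le> \<delta>"
      "\<bar>Dv - 1/2\<bar> \<le> \<delta>"
      "\<bar>Eu - 1/2\<bar> \<le> \<delta>"
      "\<bar>Ev - (-1/2)\<bar> \<le> \<delta>"
      "\<bar>gu - 0\<bar> \<le> \<delta>"
      "\<bar>gv - 0\<bar> \<le> \<delta>"
      "\<bar>Gu - (-1)\<bar> \<le> \<delta>"
      "\<bar>Gv - (-1)\<bar> \<le> \<delta>"
      "\<bar>q3 - 0\<bar> \<le> \<delta>"
      "\<bar>p1 - 0\<bar> \<le> \<delta>"
      "\<bar>p2 - 1\<bar> \<le> \<delta>"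
      "\<bar>p3 - 0\<bar> \<le> \<delta>"
      "\<bar>r1 - 0\<bar> \<le> \<delta>"
      "\<bar>r2 - 1\<bar> \<le> \<delta>"
      "\<bar>r3 - 0\<bar> \<le> \<delta>"
      "\<bar>c1 - 1\<bar> \<le> \<delta>"
      "\<bar>c2 - 0\<bar> \<le> \<delta>"
      unfolding diffs by (rule cl[THEN less_imp_le])+
    interpret D: folded_data al au av Du Dv Eu Ev gu gv Gu Gv q2 q3 p1 p2 p3 r1 r2 r3 c1 c2
      by (rule folded_equations[OF al_def au_def av_def Du_def Dv_def Eu_def Ev_def gu_def gv_def Gu_def Gv_def q2_def q3_def p1_def p2_def p3_def r1_def r2_def r3_def c1_def c2_def zero])
    have space: "D.space 0 = (0, q2, q3)"
      "D.space 1 = (p1, p2, p3)"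
      "D.space 2 = (c1, c2, 0)"
      "D.space 3 = (0, - q2, - q3)"
      "D.space 4 = (c1, - c2, 0)"
      "D.space 5 = (r1, - r2, - r3)"
      "D.space 6 = (r1, r2, r3)"
      "D.space 7 = (p1, - p2, - p3)"
      by (simp_all add: D.space_def)
    have label: "D.label_u (0, 0, 0) = 0"
      "D.label_u (1, 0, -1) = - au - D.l2u"
      "D.label_u (1, 0, 0) = - au"
      "D.label_u (2, -1, 0) = - D.cu - D.l1u"
      "D.label_u (2, 0, 0) = - D.cu"
      "D.label_u (3, 0, 0) = D.du - D.cu"
      "D.label_u (3, 0, 1) = D.du - D.cu + D.l2u"
      "D.label_u (4, 0, 0) = D.du"
      "D.label_u (4, 1, 0) = D.du + D.l1u"
      "D.label_u (5, 0, 0) = D.fu"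
      "D.label_u (5, 1, -1) = D.fu + D.l1u - D.l2u"
      "D.label_u (5, 1, 0) = D.fu + D.l1u"
      "D.label_u (6, 0, -1) = D.eu - D.l2u"
      "D.label_u (6, 0, 0) = D.eu"
      "D.label_u (6, 1, -1) = D.eu + D.l1u - D.l2u"
      "D.label_u (7, 0, -1) = D.bu - D.l2u"
      "D.label_u (7, 0, 0) = D.bu"
      "D.label_v (0, 0, 0) = 0"
      "D.label_v (1, 0, -1) = - av - D.l2v"
      "D.label_v (1, 0, 0) = - av"
      "D.label_v (2, -1, 0) = - D.cv - D.l1v"
      "D.label_v (2, 0, 0) = - D.cv"
      "D.label_v (3, 0, 0) = D.dv - D.cv"
      "D.label_v (3, 0, 1) = D.dv - D.cv + D.l2v"
      "D.label_v (4, 0, 0) = D.dv"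
      "D.label_v (4, 1, 0) = D.dv + D.l1v"
      "D.label_v (5, 0, 0) = D.fv"
      "D.label_v (5, 1, -1) = D.fv + D.l1v - D.l2v"
      "D.label_v (5, 1, 0) = D.fv + D.l1v"
      "D.label_v (6, 0, -1) = D.ev - D.l2v"
      "D.label_v (6, 0, 0) = D.ev"
      "D.label_v (6, 1, -1) = D.ev + D.l1v - D.l2v"
      "D.label_v (7, 0, -1) = av - D.l2v"
      "D.label_v (7, 0, 0) = av"
      by (simp_all add: D.label_u_def D.label_v_def D.planar_u_def D.planar_v_def)
    have planar: "D.planar_u 0 = 0"
      "D.planar_u 1 = - au"
      "D.planar_u 2 = - D.cu"
      "D.planar_u 3 = D.du - D.cu"
      "D.planar_u 4 = D.du"
      "D.planar_u 5 = D.fu"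
      "D.planar_u 6 = D.eu"
      "D.planar_u 7 = D.bu"
      "D.planar_v 0 = 0"
      "D.planar_v 1 = - av"
      "D.planar_v 2 = - D.cv"
      "D.planar_v 3 = D.dv - D.cv"
      "D.planar_v 4 = D.dv"
      "D.planar_v 5 = D.fv"
      "D.planar_v 6 = D.ev"
      "D.planar_v 7 = av"
      by (simp_all add: D.planar_u_def D.planar_v_def)
    have limits: "limit_u 0 = 0"
      "limit_u 1 = 0"
      "limit_u 2 = -1"
      "limit_u 3 = 1"
      "limit_u 4 = 2"
      "limit_u 5 = 1"
      "limit_u 6 = 0"
      "limit_u 7 = -2"
      "limit_v 0 = 0"
      "limit_v 1 = 0"
      "limit_v 2 = 1"
      "limit_v 3 = 1"
      "limit_v 4 = 0"
      "limit_v 5 = -1"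
      "limit_v 6 = 0"
      "limit_v 7 = 0"
      "limit_space 0 = point3 0 1 0"
      "limit_space 1 = point3 0 1 0"
      "limit_space 2 = point3 1 0 0"
      "limit_space 3 = point3 0 (-1) 0"
      "limit_space 4 = point3 1 0 0"
      "limit_space 5 = point3 0 (-1) 0"
      "limit_space 6 = point3 0 1 0"
      "limit_space 7 = point3 0 (-1) 0"
      by (simp_all add: limit_u_def limit_v_def limit_space_def)
    note ldefs = D.l1u_def D.l1v_def D.l2u_def D.l2v_def D.planar_defs
    note vols = space vol3_def prod.case
    note labels = D.label_orient_def prod.case label ldefs
    note bounds = close[THEN abs_le_D1] close[THEN abs_le_D2] q2_def \<delta>(1)
    \<comment> \<open>In this and the following computations the volume is a power of
      \<open>e\<close> times one of the assumed positive polynomials. A quadruple and its image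
      under the half-turn use the same one.\<close>
    have eq: "of_int (-1) * vol3 (D.space 0) (D.space 1) (D.space 2) (D.space 3) = e^2 * (24 + 24 * e * c - 32 * e^2 * a)"
      unfolding vols unfolding defs by (simp add: eval_nat_numeral algebra_simps)
    have v0: "0 < of_int (-1) * vol3 (D.space 0) (D.space 1) (D.space 2) (D.space 3)" unfolding eq by (rule mult_pos_pos[OF zero_less_power[OF e] G0])
    have eq: "of_int (1) * vol3 (D.space 0) (D.space 1) (D.space 2) (D.space 5) = e^2 * (12 + 15 * e + 12 * e * c - 12 * e * x - 4 * e * a + 15 * e^2 * c - 48 * e^2 * x - 27 * e^2 * a)"
      unfolding vols unfolding defs by (simp add: eval_nat_numeral algebra_simps)
    have v1: "0 < of_int (1) * vol3 (D.space 0) (D.space 1) (D.space 2) (D.space 5)" unfolding eq by (rule mult_pos_pos[OF zero_less_power[OF e] G1])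
    have eq: "of_int (-1) * vol3 (D.space 0) (D.space 1) (D.space 2) (D.space 7) = e^2 * (24 + 24 * e * c - 56 * e^2 * a - 96 * e^3 * a)"
      unfolding vols unfolding defs by (simp add: eval_nat_numeral algebra_simps)
    have v2: "0 < of_int (-1) * vol3 (D.space 0) (D.space 1) (D.space 2) (D.space 7)" unfolding eq by (rule mult_pos_pos[OF zero_less_power[OF e] G2])
    have eq: "of_int (1) * vol3 (D.space 0) (D.space 1) (D.space 3) (D.space 4) = e^2 * (24 + 24 * e * c + 32 * e^2 * a)"
      unfolding vols unfolding defs by (simp add: eval_nat_numeral algebra_simps)
    have v3: "0 < of_int (1) * vol3 (D.space 0) (D.space 1) (D.space 3) (D.space 4)" unfolding eq by (rule mult_pos_pos[OF zero_less_power[OF e] G3])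
    have eq: "of_int (1) * vol3 (D.space 0) (D.space 1) (D.space 3) (D.space 5) = e^3 * (- 24 * x - 8 * a + 10 * e * a)"
      unfolding vols unfolding defs by (simp add: eval_nat_numeral algebra_simps)
    have v4: "0 < of_int (1) * vol3 (D.space 0) (D.space 1) (D.space 3) (D.space 5)" unfolding eq by (rule mult_pos_pos[OF zero_less_power[OF e] G4])
    have eq: "of_int (-1) * vol3 (D.space 0) (D.space 1) (D.space 3) (D.space 7) = e^4 * (- 48 * a)"
      unfolding vols unfolding defs by (simp add: eval_nat_numeral algebra_simps)
    have v5: "0 < of_int (-1) * vol3 (D.space 0) (D.space 1) (D.space 3) (D.space 7)" unfolding eq by (rule mult_pos_pos[OF zero_less_power[OF e] G5])
    have eq: "of_int (1) * vol3 (D.space 0) (D.space 1) (D.space 4) (D.space 5) = e^2 * (12 + 15 * e + 12 * e * c - 12 * e * x - 4 * e * a + 15 * e^2 * c + 48 * e^2 * x + 37 * e^2 * a)"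
      unfolding vols unfolding defs by (simp add: eval_nat_numeral algebra_simps)
    have v6: "0 < of_int (1) * vol3 (D.space 0) (D.space 1) (D.space 4) (D.space 5)" unfolding eq by (rule mult_pos_pos[OF zero_less_power[OF e] G6])
    have eq: "of_int (1) * vol3 (D.space 0) (D.space 1) (D.space 5) (D.space 6) = e^3 * (48 * x + 8 * a + 30 * e * x - 10 * e * a)"
      unfolding vols unfolding defs by (simp add: eval_nat_numeral algebra_simps)
    have v7: "0 < of_int (1) * vol3 (D.space 0) (D.space 1) (D.space 5) (D.space 6)" unfolding eq by (rule mult_pos_pos[OF zero_less_power[OF e] G7])
    have eq: "of_int (-1) * vol3 (D.space 0) (D.space 1) (D.space 5) (D.space 7) = e^3 * (- 24 * x - 8 * a + 34 * e * a + 30 * e^2 * a)"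
      unfolding vols unfolding defs by (simp add: eval_nat_numeral algebra_simps)
    have v8: "0 < of_int (-1) * vol3 (D.space 0) (D.space 1) (D.space 5) (D.space 7)" unfolding eq by (rule mult_pos_pos[OF zero_less_power[OF e] G8])
    have eq: "of_int (1) * vol3 (D.space 0) (D.space 1) (D.space 6) (D.space 7) = e^3 * (24 * x - 8 * a + 82 * e * a + 30 * e^2 * a)"
      unfolding vols unfolding defs by (simp add: eval_nat_numeral algebra_simps)
    have v9: "0 < of_int (1) * vol3 (D.space 0) (D.space 1) (D.space 6) (D.space 7)" unfolding eq by (rule mult_pos_pos[OF zero_less_power[OF e] G9])
    have eq: "of_int (1) * vol3 (D.space 0) (D.space 2) (D.space 3) (D.space 4) = e^2 * (64 + 64 * e * c)"
      unfolding vols unfolding defs by (simp add: eval_nat_numeral algebra_simps)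
    have v10: "0 < of_int (1) * vol3 (D.space 0) (D.space 2) (D.space 3) (D.space 4)" unfolding eq by (rule mult_pos_pos[OF zero_less_power[OF e] G10])
    have eq: "of_int (1) * vol3 (D.space 0) (D.space 2) (D.space 3) (D.space 6) = e^1 * (8 - 10 * e + 8 * e * c - 10 * e^2 * c - 32 * e^2 * x)"
      unfolding vols unfolding defs by (simp add: eval_nat_numeral algebra_simps)
    have v11: "0 < of_int (1) * vol3 (D.space 0) (D.space 2) (D.space 3) (D.space 6)" unfolding eq by (rule mult_pos_pos[OF zero_less_power[OF e] G11])
    have eq: "of_int (1) * vol3 (D.space 0) (D.space 2) (D.space 3) (D.space 7) = e^2 * (24 + 24 * e * c + 32 * e^2 * a)"
      unfolding vols unfolding defs by (simp add: eval_nat_numeral algebra_simps)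
    have v12: "0 < of_int (1) * vol3 (D.space 0) (D.space 2) (D.space 3) (D.space 7)" unfolding eq by (rule mult_pos_pos[OF zero_less_power[OF e] G3])
    have eq: "of_int (1) * vol3 (D.space 0) (D.space 2) (D.space 4) (D.space 5) = e^2 * (64 + 64 * e * c - 32 * e * x)"
      unfolding vols unfolding defs by (simp add: eval_nat_numeral algebra_simps)
    have v13: "0 < of_int (1) * vol3 (D.space 0) (D.space 2) (D.space 4) (D.space 5)" unfolding eq by (rule mult_pos_pos[OF zero_less_power[OF e] G12])
    have eq: "of_int (-1) * vol3 (D.space 0) (D.space 2) (D.space 4) (D.space 6) = e^2 * (128 + 128 * e * c + 32 * e * x)"
      unfolding vols unfolding defs by (simp add: eval_nat_numeral algebra_simps)
    have v14: "0 < of_int (-1) * vol3 (D.space 0) (D.space 2) (D.space 4) (D.space 6)" unfolding eq by (rule mult_pos_pos[OF zero_less_power[OF e] G13])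
    have eq: "of_int (-1) * vol3 (D.space 0) (D.space 2) (D.space 4) (D.space 7) = e^2 * (64 + 96 * e + 64 * e * c + 96 * e^2 * c - 32 * e^2 * a)"
      unfolding vols unfolding defs by (simp add: eval_nat_numeral algebra_simps)
    have v15: "0 < of_int (-1) * vol3 (D.space 0) (D.space 2) (D.space 4) (D.space 7)" unfolding eq by (rule mult_pos_pos[OF zero_less_power[OF e] G14])
    have eq: "of_int (1) * vol3 (D.space 0) (D.space 2) (D.space 5) (D.space 6) = e^1 * (8 - 10 * e + 8 * e * c + 8 * e * x - 10 * e^2 * c + 86 * e^2 * x)"
      unfolding vols unfolding defs by (simp add: eval_nat_numeral algebra_simps)
    have v16: "0 < of_int (1) * vol3 (D.space 0) (D.space 2) (D.space 5) (D.space 6)" unfolding eq by (rule mult_pos_pos[OF zero_less_power[OF e] G15])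
    have eq: "of_int (-1) * vol3 (D.space 0) (D.space 2) (D.space 6) (D.space 7) = e^1 * (8 - 46 * e + 8 * e * c - 15 * e^2 - 46 * e^2 * c - 44 * e^2 * x - 4 * e^2 * a - 15 * e^3 * c -
     48 * e^3 * x - 59 * e^3 * a)"
      unfolding vols unfolding defs by (simp add: eval_nat_numeral algebra_simps)
    have v17: "0 < of_int (-1) * vol3 (D.space 0) (D.space 2) (D.space 6) (D.space 7)" unfolding eq by (rule mult_pos_pos[OF zero_less_power[OF e] G16])
    have eq: "of_int (1) * vol3 (D.space 0) (D.space 3) (D.space 4) (D.space 5) = e^1 * (8 - 10 * e + 8 * e * c - 10 * e^2 * c - 32 * e^2 * x)"
      unfolding vols unfolding defs by (simp add: eval_nat_numeral algebra_simps)
    have v18: "0 < of_int (1) * vol3 (D.space 0) (D.space 3) (D.space 4) (D.space 5)" unfolding eq by (rule mult_pos_pos[OF zero_less_power[OF e] G11])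
    have eq: "of_int (-1) * vol3 (D.space 0) (D.space 3) (D.space 4) (D.space 6) = e^1 * (8 - 10 * e + 8 * e * c - 10 * e^2 * c + 32 * e^2 * x)"
      unfolding vols unfolding defs by (simp add: eval_nat_numeral algebra_simps)
    have v19: "0 < of_int (-1) * vol3 (D.space 0) (D.space 3) (D.space 4) (D.space 6)" unfolding eq by (rule mult_pos_pos[OF zero_less_power[OF e] G17])
    have eq: "of_int (-1) * vol3 (D.space 0) (D.space 3) (D.space 4) (D.space 7) = e^2 * (24 + 24 * e * c - 32 * e^2 * a)"
      unfolding vols unfolding defs by (simp add: eval_nat_numeral algebra_simps)
    have v20: "0 < of_int (-1) * vol3 (D.space 0) (D.space 3) (D.space 4) (D.space 7)" unfolding eq by (rule mult_pos_pos[OF zero_less_power[OF e] G0])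
    have eq: "of_int (1) * vol3 (D.space 0) (D.space 3) (D.space 5) (D.space 6) = e^2 * (16 * x - 20 * e * x)"
      unfolding vols unfolding defs by (simp add: eval_nat_numeral algebra_simps)
    have v21: "0 < of_int (1) * vol3 (D.space 0) (D.space 3) (D.space 5) (D.space 6)" unfolding eq by (rule mult_pos_pos[OF zero_less_power[OF e] G18])
    have eq: "of_int (-1) * vol3 (D.space 0) (D.space 3) (D.space 6) (D.space 7) = e^3 * (- 24 * x - 8 * a + 10 * e * a)"
      unfolding vols unfolding defs by (simp add: eval_nat_numeral algebra_simps)
    have v22: "0 < of_int (-1) * vol3 (D.space 0) (D.space 3) (D.space 6) (D.space 7)" unfolding eq by (rule mult_pos_pos[OF zero_less_power[OF e] G4])
    have eq: "of_int (1) * vol3 (D.space 0) (D.space 4) (D.space 5) (D.space 6) = e^1 * (8 - 10 * e + 8 * e * c + 8 * e * x - 10 * e^2 * c - 106 * e^2 * x)"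
      unfolding vols unfolding defs by (simp add: eval_nat_numeral algebra_simps)
    have v23: "0 < of_int (1) * vol3 (D.space 0) (D.space 4) (D.space 5) (D.space 6)" unfolding eq by (rule mult_pos_pos[OF zero_less_power[OF e] G19])
    have eq: "of_int (1) * vol3 (D.space 0) (D.space 4) (D.space 5) (D.space 7) = e^1 * (8 - 22 * e + 8 * e * c - 15 * e^2 - 22 * e^2 * c - 20 * e^2 * x - 4 * e^2 * a - 15 * e^3 * c -
     48 * e^3 * x + 37 * e^3 * a)"
      unfolding vols unfolding defs by (simp add: eval_nat_numeral algebra_simps)
    have v24: "0 < of_int (1) * vol3 (D.space 0) (D.space 4) (D.space 5) (D.space 7)" unfolding eq by (rule mult_pos_pos[OF zero_less_power[OF e] G20])
    have eq: "of_int (-1) * vol3 (D.space 0) (D.space 4) (D.space 6) (D.space 7) = e^1 * (8 - 46 * e + 8 * e * c - 15 * e^2 - 46 * e^2 * c + 20 * e^2 * x - 4 * e^2 * a - 15 * e^3 * c +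
     48 * e^3 * x + 69 * e^3 * a)"
      unfolding vols unfolding defs by (simp add: eval_nat_numeral algebra_simps)
    have v25: "0 < of_int (-1) * vol3 (D.space 0) (D.space 4) (D.space 6) (D.space 7)" unfolding eq by (rule mult_pos_pos[OF zero_less_power[OF e] G21])
    have eq: "of_int (1) * vol3 (D.space 0) (D.space 5) (D.space 6) (D.space 7) = e^2 * (16 * x - 68 * e * x + 8 * e * a - 30 * e^2 * x - 10 * e^2 * a)"
      unfolding vols unfolding defs by (simp add: eval_nat_numeral algebra_simps)
    have v26: "0 < of_int (1) * vol3 (D.space 0) (D.space 5) (D.space 6) (D.space 7)" unfolding eq by (rule mult_pos_pos[OF zero_less_power[OF e] G22])
    have eq: "of_int (1) * vol3 (D.space 1) (D.space 2) (D.space 3) (D.space 4) = e^2 * (64 + 96 * e + 64 * e * c + 96 * e^2 * c - 32 * e^2 * a)"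
      unfolding vols unfolding defs by (simp add: eval_nat_numeral algebra_simps)
    have v27: "0 < of_int (1) * vol3 (D.space 1) (D.space 2) (D.space 3) (D.space 4)" unfolding eq by (rule mult_pos_pos[OF zero_less_power[OF e] G14])
    have eq: "of_int (-1) * vol3 (D.space 1) (D.space 2) (D.space 3) (D.space 5) = e^1 * (8 - 46 * e + 8 * e * c - 15 * e^2 - 46 * e^2 * c + 20 * e^2 * x - 4 * e^2 * a - 15 * e^3 * c +
     48 * e^3 * x + 69 * e^3 * a)"
      unfolding vols unfolding defs by (simp add: eval_nat_numeral algebra_simps)
    have v28: "0 < of_int (-1) * vol3 (D.space 1) (D.space 2) (D.space 3) (D.space 5)" unfolding eq by (rule mult_pos_pos[OF zero_less_power[OF e] G21])
    have eq: "of_int (1) * vol3 (D.space 1) (D.space 2) (D.space 3) (D.space 6) = e^1 * (8 - 22 * e + 8 * e * c - 15 * e^2 - 22 * e^2 * c - 20 * e^2 * x - 4 * e^2 * a - 15 * e^3 * c -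
     48 * e^3 * x + 37 * e^3 * a)"
      unfolding vols unfolding defs by (simp add: eval_nat_numeral algebra_simps)
    have v29: "0 < of_int (1) * vol3 (D.space 1) (D.space 2) (D.space 3) (D.space 6)" unfolding eq by (rule mult_pos_pos[OF zero_less_power[OF e] G20])
    have eq: "of_int (1) * vol3 (D.space 1) (D.space 2) (D.space 3) (D.space 7) = e^2 * (24 + 24 * e * c + 8 * e^2 * a + 96 * e^3 * a)"
      unfolding vols unfolding defs by (simp add: eval_nat_numeral algebra_simps)
    have v30: "0 < of_int (1) * vol3 (D.space 1) (D.space 2) (D.space 3) (D.space 7)" unfolding eq by (rule mult_pos_pos[OF zero_less_power[OF e] G23])
    have eq: "of_int (1) * vol3 (D.space 1) (D.space 2) (D.space 4) (D.space 5) = e^2 * (64 - 96 * e + 64 * e * c - 32 * e * x - 96 * e^2 * c - 96 * e^2 * x - 96 * e^2 * a)"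
      unfolding vols unfolding defs by (simp add: eval_nat_numeral algebra_simps)
    have v31: "0 < of_int (1) * vol3 (D.space 1) (D.space 2) (D.space 4) (D.space 5)" unfolding eq by (rule mult_pos_pos[OF zero_less_power[OF e] G24])
    have eq: "of_int (-1) * vol3 (D.space 1) (D.space 2) (D.space 4) (D.space 6) = e^2 * (128 + 96 * e + 128 * e * c + 32 * e * x + 96 * e^2 * c + 96 * e^2 * x - 96 * e^2 * a)"
      unfolding vols unfolding defs by (simp add: eval_nat_numeral algebra_simps)
    have v32: "0 < of_int (-1) * vol3 (D.space 1) (D.space 2) (D.space 4) (D.space 6)" unfolding eq by (rule mult_pos_pos[OF zero_less_power[OF e] G25])
    have eq: "of_int (-1) * vol3 (D.space 1) (D.space 2) (D.space 4) (D.space 7) = e^2 * (64 + 192 * e + 64 * e * c + 192 * e^2 * c - 64 * e^2 * a - 192 * e^3 * a)"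
      unfolding vols unfolding defs by (simp add: eval_nat_numeral algebra_simps)
    have v33: "0 < of_int (-1) * vol3 (D.space 1) (D.space 2) (D.space 4) (D.space 7)" unfolding eq by (rule mult_pos_pos[OF zero_less_power[OF e] G26])
    have eq: "of_int (1) * vol3 (D.space 1) (D.space 2) (D.space 5) (D.space 6) = e^1 * (8 - 58 * e + 8 * e * c + 8 * e * x - 30 * e^2 - 58 * e^2 * c + 38 * e^2 * x - 30 * e^3 * c - 30
     * e^3 * x + 96 * e^3 * a)"
      unfolding vols unfolding defs by (simp add: eval_nat_numeral algebra_simps)
    have v34: "0 < of_int (1) * vol3 (D.space 1) (D.space 2) (D.space 5) (D.space 6)" unfolding eq by (rule mult_pos_pos[OF zero_less_power[OF e] G27])
    have eq: "of_int (1) * vol3 (D.space 1) (D.space 2) (D.space 5) (D.space 7) = e^1 * (8 - 58 * e + 8 * e * c - 30 * e^2 - 58 * e^2 * c + 32 * e^2 * x - 8 * e^2 * a - 30 * e^3 * c +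
     96 * e^3 * x + 90 * e^3 * a + 126 * e^4 * a)"
      unfolding vols unfolding defs by (simp add: eval_nat_numeral algebra_simps)
    have v35: "0 < of_int (1) * vol3 (D.space 1) (D.space 2) (D.space 5) (D.space 7)" unfolding eq by (rule mult_pos_pos[OF zero_less_power[OF e] G28])
    have eq: "of_int (-1) * vol3 (D.space 1) (D.space 2) (D.space 6) (D.space 7) = e^1 * (8 - 58 * e + 8 * e * c - 30 * e^2 - 58 * e^2 * c - 32 * e^2 * x - 8 * e^2 * a - 30 * e^3 * c -
     96 * e^3 * x + 26 * e^3 * a - 66 * e^4 * a)"
      unfolding vols unfolding defs by (simp add: eval_nat_numeral algebra_simps)
    have v36: "0 < of_int (-1) * vol3 (D.space 1) (D.space 2) (D.space 6) (D.space 7)" unfolding eq by (rule mult_pos_pos[OF zero_less_power[OF e] G29])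
    have eq: "of_int (1) * vol3 (D.space 1) (D.space 3) (D.space 4) (D.space 5) = e^1 * (8 - 46 * e + 8 * e * c - 15 * e^2 - 46 * e^2 * c - 44 * e^2 * x - 4 * e^2 * a - 15 * e^3 * c -
     48 * e^3 * x - 59 * e^3 * a)"
      unfolding vols unfolding defs by (simp add: eval_nat_numeral algebra_simps)
    have v37: "0 < of_int (1) * vol3 (D.space 1) (D.space 3) (D.space 4) (D.space 5)" unfolding eq by (rule mult_pos_pos[OF zero_less_power[OF e] G16])
    have eq: "of_int (-1) * vol3 (D.space 1) (D.space 3) (D.space 4) (D.space 6) = e^1 * (8 - 22 * e + 8 * e * c - 15 * e^2 - 22 * e^2 * c + 44 * e^2 * x - 4 * e^2 * a - 15 * e^3 * c +
     48 * e^3 * x - 27 * e^3 * a)"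
      unfolding vols unfolding defs by (simp add: eval_nat_numeral algebra_simps)
    have v38: "0 < of_int (-1) * vol3 (D.space 1) (D.space 3) (D.space 4) (D.space 6)" unfolding eq by (rule mult_pos_pos[OF zero_less_power[OF e] G30])
    have eq: "of_int (-1) * vol3 (D.space 1) (D.space 3) (D.space 4) (D.space 7) = e^2 * (24 + 24 * e * c - 56 * e^2 * a - 96 * e^3 * a)"
      unfolding vols unfolding defs by (simp add: eval_nat_numeral algebra_simps)
    have v39: "0 < of_int (-1) * vol3 (D.space 1) (D.space 3) (D.space 4) (D.space 7)" unfolding eq by (rule mult_pos_pos[OF zero_less_power[OF e] G2])
    have eq: "of_int (1) * vol3 (D.space 1) (D.space 3) (D.space 5) (D.space 6) = e^2 * (16 * x - 68 * e * x + 8 * e * a - 30 * e^2 * x - 10 * e^2 * a)"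
      unfolding vols unfolding defs by (simp add: eval_nat_numeral algebra_simps)
    have v40: "0 < of_int (1) * vol3 (D.space 1) (D.space 3) (D.space 5) (D.space 6)" unfolding eq by (rule mult_pos_pos[OF zero_less_power[OF e] G22])
    have eq: "of_int (1) * vol3 (D.space 1) (D.space 3) (D.space 5) (D.space 7) = e^3 * (24 * x - 8 * a + 82 * e * a + 30 * e^2 * a)"
      unfolding vols unfolding defs by (simp add: eval_nat_numeral algebra_simps)
    have v41: "0 < of_int (1) * vol3 (D.space 1) (D.space 3) (D.space 5) (D.space 7)" unfolding eq by (rule mult_pos_pos[OF zero_less_power[OF e] G9])
    have eq: "of_int (-1) * vol3 (D.space 1) (D.space 3) (D.space 6) (D.space 7) = e^3 * (- 24 * x - 8 * a + 34 * e * a + 30 * e^2 * a)"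
      unfolding vols unfolding defs by (simp add: eval_nat_numeral algebra_simps)
    have v42: "0 < of_int (-1) * vol3 (D.space 1) (D.space 3) (D.space 6) (D.space 7)" unfolding eq by (rule mult_pos_pos[OF zero_less_power[OF e] G8])
    have eq: "of_int (1) * vol3 (D.space 1) (D.space 4) (D.space 5) (D.space 7) = e^1 * (8 - 58 * e + 8 * e * c - 30 * e^2 - 58 * e^2 * c - 32 * e^2 * x - 8 * e^2 * a - 30 * e^3 * c -
     96 * e^3 * x + 26 * e^3 * a - 66 * e^4 * a)"
      unfolding vols unfolding defs by (simp add: eval_nat_numeral algebra_simps)
    have v43: "0 < of_int (1) * vol3 (D.space 1) (D.space 4) (D.space 5) (D.space 7)" unfolding eq by (rule mult_pos_pos[OF zero_less_power[OF e] G29])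
    have eq: "of_int (-1) * vol3 (D.space 1) (D.space 4) (D.space 6) (D.space 7) = e^1 * (8 - 58 * e + 8 * e * c - 30 * e^2 - 58 * e^2 * c + 32 * e^2 * x - 8 * e^2 * a - 30 * e^3 * c +
     96 * e^3 * x + 90 * e^3 * a + 126 * e^4 * a)"
      unfolding vols unfolding defs by (simp add: eval_nat_numeral algebra_simps)
    have v44: "0 < of_int (-1) * vol3 (D.space 1) (D.space 4) (D.space 6) (D.space 7)" unfolding eq by (rule mult_pos_pos[OF zero_less_power[OF e] G28])
    have eq: "of_int (1) * vol3 (D.space 1) (D.space 5) (D.space 6) (D.space 7) = e^2 * (16 * x - 116 * e * x + 16 * e * a - 60 * e^2 * x - 116 * e^2 * a - 60 * e^3 * a)"
      unfolding vols unfolding defs by (simp add: eval_nat_numeral algebra_simps)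
    have v45: "0 < of_int (1) * vol3 (D.space 1) (D.space 5) (D.space 6) (D.space 7)" unfolding eq by (rule mult_pos_pos[OF zero_less_power[OF e] G31])
    have eq: "of_int (-1) * vol3 (D.space 2) (D.space 3) (D.space 4) (D.space 5) = e^2 * (128 + 128 * e * c + 32 * e * x)"
      unfolding vols unfolding defs by (simp add: eval_nat_numeral algebra_simps)
    have v46: "0 < of_int (-1) * vol3 (D.space 2) (D.space 3) (D.space 4) (D.space 5)" unfolding eq by (rule mult_pos_pos[OF zero_less_power[OF e] G13])
    have eq: "of_int (1) * vol3 (D.space 2) (D.space 3) (D.space 4) (D.space 6) = e^2 * (64 + 64 * e * c - 32 * e * x)"
      unfolding vols unfolding defs by (simp add: eval_nat_numeral algebra_simps)
    have v47: "0 < of_int (1) * vol3 (D.space 2) (D.space 3) (D.space 4) (D.space 6)" unfolding eq by (rule mult_pos_pos[OF zero_less_power[OF e] G12])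
    have eq: "of_int (1) * vol3 (D.space 2) (D.space 3) (D.space 4) (D.space 7) = e^3 * (96 + 96 * e * c + 32 * e * a)"
      unfolding vols unfolding defs by (simp add: eval_nat_numeral algebra_simps)
    have v48: "0 < of_int (1) * vol3 (D.space 2) (D.space 3) (D.space 4) (D.space 7)" unfolding eq by (rule mult_pos_pos[OF zero_less_power[OF e] G32])
    have eq: "of_int (1) * vol3 (D.space 2) (D.space 3) (D.space 5) (D.space 6) = e^1 * (8 - 10 * e + 8 * e * c + 8 * e * x - 10 * e^2 * c - 106 * e^2 * x)"
      unfolding vols unfolding defs by (simp add: eval_nat_numeral algebra_simps)
    have v49: "0 < of_int (1) * vol3 (D.space 2) (D.space 3) (D.space 5) (D.space 6)" unfolding eq by (rule mult_pos_pos[OF zero_less_power[OF e] G19])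
    have eq: "of_int (-1) * vol3 (D.space 2) (D.space 3) (D.space 6) (D.space 7) = e^2 * (12 + 15 * e + 12 * e * c - 12 * e * x - 4 * e * a + 15 * e^2 * c + 48 * e^2 * x + 37 * e^2 * a)"
      unfolding vols unfolding defs by (simp add: eval_nat_numeral algebra_simps)
    have v50: "0 < of_int (-1) * vol3 (D.space 2) (D.space 3) (D.space 6) (D.space 7)" unfolding eq by (rule mult_pos_pos[OF zero_less_power[OF e] G6])
    have eq: "of_int (-1) * vol3 (D.space 2) (D.space 4) (D.space 5) (D.space 6) = e^2 * (192 + 192 * e * c + 192 * e * x)"
      unfolding vols unfolding defs by (simp add: eval_nat_numeral algebra_simps)
    have v51: "0 < of_int (-1) * vol3 (D.space 2) (D.space 4) (D.space 5) (D.space 6)" unfolding eq by (rule mult_pos_pos[OF zero_less_power[OF e] G33])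
    have eq: "of_int (-1) * vol3 (D.space 2) (D.space 4) (D.space 5) (D.space 7) = e^2 * (128 + 96 * e + 128 * e * c + 32 * e * x + 96 * e^2 * c + 96 * e^2 * x - 96 * e^2 * a)"
      unfolding vols unfolding defs by (simp add: eval_nat_numeral algebra_simps)
    have v52: "0 < of_int (-1) * vol3 (D.space 2) (D.space 4) (D.space 5) (D.space 7)" unfolding eq by (rule mult_pos_pos[OF zero_less_power[OF e] G25])
    have eq: "of_int (1) * vol3 (D.space 2) (D.space 4) (D.space 6) (D.space 7) = e^2 * (64 - 96 * e + 64 * e * c - 32 * e * x - 96 * e^2 * c - 96 * e^2 * x - 96 * e^2 * a)"
      unfolding vols unfolding defs by (simp add: eval_nat_numeral algebra_simps)
    have v53: "0 < of_int (1) * vol3 (D.space 2) (D.space 4) (D.space 6) (D.space 7)" unfolding eq by (rule mult_pos_pos[OF zero_less_power[OF e] G24])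
    have eq: "of_int (-1) * vol3 (D.space 3) (D.space 4) (D.space 5) (D.space 6) = e^1 * (8 - 10 * e + 8 * e * c + 8 * e * x - 10 * e^2 * c + 86 * e^2 * x)"
      unfolding vols unfolding defs by (simp add: eval_nat_numeral algebra_simps)
    have v54: "0 < of_int (-1) * vol3 (D.space 3) (D.space 4) (D.space 5) (D.space 6)" unfolding eq by (rule mult_pos_pos[OF zero_less_power[OF e] G15])
    have eq: "of_int (-1) * vol3 (D.space 3) (D.space 4) (D.space 5) (D.space 7) = e^2 * (36 + 15 * e + 36 * e * c + 12 * e * x - 4 * e * a + 15 * e^2 * c + 48 * e^2 * x - 59 * e^2 * a)"
      unfolding vols unfolding defs by (simp add: eval_nat_numeral algebra_simps)
    have v55: "0 < of_int (-1) * vol3 (D.space 3) (D.space 4) (D.space 5) (D.space 7)" unfolding eq by (rule mult_pos_pos[OF zero_less_power[OF e] G34])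
    have eq: "of_int (1) * vol3 (D.space 3) (D.space 4) (D.space 6) (D.space 7) = e^2 * (12 + 15 * e + 12 * e * c - 12 * e * x - 4 * e * a + 15 * e^2 * c - 48 * e^2 * x - 27 * e^2 * a)"
      unfolding vols unfolding defs by (simp add: eval_nat_numeral algebra_simps)
    have v56: "0 < of_int (1) * vol3 (D.space 3) (D.space 4) (D.space 6) (D.space 7)" unfolding eq by (rule mult_pos_pos[OF zero_less_power[OF e] G1])
    have eq: "of_int (-1) * vol3 (D.space 3) (D.space 5) (D.space 6) (D.space 7) = e^3 * (48 * x + 8 * a + 30 * e * x - 10 * e * a)"
      unfolding vols unfolding defs by (simp add: eval_nat_numeral algebra_simps)
    have v57: "0 < of_int (-1) * vol3 (D.space 3) (D.space 5) (D.space 6) (D.space 7)" unfolding eq by (rule mult_pos_pos[OF zero_less_power[OF e] G7])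
    have eq: "of_int (1) * vol3 (D.space 4) (D.space 5) (D.space 6) (D.space 7) = e^1 * (8 - 58 * e + 8 * e * c + 8 * e * x - 30 * e^2 - 58 * e^2 * c + 38 * e^2 * x - 30 * e^3 * c - 30
     * e^3 * x + 96 * e^3 * a)"
      unfolding vols unfolding defs by (simp add: eval_nat_numeral algebra_simps)
    have v58: "0 < of_int (1) * vol3 (D.space 4) (D.space 5) (D.space 6) (D.space 7)" unfolding eq by (rule mult_pos_pos[OF zero_less_power[OF e] G27])
    have "list_all (\<lambda>((i, j, k, l), s). 0 < of_int s * vol3 (D.space i) (D.space j) (D.space k) (D.space l)) volume_signs"
      unfolding volume_signs_def by (simp only: list.pred_inject prod.case simp_thms v0 v1 v2 v3 v4 v5 v6 v7 v8 v9 v10 v11 v12 v13 v14 v15 v16 v17 v18 v19 v20 v21 v22 v23 v24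
        v25 v26 v27 v28 v29 v30 v31 v32 v33 v34 v35 v36 v37 v38 v39 v40 v41 v42 v43 v44 v45 v46
        v47 v48 v49 v50 v51 v52 v53 v54 v55 v56 v57 v58)
    then have signs: "0 < of_int s * vol3 (D.space i) (D.space j) (D.space k) (D.space l)" if "((i, j, k, l), s) \<in> set volume_signs" for i j k l s
      using that unfolding list_all_iff by fast
    have eq: "D.label_orient ((0, 0, 0), (5, 0, 0), (4, 0, 0)) = 2 - 2 * e * g2 + e * h2 + e * h1 - e * e2 + e * e1 - e * d2 + e * d1 + e^2 * h2 * g1 - e^2 * h1
     * g2 + e^2 * e2 * g1 - e^2 * e2 * h1 - e^2 * e1 * g2 + e^2 * e1 * h2 + e^2 * d2 * g1 - e^2 * d2
     * h1 - e^2 * d1 * g2 + e^2 * d1 * h2 + e^2 * l - e^3 * l * g2 + e^3 * l * h2"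
      unfolding labels unfolding defs by (simp add: eval_nat_numeral algebra_simps)
    have o0: "0 < D.label_orient ((0, 0, 0), (5, 0, 0), (4, 0, 0))" unfolding eq by (rule G35)
    have eq: "D.label_orient ((0, 0, 0), (4, 0, 0), (3, 0, 0)) = 2 - e * h2 + e * h1 - e * e2 + e * e1 + 3 * e * d2 + e * d1 + 2 * e^2 * d2 * h1 + 2 * e^2 * d2 *
     e1 - 2 * e^2 * d1 * h2 - 2 * e^2 * d1 * e2 + e^2 * l + 2 * e^3 * l * d2"
      unfolding labels unfolding defs by (simp add: eval_nat_numeral algebra_simps)
    have o1: "0 < D.label_orient ((0, 0, 0), (4, 0, 0), (3, 0, 0))" unfolding eq by (rule G36)
    have eq: "D.label_orient ((0, 0, 0), (3, 0, 0), (2, 0, 0)) = 2 - e * h2 + e * h1 - e * e2 + e * e1 + 3 * e * d2 + e * d1 + 2 * e^2 * d2 * h1 + 2 * e^2 * d2 *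
     e1 - 2 * e^2 * d1 * h2 - 2 * e^2 * d1 * e2 + e^2 * l + 2 * e^3 * l * d2"
      unfolding labels unfolding defs by (simp add: eval_nat_numeral algebra_simps)
    have o2: "0 < D.label_orient ((0, 0, 0), (3, 0, 0), (2, 0, 0))" unfolding eq by (rule G36)
    have eq: "D.label_orient ((0, 0, 0), (2, 0, 0), (1, 0, 0)) = e^1 * (9 - 9 * e * h2 - 9 * e * e2 + 9 * e * d2 + e * w + e^2 * w * h1 + e^2 * w * e1 - e^2 * w * d1 +
     e^2 * m - e^3 * m * h2 - e^3 * m * e2 + e^3 * m * d2 + e^3 * l * w)"
      unfolding labels unfolding defs by (simp add: eval_nat_numeral algebra_simps)
    have o3: "0 < D.label_orient ((0, 0, 0), (2, 0, 0), (1, 0, 0))" unfolding eq by (rule mult_pos_pos[OF zero_less_power[OF e] G37])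
    have eq: "D.label_orient ((0, 0, 0), (1, 0, 0), (7, 0, 0)) = e^2 * (- 2 * w - 2 * e^2 * l * w)"
      unfolding labels unfolding defs by (simp add: eval_nat_numeral algebra_simps)
    have o4: "0 < D.label_orient ((0, 0, 0), (1, 0, 0), (7, 0, 0))" unfolding eq by (rule mult_pos_pos[OF zero_less_power[OF e] G38])
    have eq: "D.label_orient ((0, 0, 0), (7, 0, 0), (6, 0, 0)) = e^1 * (2 * g2 - 2 * e2 + 2 * d2 - 9 * e * g2 + 9 * e * e2 - 9 * e * d2 + e^2 * w * g1 - e^2 * w * e1 +
     e^2 * w * d1 + 2 * e^2 * l * g2 - 2 * e^2 * l * e2 + 2 * e^2 * l * d2 - e^3 * m * g2 + e^3 * m *
     e2 - e^3 * m * d2 + e^3 * l * w)"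
      unfolding labels unfolding defs by (simp add: eval_nat_numeral algebra_simps)
    have o5: "0 < D.label_orient ((0, 0, 0), (7, 0, 0), (6, 0, 0))" unfolding eq by (rule mult_pos_pos[OF zero_less_power[OF e] G39])
    have eq: "D.label_orient ((0, 0, 0), (6, 0, 0), (5, 0, 0)) = e^1 * (g2 + g1 - e2 - e1 + d2 + d1 - 2 * e * e2 * g1 + 2 * e * e1 * g2 + 2 * e * d2 * e1 - 2 * e * d1 *
     e2 + e * l - 2 * e^2 * l * e2)"
      unfolding labels unfolding defs by (simp add: eval_nat_numeral algebra_simps)
    have o6: "0 < D.label_orient ((0, 0, 0), (6, 0, 0), (5, 0, 0))" unfolding eq by (rule mult_pos_pos[OF zero_less_power[OF e] G40])
    have eq: "D.label_orient ((1, 0, 0), (2, 0, 0), (5, 1, 0)) = 2 - 9 * e - e * g2 - e * g1 - 2 * e * h2 - e * e2 + e * e1 + e * d2 - e * d1 + 9 * e^2 * g2 + 9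
     * e^2 * h2 + e^2 * h2 * g1 - e^2 * h1 * g2 + e^2 * e2 * g1 + e^2 * e2 * h1 - e^2 * e1 * g2 - e^2
     * e1 * h2 - e^2 * d2 * g1 - e^2 * d2 * h1 + e^2 * d1 * g2 + e^2 * d1 * h2 + e^2 * w + e^2 * l -
     e^3 * w * g1 - e^3 * w * h1 - e^3 * m - e^3 * l * g2 - e^3 * l * h2 + e^4 * m * g2 + e^4 * m *
     h2"
      unfolding labels unfolding defs by (simp add: eval_nat_numeral algebra_simps)
    have o7: "0 < D.label_orient ((1, 0, 0), (2, 0, 0), (5, 1, 0))" unfolding eq by (rule G41)
    have eq: "D.label_orient ((1, 0, 0), (5, 1, 0), (3, 0, 1)) = e^1 * (2 * g2 - 2 * e2 + 2 * d2 - 9 * e * g2 + 9 * e * e2 - 9 * e * d2 + e^2 * w * g1 - e^2 * w * e1 +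
     e^2 * w * d1 + 2 * e^2 * l * g2 - 2 * e^2 * l * e2 + 2 * e^2 * l * d2 - e^3 * m * g2 + e^3 * m *
     e2 - e^3 * m * d2 + e^3 * l * w)"
      unfolding labels unfolding defs by (simp add: eval_nat_numeral algebra_simps)
    have o8: "0 < D.label_orient ((1, 0, 0), (5, 1, 0), (3, 0, 1))" unfolding eq by (rule mult_pos_pos[OF zero_less_power[OF e] G39])
    have eq: "D.label_orient ((2, 0, 0), (4, 1, 0), (5, 1, 0)) = e^1 * (2 * h2 - 2 * h1 - 2 * e * h2 * g1 + 2 * e * h1 * g2)"
      unfolding labels unfolding defs by (simp add: eval_nat_numeral algebra_simps)
    have o9: "0 < D.label_orient ((2, 0, 0), (4, 1, 0), (5, 1, 0))" unfolding eq by (rule mult_pos_pos[OF zero_less_power[OF e] G42])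
    have eq: "D.label_orient ((3, 0, 0), (4, 0, 0), (7, 0, -1)) = e^1 * (9 - 9 * e * h2 - 9 * e * e2 + 9 * e * d2 + e * w + e^2 * w * h1 + e^2 * w * e1 - e^2 * w * d1 +
     e^2 * m - e^3 * m * h2 - e^3 * m * e2 + e^3 * m * d2 + e^3 * l * w)"
      unfolding labels unfolding defs by (simp add: eval_nat_numeral algebra_simps)
    have o10: "0 < D.label_orient ((3, 0, 0), (4, 0, 0), (7, 0, -1))" unfolding eq by (rule mult_pos_pos[OF zero_less_power[OF e] G37])
    have eq: "D.label_orient ((3, 0, 0), (7, 0, -1), (1, 0, -1)) = e^2 * (- 2 * w - 2 * e^2 * l * w)"
      unfolding labels unfolding defs by (simp add: eval_nat_numeral algebra_simps)
    have o11: "0 < D.label_orient ((3, 0, 0), (7, 0, -1), (1, 0, -1))" unfolding eq by (rule mult_pos_pos[OF zero_less_power[OF e] G38])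
    have eq: "D.label_orient ((7, 0, -1), (4, 0, 0), (6, 0, -1)) = 2 - 9 * e - e * g2 - e * g1 - 2 * e * h2 - e * e2 + e * e1 + e * d2 - e * d1 + 9 * e^2 * g2 + 9
     * e^2 * h2 + e^2 * h2 * g1 - e^2 * h1 * g2 + e^2 * e2 * g1 + e^2 * e2 * h1 - e^2 * e1 * g2 - e^2
     * e1 * h2 - e^2 * d2 * g1 - e^2 * d2 * h1 + e^2 * d1 * g2 + e^2 * d1 * h2 + e^2 * w + e^2 * l -
     e^3 * w * g1 - e^3 * w * h1 - e^3 * m - e^3 * l * g2 - e^3 * l * h2 + e^4 * m * g2 + e^4 * m *
     h2"
      unfolding labels unfolding defs by (simp add: eval_nat_numeral algebra_simps)
    have o12: "0 < D.label_orient ((7, 0, -1), (4, 0, 0), (6, 0, -1))" unfolding eq by (rule G41)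
    have eq: "D.label_orient ((3, 0, 0), (5, 1, -1), (6, 1, -1)) = e^1 * (g2 + g1 - e2 - e1 + d2 + d1 - 2 * e * e2 * g1 + 2 * e * e1 * g2 + 2 * e * d2 * e1 - 2 * e * d1 *
     e2 + e * l - 2 * e^2 * l * e2)"
      unfolding labels unfolding defs by (simp add: eval_nat_numeral algebra_simps)
    have o13: "0 < D.label_orient ((3, 0, 0), (5, 1, -1), (6, 1, -1))" unfolding eq by (rule mult_pos_pos[OF zero_less_power[OF e] G40])
    have eq: "D.label_orient ((3, 0, 0), (6, 1, -1), (2, 0, 0)) = 2 - 2 * e * g2 + e * h2 + e * h1 - e * e2 + e * e1 - e * d2 + e * d1 + e^2 * h2 * g1 - e^2 * h1
     * g2 + e^2 * e2 * g1 - e^2 * e2 * h1 - e^2 * e1 * g2 + e^2 * e1 * h2 + e^2 * d2 * g1 - e^2 * d2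
     * h1 - e^2 * d1 * g2 + e^2 * d1 * h2 + e^2 * l - e^3 * l * g2 + e^3 * l * h2"
      unfolding labels unfolding defs by (simp add: eval_nat_numeral algebra_simps)
    have o14: "0 < D.label_orient ((3, 0, 0), (6, 1, -1), (2, 0, 0))" unfolding eq by (rule G35)
    have eq: "D.label_orient ((4, 0, 0), (2, -1, 0), (6, 0, -1)) = e^1 * (2 * h2 - 2 * h1 - 2 * e * h2 * g1 + 2 * e * h1 * g2)"
      unfolding labels unfolding defs by (simp add: eval_nat_numeral algebra_simps)
    have o15: "0 < D.label_orient ((4, 0, 0), (2, -1, 0), (6, 0, -1))" unfolding eq by (rule mult_pos_pos[OF zero_less_power[OF e] G42])
    have "list_all (\<lambda>t. 0 < D.label_orient t) torus_triangles"
      unfolding torus_triangles_def by (simp only: list.pred_inject simp_thms o0 o1 o2 o3 o4 o5 o6 o7 o8 o9 o10 o11 o12 o13 o14 o15)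
    then have orient: "0 < D.label_orient t" if "t \<in> set torus_triangles" for t
      using that unfolding list_all_iff by fast
    \<comment> \<open>The limits of the generators are \<open>(-3, 1)\<close> and
      \<open>(-3, -1)\<close>, which \<open>point2\<close> takes to those of the hexagonal
      lattice.\<close>
    have "dist (point2 D.l1u D.l1v) 1 < \<eta>" "dist (point2 D.l2u D.l2v) (Complex (1/2) (sqrt 3 / 2)) < \<eta>"
      unfolding point2_limits[symmetric] \<delta>(2) ldefs
      by (rule dist_point2_less[OF _ _ \<delta>(1)]; unfold abs_le_iff; rule conjI; use bounds in linarith)+
    moreover have "\<forall>i<8. dist (D.pos i) (point2 (limit_u i) (limit_v i)) < \<eta>"
      unfolding all_less_8 D.pos_def \<delta>(2) planar limits ldefs
      by (intro conjI; rule dist_point2_less[OF _ _ \<delta>(1)]; unfold abs_le_iff; rule conjI; use bounds in linarith)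
    moreover have "\<forall>i<8. dist (D.f i) (limit_space i) < \<eta>"
      unfolding all_less_8 D.f_def space prod.case limits \<delta>(2)
      by (intro conjI; rule dist_point3_less[OF _ _ _ \<delta>(1)]; unfold abs_le_iff; rule conjI; use bounds in linarith)
    ultimately show ?thesis
      using D.paper_torus_folded[OF signs orient] by blast
  qed
qed

section \<open>The folded hexagonal torus\<close>

abbreviation hex_gen :: complex where
  "hex_gen \<equiv> Complex (1/2) (sqrt 3 / 2)"

definition hexpt :: "real \<Rightarrow> real \<Rightarrow> complex" where
  "hexpt x y = Complex (x + y / 2) (y * (sqrt 3 / 2))"

lemma hexpt_eq: "hexpt x y = x *\<^sub>R 1 + y *\<^sub>R hex_gen"
  by (simp add: hexpt_def complex_eq_iff)

lemma hexpt_add: "hexpt x y + hexpt x' y' = hexpt (x + x') (y + y')"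
  by (simp add: hexpt_def complex_eq_iff algebra_simps add_divide_distrib)

lemma orient_hexpt:
  "orient (hexpt x y) (hexpt x' y') (hexpt x'' y'') =
    (sqrt 3 / 2) * ((x' - x) * (y'' - y) - (y' - y) * (x'' - x))"
  by (simp add: hexpt_def orient_def field_simps)

lemma orient_hex_gen: "orient 0 1 hex_gen = sqrt 3 / 2"
  by (simp add: orient_def)

lemma dist_hexpt: "dist (hexpt x y) (hexpt x' y') = sqrt ((x - x')\<^sup>2 + (x - x') * (y - y') + (y - y')\<^sup>2)"
proof -
  have "(a + b / 2)\<^sup>2 + (b * (sqrt 3 / 2))\<^sup>2 = a\<^sup>2 + a * b + b\<^sup>2" for a b :: real
    by (simp add: power_mult_distrib power2_sum power_divide)
  moreover have "hexpt x y - hexpt x' y' = Complex ((x - x') + (y - y') / 2) ((y - y') * (sqrt 3 / 2))"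
    by (simp add: hexpt_def complex_eq_iff algebra_simps diff_divide_distrib)
  ultimately show ?thesis by (simp add: dist_norm complex_norm)
qed

text \<open>Vertex classes \<open>0, 1, 2\<close> are mapped to the three corners of the triangle; the six triangles
  surround the vertex \<open>0\<close>.\<close>

definition hex_pos :: "nat \<Rightarrow> complex" where
  "hex_pos i = [hexpt 0 0, hexpt (1/3) (1/3), hexpt (2/3) (-1/3)] ! i"

definition hex_triangles :: "ltriangle list" where
  "hex_triangles =
  [((0, 0, 0), (2, 0, 0), (1, 0, 0)), ((0, 0, 0), (1, 0, 0), (2, -1, 1)), ((0, 0, 0), (2, -1, 1), (1,
   -1, 0)), ((0, 0, 0), (1, -1, 0), (2, -1, 0)), ((0, 0, 0), (2, -1, 0), (1, 0, -1)), ((0, 0, 0),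
   (1, 0, -1), (2, 0, 0))]"

definition hex_fold :: "nat \<Rightarrow> real^3" where
  "hex_fold i = [point3 0 1 0, point3 0 (-1) 0, point3 1 0 0] ! i"

text \<open>The triangles of the folded map do not form a simplicial complex on the torus, as all six have
  the same vertex classes; cutting each into four does.\<close>

definition hex_small_pos :: "nat \<Rightarrow> complex" where
  "hex_small_pos k = hexpt (real (k div 2) / 6) (real (k div 2 mod 3 + 3 * (k mod 2)) / 6)"

text \<open>Four consecutive entries subdivide one entry of \<open>hex_triangles\<close>, in the
  same order. The vertices are the points \<open>(i/6, j/6)\<close> in lattice coordinates with
  \<open>i\<close> and \<open>j\<close> congruent modulo 3.\<close>

definition hex_small_triangles :: "ltriangle list" where
  "hex_small_triangles =
  [((0, 0, 0), (5, 0, -1), (2, 0, 0)), ((5, 0, -1), (9, 0, -1), (6, 0, 0)), ((2, 0, 0), (6, 0, 0), (4,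
   0, 0)), ((5, 0, -1), (6, 0, 0), (2, 0, 0)), ((0, 0, 0), (2, 0, 0), (10, -1, 0)), ((2, 0, 0), (4,
   0, 0), (1, 0, 0)), ((10, -1, 0), (1, 0, 0), (9, -1, 0)), ((2, 0, 0), (1, 0, 0), (10, -1, 0)),
   ((0, 0, 0), (10, -1, 0), (8, -1, 0)), ((10, -1, 0), (9, -1, 0), (7, -1, 0)), ((8, -1, 0), (7, -1,
   0), (4, -1, 0)), ((10, -1, 0), (7, -1, 0), (8, -1, 0)), ((0, 0, 0), (8, -1, 0), (11, -1, -1)),
   ((8, -1, 0), (4, -1, 0), (6, -1, 0)), ((11, -1, -1), (6, -1, 0), (9, -1, -1)), ((8, -1, 0), (6,
   -1, 0), (11, -1, -1)), ((0, 0, 0), (11, -1, -1), (3, 0, -1)), ((11, -1, -1), (9, -1, -1), (1, 0,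
   -1)), ((3, 0, -1), (1, 0, -1), (4, 0, -1)), ((11, -1, -1), (1, 0, -1), (3, 0, -1)), ((0, 0, 0),
   (3, 0, -1), (5, 0, -1)), ((3, 0, -1), (4, 0, -1), (7, 0, -1)), ((5, 0, -1), (7, 0, -1), (9, 0,
   -1)), ((3, 0, -1), (7, 0, -1), (5, 0, -1))]"

lemma matched_hex: "matched_torus 3 hex_triangles"
  by code_simp

lemma simplicial_hex: "simplicial_torus 12 hex_small_triangles"
  by code_simp

interpretation hexc: torus_complex 1 hex_gen hex_pos 3 hex_triangles
  by unfold_locales (use matched_hex in \<open>simp_all add: orient_hex_gen\<close>)

interpretation smallc: torus_complex 1 hex_gen hex_small_pos 12 hex_small_triangles
  by unfold_locales (use simplicial_hex in \<open>simp_all add: orient_hex_gen simplicial_torus_def\<close>)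

lemma hex_lat: "hexc.lat s = hexpt (of_int (fst s)) (of_int (snd s))"
  by (simp add: hexc.lat_def hexpt_eq)

lemma hex_vp: 
  "hexc.vp (0, s) = hexpt (of_int (fst s)) (of_int (snd s))"
  "hexc.vp (1, s) = hexpt (1/3 + of_int (fst s)) (1/3 + of_int (snd s))"
  "hexc.vp (Suc 0, s) = hexpt (1/3 + of_int (fst s)) (1/3 + of_int (snd s))"
  "hexc.vp (2, s) = hexpt (2/3 + of_int (fst s)) (- 1/3 + of_int (snd s))"
  by (simp_all add: hexc.vp_def hex_lat hex_pos_def hexpt_add)

lemma small_vp:
  "smallc.vp (k, s) = hexpt (real (k div 2) / 6 + of_int (fst s)) (real (k div 2 mod 3 + 3 * (k mod 2)) / 6 + of_int (snd s))"
  by (simp add: smallc.vp_def hex_lat hex_small_pos_def hexpt_add)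

lemma hex_orient:
  assumes "(p, q, r) \<in> set hex_triangles"
  shows "orient (hexc.vp p) (hexc.vp q) (hexc.vp r) = sqrt 3 / 6"
  using assms unfolding hex_triangles_def by (auto simp: hex_vp orient_hexpt)

lemma small_orient:
  assumes "(p, q, r) \<in> set hex_small_triangles"
  shows "orient (smallc.vp p) (smallc.vp q) (smallc.vp r) = sqrt 3 / 24"
  using assms unfolding hex_small_triangles_def by (auto simp: small_vp orient_hexpt)

interpretation hex: torus_tiling 1 hex_gen hex_pos 3 hex_triangles
proof
  show "orient (hexc.vp p) (hexc.vp q) (hexc.vp r) > 0" if "(p, q, r) \<in> set hex_triangles" for p q r
    unfolding hex_orient[OF that] by simp
  have "(\<Sum>t\<leftarrow>hex_triangles. case t of (p, q, r) \<Rightarrow> orient (hexc.vp p) (hexc.vp q) (hexc.vp r)) =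
      (\<Sum>t\<leftarrow>hex_triangles. sqrt 3 / 6)"
    by (intro arg_cong[where f = sum_list] map_cong refl) (auto simp: hex_orient)
  then show "(\<Sum>t\<leftarrow>hex_triangles. case t of (p, q, r) \<Rightarrow> orient (hexc.vp p) (hexc.vp q) (hexc.vp r)) = 2 * orient 0 1 hex_gen"
    by (simp add: orient_hex_gen hex_triangles_def)
qed

interpretation small: simplicial_tiling 1 hex_gen hex_small_pos 12 hex_small_triangles
proof
  show "orient (smallc.vp p) (smallc.vp q) (smallc.vp r) > 0" if "(p, q, r) \<in> set hex_small_triangles" for p q r
    unfolding small_orient[OF that] by simp
  have "(\<Sum>t\<leftarrow>hex_small_triangles. case t of (p, q, r) \<Rightarrow> orient (smallc.vp p) (smallc.vp q) (smallc.vp r)) =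
      (\<Sum>t\<leftarrow>hex_small_triangles. sqrt 3 / 24)"
    by (intro arg_cong[where f = sum_list] map_cong refl) (auto simp: small_orient)
  then show "(\<Sum>t\<leftarrow>hex_small_triangles. case t of (p, q, r) \<Rightarrow> orient (smallc.vp p) (smallc.vp q) (smallc.vp r)) = 2 * orient 0 1 hex_gen"
    by (simp add: orient_hex_gen hex_small_triangles_def)
  show "simplicial_torus 12 hex_small_triangles" by (rule simplicial_hex)
qed

abbreviation hex_map :: "complex set \<Rightarrow> real^3" where
  "hex_map \<equiv> hex.torus_map hex_fold"

lemma dist_hex_fold: 
  assumes "i < 3" "j < 3" "i \<noteq> j" shows "dist (hex_fold i) (hex_fold j) = sqrt (1/3)"
proof -
  have "norm kap = sqrt (1 / 12)" using norm_kap by (metis real_sqrt_unique less_imp_le)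
  then have k: "norm kap * sqrt 4 = sqrt (1 / 3)"
    using real_sqrt_mult[of "1 / 12" 4] by simp
  have "(i, j) \<in> {(0, 1), (1, 0), (0, 2), (2, 0), (1, 2), (2, 1)}" using assms by auto
  then show ?thesis using k by (auto simp: hex_fold_def dist_point3)
qed

lemma isometric_hex: "isometric_on_triangles hex_lattice (hex.tile ` set hex_triangles) hex_map"
  unfolding hex_lattice_def
proof (rule hex.isometric_torus_map)
  fix p q r assume "(p, q, r) \<in> set hex_triangles"
  then show "dist (hex_fold (fst p)) (hex_fold (fst q)) = dist (hexc.vp p) (hexc.vp q) \<and>
      dist (hex_fold (fst q)) (hex_fold (fst r)) = dist (hexc.vp q) (hexc.vp r) \<and>
      dist (hex_fold (fst p)) (hex_fold (fst r)) = dist (hexc.vp p) (hexc.vp r)"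
    unfolding hex_triangles_def
    by (auto simp: dist_hex_fold hex_vp dist_hexpt power2_eq_square)
qed

lemma small_tile_subset:
  assumes "t \<in> set hex_small_triangles" shows "\<exists>T\<in>set hex_triangles. small.tile t \<subseteq> hex.tile T"
proof -
  have sub: "small.tile t \<subseteq> hex.tile T"
    if T: "T \<in> set hex_triangles" and c: "\<forall>x\<in>set (corners t). smallc.vp x \<in> hex.tile T" for t T
    unfolding small.tile_eq_hull_verts small.verts_eq_corners
    using c by (intro hull_minimal hex.convex_tile) auto
  let ?in = "\<lambda>w T. case T of (p, q, r) \<Rightarrow>
    0 \<le> orient (hexc.vp p) (hexc.vp q) w \<and> 0 \<le> orient (hexc.vp q) (hexc.vp r) w \<and> 0 \<le> orient (hexc.vp r) (hexc.vp p) w"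
  \<comment> \<open>Each large triangle is repeated four times, so that the list is aligned with the
    subdivided one.\<close>
  let ?Ts = "concat (map (\<lambda>T. [T, T, T, T]) hex_triangles)"
  have mem: "w \<in> hex.tile T" if "T \<in> set hex_triangles" "?in w T" for T w
  proof -
    obtain p q r where "T = (p, q, r)" by (cases T)
    then show ?thesis using hex.mem_tile[of p q r w] hexc.Ts_in[of T] that by auto
  qed
  have "list_all (\<lambda>(t, T). T \<in> set hex_triangles \<and> (\<forall>x\<in>set (corners t). ?in (smallc.vp x) T)) (zip hex_small_triangles ?Ts)"
    by (simp add: hex_small_triangles_def hex_triangles_def small_vp hex_vp orient_hexpt)
  then have all: "\<forall>x\<in>set (zip hex_small_triangles ?Ts). case x of (t, T) \<Rightarrow>
      T \<in> set hex_triangles \<and> (\<forall>x\<in>set (corners t). ?in (smallc.vp x) T)"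
    unfolding list_all_iff .
  have len: "length hex_small_triangles = 24" "length ?Ts = 24"
    by (simp_all add: hex_small_triangles_def hex_triangles_def)
  obtain k where k: "k < 24" "t = hex_small_triangles ! k"
    using assms len(1) unfolding in_set_conv_nth by metis
  have "zip hex_small_triangles ?Ts ! k \<in> set (zip hex_small_triangles ?Ts)"
    by (rule nth_mem) (simp only: len k(1) length_zip min.idem)
  moreover have "zip hex_small_triangles ?Ts ! k = (t, ?Ts ! k)"
    unfolding k(2) by (rule nth_zip) (simp_all only: len k(1))
  ultimately have "(t, ?Ts ! k) \<in> set (zip hex_small_triangles ?Ts)" by (simp only:)
  note * = bspec[OF all this, unfolded prod.case]
  show ?thesis
  proof
    show "?Ts ! k \<in> set hex_triangles" by (rule conjunct1[OF *])
    show "small.tile t \<subseteq> hex.tile (?Ts ! k)"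
      by (rule sub[OF conjunct1[OF *]], rule ballI, rule mem[OF conjunct1[OF *]]) (rule bspec[OF conjunct2[OF *]])
  qed
qed

text \<open>An affine isometry on a large triangle restricts to the small ones, and these do form a
  triangulation.\<close>

lemma piecewise_isometric_hex_map: "piecewise_isometric hex_lattice hex_map"
proof -
  have "isometric_on_triangles hex_lattice (small.tile ` set hex_small_triangles) hex_map"
    unfolding isometric_on_triangles_def
  proof
    fix K assume "K \<in> small.tile ` set hex_small_triangles"
    then obtain t where "t \<in> set hex_small_triangles" "K = small.tile t" by (rule imageE)
    then obtain T where T: "T \<in> set hex_triangles" "K \<subseteq> hex.tile T" using small_tile_subset[of t] by metis
    have "affine_isometry_on (hex.tile T) (hex_map \<circ> torus_proj hex_lattice)"
      using isometric_hex[unfolded isometric_on_triangles_def] T(1) by (rule bspec[OF _ imageI])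
    then show "affine_isometry_on K (hex_map \<circ> torus_proj hex_lattice)"
      using T(2) unfolding affine_isometry_on_def by (meson subsetD)
  qed
  then show ?thesis
    unfolding piecewise_isometric_def
    using hex.continuous_torus_map[of hex_fold] small.triangulation by (auto simp: hex_lattice_def)
qed

section \<open>The image and the fibres of the folding map\<close>

text \<open>The sides opposite to the centre, with the vertex of class 1 first. Adjacent triangles
  have opposite cyclic orders of classes; with this convention a barycentric triple has the same
  image from all six.\<close>

definition hex_sides :: "(lvertex \<times> lvertex) list" where
  "hex_sides = [((1, 0, 0), (2, 0, 0)), ((1, 0, 0), (2, -1, 1)), ((1, -1, 0), (2, -1, 1)),
     ((1, -1, 0), (2, -1, 0)), ((1, 0, -1), (2, -1, 0)), ((1, 0, -1), (2, 0, 0))]"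

lemma hex_sides:
  assumes "(b, c) \<in> set hex_sides"
  shows "((0, 0, 0), b, c) \<in> set hex_triangles \<or> ((0, 0, 0), c, b) \<in> set hex_triangles"
    "fst b = 1" "fst c = 2"
  using assms unfolding hex_sides_def hex_triangles_def by auto

lemma hex_triangle_side:
  assumes "t \<in> set hex_triangles"
  obtains b c where "(b, c) \<in> set hex_sides" "t = ((0, 0, 0), b, c) \<or> t = ((0, 0, 0), c, b)"
proof -
  have "\<exists>bc\<in>set hex_sides. t = ((0, 0, 0), fst bc, snd bc) \<or> t = ((0, 0, 0), snd bc, fst bc)"
    using assms unfolding hex_sides_def hex_triangles_def by auto
  then show ?thesis using that by force
qed

definition hex_bary :: "lvertex \<Rightarrow> lvertex \<Rightarrow> real \<times> real \<times> real \<Rightarrow> complex" where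
  "hex_bary b c = (\<lambda>(x, y, w). x *\<^sub>R hexc.vp (0, 0, 0) + y *\<^sub>R hexc.vp b + w *\<^sub>R hexc.vp c)"

definition fold_bary :: "real \<times> real \<times> real \<Rightarrow> real^3" where
  "fold_bary = (\<lambda>(x, y, w). x *\<^sub>R hex_fold 0 + y *\<^sub>R hex_fold 1 + w *\<^sub>R hex_fold 2)"

definition bary :: "(real \<times> real \<times> real) set" where
  "bary = {(x, y, w). 0 \<le> x \<and> 0 \<le> y \<and> 0 \<le> w \<and> x + y + w = 1}"

lemma plane_map_hex_bary:
  assumes bc: "(b, c) \<in> set hex_sides" and g: "g \<in> bary"
  shows "hex.plane_map hex_fold (hex_bary b c g) = fold_bary g"
proof -
  obtain x y w where xyw: "g = (x, y, w)" by (cases g)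
  have g': "0 \<le> x" "0 \<le> y" "0 \<le> w" "x + y + w = 1" "x + w + y = 1" using g by (auto simp: bary_def xyw)
  show ?thesis
    using hex_sides(1)[OF bc]
  proof
    assume "((0, 0, 0), b, c) \<in> set hex_triangles"
    from hex.plane_map_vertex_sum[OF hexc.Ts_in[OF this] g'(1,2,3,4), of hex_fold]
    show ?thesis using hex_sides(2,3)[OF bc] by (simp add: xyw hex_bary_def fold_bary_def)
  next
    assume "((0, 0, 0), c, b) \<in> set hex_triangles"
    from hex.plane_map_vertex_sum[OF hexc.Ts_in[OF this] g'(1,3,2,5), of hex_fold]
    show ?thesis using hex_sides(2,3)[OF bc] by (simp add: xyw hex_bary_def fold_bary_def add_ac)
  qed
qed

lemma obtain_hex_bary:
  obtains b c g s where "(b, c) \<in> set hex_sides" "g \<in> bary" "z = hex_bary b c g + hexc.lat s"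
proof -
  obtain t s where ts: "t \<in> set hex_triangles" "z - hexc.lat s \<in> hex.tile t" by (rule hex.obtain_tile)
  obtain b c where bc: "(b, c) \<in> set hex_sides" "t = ((0, 0, 0), b, c) \<or> t = ((0, 0, 0), c, b)"
    using hex_triangle_side[OF ts(1)] by blast
  have "z - hexc.lat s \<in> convex hull {hexc.vp (0, 0, 0), hexc.vp b, hexc.vp c}"
    using bc(2) ts(2) by (auto simp: insert_commute)
  then obtain x y w where xyw: "0 \<le> x" "0 \<le> y" "0 \<le> w" "x + y + w = 1"
    "z - hexc.lat s = x *\<^sub>R hexc.vp (0, 0, 0) + y *\<^sub>R hexc.vp b + w *\<^sub>R hexc.vp c"
    unfolding convex_hull_3 by blast
  show ?thesis
    by (rule that[OF bc(1), of "(x, y, w)" s]) (use xyw in \<open>auto simp: bary_def hex_bary_def algebra_simps\<close>)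
qed

lemma fold_bary_inj: "inj_on fold_bary bary"
proof
  fix g g' assume g: "g \<in> bary" "g' \<in> bary" "fold_bary g = fold_bary g'"
  obtain x y w x' y' w' where xyw: "g = (x, y, w)" "g' = (x', y', w')" by (cases g; cases g')
  have "fold_bary g $ 1 = fold_bary g' $ 1" "fold_bary g $ 2 = fold_bary g' $ 2" using g(3) by simp_all
  then have "norm kap * sqrt 3 * w = norm kap * sqrt 3 * w'" "norm kap * (x - y) = norm kap * (x' - y')"
    by (simp_all add: xyw fold_bary_def hex_fold_def point3_def algebra_simps)
  then have "w = w'" "x - y = x' - y'" using norm_kap(1) by simp_all
  then show "g = g'" using g(1,2) by (auto simp: xyw bary_def)
qed

lemma image_hex_map: "hex_map ` flat_torus hex_lattice = fold_bary ` bary"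
proof (intro equalityI subsetI)
  fix q assume "q \<in> hex_map ` flat_torus hex_lattice"
  then obtain z where z: "q = hex.plane_map hex_fold z"
    by (auto simp: flat_torus_def hex_lattice_def hex.torus_map_proj)
  obtain b c g s where "(b, c) \<in> set hex_sides" "g \<in> bary" "z = hex_bary b c g + hexc.lat s"
    by (rule obtain_hex_bary)
  then show "q \<in> fold_bary ` bary" using z by (simp add: hex.plane_map_shift plane_map_hex_bary)
next
  fix q assume "q \<in> fold_bary ` bary"
  then obtain g where g: "g \<in> bary" "q = fold_bary g" by blast
  have "((1, 0, 0), (2, 0, 0)) \<in> set hex_sides" by (simp add: hex_sides_def)
  then have "q = hex_map (torus_proj hex_lattice (hex_bary (1, 0, 0) (2, 0, 0) g))"
    using g by (simp add: hex_lattice_def hex.torus_map_proj plane_map_hex_bary)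
  then show "q \<in> hex_map ` flat_torus hex_lattice" by (auto simp: flat_torus_def)
qed

lemma equilateral_hex_map: "is_equilateral_triangle (hex_map ` flat_torus hex_lattice)"
  unfolding is_equilateral_triangle_def
proof (intro exI conjI)
  show "hex_fold 0 \<noteq> hex_fold 1" using dist_hex_fold[of 0 1] by (metis dist_self real_sqrt_eq_zero_cancel_iff zero_neq_one divide_eq_0_iff numeral_neq_zero zero_neq_numeral one_less_numeral_iff semiring_norm(77) zero_less_numeral)
  show "dist (hex_fold 0) (hex_fold 1) = dist (hex_fold 1) (hex_fold 2)"
    "dist (hex_fold 1) (hex_fold 2) = dist (hex_fold 2) (hex_fold 0)"
    by (simp_all add: dist_hex_fold)
  show "hex_map ` flat_torus hex_lattice = convex hull {hex_fold 0, hex_fold 1, hex_fold 2}"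
    unfolding image_hex_map convex_hull_3 by (force simp: bary_def fold_bary_def image_def)
qed

text \<open>With all coordinates positive, the carrier of the point is the whole triangle, so the
  first triangle, suitably translated, has the vertices of the second.\<close>

lemma proj_hex_bary_inj:
  assumes bc: "(b, c) \<in> set hex_sides" "(b', c') \<in> set hex_sides"
    and g: "g \<in> bary" "0 < fst g" "0 < fst (snd g)" "0 < snd (snd g)"
    and eq: "torus_proj hex_lattice (hex_bary b c g) = torus_proj hex_lattice (hex_bary b' c' g)"
  shows "(b, c) = (b', c')"
proof -
  have wt: "\<exists>t\<in>set hex_triangles. hex.verts t = {(0, 0, 0), b, c} \<and> hex_bary b c g \<in> hex.tile t \<and>
      (\<forall>x\<in>hex.verts t. 0 < hex.weight t (hex_bary b c g) x)"
    if bc: "(b, c) \<in> set hex_sides" for b c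
  proof -
    obtain x y w where xyw: "g = (x, y, w)" by (cases g)
    have p: "0 < x" "0 < y" "0 < w" "x + y + w = 1" using g by (simp_all add: xyw bary_def)
    obtain t where t: "t \<in> set hex_triangles" "t = ((0, 0, 0), b, c) \<or> t = ((0, 0, 0), c, b)"
      using hex_sides(1)[OF bc] by blast
    have v: "hex.verts t = {(0, 0, 0), b, c}" using t(2) by auto
    have d: "b \<noteq> (0, 0, 0)" "c \<noteq> (0, 0, 0)" "b \<noteq> c" using hex_sides(2,3)[OF bc] by auto
    define h where "h = (\<lambda>l. if l = b then y else if l = c then w else x)"
    have wl: "hex.weight t (hex_bary b c g) l = h l" if "l \<in> hex.verts t" for l
    proof (rule hex.weight_unique[OF hexc.Ts_in[OF t(1)] _ _ that])
      show "(\<Sum>l\<in>hex.verts t. h l) = 1" unfolding v using d p by (simp add: h_def)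
      show "hex_bary b c g = (\<Sum>l\<in>hex.verts t. h l *\<^sub>R hexc.vp l)" unfolding v using d by (simp add: h_def hex_bary_def xyw)
    qed
    have "hex_bary b c g \<in> convex hull {hexc.vp (0, 0, 0), hexc.vp b, hexc.vp c}"
      unfolding convex_hull_3 mem_Collect_eq
      by (intro exI[of _ x] exI[of _ y] exI[of _ w]) (use p in \<open>simp add: hex_bary_def xyw\<close>)
    then have "hex_bary b c g \<in> hex.tile t"
      unfolding hex.tile_eq_hull_verts v by (simp only: image_insert image_empty)
    moreover have "\<forall>l\<in>hex.verts t. 0 < hex.weight t (hex_bary b c g) l"
      using wl p by (simp add: h_def)
    ultimately show ?thesis using t(1) v by (intro bexI[of _ t] conjI)
  qed
  obtain t where t: "t \<in> set hex_triangles" "hex.verts t = {(0, 0, 0), b, c}" "hex_bary b c g \<in> hex.tile t"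
    using wt[OF bc(1)] by blast
  obtain t' where t': "t' \<in> set hex_triangles" "hex.verts t' = {(0, 0, 0), b', c'}" "hex_bary b' c' g \<in> hex.tile t'"
      "\<forall>x\<in>hex.verts t'. 0 < hex.weight t' (hex_bary b' c' g) x"
    using wt[OF bc(2)] by blast
  obtain s where s: "hex_bary b' c' g = hex_bary b c g + hexc.lat s"
    by (rule hex.proj_eqD[OF eq[unfolded hex_lattice_def]])
  have st: "shift3 s t \<in> hexc.\<K>" "hex_bary b' c' g \<in> hex.tile (shift3 s t)"
    using hexc.shift3_in[OF hexc.Ts_in[OF t(1)]] t(3) s by (simp_all add: hex.tile_shift3)
  have sub: "x \<in> shift s ` {(0, 0, 0), b, c}" if "x \<in> {(0, 0, 0), b', c'}" for x
  proof -
    have "x \<in> hex.verts t'" using that t'(2) by simp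
    then have "0 < hex.weight t' (hex_bary b' c' g) x" using t'(4) by (rule bspec[rotated])
    then have "x \<in> hex.verts (shift3 s t)" by (rule hex.weight_pos_common[OF hexc.Ts_in[OF t'(1)] t'(3) _ st])
    then show ?thesis unfolding hex.verts_shift3 t(2) .
  qed
  note f = hex_sides(2,3)[OF bc(1)] hex_sides(2,3)[OF bc(2)]
  \<comment> \<open>Both triangles contain the vertex of class 0 with offset zero, and it is the
    only vertex of that class; this excludes a nonzero translation.\<close>
  have "(0, 0, 0) = shift s (0, 0, 0)" using sub[of "(0, 0, 0)"] f by (auto dest: arg_cong[where f = fst])
  then have "s = 0" by (metis add_0 hexc.snd_shift snd_conv zero_prod_def)
  then have "b' \<in> {(0, 0, 0), b, c}" "c' \<in> {(0, 0, 0), b, c}" using sub[of b'] sub[of c'] by auto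
  then show ?thesis using f by auto
qed

text \<open>The exceptional segments are the three sides of the image triangle. Off them the
  barycentric coordinates are positive and determined by the image point, and each of the six
  triangles contributes one preimage.\<close>

lemma generically_hex_map: "generically_to_one 6 hex_lattice hex_map"
  unfolding generically_to_one_def
proof (intro exI conjI ballI)
  let ?E = "{(hex_fold 0, hex_fold 1), (hex_fold 1, hex_fold 2), (hex_fold 2, hex_fold 0)}"
  show "finite ?E" by simp
  fix q assume q: "q \<in> hex_map ` flat_torus hex_lattice - (\<Union>(a, b)\<in>?E. closed_segment a b)"
  then obtain g where g: "g \<in> bary" "q = fold_bary g" unfolding image_hex_map by blast
  obtain x y w where xyw: "g = (x, y, w)" by (cases g)
  have p: "0 \<le> x" "0 \<le> y" "0 \<le> w" "x + y + w = 1" using g(1) by (simp_all add: xyw bary_def)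
  have seg: "q \<notin> closed_segment (hex_fold 0) (hex_fold 1)" "q \<notin> closed_segment (hex_fold 1) (hex_fold 2)"
    "q \<notin> closed_segment (hex_fold 2) (hex_fold 0)" using q by auto
  have "w \<noteq> 0"
  proof
    assume "w = 0"
    then have "q = (1 - y) *\<^sub>R hex_fold 0 + y *\<^sub>R hex_fold 1" using p(4) g(2) by (simp add: xyw fold_bary_def flip: p(4))
    then have "q \<in> closed_segment (hex_fold 0) (hex_fold 1)"
      unfolding in_segment using p \<open>w = 0\<close> by (intro exI[of _ y]) simp
    then show False using seg(1) by blast
  qed
  moreover have "x \<noteq> 0"
  proof
    assume "x = 0"
    then have "q = (1 - w) *\<^sub>R hex_fold 1 + w *\<^sub>R hex_fold 2" using p(4) g(2) by (simp add: xyw fold_bary_def flip: p(4))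
    then have "q \<in> closed_segment (hex_fold 1) (hex_fold 2)"
      unfolding in_segment using p \<open>x = 0\<close> by (intro exI[of _ w]) simp
    then show False using seg(2) by blast
  qed
  moreover have "y \<noteq> 0"
  proof
    assume "y = 0"
    then have "q = (1 - x) *\<^sub>R hex_fold 2 + x *\<^sub>R hex_fold 0" using p(4) g(2) by (simp add: xyw fold_bary_def flip: p(4))
    then have "q \<in> closed_segment (hex_fold 2) (hex_fold 0)"
      unfolding in_segment using p \<open>y = 0\<close> by (intro exI[of _ x]) simp
    then show False using seg(3) by blast
  qed
  ultimately have pos: "0 < fst g" "0 < fst (snd g)" "0 < snd (snd g)" using p by (simp_all add: xyw)
  define P where "P = (\<lambda>(b, c). torus_proj hex_lattice (hex_bary b c g))"
  have "{X \<in> flat_torus hex_lattice. hex_map X = q} = P ` set hex_sides"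
  proof (intro equalityI subsetI)
    fix X assume "X \<in> {X \<in> flat_torus hex_lattice. hex_map X = q}"
    then obtain z where z: "X = torus_proj hex_lattice z" "hex.plane_map hex_fold z = q"
      by (auto simp: flat_torus_def hex_lattice_def hex.torus_map_proj)
    obtain b c g' s where *: "(b, c) \<in> set hex_sides" "g' \<in> bary" "z = hex_bary b c g' + hexc.lat s"
      by (rule obtain_hex_bary)
    then have "fold_bary g' = fold_bary g" using z(2) g(2) by (simp add: hex.plane_map_shift plane_map_hex_bary)
    then have "g' = g" using fold_bary_inj *(2) g(1) by (meson inj_onD)
    then have "X = P (b, c)" using z(1) *(3) by (simp add: P_def hex_lattice_def hex.proj_shift)
    then show "X \<in> P ` set hex_sides" using *(1) by blast
  next
    fix X assume "X \<in> P ` set hex_sides"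
    then obtain b c where "(b, c) \<in> set hex_sides" "X = torus_proj hex_lattice (hex_bary b c g)" by (auto simp: P_def)
    then show "X \<in> {X \<in> flat_torus hex_lattice. hex_map X = q}"
      using g by (simp add: flat_torus_def hex_lattice_def hex.torus_map_proj plane_map_hex_bary)
  qed
  moreover have "inj_on P (set hex_sides)"
    by (rule inj_onI) (use proj_hex_bary_inj[OF _ _ g(1) pos] in \<open>force simp: P_def\<close>)
  moreover have "card (set hex_sides) = 6" by (simp add: hex_sides_def)
  ultimately show "finite {X \<in> flat_torus hex_lattice. hex_map X = q}" "card {X \<in> flat_torus hex_lattice. hex_map X = q} = 6"
    by (simp_all add: card_image)
qed

section \<open>Collapse to the folded map and the approximation\<close>

text \<open>In contrast to \<open>plane_map_vertex_sum\<close> the three vertices may coincide, as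
  they do for triangles that collapse to an edge; the weights of equal vertices are added.\<close>

lemma (in torus_tiling) plane_map_vertices:
  assumes t: "t \<in> \<K>" and v: "p \<in> verts t" "q \<in> verts t" "r \<in> verts t"
    and w: "0 \<le> x" "0 \<le> y" "0 \<le> w" "x + y + w = 1"
  shows "plane_map f (x *\<^sub>R vp p + y *\<^sub>R vp q + w *\<^sub>R vp r) = x *\<^sub>R f (fst p) + y *\<^sub>R f (fst q) + w *\<^sub>R f (fst r)"
proof -
  define g where "g = (\<lambda>l. (if l = p then x else 0) + (if l = q then y else 0) + (if l = r then w else 0))"
  have sum: "(\<Sum>l\<in>verts t. g l *\<^sub>R h l) = x *\<^sub>R h p + y *\<^sub>R h q + w *\<^sub>R h r" for h :: "lvertex \<Rightarrow> 'b :: real_vector"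
  proof -
    have "(\<Sum>l\<in>verts t. (if l = a then k else 0) *\<^sub>R h l) = k *\<^sub>R h a" if "a \<in> verts t" for a k
    proof -
      have "(\<Sum>l\<in>verts t. (if l = a then k else 0) *\<^sub>R h l) = (\<Sum>l\<in>verts t. if l = a then k *\<^sub>R h l else 0)"
        by (intro sum.cong) auto
      then show ?thesis using that by simp
    qed
    then show ?thesis using v by (simp only: g_def scaleR_add_left sum.distrib)
  qed
  have "plane_map f (\<Sum>l\<in>verts t. g l *\<^sub>R vp l) = (\<Sum>l\<in>verts t. g l *\<^sub>R f (fst l))"
    unfolding plane_map_def
  proof (rule pl_combination[OF t])
    show "0 \<le> g l" for l using w by (simp add: g_def)
    show "(\<Sum>l\<in>verts t. g l) = 1" using sum[of "\<lambda>_. 1 :: real"] w(4) by simp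
  qed
  then show ?thesis by (simp only: sum)
qed

text \<open>In the limit, the eight vertices collapse onto the three vertex classes of the hexagonal torus,
  and each of the sixteen triangles onto a face of one of the six triangles.\<close>

fun collapse :: "lvertex \<Rightarrow> lvertex" where
  "collapse (i, s) = shift s ([(0, 0, 0), (0, 0, 0), (2, 0, 0), (1, 0, -1), (2, -1, 0), (1, -1, 0), (0, 0, 0), (1, 0, 0)] ! i)"

text \<open>A finite search over the neighbouring translates, so that it can be decided by
  evaluation.\<close>

lemma collapse_check:
  "\<forall>t\<in>set torus_triangles. \<exists>T\<in>set hex_triangles. \<exists>s\<in>set (List.product [-1, 0, 1] [-1, 0, 1]).
     \<forall>x\<in>set (corners t). collapse x \<in> set (corners (shift3 s T))"
  by code_simp

lemma torus_triangles_range: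
  "\<forall>t\<in>set torus_triangles. \<forall>x\<in>set (corners t). fst x < 8 \<and> \<bar>fst (snd x)\<bar> \<le> 1 \<and> \<bar>snd (snd x)\<bar> \<le> 1"
  by (simp add: torus_triangles_def)

lemma collapse_tile:
  assumes "(p, q, r) \<in> set torus_triangles"
  obtains T where "T \<in> hexc.\<K>" "collapse p \<in> hex.verts T" "collapse q \<in> hex.verts T" "collapse r \<in> hex.verts T"
proof -
  obtain T s where T: "T \<in> set hex_triangles" "\<forall>x\<in>set (corners (p, q, r)). collapse x \<in> set (corners (shift3 s T))"
    using bspec[OF collapse_check assms] by (elim bexE) blast
  show ?thesis
    by (rule that[OF hexc.shift3_in[OF hexc.Ts_in[OF T(1)], of s]])
      (use T(2) in \<open>simp_all add: hex.verts_eq_corners\<close>)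
qed

text \<open>Change of basis: the lattice coordinates \<open>x\<close>, \<open>y\<close> multiply the
  generators \<open>(-3, 1)\<close> and \<open>(-3, -1)\<close>.\<close>

lemma point2_hexpt: "point2 (- 3 * x - 3 * y) (x - y) = hexpt x y"
proof -
  have nz: "Complex (-3) (sqrt 3) \<noteq> 0" by (simp add: complex_eq_iff)
  have "Complex (- 3 * x - 3 * y) (sqrt 3 * (x - y)) = Complex (-3) (sqrt 3) * hexpt x y"
    by (simp add: complex_eq_iff hexpt_def algebra_simps)
  then show ?thesis using nz by (simp add: point2_def kap_def)
qed

lemma collapse_limit:
  assumes "i < 8"
  shows "hexc.vp (collapse (i, s)) = point2 (limit_u i) (limit_v i) + hexc.lat s"
    "hex_fold (fst (collapse (i, s))) = limit_space i"
    "norm (point2 (limit_u i) (limit_v i)) \<le> 4/3"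
proof -
  have nm: "norm (hexpt x y) \<le> \<bar>x\<bar> + \<bar>y\<bar>" for x y
    unfolding hexpt_eq by (rule order_trans[OF norm_triangle_ineq]) (simp add: norm_scaleR complex_norm power_divide)
  have p: "point2 a b = hexpt ((3 * b - a) / 6) (- (a + 3 * b) / 6)" for a b
    using point2_hexpt[of "(3 * b - a) / 6" "- (a + 3 * b) / 6"] by (simp add: field_simps)
  obtain m n where s: "s = (m, n)" by (cases s)
  have "\<forall>i<8. hexc.vp (collapse (i, s)) = point2 (limit_u i) (limit_v i) + hexc.lat s"
    unfolding all_less_8 by (simp add: s limit_u_def limit_v_def p hex_vp hex_lat hexpt_add)
  then show "hexc.vp (collapse (i, s)) = point2 (limit_u i) (limit_v i) + hexc.lat s" using assms by blast
  have "\<forall>i<8. hex_fold (fst (collapse (i, s))) = limit_space i"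
    unfolding all_less_8 by (simp add: s limit_space_def hex_fold_def)
  then show "hex_fold (fst (collapse (i, s))) = limit_space i" using assms by blast
  have "\<forall>i<8. norm (point2 (limit_u i) (limit_v i)) \<le> 4/3"
    unfolding all_less_8 p
    by (intro conjI order_trans[OF nm]) (simp_all add: limit_u_def limit_v_def)
  then show "norm (point2 (limit_u i) (limit_v i)) \<le> 4/3" using assms by blast
qed

text \<open>Distances on the torus are \<open>setdist\<close> of cosets, so Lipschitz bounds of a
  map of the plane pass to the torus once the map takes cosets to cosets.\<close>

lemma setdist_image_le:
  assumes "X \<noteq> {}" "Y \<noteq> {}" "\<And>x y. x \<in> X \<Longrightarrow> y \<in> Y \<Longrightarrow> dist (h x) (h y) \<le> C * dist x y" "0 < C"
  shows "setdist (h ` X) (h ` Y) \<le> C * setdist X Y"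
proof -
  have "setdist (h ` X) (h ` Y) / C \<le> setdist X Y"
  proof (rule le_setdistI)
    fix x y assume xy: "x \<in> X" "y \<in> Y"
    have "setdist (h ` X) (h ` Y) \<le> dist (h x) (h y)" using xy by (intro setdist_le_dist) auto
    also have "\<dots> \<le> C * dist x y" using assms(3) xy .
    finally show "setdist (h ` X) (h ` Y) / C \<le> dist x y" using assms(4) by (simp add: field_simps)
  qed (use assms(1,2) in auto)
  then show ?thesis using assms(4) by (simp add: field_simps)
qed

lemma setdist_le_image:
  assumes "X \<noteq> {}" "Y \<noteq> {}" "\<And>x y. x \<in> X \<Longrightarrow> y \<in> Y \<Longrightarrow> dist x y / C \<le> dist (h x) (h y)" "0 < C"
  shows "setdist X Y / C \<le> setdist (h ` X) (h ` Y)"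
proof (rule le_setdistI)
  fix a b assume "a \<in> h ` X" "b \<in> h ` Y"
  then obtain x y where xy: "x \<in> X" "y \<in> Y" "a = h x" "b = h y" by blast
  have "setdist X Y \<le> dist x y" using xy by (intro setdist_le_dist) auto
  then have "setdist X Y / C \<le> dist x y / C" using assms(4) by (simp add: divide_right_mono)
  also have "\<dots> \<le> dist a b" using assms(3) xy by simp
  finally show "setdist X Y / C \<le> dist a b" .
qed (use assms(1,2) in auto)

lemma dist_convex_combination3:
  fixes a b c a' b' c' :: "'a :: real_normed_vector"
  assumes "0 \<le> x" "0 \<le> y" "0 \<le> w" "x + y + w = 1" "dist a a' \<le> d" "dist b b' \<le> d" "dist c c' \<le> d"
  shows "dist (x *\<^sub>R a + y *\<^sub>R b + w *\<^sub>R c) (x *\<^sub>R a' + y *\<^sub>R b' + w *\<^sub>R c') \<le> d"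
proof -
  have "(x *\<^sub>R a + y *\<^sub>R b + w *\<^sub>R c) - (x *\<^sub>R a' + y *\<^sub>R b' + w *\<^sub>R c') =
      x *\<^sub>R (a - a') + y *\<^sub>R (b - b') + w *\<^sub>R (c - c')" by (simp add: algebra_simps)
  also have "norm \<dots> \<le> x * norm (a - a') + y * norm (b - b') + w * norm (c - c')"
    using assms(1-3) by (intro order_trans[OF norm_triangle_ineq] add_mono) simp_all
  also have "\<dots> \<le> x * d + y * d + w * d"
    using assms by (intro add_mono mult_left_mono) (simp_all add: dist_norm)
  also have "\<dots> = d" using assms(4) by (simp flip: distrib_right)
  finally show ?thesis by (simp add: dist_norm)
qed

text \<open>The linear map taking 1 to \<open>u\<close> and \<open>hex_gen\<close> to
  \<open>v\<close>. Its deviation from the identity is controlled by how far it moves the two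
  generators.\<close>

lemma near_hex_generators:
  assumes u: "dist u 1 \<le> \<eta>" and v: "dist v hex_gen \<le> \<eta>"
  obtains L where "linear L" "\<And>s. L (hexc.lat s) = of_int (fst s) *\<^sub>R u + of_int (snd s) *\<^sub>R v"
    "\<And>z. dist (L z) z \<le> 4 * \<eta> * norm z"
proof
  \<comment> \<open>The coordinates of \<open>z\<close> in the basis 1, \<open>hex_gen\<close>. Both
    are at most \<open>2 * norm z\<close>, which gives the constant 4.\<close>
  define S T where "S = (\<lambda>z. Re z - Im z / sqrt 3)" and "T = (\<lambda>z. 2 * Im z / sqrt 3)"
  define L where "L = (\<lambda>z. S z *\<^sub>R u + T z *\<^sub>R v)"
  show "linear L"
    unfolding L_def S_def T_def by (rule linearI) (simp_all add: algebra_simps add_divide_distrib diff_divide_distrib)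
  have ST: "S (hexpt a b) = a" "T (hexpt a b) = b" for a b by (simp_all add: S_def T_def hexpt_def)
  show "L (hexc.lat s) = of_int (fst s) *\<^sub>R u + of_int (snd s) *\<^sub>R v" for s
    by (simp add: L_def hex_lat ST)
  fix z
  have z: "z = S z *\<^sub>R 1 + T z *\<^sub>R hex_gen" by (simp add: S_def T_def complex_eq_iff field_simps)
  have s3: "1 \<le> sqrt 3" by simp
  have I: "\<bar>Im z / sqrt 3\<bar> \<le> norm z"
  proof -
    have "\<bar>Im z / sqrt 3\<bar> = \<bar>Im z\<bar> / sqrt 3" by (simp add: abs_divide)
    also have "\<dots> \<le> \<bar>Im z\<bar> / 1" using s3 by (intro divide_left_mono) auto
    finally show ?thesis using abs_Im_le_cmod[of z] by simp
  qed
  then have ST2: "\<bar>S z\<bar> \<le> 2 * norm z" "\<bar>T z\<bar> \<le> 2 * norm z"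
    using abs_Re_le_cmod[of z] unfolding S_def T_def by linarith+
  have "0 \<le> \<eta>" using u zero_le_dist order_trans by blast
  have "L z - z = S z *\<^sub>R (u - 1) + T z *\<^sub>R (v - hex_gen)"
    by (subst z) (simp add: L_def algebra_simps)
  then have "dist (L z) z \<le> \<bar>S z\<bar> * norm (u - 1) + \<bar>T z\<bar> * norm (v - hex_gen)"
    using norm_triangle_ineq[of "S z *\<^sub>R (u - 1)" "T z *\<^sub>R (v - hex_gen)"] by (simp add: dist_norm)
  also have "\<dots> \<le> (2 * norm z) * \<eta> + (2 * norm z) * \<eta>"
    using ST2 u v \<open>0 \<le> \<eta>\<close> by (intro add_mono mult_mono) (simp_all add: dist_norm)
  finally show "dist (L z) z \<le> 4 * \<eta> * norm z" by simp
qed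

lemma hex_map_approximation:
  assumes e: "0 < e"
  shows "\<exists>\<Lambda>' \<phi>'. paper_torus 8 \<Lambda>' \<phi>' \<and> (\<exists>\<alpha>. torus_bilipschitz (1 + e) hex_lattice \<Lambda>' \<alpha> \<and>
    (\<forall>p\<in>flat_torus hex_lattice. dist (hex_map p) (\<phi>' (\<alpha> p)) \<le> e))"
proof -
  \<comment> \<open>After removal of a lattice translation all points to be compared lie in the ball
    of radius 10.\<close>
  have "uniformly_continuous_on (cball 0 10) (hex.plane_map hex_fold)"
    by (rule compact_uniformly_continuous[OF continuous_on_subset[OF hex.continuous_plane_map]]) auto
  then obtain d where d: "0 < d" "\<And>x y. norm x \<le> 10 \<Longrightarrow> norm y \<le> 10 \<Longrightarrow> dist x y < d \<Longrightarrow>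
      dist (hex.plane_map hex_fold x) (hex.plane_map hex_fold y) < e / 2"
    unfolding uniformly_continuous_on_def using e by (metis half_gt_zero mem_cball_0)
  \<comment> \<open>The four bounds serve in turn: \<open>z'\<close> and \<open>z0\<close> are at
    most \<open>4 * \<eta> * 10 + 3 * \<eta>\<close> apart, which must be below \<open>d\<close>;
    the images of vertices move by at most \<open>e / 2\<close>; \<open>norm z'\<close> stays below
    10; and \<open>L\<close> is bilipschitz with constant \<open>1 + e\<close>.\<close>
  define \<eta> where "\<eta> = Min {d / 44, e / 2, 1 / 8, e / (4 * (1 + e))}"
  have \<eta>: "0 < \<eta>" "\<eta> \<le> d / 44" "\<eta> \<le> e / 2" "\<eta> \<le> 1 / 8" "\<eta> \<le> e / (4 * (1 + e))"
  proof -
    show "0 < \<eta>" using d(1) e by (simp add: \<eta>_def)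
  qed (unfold \<eta>_def, (intro Min_le; simp)+)
  obtain u v pos f \<phi>' where pt: "0 < orient 0 u v" "paper_torus 8 (lattice_span u v) \<phi>'"
    and cov: "\<And>z. \<exists>p q r x y w m n. (p, q, r) \<in> set torus_triangles \<and> 0 \<le> x \<and> 0 \<le> y \<and> 0 \<le> w \<and> x + y + w = 1 \<and>
      z = x *\<^sub>R lvp u v pos p + y *\<^sub>R lvp u v pos q + w *\<^sub>R lvp u v pos r + (of_int m *\<^sub>R u + of_int n *\<^sub>R v) \<and>
      \<phi>' (torus_proj (lattice_span u v) z) = x *\<^sub>R f (fst p) + y *\<^sub>R f (fst q) + w *\<^sub>R f (fst r)"
    and u: "dist u 1 < \<eta>" and v: "dist v hex_gen < \<eta>"
    and near: "\<forall>i<8. dist (pos i) (point2 (limit_u i) (limit_v i)) < \<eta> \<and> dist (f i) (limit_space i) < \<eta>"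
    using paper_tori_near_limit[OF \<eta>(1)] by (elim exE conjE) blast
  obtain L where L: "linear L" "\<And>s. L (hexc.lat s) = of_int (fst s) *\<^sub>R u + of_int (snd s) *\<^sub>R v"
    "\<And>z. dist (L z) z \<le> 4 * \<eta> * norm z"
    using near_hex_generators[OF less_imp_le[OF u] less_imp_le[OF v]] by blast
  have e4: "1 \<le> (1 + e) * (1 - 4 * \<eta>)"
  proof -
    have "\<eta> * (4 * (1 + e)) \<le> e" using \<eta>(5) e by (simp add: pos_le_divide_eq)
    then show ?thesis by (simp add: algebra_simps)
  qed
  have lip: "dist x y / (1 + e) \<le> dist (L x) (L y)" "dist (L x) (L y) \<le> (1 + e) * dist x y" for x y
  proof -
    have D: "L x - L y = L (x - y)" using linear_diff[OF L(1)] by simp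
    have "dist (L (x - y)) (x - y) \<le> 4 * \<eta> * norm (x - y)" by (rule L(3))
    then have "norm (x - y) - 4 * \<eta> * norm (x - y) \<le> norm (L (x - y))" "norm (L (x - y)) \<le> norm (x - y) + 4 * \<eta> * norm (x - y)"
      using norm_triangle_ineq2[of "x - y" "L (x - y)"] norm_triangle_ineq2[of "L (x - y)" "x - y"]
      by (simp_all add: dist_norm norm_minus_commute)
    then have n: "(1 - 4 * \<eta>) * norm (x - y) \<le> norm (L (x - y))" "norm (L (x - y)) \<le> (1 + 4 * \<eta>) * norm (x - y)"
      by (simp_all add: algebra_simps)
    have "norm (x - y) \<le> ((1 + e) * (1 - 4 * \<eta>)) * norm (x - y)" using mult_right_mono[OF e4, of "norm (x - y)"] by simp
    also have "\<dots> \<le> (1 + e) * norm (L (x - y))" using n(1) e by (simp add: mult.assoc)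
    finally show "dist x y / (1 + e) \<le> dist (L x) (L y)" using e by (simp add: dist_norm D field_simps)
    have "4 * \<eta> * 1 \<le> 4 * \<eta> * (1 + e)" using \<eta>(1) e by (intro mult_left_mono) auto
    then have "4 * \<eta> \<le> e" using e4 by (simp add: algebra_simps)
    then have "(1 + 4 * \<eta>) * norm (x - y) \<le> (1 + e) * norm (x - y)" by (intro mult_right_mono) auto
    then show "dist (L x) (L y) \<le> (1 + e) * dist x y" using n(2) by (simp add: dist_norm D)
  qed
  have proj: "L ` torus_proj hex_lattice z = torus_proj (lattice_span u v) (L z)" for z
  proof -
    have "L ` hex_lattice = lattice_span u v"
    proof -
      have hl: "hex_lattice = range hexc.lat" unfolding hex_lattice_def by (rule hex.lattice_eq)
      have "L ` hex_lattice = range (\<lambda>s. L (hexc.lat s))"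
        by (rule trans[OF arg_cong[where f = "(`) L", OF hl]]) (rule image_image)
      also have "\<dots> = lattice_span u v"
        unfolding L(2) lattice_span_def image_def by (simp add: split_paired_Ex)
      finally show ?thesis .
    qed
    then show ?thesis
      unfolding torus_proj_def by (simp add: image_image linear_add[OF L(1)] flip: \<open>L ` hex_lattice = lattice_span u v\<close>)
  qed
  have "torus_bilipschitz (1 + e) hex_lattice (lattice_span u v) ((`) L)"
    unfolding torus_bilipschitz_def
  proof (intro conjI ballI)
    show "(`) L \<in> flat_torus hex_lattice \<rightarrow> flat_torus (lattice_span u v)"
      by (auto simp: flat_torus_def proj)
    fix X Y assume "X \<in> flat_torus hex_lattice" "Y \<in> flat_torus hex_lattice"
    moreover have "torus_proj hex_lattice z \<noteq> {}" for z
      by (auto simp: torus_proj_def hex_lattice_def lattice_span_def)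
    ultimately have "X \<noteq> {}" "Y \<noteq> {}" by (auto simp: flat_torus_def)
    then show "setdist X Y / (1 + e) \<le> setdist (L ` X) (L ` Y)" "setdist (L ` X) (L ` Y) \<le> (1 + e) * setdist X Y"
      using e by (auto intro!: setdist_le_image setdist_image_le lip)
  qed
  moreover have "dist (hex_map X) (\<phi>' (L ` X)) \<le> e" if X: "X \<in> flat_torus hex_lattice" for X
  proof -
    obtain z where z: "X = torus_proj hex_lattice z" using X by (auto simp: flat_torus_def)
    obtain p q r x y w m n where t: "(p, q, r) \<in> set torus_triangles" and xyw: "0 \<le> x" "0 \<le> y" "0 \<le> w" "x + y + w = 1"
      and Lz: "L z = x *\<^sub>R lvp u v pos p + y *\<^sub>R lvp u v pos q + w *\<^sub>R lvp u v pos r + (of_int m *\<^sub>R u + of_int n *\<^sub>R v)"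
      and \<phi>': "\<phi>' (torus_proj (lattice_span u v) (L z)) = x *\<^sub>R f (fst p) + y *\<^sub>R f (fst q) + w *\<^sub>R f (fst r)"
      using cov[of "L z"] by (elim exE conjE) (rule that)
    \<comment> \<open>The representative of the coset whose image under \<open>L\<close> is the
      barycentric combination without lattice translation; \<open>z0\<close> is the same combination
      of the collapsed vertices.\<close>
    define z' where "z' = z - hexc.lat (m, n)"
    define z0 where "z0 = x *\<^sub>R hexc.vp (collapse p) + y *\<^sub>R hexc.vp (collapse q) + w *\<^sub>R hexc.vp (collapse r)"
    have Lz': "L z' = x *\<^sub>R lvp u v pos p + y *\<^sub>R lvp u v pos q + w *\<^sub>R lvp u v pos r"
      using Lz by (simp add: z'_def linear_diff[OF L(1)] L(2))
    have rng: "fst l < 8" "\<bar>fst (snd l)\<bar> \<le> 1" "\<bar>snd (snd l)\<bar> \<le> 1" if "l \<in> {p, q, r}" for l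
      using bspec[OF torus_triangles_range t] that by auto
    have vd: "dist (lvp u v pos l) (hexc.vp (collapse l)) \<le> 3 * \<eta> \<and> norm (hexc.vp (collapse l)) \<le> 4"
      if l: "l \<in> {p, q, r}" for l
    proof -
      obtain i a b where iab: "l = (i, a, b)" by (cases l)
      have i: "i < 8" and ab: "\<bar>real_of_int a\<bar> \<le> 1" "\<bar>real_of_int b\<bar> \<le> 1" using rng[OF l] by (simp_all add: iab)
      have c: "hexc.vp (collapse l) = point2 (limit_u i) (limit_v i) + (of_int a *\<^sub>R 1 + of_int b *\<^sub>R hex_gen)"
        using collapse_limit(1)[OF i, of "(a, b)"] by (simp add: iab hexc.lat_def)
      have "lvp u v pos l - hexc.vp (collapse l) =
          (pos i - point2 (limit_u i) (limit_v i)) + (of_int a *\<^sub>R (u - 1) + of_int b *\<^sub>R (v - hex_gen))"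
        unfolding c by (simp add: iab lvp_def algebra_simps)
      also have "norm \<dots> \<le> norm (pos i - point2 (limit_u i) (limit_v i)) + (\<bar>of_int a\<bar> * norm (u - 1) + \<bar>of_int b\<bar> * norm (v - hex_gen))"
        by (intro order_trans[OF norm_triangle_ineq] add_mono order_refl) simp_all
      also have "\<dots> \<le> \<eta> + (1 * \<eta> + 1 * \<eta>)"
        using near i u v ab by (intro add_mono mult_mono) (auto simp: dist_norm intro: less_imp_le)
      finally have "dist (lvp u v pos l) (hexc.vp (collapse l)) \<le> 3 * \<eta>" by (simp add: dist_norm)
      moreover have "norm (of_int a *\<^sub>R 1 + of_int b *\<^sub>R hex_gen) \<le> 1 + 1"
      proof (rule order_trans[OF norm_triangle_ineq], rule add_mono)
        have "norm hex_gen = 1" by (simp add: complex_norm power_divide)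
        then show "norm (of_int b *\<^sub>R hex_gen) \<le> 1" using ab by (simp only: norm_scaleR)
      qed (use ab in simp)
      then have "norm (hexc.vp (collapse l)) \<le> 4/3 + 2"
        using norm_triangle_ineq[of "point2 (limit_u i) (limit_v i)" "of_int a *\<^sub>R 1 + of_int b *\<^sub>R hex_gen"]
          collapse_limit(3)[OF i] unfolding c by linarith
      ultimately show ?thesis by simp
    qed
    have near0: "dist (L z') z0 \<le> 3 * \<eta>"
      unfolding Lz' z0_def using vd by (intro dist_convex_combination3 xyw) auto
    have "dist z0 (x *\<^sub>R 0 + y *\<^sub>R 0 + w *\<^sub>R 0) \<le> 4"
      unfolding z0_def using vd by (intro dist_convex_combination3 xyw) auto
    then have n0: "norm z0 \<le> 4" by simp
    \<comment> \<open>As \<open>4 * \<eta>\<close> is at most 1/2, half of \<open>norm z'\<close>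
      can be absorbed, and the bound for \<open>z0\<close> carries over.\<close>
    have "norm z' \<le> norm (L z') + dist (L z') z'"
      using norm_triangle_ineq[of "L z'" "z' - L z'"] by (simp add: dist_norm norm_minus_commute)
    moreover have "4 * \<eta> * norm z' \<le> (1 / 2) * norm z'" using \<eta>(4) by (intro mult_right_mono) auto
    moreover have "norm (L z') \<le> norm z0 + dist (L z') z0"
      using norm_triangle_ineq[of z0 "L z' - z0"] by (simp add: dist_norm)
    ultimately have n': "norm z' \<le> 10" using L(3)[of z'] n0 near0 \<eta>(4) by linarith
    have "4 * \<eta> * norm z' \<le> 4 * \<eta> * 10" using n' \<eta>(1) by (intro mult_left_mono) auto
    then have "dist z' z0 < d"
      using dist_triangle3[of z' z0 "L z'"] L(3)[of z'] near0 \<eta>(1,2) by linarith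
    then have 1: "dist (hex.plane_map hex_fold z') (hex.plane_map hex_fold z0) < e / 2"
      using n' n0 by (intro d(2)) auto
    have 2: "hex_map X = hex.plane_map hex_fold z'"
      unfolding z hex_lattice_def hex.torus_map_proj
      using hex.plane_map_shift[of hex_fold z' "(m, n)"] by (simp add: z'_def)
    \<comment> \<open>The collapsed vertices lie in one tile of the folded torus, on which the
      folding map is affine.\<close>
    obtain T where T: "T \<in> hexc.\<K>" "collapse p \<in> hex.verts T" "collapse q \<in> hex.verts T" "collapse r \<in> hex.verts T"
      using collapse_tile[OF t] .
    have 3: "hex.plane_map hex_fold z0 = x *\<^sub>R hex_fold (fst (collapse p)) + y *\<^sub>R hex_fold (fst (collapse q)) + w *\<^sub>R hex_fold (fst (collapse r))"
      unfolding z0_def by (rule hex.plane_map_vertices[OF T xyw])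
    have fd: "dist (hex_fold (fst (collapse l))) (f (fst l)) \<le> \<eta>" if l: "l \<in> {p, q, r}" for l
    proof -
      have "hex_fold (fst (collapse l)) = limit_space (fst l)"
        using collapse_limit(2)[OF rng(1)[OF l], of "snd l"] by (simp del: collapse.simps)
      moreover have "dist (f (fst l)) (limit_space (fst l)) < \<eta>" using near rng(1)[OF l] by blast
      ultimately show ?thesis by (metis dist_commute less_imp_le)
    qed
    have 4: "dist (hex.plane_map hex_fold z0) (\<phi>' (L ` X)) \<le> \<eta>"
      unfolding 3 z proj \<phi>' using fd by (intro dist_convex_combination3 xyw) auto
    show ?thesis
      using dist_triangle[of "hex_map X" "\<phi>' (L ` X)" "hex.plane_map hex_fold z0"] 1 4 \<eta>(3)
      unfolding 2 by linarith
  qed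
  ultimately show ?thesis
    using pt(2) by (intro exI[of _ "lattice_span u v"] exI[of _ \<phi>'] conjI exI[of _ "(`) L"] ballI) auto
qed

theorem corollary1p5:
  shows "\<exists>\<phi> :: complex set \<Rightarrow> real^3.
    piecewise_isometric hex_lattice \<phi> \<and>
    generically_to_one 6 hex_lattice \<phi> \<and>
    is_equilateral_triangle (\<phi> ` flat_torus hex_lattice) \<and>
    (\<forall>\<epsilon>::real. \<epsilon> > 0 \<longrightarrow>
       (\<exists>\<Lambda>' \<phi>'. paper_torus 8 \<Lambda>' \<phi>' \<and>
          uniform_distance hex_lattice \<phi> \<Lambda>' \<phi>' < ereal \<epsilon>))"
proof (intro exI[of _ hex_map] conjI allI impI)
  show "piecewise_isometric hex_lattice hex_map" by (rule piecewise_isometric_hex_map)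
  show "generically_to_one 6 hex_lattice hex_map" by (rule generically_hex_map)
  show "is_equilateral_triangle (hex_map ` flat_torus hex_lattice)" by (rule equilateral_hex_map)
  fix \<epsilon> :: real assume "\<epsilon> > 0"
  \<comment> \<open>Half of the tolerance makes the infimum strictly smaller than
    \<open>\<epsilon>\<close>.\<close>
  then have "0 < \<epsilon> / 2" by simp
  from hex_map_approximation[OF this] obtain \<Lambda>' \<phi>' \<alpha> where *: "paper_torus 8 \<Lambda>' \<phi>'"
    "torus_bilipschitz (1 + \<epsilon> / 2) hex_lattice \<Lambda>' \<alpha>"
    "\<forall>p\<in>flat_torus hex_lattice. dist (hex_map p) (\<phi>' (\<alpha> p)) \<le> \<epsilon> / 2" by blast
  have "uniform_distance hex_lattice hex_map \<Lambda>' \<phi>' \<le> ereal (\<epsilon> / 2)"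
    unfolding uniform_distance_def using * \<open>\<epsilon> > 0\<close> by (intro Inf_lower CollectI exI[of _ "\<epsilon> / 2"] conjI exI[of _ \<alpha>]) auto
  also have "\<dots> < ereal \<epsilon>" using \<open>\<epsilon> > 0\<close> by simp
  finally show "\<exists>\<Lambda>' \<phi>'. paper_torus 8 \<Lambda>' \<phi>' \<and> uniform_distance hex_lattice hex_map \<Lambda>' \<phi>' < ereal \<epsilon>"
    using *(1) by blast
qed

end
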